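(* Let $(X_k)_{k\ge -p+1}$ be a time-homogeneous INAR($p$) process with coefficients $\alpha_1,\dots,\alpha_p$, innovation mean $\mu$ and innovation variance $\sigma^2$, such that $\operatorname{E}(X_0^6)<\infty,\dots,\operatorname{E}(X_{-p+1}^6)<\infty$, $\operatorname{E}(\varepsilon_1^6)<\infty$, $\alpha_1+\cdots+\alpha_p<1$, $\mu>0$, and such that $\alpha_1+\cdots+\alpha_p>0$ or $\sigma^2>0$. Then the test process $(\widehat{\boldsymbol{\mathcal M}}_n(t))_{0\le t\le 1}$ satisfies $$\widehat{\boldsymbol{\mathcal M}}_n \stackrel{\mathcal D}{\longrightarrow} \boldsymbol{\mathcal B}\qquad\text{as } n\to\infty,$$ where $(\boldsymbol{\mathcal B}(t))_{0\le t\le 1}$ is a $(p+1)$-dimensional standard Brownian bridge (its components are independent standard Brownian bridges) and $\stackrel{\mathcal D}{\longrightarrow}$ denotes convergence in distribution in the Skorokhod space $D([0,1])$ (of $\mathbb R^{p+1}$-valued functions).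
   Context: Time-homogeneous INAR($p$) process, $p\ge1$: a sequence $(X_k)_{k\ge -p+1}$ with $$X_k=\sum_{j=1}^{X_{k-1}}\xi_{1,k,j}+\cdots+\sum_{j=1}^{X_{k-p}}\xi_{p,k,j}+\varepsilon_k,\qquad k\in\mathbb N=\{1,2,\dots\},$$ where $\{\varepsilon_k\}_{k\in\mathbb N}$ (the innovations) are i.i.d. non-negative integer-valued random variables with mean $\mu<\infty$ and variance $\sigma^2<\infty$; for each $k\in\mathbb N$, $i\in\{1,\dots,p\}$ the variables $\{\xi_{i,k,j}:j\in\mathbb N\}$ are i.i.d. Bernoulli with mean $\alpha_i$; these sequences are mutually independent and independent of the innovations; and $X_0,\dots,X_{-p+1}$ are non-negative integer-valued random variables independent of all $\xi_{i,k,j}$ and $\varepsilon_k$. Put $\boldsymbol X_k:=(X_k,\dots,X_{k-p+1})^\top$, $\boldsymbol Y_k:=\begin{bmatrix}\boldsymbol X_{k-1}\\1\end{bmatrix}\in\mathbb R^{p+1}$, $\boldsymbol Q_n:=\sum_{k=1}^n\boldsymbol Y_k\boldsymbol Y_k^\top$. The conditional least squares estimator is $$\widehat{\boldsymbol\theta}_n=(\widehat\alpha_1^{(n)},\dots,\widehat\alpha_p^{(n)},\widehat\mu_n)^\top:=\boldsymbol Q_n^{-1}\sum_{k=1}^nX_k\boldsymbol Y_k,\qquad \widehat M_k^{(n)}:=X_k-\widehat{\boldsymbol\theta}_n^\top\boldsymbol Y_k.$$ The variance estimator is $$\widehat\sigma_n^2:=\frac1n\sum_{k=1}^n\Big((\widehat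 M_k^{(n)})^2-\sum_{i=1}^p\widehat\alpha_i^{(n)}(1-\widehat\alpha_i^{(n)})X_{k-i}\Big).$$ Set $$\widehat{\boldsymbol I}_n:=\sum_{k=1}^n\Big(\sum_{i=1}^p\widehat\alpha_i^{(n)}(1-\widehat\alpha_i^{(n)})X_{k-i}+\widehat\sigma_n^2\Big)\boldsymbol Y_k\boldsymbol Y_k^\top,\qquad \widehat{\boldsymbol{\mathcal M}}_n(t):=\widehat{\boldsymbol I}_n^{-1/2}\sum_{k=1}^{\lfloor nt\rfloor}\widehat M_k^{(n)}\boldsymbol Y_k,\quad t\in[0,1].$$ Convention: the matrix inverses and inverse (symmetric) square roots exist with probability tending to $1$; on the complementary event the quantities may be defined arbitrarily. *)

theory Defs
  imports "HOL-Probability.Probability"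
begin

section \<open>The Skorokhod space on the unit interval\<close>

definition cadlag_on01 :: "(real \<Rightarrow> 'a::topological_space) \<Rightarrow> bool" where
  "cadlag_on01 x \<longleftrightarrow>
     (\<forall>t\<in>{0..<1}. (x \<longlongrightarrow> x t) (at_right t)) \<and>
     (\<forall>t\<in>{0<..1}. \<exists>l. (x \<longlongrightarrow> l) (at_left t))"

lemma cadlag_on01_cong:
  assumes "\<And>t. t \<in> {0..1} \<Longrightarrow> x t = y t"
  shows "cadlag_on01 x \<longleftrightarrow> cadlag_on01 y"
proof -
  have 1: "cadlag_on01 y" if c: "cadlag_on01 x" and e: "\<And>t. t \<in> {0..1} \<Longrightarrow> x t = y t"
    for x y :: "real \<Rightarrow> 'a"
    unfolding cadlag_on01_def
  proof (intro conjI ballI)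
    fix t :: real assume t: "t \<in> {0..<1}"
    have "eventually (\<lambda>s. x s = y s) (at_right t)"
      unfolding eventually_at_right_field using t by (intro exI[of _ 1]) (auto intro!: e)
    moreover have "(x \<longlongrightarrow> y t) (at_right t)"
      using c t e[of t, symmetric] by (auto simp: cadlag_on01_def)
    ultimately show "(y \<longlongrightarrow> y t) (at_right t)"
      using tendsto_cong by blast
  next
    fix t :: real assume t: "t \<in> {0<..1}"
    have "eventually (\<lambda>s. x s = y s) (at_left t)"
      unfolding eventually_at_left_field using t by (intro exI[of _ 0]) (auto intro!: e)
    moreover obtain l where "(x \<longlongrightarrow> l) (at_left t)"
      using c t unfolding cadlag_on01_def by blast
    ultimately show "\<exists>l. (y \<longlongrightarrow> l) (at_left t)"
      using tendsto_cong by blast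
  qed
  from 1[of x y] 1[of y x] assms show ?thesis by auto
qed

lemma cadlag_on01_continuous:
  assumes "continuous_on {0..1} x"
  shows "cadlag_on01 x"
  unfolding cadlag_on01_def
proof (intro conjI ballI)
  fix t :: real assume t: "t \<in> {0..<1}"
  then have "(x \<longlongrightarrow> x t) (at t within {0..1})"
    using assms by (auto simp: continuous_on_def)
  then have "(x \<longlongrightarrow> x t) (at t within {t..1})"
    by (rule tendsto_within_subset) (use t in auto)
  then show "(x \<longlongrightarrow> x t) (at_right t)"
    using t by (simp add: at_within_Icc_at_right)
next
  fix t :: real assume t: "t \<in> {0<..1}"
  then have "(x \<longlongrightarrow> x t) (at t within {0..1})"
    using assms by (auto simp: continuous_on_def)
  then have "(x \<longlongrightarrow> x t) (at t within {0..t})"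
    by (rule tendsto_within_subset) (use t in auto)
  then show "\<exists>l. (x \<longlongrightarrow> l) (at_left t)"
    using t by (auto simp add: at_within_Icc_at_left)
qed

lemma cadlag_on01_bounded:
  fixes x :: "real \<Rightarrow> 'a::metric_space"
  assumes "cadlag_on01 x"
  shows "bounded (x ` {0..1})"
proof -
  have "\<exists>d>0. bounded (x ` ({t - d<..<t + d} \<inter> {0..1}))" if t: "t \<in> {0..1}" for t
  proof -
    have R: "\<exists>d>0. bounded (x ` ({t<..<t + d} \<inter> {0..1}))"
    proof (cases "t < 1")
      case True
      then have "(x \<longlongrightarrow> x t) (at_right t)" using assms t by (auto simp: cadlag_on01_def)
      then have "eventually (\<lambda>s. dist (x s) (x t) < 1) (at_right t)"
        by (rule tendstoD) simp
      then obtain b where b: "b > t" "\<And>s. t < s \<Longrightarrow> s < b \<Longrightarrow> dist (x s) (x t) < 1"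
        by (auto simp: eventually_at_right_field)
      have "x ` ({t<..<t + (b - t)} \<inter> {0..1}) \<subseteq> ball (x t) 1"
        using b by (auto simp: dist_commute)
      with b(1) show ?thesis
        by (intro exI[of _ "b - t"]) (auto intro: bounded_subset[OF bounded_ball])
    next
      case False
      then have "{t<..<t + 1} \<inter> {0..1} = {}" by auto
      then show ?thesis by (intro exI[of _ 1]) auto
    qed
    have L: "\<exists>d>0. bounded (x ` ({t - d<..<t} \<inter> {0..1}))"
    proof (cases "0 < t")
      case True
      then have "t \<in> {0<..1}" using t by simp
      then obtain l where "(x \<longlongrightarrow> l) (at_left t)" using assms unfolding cadlag_on01_def by blast
      then have "eventually (\<lambda>s. dist (x s) l < 1) (at_left t)"
        by (rule tendstoD) simp
      then obtain b where b: "b < t" "\<And>s. b < s \<Longrightarrow> s < t \<Longrightarrow> dist (x s) l < 1"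
        by (auto simp: eventually_at_left_field)
      have "x ` ({t - (t - b)<..<t} \<inter> {0..1}) \<subseteq> ball l 1"
        using b by (auto simp: dist_commute)
      with b(1) show ?thesis
        by (intro exI[of _ "t - b"]) (auto intro: bounded_subset[OF bounded_ball])
    next
      case False
      then have "{t - 1<..<t} \<inter> {0..1} = {}" by auto
      then show ?thesis by (intro exI[of _ 1]) auto
    qed
    from R L obtain d1 d2 where d: "d1 > 0" "d2 > 0"
      "bounded (x ` ({t<..<t + d1} \<inter> {0..1}))" "bounded (x ` ({t - d2<..<t} \<inter> {0..1}))"
      by blast
    have "x ` ({t - min d1 d2<..<t + min d1 d2} \<inter> {0..1}) \<subseteq>
        insert (x t) (x ` ({t<..<t + d1} \<inter> {0..1}) \<union> x ` ({t - d2<..<t} \<inter> {0..1}))"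
    proof (rule image_subsetI)
      fix s assume "s \<in> {t - min d1 d2<..<t + min d1 d2} \<inter> {0..1}"
      then have "s = t \<or> s \<in> {t<..<t + d1} \<inter> {0..1} \<or> s \<in> {t - d2<..<t} \<inter> {0..1}" by auto
      then show "x s \<in> insert (x t) (x ` ({t<..<t + d1} \<inter> {0..1}) \<union> x ` ({t - d2<..<t} \<inter> {0..1}))"
        by blast
    qed
    moreover have "bounded (insert (x t) (x ` ({t<..<t + d1} \<inter> {0..1}) \<union> x ` ({t - d2<..<t} \<inter> {0..1})))"
      using d by (simp add: bounded_Un)
    ultimately have "bounded (x ` ({t - min d1 d2<..<t + min d1 d2} \<inter> {0..1}))"
      by (rule bounded_subset[rotated])
    then show ?thesis using d(1,2) by (intro exI[of _ "min d1 d2"]) simp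
  qed
  then obtain d where d: "\<And>t. t \<in> {0..1} \<Longrightarrow> d t > 0"
    "\<And>t. t \<in> {0..1} \<Longrightarrow> bounded (x ` ({t - d t<..<t + d t} \<inter> {0..1}))"
    by metis
  have "compact {0..1::real}" by simp
  moreover have "\<And>t. t \<in> {0..1} \<Longrightarrow> open {t - d t<..<t + d t}" by simp
  moreover have "{0..1} \<subseteq> (\<Union>t\<in>{0..1}. {t - d t<..<t + d t})"
  proof
    fix t :: real assume "t \<in> {0..1}"
    with d(1)[of t] show "t \<in> (\<Union>t\<in>{0..1}. {t - d t<..<t + d t})"
      by (intro UN_I[of t]) auto
  qed
  ultimately obtain C where C: "C \<subseteq> {0..1}" "finite C" "{0..1} \<subseteq> (\<Union>t\<in>C. {t - d t<..<t + d t})"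
    by (rule compactE_image)
  have "x ` {0..1} \<subseteq> (\<Union>t\<in>C. x ` ({t - d t<..<t + d t} \<inter> {0..1}))"
    using C(3) by blast
  moreover have "bounded (\<Union>t\<in>C. x ` ({t - d t<..<t + d t} \<inter> {0..1}))"
    using C d(2) by (intro bounded_UN) auto
  ultimately show ?thesis by (rule bounded_subset[rotated])
qed

text \<open>Paths are functions on \<open>\<real>\<close> normalised to be \<^const>\<open>undefined\<close> off the unit interval, so
  that equality in the type is equality on the unit interval.\<close>

typedef (overloaded) ('a::topological_space) skorokhod =
  "{x \<in> extensional {0..1::real}. cadlag_on01 (x :: real \<Rightarrow> 'a)}"
  morphisms path_of Abs_skorokhod
proof
  show "restrict (\<lambda>_. undefined) {0..1} \<in> {x \<in> extensional {0..1::real}. cadlag_on01 (x :: real \<Rightarrow> 'a)}"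
    by (auto simp: cadlag_on01_continuous cong: cadlag_on01_cong)
qed

text \<open>Only meaningful for functions satisfying \<^const>\<open>cadlag_on01\<close>.\<close>

definition to_skorokhod :: "(real \<Rightarrow> 'a::topological_space) \<Rightarrow> 'a skorokhod" where
  "to_skorokhod x = Abs_skorokhod (restrict x {0..1})"

lemma path_of_to_skorokhod:
  assumes "cadlag_on01 x" "t \<in> {0..1}"
  shows "path_of (to_skorokhod x) t = x t"
proof -
  have "cadlag_on01 (restrict x {0..1})"
    using assms(1) cadlag_on01_cong[of "restrict x {0..1}" x] by simp
  with assms(2) show ?thesis
    by (simp add: to_skorokhod_def Abs_skorokhod_inverse)
qed

definition time_changes :: "(real \<Rightarrow> real) set" where
  "time_changes = {\<tau>. continuous_on {0..1} \<tau> \<and> strict_mono_on {0..1} \<tau> \<and> \<tau> ` {0..1} = {0..1}}"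

definition skorokhod_close :: "real \<Rightarrow> 'a::metric_space skorokhod \<Rightarrow> 'a skorokhod \<Rightarrow> bool" where
  "skorokhod_close e x y \<longleftrightarrow>
     (\<exists>\<tau>\<in>time_changes. \<forall>t\<in>{0..1}. \<bar>\<tau> t - t\<bar> \<le> e \<and> dist (path_of x t) (path_of y (\<tau> t)) \<le> e)"

lemma id_time_change: "(\<lambda>t. t) \<in> time_changes"
  by (auto simp: time_changes_def strict_mono_on_def)

lemma skorokhod_close_ex: "\<exists>e>0. skorokhod_close e x y"
proof -
  have "bounded (path_of x ` {0..1} \<union> path_of y ` {0..1})"
    using path_of[of x] path_of[of y] by (simp add: cadlag_on01_bounded)
  then obtain e where e: "\<forall>u\<in>path_of x ` {0..1} \<union> path_of y ` {0..1}.
      \<forall>v\<in>path_of x ` {0..1} \<union> path_of y ` {0..1}. dist u v \<le> e"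
    by (auto simp: bounded_two_points)
  then have "\<forall>t\<in>{0..1}. dist (path_of x t) (path_of y t) \<le> max e 1"
    by (auto simp: le_max_iff_disj)
  then have "skorokhod_close (max e 1) x y"
    unfolding skorokhod_close_def using id_time_change by (intro bexI[of _ "\<lambda>t. t"]) auto
  then show ?thesis by (intro exI[of _ "max e 1"]) auto
qed

lemma skorokhod_close_mono: "skorokhod_close e x y \<Longrightarrow> e \<le> e' \<Longrightarrow> skorokhod_close e' x y"
  unfolding skorokhod_close_def by force

lemma skorokhod_close_sym:
  assumes "skorokhod_close e x y" shows "skorokhod_close e y x"
proof -
  obtain l where l: "continuous_on {0..1} l" "strict_mono_on {0..1} l" "l ` {0..1} = {0..1}"
    and c: "\<And>t. t \<in> {0..1} \<Longrightarrow> \<bar>l t - t\<bar> \<le> e \<and> dist (path_of x t) (path_of y (l t)) \<le> e"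
    using assms unfolding skorokhod_close_def time_changes_def by auto
  define m where "m = inv_into {0..1} l"
  have inj: "inj_on l {0..1}" using l(2) strict_mono_on_imp_inj_on by blast
  have m1: "l (m t) = t" "m t \<in> {0..1}" if "t \<in> {0..1}" for t
    using that l(3) unfolding m_def by (auto simp: f_inv_into_f inv_into_into)
      (metis atLeastAtMost_iff inv_into_into)+
  have m2: "m (l t) = t" if "t \<in> {0..1}" for t
    using that inj unfolding m_def by simp
  have "continuous_on (l ` {0..1}) m"
    using l(1) m2 by (intro continuous_on_inv) auto
  moreover have "strict_mono_on {0..1} m"
  proof (rule strict_mono_onI)
    fix r s :: real assume rs: "r \<in> {0..1}" "s \<in> {0..1}" "r < s"
    then show "m r < m s"
      using m1[of r] m1[of s] strict_mono_onD[OF l(2), of "m s" "m r"]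
      by (cases "m r" "m s" rule: linorder_cases) auto
  qed
  moreover have "m ` {0..1} = {0..1}"
  proof
    show "m ` {0..1} \<subseteq> {0..1}" using m1(2) by blast
    show "{0..1} \<subseteq> m ` {0..1}"
    proof
      fix t :: real assume t: "t \<in> {0..1}"
      then have "l t \<in> {0..1}" using l(3) by blast
      then show "t \<in> m ` {0..1}" using m2[OF t] by (metis imageI)
    qed
  qed
  ultimately have "m \<in> time_changes" using l(3) by (simp add: time_changes_def)
  moreover have "\<bar>m t - t\<bar> \<le> e \<and> dist (path_of y t) (path_of x (m t)) \<le> e" if "t \<in> {0..1}" for t
    using c[of "m t"] m1[OF that] by (auto simp: dist_commute abs_minus_commute)
  ultimately show ?thesis unfolding skorokhod_close_def by blast
qed

lemma skorokhod_close_trans: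
  assumes "skorokhod_close e x y" "skorokhod_close e' y z"
  shows "skorokhod_close (e + e') x z"
proof -
  obtain l where l: "continuous_on {0..1} l" "strict_mono_on {0..1} l" "l ` {0..1} = {0..1}"
    and c: "\<And>t. t \<in> {0..1} \<Longrightarrow> \<bar>l t - t\<bar> \<le> e \<and> dist (path_of x t) (path_of y (l t)) \<le> e"
    using assms(1) unfolding skorokhod_close_def time_changes_def by auto
  obtain m where m: "continuous_on {0..1} m" "strict_mono_on {0..1} m" "m ` {0..1} = {0..1}"
    and d: "\<And>t. t \<in> {0..1} \<Longrightarrow> \<bar>m t - t\<bar> \<le> e' \<and> dist (path_of y t) (path_of z (m t)) \<le> e'"
    using assms(2) unfolding skorokhod_close_def time_changes_def by auto
  have l01: "l t \<in> {0..1}" if "t \<in> {0..1}" for t using l(3) that by blast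
  have "continuous_on {0..1} (\<lambda>t. m (l t))"
    using continuous_on_compose2[OF m(1) l(1)] l(3) by simp
  moreover have "strict_mono_on {0..1} (\<lambda>t. m (l t))"
    by (rule strict_mono_onI) (meson l(2) m(2) l01 strict_mono_onD)
  moreover have "(\<lambda>t. m (l t)) ` {0..1} = {0..1}"
    using l(3) m(3) by (metis image_image)
  ultimately have "(\<lambda>t. m (l t)) \<in> time_changes" by (simp add: time_changes_def)
  moreover have "\<bar>m (l t) - t\<bar> \<le> e + e' \<and> dist (path_of x t) (path_of z (m (l t))) \<le> e + e'"
    if t: "t \<in> {0..1}" for t
    using c[OF t] d[OF l01[OF t]]
      dist_triangle[of "path_of x t" "path_of z (m (l t))" "path_of y (l t)"] by auto
  ultimately show ?thesis
    unfolding skorokhod_close_def by (intro bexI[of _ "\<lambda>t. m (l t)"]) auto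
qed

lemma skorokhod_close_all_imp_eq:
  assumes "\<And>e. e > 0 \<Longrightarrow> skorokhod_close e x y"
  shows "x = y"
proof -
  have cx: "cadlag_on01 (path_of x)" and ex: "path_of x \<in> extensional {0..1}"
    and cy: "cadlag_on01 (path_of y)" and ey: "path_of y \<in> extensional {0..1}"
    using path_of[of x] path_of[of y] by auto
  have near: "\<exists>s\<in>{0..1}. \<bar>s - t\<bar> \<le> e \<and> dist (path_of x t) (path_of y s) \<le> e" if "e > 0" "t \<in> {0..1}" for e t
    using assms[OF that(1)] that(2) unfolding skorokhod_close_def time_changes_def by blast
  have one: "path_of x 1 = path_of y 1"
  proof (rule ccontr)
    assume ne: "path_of x 1 \<noteq> path_of y 1"
    define e where "e = dist (path_of x 1) (path_of y 1) / 2"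
    have "e > 0" using ne by (simp add: e_def)
    then obtain l where lt: "l \<in> time_changes"
      and "\<forall>t\<in>{0..1}. \<bar>l t - t\<bar> \<le> e \<and> dist (path_of x t) (path_of y (l t)) \<le> e"
      using assms[of e] unfolding skorokhod_close_def by blast
    then have l3: "dist (path_of x 1) (path_of y (l 1)) \<le> e" by (meson atLeastAtMost_iff order_refl zero_le_one)
    have l: "strict_mono_on {0..1} l" "l ` {0..1} = {0..1}"
      using lt by (auto simp: time_changes_def)
    have "l 1 = 1"
    proof -
      have "1 \<in> l ` {0..1}" using l(2) by simp
      then obtain t where t: "t \<in> {0..1}" "l t = 1" by auto
      have "l 1 \<in> {0..1}" using l(2) by force
      then show ?thesis using t strict_mono_onD[OF l(1), of t 1] by (cases "t = 1") auto
    qed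
    then show False using l3 ne \<open>e > 0\<close> by (simp add: e_def)
  qed
  have main: "path_of x t = path_of y t" if t: "t \<in> {0..<1}" for t
  proof (rule ccontr)
    assume ne: "path_of x t \<noteq> path_of y t"
    define e where "e = dist (path_of x t) (path_of y t) / 4"
    have e: "e > 0" using ne by (simp add: e_def)
    have "eventually (\<lambda>s. dist (path_of x s) (path_of x t) < e) (at_right t)"
      "eventually (\<lambda>s. dist (path_of y s) (path_of y t) < e) (at_right t)"
      using cx cy t e by (auto simp: cadlag_on01_def intro!: tendstoD)
    then have "eventually (\<lambda>s. dist (path_of x s) (path_of x t) < e \<and> dist (path_of y s) (path_of y t) < e) (at_right t)"
      by (rule eventually_conj)
    then obtain b where b: "b > t" "\<And>s. t < s \<Longrightarrow> s < b \<Longrightarrow>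
        dist (path_of x s) (path_of x t) < e \<and> dist (path_of y s) (path_of y t) < e"
      by (auto simp: eventually_at_right_field)
    define c where "c = min b 1"
    define s where "s = (t + c) / 2"
    define r where "r = min e ((c - t) / 4)"
    have c: "t < c" "c \<le> b" "c \<le> 1" using b(1) t by (auto simp: c_def)
    have r: "r > 0" "r \<le> e" "r \<le> (c - t) / 4"
      using c(1) e min.cobounded1[of e "(c - t) / 4"] min.cobounded2[of e "(c - t) / 4"]
      by (simp_all only: r_def, simp)
    have s: "s \<in> {0..1}" "t < s" "s < b" using c t by (auto simp: s_def)
    obtain u where u: "u \<in> {0..1}" "\<bar>u - s\<bar> \<le> r" "dist (path_of x s) (path_of y u) \<le> r"
      using near[OF r(1) s(1)] by blast
    have "t < u" "u < b" using u(2) r(3) c by (auto simp: s_def abs_le_iff field_simps)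
    then have "dist (path_of y u) (path_of y t) < e" "dist (path_of x s) (path_of x t) < e"
      using b(2) s by auto
    with u(3) r(2) have "dist (path_of x t) (path_of y t) < 3 * e"
      by metric
    then show False using e by (simp add: e_def)
  qed
  have "path_of x = path_of y"
  proof (rule extensionalityI[OF ex ey])
    fix t :: real assume "t \<in> {0..1}"
    then show "path_of x t = path_of y t" using one main[of t] by (cases "t = 1") auto
  qed
  then show ?thesis by (simp add: path_of_inject)
qed

text \<open>The metric is Billingsley's \<open>d\<close>; it is not complete, but it induces the Skorokhod (J1) topology.\<close>

instantiation skorokhod :: (metric_space) metric_space
begin

definition dist_skorokhod :: "'a skorokhod \<Rightarrow> 'a skorokhod \<Rightarrow> real" where
  "dist_skorokhod x y = Inf {e. 0 < e \<and> skorokhod_close e x y}"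

definition uniformity_skorokhod :: "('a skorokhod \<times> 'a skorokhod) filter" where
  "uniformity_skorokhod = (INF e\<in>{0<..}. principal {(x, y). dist x y < e})"

definition open_skorokhod :: "'a skorokhod set \<Rightarrow> bool" where
  "open_skorokhod U \<longleftrightarrow> (\<forall>x\<in>U. eventually (\<lambda>(x', y). x' = x \<longrightarrow> y \<in> U) uniformity)"

instance
proof
  have ne: "{e. 0 < e \<and> skorokhod_close e x y} \<noteq> {}" for x y :: "'a skorokhod"
    using skorokhod_close_ex[of x y] by auto
  have bdd: "bdd_below {e. 0 < e \<and> skorokhod_close e x y}" for x y :: "'a skorokhod"
    by (rule bdd_belowI[of _ 0]) auto
  have less: "skorokhod_close e x y" if "dist x y < e" for x y :: "'a skorokhod" and e
    using that cInf_less_iff[OF ne bdd, of x y e] skorokhod_close_mono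
    unfolding dist_skorokhod_def by fastforce
  have nonneg: "0 \<le> dist x y" for x y :: "'a skorokhod"
    unfolding dist_skorokhod_def using ne by (intro cInf_greatest) auto
  have le: "dist x y \<le> e" if "0 < e" "skorokhod_close e x y" for x y :: "'a skorokhod" and e
    unfolding dist_skorokhod_def using that by (intro cInf_lower bdd) auto
  have sym: "dist x y = dist y x" for x y :: "'a skorokhod"
    unfolding dist_skorokhod_def using skorokhod_close_sym by metis
  fix x y z :: "'a skorokhod"
  show "dist x y = 0 \<longleftrightarrow> x = y"
  proof
    assume "dist x y = 0"
    then show "x = y" by (intro skorokhod_close_all_imp_eq less) simp
  next
    assume "x = y"
    then have "skorokhod_close e x y" if "e > 0" for e
      unfolding skorokhod_close_def using that id_time_change by (intro bexI[of _ "\<lambda>t. t"]) auto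
    then have "dist x y \<le> e" if "e > 0" for e using that le by blast
    then show "dist x y = 0" using nonneg[of x y] by (meson dense_ge order_antisym)
  qed
  show "dist x y \<le> dist x z + dist y z"
  proof (rule field_le_epsilon)
    fix e :: real assume e: "0 < e"
    have "skorokhod_close (dist x z + e / 2) x z" "skorokhod_close (dist z y + e / 2) z y"
      using e by (auto intro!: less)
    then have "skorokhod_close (dist x z + e / 2 + (dist z y + e / 2)) x y"
      by (rule skorokhod_close_trans)
    then have "dist x y \<le> dist x z + e / 2 + (dist z y + e / 2)"
      using e nonneg[of x z] nonneg[of z y] by (intro le) auto
    then show "dist x y \<le> dist x z + dist y z + e" by (simp add: sym[of z y])
  qed
qed (fact uniformity_skorokhod_def open_skorokhod_def)+

end


section \<open>Convergence in distribution\<close>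

definition conv_in_distribution ::
  "'a measure \<Rightarrow> (nat \<Rightarrow> 'a \<Rightarrow> 'c::topological_space) \<Rightarrow> 'b measure \<Rightarrow> ('b \<Rightarrow> 'c) \<Rightarrow> bool" where
  "conv_in_distribution M Z N W \<longleftrightarrow>
     (\<forall>n. Z n \<in> borel_measurable M) \<and> W \<in> borel_measurable N \<and>
     (\<forall>f :: 'c \<Rightarrow> real. continuous_on UNIV f \<and> bounded (range f) \<longrightarrow>
        (\<lambda>n. \<integral>\<omega>. f (Z n \<omega>) \<partial>M) \<longlonglongrightarrow> (\<integral>\<omega>. f (W \<omega>) \<partial>N))"

definition conv_in_distribution_D ::
  "'a measure \<Rightarrow> (nat \<Rightarrow> real \<Rightarrow> 'a \<Rightarrow> 'c::metric_space) \<Rightarrow>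
   'b measure \<Rightarrow> (real \<Rightarrow> 'b \<Rightarrow> 'c) \<Rightarrow> bool" where
  "conv_in_distribution_D M Z N W \<longleftrightarrow>
     (\<forall>n. \<forall>\<omega>\<in>space M. cadlag_on01 (\<lambda>t. Z n t \<omega>)) \<and>
     (\<forall>\<omega>\<in>space N. cadlag_on01 (\<lambda>t. W t \<omega>)) \<and>
     conv_in_distribution
       M (\<lambda>n \<omega>. to_skorokhod (\<lambda>t. Z n t \<omega>)) N (\<lambda>\<omega>. to_skorokhod (\<lambda>t. W t \<omega>))"


section \<open>Brownian bridges\<close>

definition gaussian_rv :: "'a measure \<Rightarrow> ('a \<Rightarrow> real) \<Rightarrow> bool" where
  "gaussian_rv M Z \<longleftrightarrow> Z \<in> borel_measurable M \<and>
     (\<exists>m. (AE \<omega> in M. Z \<omega> = m) \<or> (\<exists>s>0. distributed M lborel Z (normal_density m s)))"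

definition gaussian_process_on :: "'t set \<Rightarrow> 'a measure \<Rightarrow> ('t \<Rightarrow> 'a \<Rightarrow> real) \<Rightarrow> bool" where
  "gaussian_process_on T M Z \<longleftrightarrow>
     (\<forall>S c. finite S \<and> S \<subseteq> T \<longrightarrow> gaussian_rv M (\<lambda>\<omega>. \<Sum>t\<in>S. c t * Z t \<omega>))"

definition standard_brownian_bridge :: "'a measure \<Rightarrow> (real \<Rightarrow> 'a \<Rightarrow> real) \<Rightarrow> bool" where
  "standard_brownian_bridge M b \<longleftrightarrow>
     prob_space M \<and>
     gaussian_process_on {0..1} M b \<and>
     (\<forall>t\<in>{0..1}. (\<integral>\<omega>. b t \<omega> \<partial>M) = 0) \<and>
     (\<forall>s\<in>{0..1}. \<forall>t\<in>{0..1}. (\<integral>\<omega>. b s \<omega> * b t \<omega> \<partial>M) = min s t - s * t) \<and>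
     (\<forall>\<omega>\<in>space M. continuous_on {0..1} (\<lambda>t. b t \<omega>))"

definition standard_brownian_bridge_vec ::
  "'a measure \<Rightarrow> (real \<Rightarrow> 'a \<Rightarrow> real ^ 'd) \<Rightarrow> bool" where
  "standard_brownian_bridge_vec M B \<longleftrightarrow>
     (\<forall>i. standard_brownian_bridge M (\<lambda>t \<omega>. B t \<omega> $ i)) \<and>
     prob_space.indep_vars M (\<lambda>_. Pi\<^sub>M {0..1} (\<lambda>_. borel))
       (\<lambda>i \<omega>. restrict (\<lambda>t. B t \<omega> $ i) {0..1}) UNIV"


section \<open>INAR processes\<close>

datatype inar_source = Init int | Innov nat | Thin nat nat nat

fun inar_source_rv ::
  "(int \<Rightarrow> 'a \<Rightarrow> nat) \<Rightarrow> (nat \<Rightarrow> nat \<Rightarrow> nat \<Rightarrow> 'a \<Rightarrow> nat) \<Rightarrow> (nat \<Rightarrow> 'a \<Rightarrow> nat) \<Rightarrow> inar_source \<Rightarrow> 'a \<Rightarrow> nat"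
where
  "inar_source_rv X \<xi> \<epsilon> (Init k) = X k"
| "inar_source_rv X \<xi> \<epsilon> (Innov k) = \<epsilon> k"
| "inar_source_rv X \<xi> \<epsilon> (Thin i k j) = \<xi> i k j"

definition inar_init :: "nat \<Rightarrow> inar_source set" where
  "inar_init p = Init ` {- int p + 1..0}"

definition inar_noise :: "nat \<Rightarrow> inar_source set" where
  "inar_noise p = Innov ` {1..} \<union> {Thin i k j |i k j. i \<in> {1..p} \<and> 1 \<le> k \<and> 1 \<le> j}"

text \<open>The initial values are jointly independent of the thinning and innovation variables, but
  need not be independent among themselves. Measurability of all variables is part of the
  independence assumptions.\<close>

locale inar_process = prob_space M for M :: "'a measure" +
  fixes p :: nat
    and \<alpha> :: "nat \<Rightarrow> real" and \<mu> :: real and \<sigma> :: real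
    and X :: "int \<Rightarrow> 'a \<Rightarrow> nat"
    and \<xi> :: "nat \<Rightarrow> nat \<Rightarrow> nat \<Rightarrow> 'a \<Rightarrow> nat"
    and \<epsilon> :: "nat \<Rightarrow> 'a \<Rightarrow> nat"
  assumes order_pos: "1 \<le> p"
    and coeff_range: "\<And>i. i \<in> {1..p} \<Longrightarrow> \<alpha> i \<in> {0..1}"
    and recursion: "\<And>k \<omega>. 1 \<le> k \<Longrightarrow> \<omega> \<in> space M \<Longrightarrow>
      X (int k) \<omega> = (\<Sum>i=1..p. \<Sum>j=1..X (int k - int i) \<omega>. \<xi> i k j \<omega>) + \<epsilon> k \<omega>"
    and thinning_law: "\<And>i k j. i \<in> {1..p} \<Longrightarrow> 1 \<le> k \<Longrightarrow> 1 \<le> j \<Longrightarrow>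
      distr M (count_space UNIV) (\<xi> i k j) = measure_pmf (map_pmf of_bool (bernoulli_pmf (\<alpha> i)))"
    and innovation_law: "\<And>k. 1 \<le> k \<Longrightarrow>
      distr M (count_space UNIV) (\<epsilon> k) = distr M (count_space UNIV) (\<epsilon> 1)"
    and innovation_square_integrable: "integrable M (\<lambda>\<omega>. (real (\<epsilon> 1 \<omega>))\<^sup>2)"
    and innovation_mean: "expectation (\<lambda>\<omega>. real (\<epsilon> 1 \<omega>)) = \<mu>"
    and innovation_variance: "variance (\<lambda>\<omega>. real (\<epsilon> 1 \<omega>)) = \<sigma>\<^sup>2"
    and noise_indep:
      "indep_vars (\<lambda>_. count_space UNIV) (inar_source_rv X \<xi> \<epsilon>) (inar_noise p)"
    and init_indep_noise:
      "indep_var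
         (Pi\<^sub>M (inar_init p) (\<lambda>_. count_space UNIV))
         (\<lambda>\<omega>. restrict (\<lambda>s. inar_source_rv X \<xi> \<epsilon> s \<omega>) (inar_init p))
         (Pi\<^sub>M (inar_noise p) (\<lambda>_. count_space UNIV))
         (\<lambda>\<omega>. restrict (\<lambda>s. inar_source_rv X \<xi> \<epsilon> s \<omega>) (inar_noise p))"


section \<open>Conditional least squares estimators and the test process\<close>

text \<open>Vectors in \<open>\<real>\<^sup>p\<^sup>+\<^sup>1\<close> have type \<^typ>\<open>real ^ 'p option\<close> with \<open>p = CARD('p)\<close>: the coordinate
  \<^term>\<open>Some i\<close>, for \<open>i\<close> the \<open>l\<close>-th smallest element of \<^typ>\<open>'p\<close>, is the \<open>l\<close>-th coordinate
  (belonging to \<open>X\<^sub>k\<^sub>-\<^sub>l\<close> and \<open>\<alpha>\<^sub>l\<close>), and \<^term>\<open>None\<close> is the last one.\<close>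

definition lag :: "'p::{finite,linorder} \<Rightarrow> nat" where
  "lag i = card {..i}"

lemma bij_betw_lag: "bij_betw lag (UNIV :: 'p set) {1..CARD('p::{finite,linorder})}"
proof -
  have less: "lag i < lag j" if "i < j" for i j :: 'p
    unfolding lag_def using that by (intro psubset_card_mono) auto
  then have inj: "inj (lag :: 'p \<Rightarrow> nat)"
    by (metis injI less_irrefl linorder_neqE)
  have "lag i \<in> {1..CARD('p)}" for i :: 'p
  proof -
    have "card {i} \<le> card {..i}" "card {..i} \<le> CARD('p)" by (intro card_mono; simp)+
    then show ?thesis by (simp add: lag_def)
  qed
  then have "range (lag :: 'p \<Rightarrow> nat) \<subseteq> {1..CARD('p)}" by blast
  moreover have "card (range (lag :: 'p \<Rightarrow> nat)) = card {1..CARD('p)}"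
    using inj by (simp add: card_image)
  ultimately have "range (lag :: 'p \<Rightarrow> nat) = {1..CARD('p)}"
    by (intro card_subset_eq) auto
  with inj show ?thesis by (simp add: bij_betw_def)
qed

definition outer :: "real ^ 'd \<Rightarrow> real ^ 'd \<Rightarrow> real ^ 'd ^ 'd" where
  "outer u v = (\<chi> i j. u $ i * v $ j)"

definition psd :: "real ^ 'd ^ 'd \<Rightarrow> bool" where
  "psd A \<longleftrightarrow> transpose A = A \<and> (\<forall>v. 0 \<le> v \<bullet> (A *v v))"

text \<open>The symmetric square root; an unspecified fixed matrix unless \<^term>\<open>psd A\<close>.\<close>

definition sqrt_mat :: "real ^ 'd ^ 'd \<Rightarrow> real ^ 'd ^ 'd" where
  "sqrt_mat A = (THE R. psd R \<and> R ** R = A)"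

context
  fixes X :: "int \<Rightarrow> 'a \<Rightarrow> nat"
begin

definition inar_Y :: "nat \<Rightarrow> 'a \<Rightarrow> real ^ 'p::{finite,linorder} option" where
  "inar_Y k \<omega> = (\<chi> c. case c of Some i \<Rightarrow> real (X (int k - int (lag i)) \<omega>) | None \<Rightarrow> 1)"

definition inar_Q :: "nat \<Rightarrow> 'a \<Rightarrow> real ^ 'p option ^ 'p::{finite,linorder} option" where
  "inar_Q n \<omega> = (\<Sum>k=1..n. outer (inar_Y k \<omega>) (inar_Y k \<omega>))"

definition cls_theta :: "nat \<Rightarrow> 'a \<Rightarrow> real ^ 'p::{finite,linorder} option" where
  "cls_theta n \<omega> = matrix_inv (inar_Q n \<omega>) *v (\<Sum>k=1..n. real (X (int k) \<omega>) *\<^sub>R inar_Y k \<omega>)"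

text \<open>The estimators that return numbers take the estimate \<open>\<theta>\<close> as an explicit argument, which
  fixes the dimension; it is always instantiated with \<^const>\<open>cls_theta\<close>.\<close>

definition residual :: "real ^ 'p::{finite,linorder} option \<Rightarrow> nat \<Rightarrow> 'a \<Rightarrow> real" where
  "residual \<theta> k \<omega> = real (X (int k) \<omega>) - \<theta> \<bullet> inar_Y k \<omega>"

definition thinning_variance :: "real ^ 'p::{finite,linorder} option \<Rightarrow> nat \<Rightarrow> 'a \<Rightarrow> real" where
  "thinning_variance \<theta> k \<omega> =
     (\<Sum>i\<in>UNIV. \<theta> $ Some i * (1 - \<theta> $ Some i) * real (X (int k - int (lag i)) \<omega>))"

definition sigma2_est :: "real ^ 'p::{finite,linorder} option \<Rightarrow> nat \<Rightarrow> 'a \<Rightarrow> real" where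
  "sigma2_est \<theta> n \<omega> =
     (1 / real n) * (\<Sum>k=1..n. (residual \<theta> k \<omega>)\<^sup>2 - thinning_variance \<theta> k \<omega>)"

definition inar_I :: "nat \<Rightarrow> 'a \<Rightarrow> real ^ 'p option ^ 'p::{finite,linorder} option" where
  "inar_I n \<omega> =
     (let \<theta> = (cls_theta n \<omega> :: real ^ 'p option) in
      \<Sum>k=1..n. (thinning_variance \<theta> k \<omega> + sigma2_est \<theta> n \<omega>) *\<^sub>R outer (inar_Y k \<omega>) (inar_Y k \<omega>))"

definition test_process :: "nat \<Rightarrow> real \<Rightarrow> 'a \<Rightarrow> real ^ 'p::{finite,linorder} option" where
  "test_process n t \<omega> =
     (let \<theta> = (cls_theta n \<omega> :: real ^ 'p option) in
      matrix_inv (sqrt_mat (inar_I n \<omega>)) *v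
        (\<Sum>k=1..nat \<lfloor>real n * t\<rfloor>. residual \<theta> k \<omega> *\<^sub>R inar_Y k \<omega>))"

end

end

theory Submission
 imports Defs "HOL-Probability.Probability"
begin

text \<open>The coefficients of the test process are estimated, so the process is a functional of the scores
\<open>S k = (\<Sum>j<k. d j *\<^sub>R Y j)\<close>, where \<open>d j\<close> is the martingale difference
\<open>X - E(X | past)\<close>. Write \<open>Q k\<close> for the partial sums of \<open>Y Y\<^sup>T\<close>. The least squares error is
\<open>Q n\<^sup>-\<^sup>1 S n\<close>, hence the residuals summed against \<open>Y\<close> up to time \<open>k\<close> give \<open>S k - Q k Q n\<^sup>-\<^sup>1 S n\<close>. By
ergodicity \<open>Q k\<close> is close to \<open>k Q\<close> for a fixed positive definite matrix \<open>Q\<close>, uniformly in \<open>k \<le> n\<close>, and the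
expression is close to \<open>S k - (k / n) S n\<close>: a bridge built from the scores, in which the parameters
have disappeared. The normalisation by the estimated information matrix \<open>I\<close> makes the limiting
covariance the identity.

The proof has four independent ingredients.

\<^item> Ergodicity. A state is the vector of the last \<open>p\<close> values. A process started from a state \<open>x\<close> is the
 sum of one started from zero and of a subcritical branching process started from \<open>x\<close>
 (\<open>iterk_add\<close>), and the latter dies out exponentially fast (\<open>branching_decay\<close>). Conditional
 expectations therefore forget the initial state, which gives a law of large numbers in \<open>L\<^sup>1\<close>
 (\<open>law_of_large_numbers\<close>) for functions whose square has bounded expectation. A linear Lyapunov
 function shows that sixth moments stay bounded (\<open>lyap_moment_bounded\<close>).

\<^item> Martingales. A central limit theorem (\<open>martingale_central_limit\<close>) and a maximal inequality
 with fourth moments (\<open>martingale_maximal_inequality\<close>), both proved for an arbitrary filtration.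

\<^item> Linear algebra. Inversion and the square root of positive definite matrices are continuous
 (\<open>matrix_inv_tendsto\<close>, \<open>sqrt_mat_tendsto\<close>). Convergence in probability is expressed as
 convergence along a filter, so that consistency of all estimators follows from the usual limit rules.

\<^item> Weak convergence in \<open>D\<close>. Since the limit has continuous paths, it suffices to compare with step
 paths on a finite grid (\<open>conv_in_distribution_D_criterion\<close>): the grid values converge by a
 multivariate continuity theorem for characteristic functions (\<open>continuity_theorem_finite_dim\<close>),
 and the oscillation between grid points is small by the maximal inequality.\<close>

text \<open>The Henstock-Kurzweil integral uses the same names; these are the facts about the
Bochner integral.\<close>

lemmas bochner_integrable_add = Bochner_Integration.integrable_add
 and bochner_integrable_bound = Bochner_Integration.integrable_bound
 and bochner_integrable_cong = Bochner_Integration.integrable_cong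
 and bochner_integrable_diff = Bochner_Integration.integrable_diff
 and bochner_integrable_max = Bochner_Integration.integrable_max
 and bochner_integrable_sum = Bochner_Integration.integrable_sum
 and bochner_integral_add = Bochner_Integration.integral_add
 and bochner_integral_cong = Bochner_Integration.integral_cong
 and bochner_integral_diff = Bochner_Integration.integral_diff
 and bochner_integral_mult_right_zero = Bochner_Integration.integral_mult_right_zero
 and bochner_integral_nonneg = Bochner_Integration.integral_nonneg
 and bochner_integral_sum = Bochner_Integration.integral_sum

abbreviation (in prob_space) mean ("\<E>") where "\<E> \<equiv> expectation"

section \<open>Weak convergence in the Skorokhod space\<close>

lemma norm_integral_le:
 fixes f :: "'a => 'b::{banach, second_countable_topology}"
 assumes "integrable M f" "integrable M g" "\<And>x. x \<in> space M ==> norm (f x) <= g x"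
 shows "norm (\<integral>x. f x \<partial>M) <= (\<integral>x. g x \<partial>M)"
 using assms by (intro order_trans[OF integral_norm_bound] integral_mono) auto

lemma dist_skorokhod_le:
 fixes x y :: "'a::metric_space skorokhod"
 assumes e: "0 <= e" and le: "\<And>t. t \<in> {0..1} ==> dist (path_of x t) (path_of y t) <= e"
 shows "dist x y <= e"
proof (rule field_le_epsilon)
 fix r :: real assume r: "0 < r"
 have "skorokhod_close (e + r) x y"
  unfolding skorokhod_close_def using id_time_change e r le
  by (intro bexI[of _ "\<lambda>t. t"]) (auto intro: add_increasing2)
 then show "dist x y <= e + r"
  unfolding dist_skorokhod_def using e r by (intro cInf_lower bdd_belowI[of _ 0]) auto
qed

text \<open>The test process and all grid approximations are of this form.\<close>

lemma cadlag_on01_floor: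
 fixes g :: "int => 'a::topological_space" and c :: real
 assumes "0 <= c"
 shows "cadlag_on01 (\<lambda>t. g \<lfloor>c * t\<rfloor>)"
proof (cases "c = 0")
 case True
 then show ?thesis by (simp add: cadlag_on01_def) (auto intro: tendsto_const)
next
 case False
 with assms have c: "0 < c" by simp
 show ?thesis
  unfolding cadlag_on01_def
 proof (intro conjI ballI)
  fix t :: real
  have "\<forall>\<^sub>F s in at_right t. \<lfloor>c * s\<rfloor> = \<lfloor>c * t\<rfloor>"
  proof -
   have "c * s < of_int (\<lfloor>c * t\<rfloor> + 1)" if "s < (of_int \<lfloor>c * t\<rfloor> + 1) / c" for s
    using that c by (simp add: field_simps)
   moreover have "c * t <= c * s" if "t < s" for s using that c by simp
   ultimately have "\<lfloor>c * s\<rfloor> = \<lfloor>c * t\<rfloor>" if "t < s" "s < (of_int \<lfloor>c * t\<rfloor> + 1) / c" for s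
    using that by (smt (verit) floor_less_iff floor_mono)
   moreover have "t < (of_int \<lfloor>c * t\<rfloor> + 1) / c" using c by (simp add: field_simps) linarith
   ultimately show ?thesis unfolding eventually_at_right_field by blast
  qed
  then show "((\<lambda>t. g \<lfloor>c * t\<rfloor>) \<longlongrightarrow> g \<lfloor>c * t\<rfloor>) (at_right t)"
   by (intro tendsto_eventually) (auto elim: eventually_mono)
 next
  fix t :: real
  have "\<forall>\<^sub>F s in at_left t. \<lfloor>c * s\<rfloor> = \<lceil>c * t\<rceil> - 1"
  proof -
   have "(of_int \<lceil>c * t\<rceil> - 1) / c < t" using c by (simp add: field_simps) linarith
   moreover have "\<lfloor>c * s\<rfloor> = \<lceil>c * t\<rceil> - 1" if "s < t" "(of_int \<lceil>c * t\<rceil> - 1) / c < s" for s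
   proof -
    have "c * s < c * t" "of_int \<lceil>c * t\<rceil> - 1 < c * s" using that c by (auto simp: field_simps)
    then show ?thesis by linarith
   qed
   ultimately show ?thesis unfolding eventually_at_left_field by blast
  qed
  then show "\<exists>l. ((\<lambda>t. g \<lfloor>c * t\<rfloor>) \<longlongrightarrow> l) (at_left t)"
   by (intro exI[of _ "g (\<lceil>c * t\<rceil> - 1)"] tendsto_eventually) (auto elim: eventually_mono)
 qed
qed

text \<open>The infimal convolution with a multiple of the distance is the standard Lipschitz regularisation:
it increases to the continuous function \<open>f\<close>.\<close>

definition inf_conv :: "('c::metric_space => real) => nat => 'c => real" where
 "inf_conv f m x = (INF y. f y + real m * dist x y)"

lemma inf_conv:
 fixes f :: "'c::metric_space => real" and m :: nat
 assumes f: "continuous_on UNIV f" and B: "\<And>x. \<bar>f x\<bar> <= B"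
 defines "h \<equiv> inf_conv f"
 shows "\<bar>h m x - h m y\<bar> <= real m * dist x y" "\<bar>h m x\<bar> <= B" "h m x <= f x"
  "(\<lambda>m. h m x) \<longlonglongrightarrow> f x"
proof -
 have bdd: "bdd_below (range (\<lambda>y. f y + real m * dist x y))" for x m
 proof (rule bdd_belowI[of _ "- B"], safe)
  fix y
  have "- B <= f y" "0 <= real m * dist x y" using B[of y] by auto
  then show "- B <= f y + real m * dist x y" by linarith
 qed
 have lower: "h m x <= f y + real m * dist x y" for m x y
  unfolding h_def inf_conv_def by (rule cINF_lower[OF bdd]) simp
 have greatest: "a <= h m x" if "\<And>y. a <= f y + real m * dist x y" for a m x
  unfolding h_def inf_conv_def by (rule cINF_greatest) (use that in auto)
 have lip: "h m x <= h m y + real m * dist x y" for m x y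
 proof -
  have "h m x - real m * dist x y <= f z + real m * dist y z" for z
  proof -
   have "real m * dist x z <= real m * (dist x y + dist y z)"
    by (intro mult_left_mono dist_triangle) auto
   with lower[of m x z] show ?thesis by (simp add: algebra_simps)
  qed
  then have "h m x - real m * dist x y <= h m y" by (rule greatest)
  then show ?thesis by simp
 qed
 show "\<bar>h m x - h m y\<bar> <= real m * dist x y"
  using lip[of m x y] lip[of m y x] by (simp add: dist_commute abs_le_iff)
 show le: "h m x <= f x" for m x using lower[of m x x] by simp
 have "- B <= h m x" for m x
 proof (rule greatest)
  fix y
  have "- B <= f y" "0 <= real m * dist x y" using B[of y] by auto
  then show "- B <= f y + real m * dist x y" by linarith
 qed
 with le B show "\<bar>h m x\<bar> <= B" by (smt (verit))
 show "(\<lambda>m. h m x) \<longlonglongrightarrow> f x"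
 proof (rule LIMSEQ_I)
  fix r :: real assume r: "0 < r"
  obtain d where d: "d > 0" "\<And>y. dist y x < d ==> dist (f y) (f x) < r / 2"
   using f r unfolding continuous_on_iff by (metis UNIV_I half_gt_zero)
  obtain m0 :: nat where m0: "2 * B / d < real m0" using reals_Archimedean2 by blast
  have "norm (h m x - f x) < r" if m: "m \<ge> m0" for m
  proof -
   have "f x - r / 2 <= f y + real m * dist x y" for y
   proof (cases "dist y x < d")
    case True
    then have "f x - r / 2 <= f y" using d(2)[OF True] unfolding dist_real_def by linarith
    then show ?thesis by (simp add: add_increasing2)
   next
    case False
    have "2 * B < real m0 * d" using m0 d(1) by (simp add: field_simps)
    also have "... <= real m * dist x y" using False m d(1) by (intro mult_mono) (auto simp: dist_commute)
    finally show ?thesis using B[of x] B[of y] r by (auto simp: abs_le_iff)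
   qed
   then have "f x - r / 2 <= h m x" by (rule greatest)
   with le[of m x] r show ?thesis by auto
  qed
  then show "\<exists>m0. \<forall>m\<ge>m0. norm (h m x - f x) < r" by blast
 qed
qed

text \<open>Approximating \<open>f\<close> from below by Lipschitz functions bounds the lower limit of the integrals of \<open>f\<close>;
the same argument for \<open>- f\<close> bounds the upper limit.\<close>

lemma conv_in_distribution_lipschitzI:
 fixes Z :: "nat => 'a => 'c::metric_space"
 assumes M: "prob_space M" and N: "prob_space N"
  and Z: "\<And>n. Z n \<in> borel_measurable M" and W: "W \<in> borel_measurable N"
  and lip: "\<And>(f :: 'c => real) L. (\<And>x y. \<bar>f x - f y\<bar> <= L * dist x y) ==> continuous_on UNIV f ==>
   bounded (range f) ==> (\<lambda>n. \<integral>w. f (Z n w) \<partial>M) \<longlonglongrightarrow> (\<integral>w. f (W w) \<partial>N)"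
 shows "conv_in_distribution M Z N W"
proof -
 interpret M: prob_space M by fact
 interpret N: prob_space N by fact
 have half: "\<forall>\<^sub>F n in sequentially. (\<integral>w. f (W w) \<partial>N) - e < (\<integral>w. f (Z n w) \<partial>M)"
  if f: "continuous_on UNIV f" and bf: "bounded (range f)" and e: "0 < e" for f :: "'c => real" and e
 proof -
  obtain B where B: "\<And>x. \<bar>f x\<bar> <= B" using bf by (auto simp: bounded_iff)
  define h where "h = inf_conv f"
  note h = inf_conv[OF f B, folded h_def]
  have hc: "continuous_on UNIV (h m)" for m
   unfolding continuous_on_iff
  proof (intro ballI allI impI)
   fix x :: 'c and r :: real assume "0 < r"
   have "dist (h m y) (h m x) < r" if "dist y x < r / (real m + 1)" for y
   proof -
    have "real m * dist y x <= (real m + 1) * dist y x" by (simp add: mult_right_mono)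
    also have "... < r" using that by (simp add: field_simps)
    finally show ?thesis using h(1)[of m y x] unfolding dist_real_def by linarith
   qed
   with \<open>0 < r\<close> show "\<exists>d>0. \<forall>y\<in>UNIV. dist y x < d \<longrightarrow> dist (h m y) (h m x) < r"
    by (intro exI[of _ "r / (real m + 1)"]) auto
  qed
  have hm[measurable]: "h m \<in> borel_measurable borel" for m
   using hc by (rule borel_measurable_continuous_onI)
  have [measurable]: "f \<in> borel_measurable borel" using f by (rule borel_measurable_continuous_onI)
  note [measurable] = Z W
  have "(\<lambda>m. \<integral>w. h m (W w) \<partial>N) \<longlonglongrightarrow> (\<integral>w. f (W w) \<partial>N)"
   by (rule integral_dominated_convergence[where w = "\<lambda>_. B"]) (use h in auto)
  then have "\<forall>\<^sub>F m in sequentially. (\<integral>w. f (W w) \<partial>N) - e / 2 < (\<integral>w. h m (W w) \<partial>N)"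
   using e by (intro order_tendstoD) auto
  then obtain m where m: "(\<integral>w. f (W w) \<partial>N) - e / 2 < (\<integral>w. h m (W w) \<partial>N)"
   by (auto simp: eventually_sequentially)
  have "bounded (range (h m))" using h(2) by (auto simp: bounded_iff)
  then have "(\<lambda>n. \<integral>w. h m (Z n w) \<partial>M) \<longlonglongrightarrow> (\<integral>w. h m (W w) \<partial>N)"
   using h(1) hc by (intro lip[where L = "real m"])
  then have "\<forall>\<^sub>F n in sequentially. (\<integral>w. h m (W w) \<partial>N) - e / 2 < (\<integral>w. h m (Z n w) \<partial>M)"
   using e by (intro order_tendstoD) auto
  then show ?thesis
  proof eventually_elim
   case (elim n)
   have "(\<integral>w. h m (Z n w) \<partial>M) <= (\<integral>w. f (Z n w) \<partial>M)"
    using h(2,3) B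
    by (intro integral_mono M.integrable_const_bound[where B = B]) auto
   with elim m show ?case by linarith
  qed
 qed
 have "(\<lambda>n. \<integral>w. f (Z n w) \<partial>M) \<longlonglongrightarrow> (\<integral>w. f (W w) \<partial>N)"
  if f: "continuous_on UNIV f" and bf: "bounded (range f)" for f :: "'c => real"
 proof (rule tendstoI)
  fix e :: real assume e: "0 < e"
  have "bounded (range (\<lambda>x. - f x))" using bf by (auto simp: bounded_iff)
  then have "\<forall>\<^sub>F n in sequentially. (\<integral>w. - f (W w) \<partial>N) - e < (\<integral>w. - f (Z n w) \<partial>M)"
   using half[of "\<lambda>x. - f x" e] e f by (auto intro: continuous_on_minus)
  with half[OF f bf e] show "\<forall>\<^sub>F n in sequentially. dist (\<integral>w. f (Z n w) \<partial>M) (\<integral>w. f (W w) \<partial>N) < e"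
   by eventually_elim (auto simp: dist_real_def)
 qed
 then show ?thesis unfolding conv_in_distribution_def using Z W by blast
qed

text \<open>The vector of grid values carries the index \<open>(j, c)\<close> of time and coordinate; it
vanishes outside a finite set of indices, which lets the product topology on functions play the role of a
finite-dimensional space.\<close>

definition step_path :: "nat => (nat \<times> 'd::finite => real) => (real ^ 'd) skorokhod" where
 "step_path m v = to_skorokhod (\<lambda>t. \<chi> c. v (nat \<lfloor>real m * t\<rfloor>, c))"

definition grid_values :: "nat => (real => real ^ 'd::finite) => nat \<times> 'd => real" where
 "grid_values m x = (\<lambda>(j, c). if j <= m then x (real j / real m) $ c else 0)"

lemma path_of_step_path:
 assumes "t \<in> {0..1}"
 shows "path_of (step_path m v) t = (\<chi> c. v (nat \<lfloor>real m * t\<rfloor>, c))"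
 unfolding step_path_def
 by (rule path_of_to_skorokhod[OF cadlag_on01_floor[where g = "\<lambda>z. \<chi> c. v (nat z, c)"] assms]) simp

lemma nat_floor_grid:
 assumes "t \<in> {0..1}" shows "nat \<lfloor>real m * t\<rfloor> <= m" "real (nat \<lfloor>real m * t\<rfloor>) = of_int \<lfloor>real m * t\<rfloor>"
proof -
 have "real m * t <= real m" using assms by (simp add: mult_left_le)
 then show "nat \<lfloor>real m * t\<rfloor> <= m" by linarith
 show "real (nat \<lfloor>real m * t\<rfloor>) = of_int \<lfloor>real m * t\<rfloor>" using assms by simp
qed

lemma path_of_step_path_grid:
 assumes "t \<in> {0..1}"
 shows "path_of (step_path m (grid_values m x)) t = x (of_int \<lfloor>real m * t\<rfloor> / real m)"
 unfolding path_of_step_path[OF assms] using nat_floor_grid[OF assms, of m]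
 by (simp add: grid_values_def vec_eq_iff)

lemma dist_step_path_le:
 "dist (step_path m v) (step_path m w) <= (\<Sum>i\<in>{..m} \<times> UNIV. \<bar>v i - w i\<bar>)"
proof (rule dist_skorokhod_le)
 fix t :: real assume t: "t \<in> {0..1}"
 define j where "j = nat \<lfloor>real m * t\<rfloor>"
 have "dist (path_of (step_path m v) t) (path_of (step_path m w) t) = norm (\<chi> c. v (j, c) - w (j, c))"
  by (simp add: path_of_step_path[OF t] dist_norm j_def) (metis (no_types, lifting) vec_lambda_beta vector_minus_component vec_eq_iff)
 also have "... <= (\<Sum>c\<in>UNIV. \<bar>v (j, c) - w (j, c)\<bar>)"
  using norm_le_l1_cart[of "\<chi> c. v (j, c) - w (j, c)"] by simp
 also have "... = (\<Sum>i\<in>{j} \<times> UNIV. \<bar>v i - w i\<bar>)"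
  by (subst sum.reindex[of "Pair j" UNIV, simplified comp_def, symmetric])
   (auto simp: inj_on_def intro!: sum.cong)
 also have "... <= (\<Sum>i\<in>{..m} \<times> UNIV. \<bar>v i - w i\<bar>)"
  using nat_floor_grid(1)[OF t, of m] by (intro sum_mono2) (auto simp: j_def)
 finally show "dist (path_of (step_path m v) t) (path_of (step_path m w) t) <= (\<Sum>i\<in>{..m} \<times> UNIV. \<bar>v i - w i\<bar>)" .
qed (auto intro: sum_nonneg)

lemma continuous_step_path: "continuous_on UNIV (step_path m :: (nat \<times> 'd::finite => real) => _)"
 unfolding continuous_on_def
proof
 fix v :: "nat \<times> 'd => real"
 have "((\<lambda>w. \<Sum>i\<in>{..m} \<times> UNIV. \<bar>w i - v i\<bar>) \<longlongrightarrow> (\<Sum>i\<in>{..m} \<times> (UNIV :: 'd set). \<bar>v i - v i\<bar>)) (at v)"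
  by (intro tendsto_intros)
   (metis continuous_on_product_coordinates continuous_on_def UNIV_I)
 then have "((\<lambda>w. \<Sum>i\<in>{..m} \<times> UNIV. \<bar>w i - v i\<bar>) \<longlongrightarrow> 0) (at v)" by simp
 then have "((\<lambda>w. dist (step_path m w) (step_path m v)) \<longlongrightarrow> 0) (at v)"
  by (rule Lim_null_comparison[rotated]) (simp add: dist_step_path_le)
 then show "(step_path m \<longlongrightarrow> step_path m v) (at v)"
  using tendsto_dist_iff by blast
qed

lemma measurable_grid_values:
 fixes x :: "real => 'a => real ^ 'd::finite"
 assumes "\<And>t. t \<in> {0..1} ==> (\<lambda>w. x t w) \<in> borel_measurable M"
 shows "(\<lambda>w. grid_values m (\<lambda>t. x t w)) \<in> borel_measurable M"
proof (rule measurable_coordinatewise_then_product)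
 fix i :: "nat \<times> 'd"
 obtain j c where i: "i = (j, c)" by fastforce
 show "(\<lambda>w. grid_values m (\<lambda>t. x t w) i) \<in> borel_measurable M"
 proof (cases "j <= m")
  case True
  have "(\<lambda>w. x (real j / real m) w) \<in> borel_measurable M" using True by (intro assms) (auto simp: divide_simps)
  moreover have "(\<lambda>y :: real ^ 'd. y $ c) \<in> borel_measurable borel"
   by (intro borel_measurable_continuous_onI continuous_intros)
  ultimately have "(\<lambda>w. x (real j / real m) w $ c) \<in> borel_measurable M" by (rule measurable_compose)
  then show ?thesis using True by (simp add: i grid_values_def)
 qed (simp add: i grid_values_def)
qed

text \<open>The limit process has continuous paths, and a uniformly continuous path is uniformly close to its
step functions, hence close in the Skorokhod metric.\<close>

lemma step_path_tendsto:
 assumes x: "continuous_on {0..1} x"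
 shows "(\<lambda>m. step_path m (grid_values m x)) \<longlonglongrightarrow> to_skorokhod x"
proof (rule metric_LIMSEQ_I)
 fix e :: real assume e: "0 < e"
 have "uniformly_continuous_on {0..1} x" by (rule compact_uniformly_continuous[OF x]) simp
 then obtain d where d: "d > 0" "\<And>s t. s \<in> {0..1} ==> t \<in> {0..1} ==> dist s t < d ==> dist (x s) (x t) < e / 2"
  using e unfolding uniformly_continuous_on_def by (metis half_gt_zero)
 obtain m0 :: nat where m0: "1 / d < real m0" using reals_Archimedean2 by blast
 have "dist (step_path m (grid_values m x)) (to_skorokhod x) <= e / 2" if m: "m \<ge> m0" for m
 proof (rule dist_skorokhod_le)
  fix t :: real assume t: "t \<in> {0..1}"
  have "0 < 1 / d" using d by simp
  then have mpos: "0 < real m" using m0 m by linarith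
  have "1 / real m < d"
  proof -
   have "1 / d < real m" using m0 m by linarith
   then show ?thesis using d(1) mpos by (simp add: field_simps)
  qed
  define s where "s = of_int \<lfloor>real m * t\<rfloor> / real m"
  have "t - s = (real m * t - of_int \<lfloor>real m * t\<rfloor>) / real m" using mpos by (simp add: s_def field_simps)
  moreover have "0 <= real m * t - of_int \<lfloor>real m * t\<rfloor>" "real m * t - of_int \<lfloor>real m * t\<rfloor> < 1" by linarith+
  ultimately have "0 <= t - s" "t - s < 1 / real m" using mpos by (simp_all add: divide_strict_right_mono)
  then have "s <= t" "t - s < 1 / real m" by simp_all
  moreover have "0 <= s" using t by (simp add: s_def)
  ultimately have "dist (x s) (x t) < e / 2" using t \<open>1 / real m < d\<close> by (intro d) (auto simp: dist_real_def)
  then show "dist (path_of (step_path m (grid_values m x)) t) (path_of (to_skorokhod x) t) <= e / 2"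
   using t x by (simp add: path_of_step_path_grid path_of_to_skorokhod cadlag_on01_continuous s_def)
 qed (use e in simp)
 then show "\<exists>m0. \<forall>m\<ge>m0. dist (step_path m (grid_values m x)) (to_skorokhod x) < e"
  using e by (intro exI[of _ m0]) fastforce
qed

text \<open>This replaces a tightness argument. For a Lipschitz test function, the expectations
of \<open>Z n\<close> and \<open>W\<close> are compared through the step paths on the grid with mesh \<open>1 / m\<close>: the hypothesis \<open>close\<close>
controls the error for \<open>Z n\<close>, continuity of the paths controls it for \<open>W\<close>, and for fixed \<open>m\<close> the step paths
converge because their grid values do. The auxiliary process \<open>V\<close>
enters through its values on the grid.\<close>

lemma conv_in_distribution_D_criterion:
 fixes Z V :: "nat => real => 'a => real ^ 'd::finite" and W :: "real => 'b => real ^ 'd"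
 assumes M: "prob_space M" and N: "prob_space N"
  and cadlag: "\<And>n w. w \<in> space M ==> cadlag_on01 (\<lambda>t. Z n t w)"
  and meas: "\<And>n. (\<lambda>w. to_skorokhod (\<lambda>t. Z n t w)) \<in> borel_measurable M"
  and V: "\<And>n t. t \<in> {0..1} ==> V n t \<in> borel_measurable M"
  and W: "\<And>t. t \<in> {0..1} ==> W t \<in> borel_measurable N"
  and cont: "\<And>w. w \<in> space N ==> continuous_on {0..1} (\<lambda>t. W t w)"
  and fidi: "\<And>m (g :: (nat \<times> 'd => real) => real). 1 <= m ==> continuous_on UNIV g ==> bounded (range g) ==>
   (\<lambda>n. \<integral>w. g (grid_values m (\<lambda>t. V n t w)) \<partial>M) \<longlonglongrightarrow> (\<integral>w. g (grid_values m (\<lambda>t. W t w)) \<partial>N)"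
  and close: "\<And>d e. 0 < d ==> 0 < e ==> \<forall>\<^sub>F m in sequentially. \<forall>\<^sub>F n in sequentially.
   \<exists>A\<in>sets M. measure M A <= e \<and>
    (\<forall>w\<in>space M - A. \<forall>t\<in>{0..1}. dist (Z n t w) (V n (of_int \<lfloor>real m * t\<rfloor> / real m) w) <= d)"
 shows "conv_in_distribution_D M Z N W"
proof -
 interpret M: prob_space M by fact
 interpret N: prob_space N by fact
 define X where "X = (\<lambda>n w. to_skorokhod (\<lambda>t. Z n t w))"
 define Y where "Y = (\<lambda>w. to_skorokhod (\<lambda>t. W t w))"
 define Ym where "Ym = (\<lambda>m w. step_path m (grid_values m (\<lambda>t. W t w)))"
 define Xm where "Xm = (\<lambda>m n w. step_path m (grid_values m (\<lambda>t. V n t w)))"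
 note [measurable] = borel_measurable_continuous_onI[OF continuous_step_path]
 have [measurable]: "Ym m \<in> borel_measurable N" for m
  using measurable_grid_values[of W N m] W unfolding Ym_def by measurable
 have [measurable]: "Xm m n \<in> borel_measurable M" for m n
  using measurable_grid_values[of "V n" M m] V unfolding Xm_def by measurable
 have [measurable]: "X n \<in> borel_measurable M" for n using meas by (simp add: X_def)
 have Ylim: "(\<lambda>m. Ym m w) \<longlonglongrightarrow> Y w" if "w \<in> space N" for w
  unfolding Ym_def Y_def by (rule step_path_tendsto[OF cont[OF that]])
 have Ymeas[measurable]: "Y \<in> borel_measurable N"
  by (rule borel_measurable_LIMSEQ_metric[of Ym]) (use Ylim in auto)
 have "conv_in_distribution M X N Y"
 proof (rule conv_in_distribution_lipschitzI[OF M N])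
  fix f :: "(real ^ 'd) skorokhod => real" and L :: real
  assume L: "\<And>x y. \<bar>f x - f y\<bar> <= L * dist x y" and cf: "continuous_on UNIV f" and bf: "bounded (range f)"
  obtain C where C: "C > 0" "\<And>x. \<bar>f x\<bar> <= C" using bf by (auto simp: bounded_pos)
  define L' where "L' = max L 1"
  have L': "L' > 0" "\<bar>f x - f y\<bar> <= L' * dist x y" for x y
   using order_trans[OF L mult_right_mono[of L L' "dist x y"]] by (auto simp: L'_def)
  have [measurable]: "f \<in> borel_measurable borel" using cf by (rule borel_measurable_continuous_onI)
  have intM: "integrable M (\<lambda>w. f (U w))" if [measurable]: "U \<in> borel_measurable M" for U
   by (rule M.integrable_const_bound[where B = C]) (use C in auto)
  show "(\<lambda>n. \<integral>w. f (X n w) \<partial>M) \<longlonglongrightarrow> (\<integral>w. f (Y w) \<partial>N)"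
  proof (rule tendstoI)
   fix e :: real assume e: "0 < e"
   have "(\<lambda>m. \<integral>w. f (Ym m w) \<partial>N) \<longlonglongrightarrow> (\<integral>w. f (Y w) \<partial>N)"
   proof (rule integral_dominated_convergence[where w = "\<lambda>_. C"])
    show "AE w in N. (\<lambda>m. f (Ym m w)) \<longlonglongrightarrow> f (Y w)"
     by (intro AE_I2 continuous_on_tendsto_compose[OF cf Ylim]) auto
   qed (use C in auto)
   then have "\<forall>\<^sub>F m in sequentially. dist (\<integral>w. f (Ym m w) \<partial>N) (\<integral>w. f (Y w) \<partial>N) < e / 4"
    using e by (intro tendstoD) auto
   moreover have "\<forall>\<^sub>F m in sequentially. \<forall>\<^sub>F n in sequentially. \<exists>A\<in>sets M. measure M A <= e / (16 * C) \<and>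
    (\<forall>w\<in>space M - A. \<forall>t\<in>{0..1}. dist (Z n t w) (V n (of_int \<lfloor>real m * t\<rfloor> / real m) w) <= e / (8 * L'))"
    using e C(1) L'(1) by (intro close) auto
   moreover have "\<forall>\<^sub>F m in sequentially. (1::nat) <= m" by (rule eventually_ge_at_top)
   ultimately have "\<forall>\<^sub>F m in sequentially. 1 <= m \<and>
     dist (\<integral>w. f (Ym m w) \<partial>N) (\<integral>w. f (Y w) \<partial>N) < e / 4 \<and>
     (\<forall>\<^sub>F n in sequentially. \<exists>A\<in>sets M. measure M A <= e / (16 * C) \<and>
      (\<forall>w\<in>space M - A. \<forall>t\<in>{0..1}. dist (Z n t w) (V n (of_int \<lfloor>real m * t\<rfloor> / real m) w) <= e / (8 * L')))"
    by eventually_elim blast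
   then obtain m where m: "1 <= m" and mY: "dist (\<integral>w. f (Ym m w) \<partial>N) (\<integral>w. f (Y w) \<partial>N) < e / 4"
    and mA: "\<forall>\<^sub>F n in sequentially. \<exists>A\<in>sets M. measure M A <= e / (16 * C) \<and>
      (\<forall>w\<in>space M - A. \<forall>t\<in>{0..1}. dist (Z n t w) (V n (of_int \<lfloor>real m * t\<rfloor> / real m) w) <= e / (8 * L'))"
    using eventually_happens'[OF sequentially_bot] by blast
   have "(\<lambda>n. \<integral>w. (f \<circ> step_path m) (grid_values m (\<lambda>t. V n t w)) \<partial>M) \<longlonglongrightarrow>
     (\<integral>w. (f \<circ> step_path m) (grid_values m (\<lambda>t. W t w)) \<partial>N)"
    using m continuous_step_path cf bf
    by (intro fidi continuous_on_compose) (auto intro: continuous_on_subset bounded_subset)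
   then have "(\<lambda>n. \<integral>w. f (Xm m n w) \<partial>M) \<longlonglongrightarrow> (\<integral>w. f (Ym m w) \<partial>N)"
    by (simp add: Xm_def Ym_def)
   then have "\<forall>\<^sub>F n in sequentially. dist (\<integral>w. f (Xm m n w) \<partial>M) (\<integral>w. f (Ym m w) \<partial>N) < e / 4"
    using e by (intro tendstoD) auto
   with mA show "\<forall>\<^sub>F n in sequentially. dist (\<integral>w. f (X n w) \<partial>M) (\<integral>w. f (Y w) \<partial>N) < e"
   proof eventually_elim
    case (elim n)
    then obtain A where A[measurable]: "A \<in> sets M" and pA: "measure M A <= e / (16 * C)"
     and cl: "\<And>w t. w \<in> space M - A ==> t \<in> {0..1} ==>
       dist (Z n t w) (V n (of_int \<lfloor>real m * t\<rfloor> / real m) w) <= e / (8 * L')"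
     by blast
    have "\<bar>f (X n w) - f (Xm m n w)\<bar> <= e / 8 + 2 * C * indicator A w" if sp: "w \<in> space M" for w
    proof (cases "w \<in> A")
     case True
     then show ?thesis using C(2)[of "X n w"] C(2)[of "Xm m n w"] e by (auto simp: abs_le_iff)
    next
     case False
     have "dist (X n w) (Xm m n w) <= e / (8 * L')"
      using cl[of w] False sp e L' cadlag[OF sp]
      by (intro dist_skorokhod_le)
       (auto simp: X_def Xm_def path_of_to_skorokhod path_of_step_path_grid)
     then have "L' * dist (X n w) (Xm m n w) <= e / 8"
      using L'(1) by (simp add: field_simps)
     then show ?thesis using L'(2)[of "X n w" "Xm m n w"] False by simp
    qed
    then have "\<bar>(\<integral>w. f (X n w) - f (Xm m n w) \<partial>M)\<bar> <= (\<integral>w. e / 8 + 2 * C * indicator A w \<partial>M)"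
     unfolding real_norm_def[symmetric]
     by (intro norm_integral_le bochner_integrable_diff intM)
      (auto simp: M.emeasure_eq_measure intro!: bochner_integrable_add)
    also have "... = e / 8 + 2 * C * measure M A"
     by (simp add: M.prob_space M.emeasure_eq_measure)
    also have "... <= e / 4" using pA C(1) by (simp add: field_simps)
    finally have "\<bar>(\<integral>w. f (X n w) \<partial>M) - (\<integral>w. f (Xm m n w) \<partial>M)\<bar> <= e / 4"
     by (subst (asm) bochner_integral_diff) (auto intro: intM)
    with elim(2) mY e show ?case unfolding dist_real_def by linarith
   qed
  qed
 qed auto
 then show ?thesis
  unfolding conv_in_distribution_D_def X_def Y_def using cadlag cont cadlag_on01_continuous by blast
qed

section \<open>Characteristic functions determine finite-dimensional limits\<close>

text \<open>The algebra of functions whose expectations are known to converge, to be used with the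
Stone-Weierstrass theorem.\<close>

inductive trig_poly :: "'i set => (('i => real) => complex) => bool" for L where
 trig_exp: "trig_poly L (\<lambda>x. iexp (\<Sum>l\<in>L. u l * x l))"
| trig_scale: "trig_poly L f ==> trig_poly L (\<lambda>x. c * f x)"
| trig_add: "trig_poly L f ==> trig_poly L g ==> trig_poly L (\<lambda>x. f x + g x)"

lemma trig_const: "trig_poly L (\<lambda>_. c)"
 using trig_scale[OF trig_exp[where u = "\<lambda>_. 0"], where c = c] by simp

lemma trig_mult:
 assumes "trig_poly L f" "trig_poly L g"
 shows "trig_poly L (\<lambda>x. f x * g x)"
 using assms(1)
proof induction
 case (trig_exp u)
 from assms(2) show ?case
 proof induction
  case (trig_exp v)
  have "(\<Sum>l\<in>L. (u l + v l) * x l) = (\<Sum>l\<in>L. u l * x l) + (\<Sum>l\<in>L. v l * x l)" for x :: "'a => real"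
   by (simp add: sum.distrib distrib_right)
  then have "(\<lambda>x. iexp (\<Sum>l\<in>L. u l * x l) * iexp (\<Sum>l\<in>L. v l * x l)) = (\<lambda>x. iexp (\<Sum>l\<in>L. (u l + v l) * x l))"
   by (simp only: of_real_add distrib_left exp_add)
  then show ?case using trig_poly.trig_exp[of L "\<lambda>l. u l + v l"] by (simp only:)
 next
  case (trig_scale h c)
  from trig_poly.trig_scale[OF this(2), of c] show ?case by (simp add: mult.left_commute)
 next
  case (trig_add h k)
  from trig_poly.trig_add[OF this(3,4)] show ?case by (simp add: distrib_left)
 qed
next
 case (trig_scale h c)
 from trig_poly.trig_scale[OF this(2), of c] show ?case by (simp add: mult.assoc)
next
 case (trig_add h k)
 from trig_poly.trig_add[OF this(3,4)] show ?case by (simp add: distrib_right)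
qed

lemma trig_sin:
 assumes "finite L" "l \<in> L"
 shows "trig_poly L (\<lambda>x. complex_of_real (sin (b * x l)))"
proof -
 have e: "trig_poly L (\<lambda>x. iexp (c * x l))" for c
 proof -
  have "(\<Sum>i\<in>L. (if i = l then c else 0) * x i) = c * x l" for x :: "'a => real"
   using assms by (simp add: if_distrib[of "\<lambda>a. a * _"] sum.delta cong: if_cong)
  then show ?thesis using trig_exp[of L "\<lambda>i. if i = l then c else 0"] by simp
 qed
 have "complex_of_real (sin (b * x)) = (1 / (2 * \<i>)) * iexp (b * x) + (- 1 / (2 * \<i>)) * iexp (- b * x)" for x
  by (simp add: sin_of_real[symmetric] sin_exp_eq field_simps)
 then show ?thesis by (simp only:) (intro trig_add trig_scale e)
qed

lemma trig_poly_expectation_tendsto: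
 fixes X :: "nat => 'a => 'i => real" and Y :: "'b => 'i => real"
 assumes M: "prob_space M" and N: "prob_space N"
  and [measurable]: "\<And>n l. (\<lambda>w. X n w l) \<in> borel_measurable M" "\<And>l. (\<lambda>w. Y w l) \<in> borel_measurable N"
  and char: "\<And>u. (\<lambda>n. \<integral>w. iexp (\<Sum>l\<in>L. u l * X n w l) \<partial>M) \<longlonglongrightarrow> (\<integral>w. iexp (\<Sum>l\<in>L. u l * Y w l) \<partial>N)"
  and f: "trig_poly L f"
 shows "(\<forall>n. integrable M (\<lambda>w. f (X n w))) \<and> integrable N (\<lambda>w. f (Y w)) \<and>
  (\<lambda>n. \<integral>w. f (X n w) \<partial>M) \<longlonglongrightarrow> (\<integral>w. f (Y w) \<partial>N)"
 using f
proof induction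
 case (trig_exp u)
 interpret M: prob_space M by fact
 interpret N: prob_space N by fact
 show ?case
  using char by (auto intro!: M.integrable_const_bound[where B = 1] N.integrable_const_bound[where B = 1])
next
 case (trig_scale f c)
 then show ?case by (auto intro: tendsto_mult_left)
next
 case (trig_add f g)
 then show ?case by (auto intro: tendsto_add)
qed

lemma compact_box_PiE:
 fixes S :: "'i => real set"
 assumes "\<And>i. compact (S i)"
 shows "compact (PiE UNIV S)"
proof -
 have "compactin (product_topology (\<lambda>_. euclidean) UNIV) (PiE UNIV S)"
  using assms by (simp add: compactin_PiE)
 then show ?thesis by (simp add: euclidean_product_topology)
qed

text \<open>A multivariate Levy continuity theorem. The one-dimensional theorem, applied to each coordinate, gives
tightness: large values have small probability, uniformly in \<open>n\<close>. Inside a box the coordinate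
\<open>x l\<close> can be recovered from \<open>sin (b * x l)\<close> by the arcus sine, so a bounded continuous
function is there a continuous function of these sines, and Stone-Weierstrass approximates it by trigonometric
polynomials in \<open>x\<close>. The sines are bounded everywhere, so the approximating
polynomial does no harm outside the box.\<close>

theorem continuity_theorem_finite_dim:
 fixes X :: "nat => 'a => 'i::countable => real" and Y :: "'b => 'i => real"
 assumes M: "prob_space M" and N: "prob_space N" and L: "finite L"
  and X: "\<And>n l. (\<lambda>w. X n w l) \<in> borel_measurable M" and Y: "\<And>l. (\<lambda>w. Y w l) \<in> borel_measurable N"
  and X0: "\<And>n w l. l \<notin> L ==> X n w l = 0" and Y0: "\<And>w l. l \<notin> L ==> Y w l = 0"
  and char: "\<And>u. (\<lambda>n. \<integral>w. iexp (\<Sum>l\<in>L. u l * X n w l) \<partial>M) \<longlonglongrightarrow> (\<integral>w. iexp (\<Sum>l\<in>L. u l * Y w l) \<partial>N)"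
  and g: "continuous_on UNIV g" and bg: "bounded (range (g :: ('i => real) => real))"
 shows "(\<lambda>n. \<integral>w. g (X n w) \<partial>M) \<longlonglongrightarrow> (\<integral>w. g (Y w) \<partial>N)"
proof (rule tendstoI)
 fix e :: real assume e: "0 < e"
 interpret M: prob_space M by fact
 interpret N: prob_space N by fact
 note [measurable] = X Y
 obtain C where C: "C > 0" "\<And>x. \<bar>g x\<bar> <= C" using bg by (auto simp: bounded_pos)
 define h :: "nat => real => real" where "h R x = min 1 (max (\<bar>x\<bar> - real R) 0)" for R x
 have h01: "0 <= h R x" "h R x <= 1" for R x by (auto simp: h_def)
 have [measurable]: "h R \<in> borel_measurable borel" for R unfolding h_def by measurable
 have intM: "integrable M (\<lambda>w. h R (X n w l))" for n R l
  by (rule M.integrable_const_bound[where B = 1]) (use h01 in auto)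
 have intN: "integrable N (\<lambda>w. h R (Y w l))" for R l
  by (rule N.integrable_const_bound[where B = 1]) (use h01 in auto)
 have h_conv: "(\<lambda>n. \<integral>w. h R (X n w l) \<partial>M) \<longlonglongrightarrow> (\<integral>w. h R (Y w l) \<partial>N)" if l: "l \<in> L" for R l
 proof -
  have sum1: "(\<Sum>i\<in>L. (if i = l then t else 0) * x i) = t * x l" for t and x :: "'i => real"
   using L l by (simp add: if_distrib[of "\<lambda>a. a * _"] sum.delta cong: if_cong)
  have "weak_conv_m (\<lambda>n. distr M borel (\<lambda>w. X n w l)) (distr N borel (\<lambda>w. Y w l))"
  proof (rule levy_continuity)
   fix t
   show "(\<lambda>n. char (distr M borel (\<lambda>w. X n w l)) t) \<longlonglongrightarrow> char (distr N borel (\<lambda>w. Y w l)) t"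
    using char[of "\<lambda>i. if i = l then t else 0"]
    by (simp add: char_def integral_distr sum1 del: of_real_mult of_real_sum)
  qed (auto intro!: M.real_distribution_distr N.real_distribution_distr)
  then have "(\<lambda>n. integral\<^sup>L (distr M borel (\<lambda>w. X n w l)) (h R)) \<longlonglongrightarrow>
    integral\<^sup>L (distr N borel (\<lambda>w. Y w l)) (h R)"
  proof (rule weak_conv_imp_integral_bdd_continuous_conv[rotated 2])
   show "isCont (h R) x" for x unfolding h_def by (intro continuous_intros)
   show "norm (h R x) <= 1" for x using h01[of R x] by simp
  qed (auto intro!: M.real_distribution_distr N.real_distribution_distr)
  then show ?thesis by (simp add: integral_distr)
 qed
 have "(\<lambda>R. \<Sum>l\<in>L. \<integral>w. h R (Y w l) \<partial>N) \<longlonglongrightarrow> (\<Sum>l\<in>L. 0)"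
 proof (intro tendsto_sum)
  fix l
  have "(\<lambda>R. \<integral>w. h R (Y w l) \<partial>N) \<longlonglongrightarrow> (\<integral>w. 0 \<partial>N)"
  proof (rule integral_dominated_convergence[where w = "\<lambda>_. 1"])
   show "AE w in N. (\<lambda>R. h R (Y w l)) \<longlonglongrightarrow> 0"
   proof (rule AE_I2)
    fix w
    obtain r :: nat where "\<bar>Y w l\<bar> < real r" using reals_Archimedean2 by blast
    then have "\<forall>\<^sub>F R in sequentially. h R (Y w l) = 0"
     unfolding eventually_sequentially by (intro exI[of _ r]) (auto simp: h_def)
    then show "(\<lambda>R. h R (Y w l)) \<longlonglongrightarrow> 0" by (rule tendsto_eventually)
   qed
  qed (use h01 in auto)
  then show "(\<lambda>R. \<integral>w. h R (Y w l) \<partial>N) \<longlonglongrightarrow> 0" by simp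
 qed
 then have "\<forall>\<^sub>F R in sequentially. (\<Sum>l\<in>L. \<integral>w. h R (Y w l) \<partial>N) < e / (16 * C)"
  using e C(1) by (intro order_tendstoD) auto
 then obtain R where R: "(\<Sum>l\<in>L. \<integral>w. h R (Y w l) \<partial>N) < e / (16 * C)"
  using eventually_happens'[OF sequentially_bot] by blast
 have "(\<lambda>n. \<Sum>l\<in>L. \<integral>w. h R (X n w l) \<partial>M) \<longlonglongrightarrow> (\<Sum>l\<in>L. \<integral>w. h R (Y w l) \<partial>N)"
  by (intro tendsto_sum h_conv)
 then have evR: "\<forall>\<^sub>F n in sequentially. (\<Sum>l\<in>L. \<integral>w. h R (X n w l) \<partial>M) < e / (16 * C)"
  using R by (rule order_tendstoD)
 \<comment> \<open>With this frequency the box of side \<open>R + 1\<close> is mapped into the domain of the arcus sine.\<close>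
 define b where "b = pi / (2 * (real R + 1))"
 have b: "b > 0" by (auto simp: b_def)
 define s :: "('i => real) => 'i => real" where "s x = (\<lambda>l. if l \<in> L then sin (b * x l) else 0)" for x
 define G where "G y = g (\<lambda>l. if l \<in> L then arcsin (y l) / b else 0)" for y
 define S where "S = PiE UNIV (\<lambda>l. if l \<in> L then {-1..1} else {0::real})"
 have S_mem: "y l \<in> (if l \<in> L then {-1..1} else {0})" if "y \<in> S" for y l
  using that unfolding S_def by (rule PiE_mem) simp
 have S_in: "y l \<in> {-1..1}" if "y \<in> S" "l \<in> L" for y l
  using S_mem[OF that(1), of l] that(2) by simp
 have S_out: "y l = 0" if "y \<in> S" "l \<notin> L" for y l
  using S_mem[OF that(1), of l] that(2) by simp
 have sS: "s x \<in> S" for x unfolding S_def by (rule PiE_I) (simp_all add: s_def)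
 have near: "\<bar>g x - G (s x)\<bar> <= 2 * C * (\<Sum>l\<in>L. h R (x l))" if x0: "\<And>l. l \<notin> L ==> x l = 0" for x
 proof (cases "\<forall>l\<in>L. \<bar>x l\<bar> <= real R + 1")
  case True
  have "arcsin (sin (b * x l)) / b = x l" if "l \<in> L" for l
  proof -
   have "\<bar>x l\<bar> <= real R + 1" using True that by blast
   then have "b * \<bar>x l\<bar> <= b * (real R + 1)" using b by (intro mult_left_mono) auto
   also have "... = pi / 2" by (simp add: b_def field_simps)
   finally have "\<bar>b * x l\<bar> <= pi / 2" using b by (simp add: abs_mult)
   then show ?thesis using b by (simp add: arcsin_sin abs_le_iff)
  qed
  then have "(\<lambda>l. if l \<in> L then arcsin (s x l) / b else 0) = x"
   using x0 by (intro ext) (simp add: s_def)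
  then have "G (s x) = g x" by (simp add: G_def)
  then show ?thesis using C(1) h01 by (simp add: sum_nonneg)
 next
  case False
  then obtain l where l: "l \<in> L" "\<bar>x l\<bar> > real R + 1" by (auto simp: not_le)
  then have "h R (x l) = 1" by (simp add: h_def)
  then have "1 <= (\<Sum>l\<in>L. h R (x l))" using member_le_sum[of l L "\<lambda>l. h R (x l)"] l(1) L h01 by auto
  then have "2 * C * 1 <= 2 * C * (\<Sum>l\<in>L. h R (x l))" using C(1) by (intro mult_left_mono) auto
  moreover have "\<bar>g x - G (s x)\<bar> <= 2 * C"
   unfolding G_def using C(2)[of x] C(2)[of "\<lambda>l. if l \<in> L then arcsin (s x l) / b else 0"] by linarith
  ultimately show ?thesis by linarith
 qed
 define Rg where "Rg = {q. continuous_on S q \<and> trig_poly L (\<lambda>x. complex_of_real (q (s x)))}"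
 have coord: "continuous_on S (\<lambda>y. y l)" for l
  by (rule continuous_on_subset[OF continuous_on_product_coordinates]) auto
 interpret R: function_ring_on Rg S
 proof
  show "compact S" unfolding S_def by (rule compact_box_PiE) auto
  show "\<exists>f\<in>Rg. f x \<noteq> f y" if xy: "x \<in> S" "y \<in> S" "x \<noteq> y" for x y
  proof -
   obtain l where l: "x l \<noteq> y l" using xy(3) by auto
   then have lL: "l \<in> L" using S_out[OF xy(1)] S_out[OF xy(2)] by metis
   then have "(\<lambda>y. y l) \<in> Rg"
    using coord trig_sin[OF L lL, of b] by (simp add: Rg_def s_def)
   then show ?thesis by (rule bexI[rotated]) (rule l)
  qed
  show "(\<lambda>_. c) \<in> Rg" for c using trig_const[of L "complex_of_real c"] by (simp add: Rg_def)
  show "continuous_on S f" if "f \<in> Rg" for f using that by (simp add: Rg_def)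
  fix f g assume fg: "f \<in> Rg" "g \<in> Rg"
  then have c: "continuous_on S f" "continuous_on S g"
   and t: "trig_poly L (\<lambda>x. complex_of_real (f (s x)))" "trig_poly L (\<lambda>x. complex_of_real (g (s x)))"
   by (simp_all add: Rg_def)
  show "(\<lambda>x. f x + g x) \<in> Rg" using continuous_on_add[OF c] trig_add[OF t] by (simp add: Rg_def)
  show "(\<lambda>x. f x * g x) \<in> Rg" using continuous_on_mult[OF c] trig_mult[OF t] by (simp add: Rg_def)
 qed
 have "continuous_on S (\<lambda>y. g (\<lambda>l. if l \<in> L then arcsin (y l) / b else 0))"
 proof (rule continuous_on_compose2[OF g])
  show "continuous_on S (\<lambda>y l. if l \<in> L then arcsin (y l) / b else 0)"
  proof (rule continuous_on_coordinatewise_then_product)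
   fix l
   show "continuous_on S (\<lambda>y. if l \<in> L then arcsin (y l) / b else 0)"
   proof (cases "l \<in> L")
    case True
    have "continuous_on S (\<lambda>y. arcsin (y l))"
     by (rule continuous_on_compose2[OF continuous_on_arcsin' coord]) (use S_in True in auto)
    then show ?thesis using True b by (auto intro!: continuous_on_divide)
   qed simp
  qed
 qed auto
 then have "continuous_on S G" by (simp add: G_def cong: continuous_on_cong)
 then obtain F where "F \<in> UNIV \<rightarrow> Rg" and F2: "uniform_limit S F G sequentially"
  using R.Stone_Weierstrass by blast
 then have F: "F n \<in> Rg" for n by auto
 have "\<forall>\<^sub>F n in sequentially. \<forall>y\<in>S. dist (F n y) (G y) < e / 8"
  using F2 e by (intro uniform_limitD) auto
 then obtain n0 where n0: "\<And>y. y \<in> S ==> dist (F n0 y) (G y) < e / 8"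
  using eventually_happens'[OF sequentially_bot] by blast
 define p where "p x = F n0 (s x)" for x
 have pG: "\<bar>p x - G (s x)\<bar> <= e / 8" for x using n0[OF sS[of x]] by (simp add: p_def dist_real_def)
 have "trig_poly L (\<lambda>x. complex_of_real (p x))" using F[of n0] by (simp add: Rg_def p_def)
 note tp = trig_poly_expectation_tendsto[OF M N X Y char this]
 have ipX: "integrable M (\<lambda>w. p (X n w))" and ipY: "integrable N (\<lambda>w. p (Y w))" for n
  using tp by (auto simp: complex_of_real_integrable_eq)
 have "(\<lambda>n. \<integral>w. p (X n w) \<partial>M) \<longlonglongrightarrow> (\<integral>w. p (Y w) \<partial>N)"
  using tp by (simp add: integral_complex_of_real tendsto_of_real_iff)
 then have evp: "\<forall>\<^sub>F n in sequentially. dist (\<integral>w. p (X n w) \<partial>M) (\<integral>w. p (Y w) \<partial>N) < e / 4"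
  using e by (intro tendstoD) auto
 have [measurable]: "g \<in> borel_measurable borel" using g by (rule borel_measurable_continuous_onI)
 have [measurable]: "X n \<in> borel_measurable M" "Y \<in> borel_measurable N" for n
  using X Y by (auto intro: measurable_coordinatewise_then_product)
 have igX: "integrable M (\<lambda>w. g (X n w))" for n by (rule M.integrable_const_bound[where B = C]) (use C in auto)
 have igY: "integrable N (\<lambda>w. g (Y w))" by (rule N.integrable_const_bound[where B = C]) (use C in auto)
 have gp: "\<bar>g x - p x\<bar> <= e / 8 + 2 * C * (\<Sum>l\<in>L. h R (x l))" if "\<And>l. l \<notin> L ==> x l = 0" for x
  using near[of x, OF that] pG[of x] by linarith
 have bX: "\<bar>(\<integral>w. g (X n w) \<partial>M) - (\<integral>w. p (X n w) \<partial>M)\<bar> <= e / 8 + 2 * C * (\<Sum>l\<in>L. \<integral>w. h R (X n w l) \<partial>M)" for n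
 proof -
  have "norm (\<integral>w. g (X n w) - p (X n w) \<partial>M) <= (\<integral>w. e / 8 + 2 * C * (\<Sum>l\<in>L. h R (X n w l)) \<partial>M)"
   using gp X0
   by (intro norm_integral_le bochner_integrable_diff igX ipX bochner_integrable_add
     integrable_mult_right bochner_integrable_sum intM M.integrable_const) simp_all
  also have "... = e / 8 + 2 * C * (\<Sum>l\<in>L. \<integral>w. h R (X n w l) \<partial>M)"
   using intM by (simp add: M.prob_space)
  finally show ?thesis using igX ipX by simp
 qed
 have bY: "\<bar>(\<integral>w. g (Y w) \<partial>N) - (\<integral>w. p (Y w) \<partial>N)\<bar> <= e / 8 + 2 * C * (\<Sum>l\<in>L. \<integral>w. h R (Y w l) \<partial>N)"
 proof -
  have "norm (\<integral>w. g (Y w) - p (Y w) \<partial>N) <= (\<integral>w. e / 8 + 2 * C * (\<Sum>l\<in>L. h R (Y w l)) \<partial>N)"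
   using gp Y0
   by (intro norm_integral_le bochner_integrable_diff igY ipY bochner_integrable_add
     integrable_mult_right bochner_integrable_sum intN N.integrable_const) simp_all
  also have "... = e / 8 + 2 * C * (\<Sum>l\<in>L. \<integral>w. h R (Y w l) \<partial>N)"
   using intN by (simp add: N.prob_space)
  finally show ?thesis using igY ipY by simp
 qed
 have C8: "2 * C * a < e / 8" if "a < e / (16 * C)" for a
  using that C(1) by (simp add: field_simps)
 from evR evp show "\<forall>\<^sub>F n in sequentially. dist (\<integral>w. g (X n w) \<partial>M) (\<integral>w. g (Y w) \<partial>N) < e"
 proof eventually_elim
  case (elim n)
  show ?case using C8[OF elim(1)] C8[OF R] elim(2) bX[of n] bY unfolding dist_real_def by linarith
 qed
qed

section \<open>Characteristic functions of the Brownian bridge\<close>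

context prob_space
begin

lemma gaussian_rv_square_integrable:
 assumes "gaussian_rv M Z"
 shows "integrable M (\<lambda>w. (Z w)\<^sup>2)" "integrable M Z"
proof -
 have [measurable]: "Z \<in> borel_measurable M" using assms by (simp add: gaussian_rv_def)
 obtain m where m: "(AE w in M. Z w = m) \<or> (\<exists>s>0. distributed M lborel Z (normal_density m s))"
  using assms unfolding gaussian_rv_def by blast
 have moments: "integrable M (\<lambda>w. (Z w - m) ^ k)" for k
  using m
 proof
  assume "AE w in M. Z w = m"
  then have "AE w in M. (Z w - m) ^ k = 0 ^ k" by eventually_elim simp
  then show ?thesis by (subst integrable_cong_AE[where g = "\<lambda>_. 0 ^ k"]) auto
 next
  assume "\<exists>s>0. distributed M lborel Z (normal_density m s)"
  then obtain s where s: "s > 0" "distributed M lborel Z (normal_density m s)" by blast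
  have "integrable lborel (\<lambda>x. normal_density m s x * (x - m) ^ k)"
   using s(1) by (rule integrable_normal_moment)
  then show ?thesis
   by (subst (asm) distributed_integrable[OF s(2)]) (use s(1) in auto)
 qed
 have "(\<lambda>w. (Z w)\<^sup>2) = (\<lambda>w. (Z w - m) ^ 2 + 2 * m * (Z w - m) ^ 1 + m\<^sup>2 * (Z w - m) ^ 0)"
  by (auto simp: power2_eq_square algebra_simps)
 then show "integrable M (\<lambda>w. (Z w)\<^sup>2)"
  using moments by (simp only:) (intro bochner_integrable_add integrable_mult_right moments)
 then show "integrable M Z" by (rule square_integrable_imp_integrable[rotated]) simp
qed

lemma gaussian_rv_char:
 assumes Z: "gaussian_rv M Z" and mean: "\<E> Z = 0"
 shows "\<E> (\<lambda>w. iexp (Z w)) = complex_of_real (exp (- \<E> (\<lambda>w. (Z w)\<^sup>2) / 2))"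
proof -
 have [measurable]: "Z \<in> borel_measurable M" using Z by (simp add: gaussian_rv_def)
 obtain m where m: "(AE w in M. Z w = m) \<or> (\<exists>s>0. distributed M lborel Z (normal_density m s))"
  using Z unfolding gaussian_rv_def by blast
 then show ?thesis
 proof
  assume ae: "AE w in M. Z w = m"
  then have "\<E> Z = \<E> (\<lambda>_. m)" by (intro integral_cong_AE) auto
  then have ae0: "AE w in M. Z w = 0" using ae mean by (simp add: prob_space)
  then have "\<E> (\<lambda>w. iexp (Z w)) = \<E> (\<lambda>_. 1)"
   by (intro integral_cong_AE) auto
  moreover have "\<E> (\<lambda>w. (Z w)\<^sup>2) = \<E> (\<lambda>_. 0)"
   using ae0 by (intro integral_cong_AE) auto
  ultimately show ?thesis by (simp add: prob_space)
 next
  assume "\<exists>s>0. distributed M lborel Z (normal_density m s)"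
  then obtain s where s: "s > 0" "distributed M lborel Z (normal_density m s)" by blast
  have "m = 0" using normal_distributed_expectation[OF s] mean by simp
  have var: "\<E> (\<lambda>w. (Z w)\<^sup>2) = s\<^sup>2"
   using normal_distributed_variance[OF s] mean by simp
  have std: "distributed M lborel (\<lambda>w. Z w / s) std_normal_density"
   using s normal_standard_normal_convert[of s Z m] \<open>m = 0\<close> by simp
  have "distr M borel (\<lambda>w. Z w / s) = distr M lborel (\<lambda>w. Z w / s)" by (intro distr_cong) auto
  also have "... = std_normal_distribution"
   using std by (rule distributed_distr_eq_density)
  finally have "char (distr M borel (\<lambda>w. Z w / s)) s = complex_of_real (exp (- s\<^sup>2 / 2))"
   by (simp add: char_std_normal_distribution)
  moreover have "char (distr M borel (\<lambda>w. Z w / s)) s = \<E> (\<lambda>w. iexp (Z w))"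
   using s(1) by (simp add: char_def integral_distr)
  ultimately show ?thesis by (simp add: var)
 qed
qed

end

text \<open>A linear combination of bridge values is Gaussian, and its variance is read off the covariance function.\<close>

lemma standard_brownian_bridge_char:
 assumes b: "standard_brownian_bridge N b" and T: "finite T" "T \<subseteq> {0..1}"
 shows "(\<integral>w. iexp (\<Sum>t\<in>T. u t * b t w) \<partial>N) =
  complex_of_real (exp (- (\<Sum>s\<in>T. \<Sum>t\<in>T. u s * u t * (min s t - s * t)) / 2))"
  "(\<lambda>w. \<Sum>t\<in>T. u t * b t w) \<in> borel_measurable N"
  "t \<in> {0..1} ==> b t \<in> borel_measurable N"
proof -
 interpret prob_space N using b by (simp add: standard_brownian_bridge_def)
 have gp: "gaussian_process_on {0..1} N b" using b by (simp add: standard_brownian_bridge_def)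
 have g1: "gaussian_rv N (b t)" if "t \<in> {0..1}" for t
  using gp[unfolded gaussian_process_on_def, rule_format, of "{t}" "\<lambda>_. 1"] that by simp
 then show "t \<in> {0..1} ==> b t \<in> borel_measurable N" by (auto simp: gaussian_rv_def)
 have meas[measurable]: "b t \<in> borel_measurable N" if "t \<in> T" for t using g1 that T by (auto simp: gaussian_rv_def)
 define Z where "Z = (\<lambda>w. \<Sum>t\<in>T. u t * b t w)"
 have Z: "gaussian_rv N Z" using gp T unfolding gaussian_process_on_def Z_def by blast
 then show "(\<lambda>w. \<Sum>t\<in>T. u t * b t w) \<in> borel_measurable N" by (simp add: gaussian_rv_def Z_def)
 have i1: "integrable N (b t)" if "t \<in> T" for t using gaussian_rv_square_integrable[OF g1] that T by blast
 have i2: "integrable N (\<lambda>w. b s w * b t w)" if "s \<in> T" "t \<in> T" for s t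
 proof (rule bochner_integrable_bound[where f = "\<lambda>w. (b s w)\<^sup>2 + (b t w)\<^sup>2"])
  show "integrable N (\<lambda>w. (b s w)\<^sup>2 + (b t w)\<^sup>2)"
   using gaussian_rv_square_integrable[OF g1] that T by (intro bochner_integrable_add) auto
  have "\<bar>x * y\<bar> <= x\<^sup>2 + y\<^sup>2" for x y :: real
  proof -
   have "0 <= \<bar>x\<bar> * \<bar>y\<bar>" by simp
   moreover have "2 * (\<bar>x\<bar> * \<bar>y\<bar>) <= x\<^sup>2 + y\<^sup>2"
    using sum_squares_bound[of "\<bar>x\<bar>" "\<bar>y\<bar>"] by (simp add: mult.assoc)
   ultimately show ?thesis unfolding abs_mult by linarith
  qed
  then show "AE w in N. norm (b s w * b t w) <= norm ((b s w)\<^sup>2 + (b t w)\<^sup>2)" by (intro AE_I2) simp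
 qed (use that in measurable)
 have mean: "expectation (b t) = 0" if "t \<in> T" for t
  using b that T by (auto simp: standard_brownian_bridge_def)
 have cov: "expectation (\<lambda>w. b s w * b t w) = min s t - s * t" if "s \<in> T" "t \<in> T" for s t
  using b that T unfolding standard_brownian_bridge_def by blast
 have EZ: "expectation Z = 0"
  using i1 mean by (simp add: Z_def bochner_integral_sum)
 have sq: "(\<lambda>w. (Z w)\<^sup>2) = (\<lambda>w. \<Sum>s\<in>T. \<Sum>t\<in>T. u s * u t * (b s w * b t w))"
  by (simp add: Z_def power2_eq_square sum_product algebra_simps)
 have "expectation (\<lambda>w. (Z w)\<^sup>2) = (\<Sum>s\<in>T. \<Sum>t\<in>T. u s * u t * (min s t - s * t))"
  unfolding sq using i2 cov by (simp add: bochner_integral_sum bochner_integrable_sum)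
 then show "(\<integral>w. iexp (\<Sum>t\<in>T. u t * b t w) \<partial>N) =
  complex_of_real (exp (- (\<Sum>s\<in>T. \<Sum>t\<in>T. u s * u t * (min s t - s * t)) / 2))"
  using gaussian_rv_char[OF Z EZ] unfolding Z_def by (simp only:)
qed

lemma standard_brownian_bridge_vec_char:
 fixes B :: "real => 'b => real ^ 'd::finite"
 assumes B: "standard_brownian_bridge_vec N B" and T: "finite T" "T \<subseteq> {0..1}"
 shows "(\<integral>w. iexp (\<Sum>t\<in>T. \<Sum>c\<in>UNIV. u t c * B t w $ c) \<partial>N) =
  complex_of_real (exp (- (\<Sum>c\<in>UNIV. \<Sum>s\<in>T. \<Sum>t\<in>T. u s c * u t c * (min s t - s * t)) / 2))"
proof -
 have b: "standard_brownian_bridge N (\<lambda>t w. B t w $ c)" for c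
  using B by (simp add: standard_brownian_bridge_vec_def)
 interpret prob_space N using b by (simp add: standard_brownian_bridge_def)
 define Z where "Z c w = (\<Sum>t\<in>T. u t c * B t w $ c)" for c w
 have [measurable]: "Z c \<in> borel_measurable N" for c
  unfolding Z_def by (rule standard_brownian_bridge_char(2)[OF b T])
 have "indep_vars (\<lambda>_. Pi\<^sub>M {0..1} (\<lambda>_. borel)) (\<lambda>c w. restrict (\<lambda>t. B t w $ c) {0..1}) UNIV"
  using B by (simp add: standard_brownian_bridge_vec_def)
 then have "indep_vars (\<lambda>_. borel) (\<lambda>c w. \<Sum>t\<in>T. u t c * restrict (\<lambda>t. B t w $ c) {0..1} t) UNIV"
  by (rule indep_vars_compose2[where Y = "\<lambda>c x. \<Sum>t\<in>T. u t c * x t"])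
   (use T in \<open>auto intro!: borel_measurable_sum borel_measurable_times measurable_component_singleton\<close>)
 also have "(\<lambda>c w. \<Sum>t\<in>T. u t c * restrict (\<lambda>t. B t w $ c) {0..1} t) = Z"
  using T by (auto simp: fun_eq_iff Z_def intro!: sum.cong)
 finally have "char (distr N borel (\<lambda>w. \<Sum>c\<in>UNIV. Z c w)) 1 = (\<Prod>c\<in>UNIV. char (distr N borel (Z c)) 1)"
  by (rule char_distr_sum)
 also have "... = (\<Prod>c\<in>UNIV. complex_of_real (exp (- (\<Sum>s\<in>T. \<Sum>t\<in>T. u s c * u t c * (min s t - s * t)) / 2)))"
  using standard_brownian_bridge_char(1)[OF b T, of "\<lambda>t. u t c" for c]
  by (intro prod.cong) (auto simp: char_def integral_distr Z_def)
 also have "... = complex_of_real (exp (- (\<Sum>c\<in>UNIV. \<Sum>s\<in>T. \<Sum>t\<in>T. u s c * u t c * (min s t - s * t)) / 2))"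
  by (simp add: of_real_prod[symmetric] exp_sum[symmetric] sum_divide_distrib sum_negf[symmetric] del: of_real_prod)
 also have "char (distr N borel (\<lambda>w. \<Sum>c\<in>UNIV. Z c w)) 1 = (\<integral>w. iexp (\<Sum>c\<in>UNIV. Z c w) \<partial>N)"
  by (simp add: char_def integral_distr)
 also have "(\<lambda>w. \<Sum>c\<in>UNIV. Z c w) = (\<lambda>w. \<Sum>t\<in>T. \<Sum>c\<in>UNIV. u t c * B t w $ c)"
  unfolding Z_def by (intro ext sum.swap)
 finally show ?thesis .
qed

section \<open>Inverses and square roots of positive definite matrices\<close>

text \<open>A quantitative form of positive definiteness; it is stable under small
perturbations and bounds the inverse.\<close>

definition coercive :: "real => real ^ 'd ^ 'd::finite => bool" where
 "coercive m A \<longleftrightarrow> (\<forall>v. m * (norm v)\<^sup>2 <= v \<bullet> (A *v v))"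

lemma inner_symmetric_matrix:
 assumes "transpose (A :: real ^ 'd ^ 'd::finite) = A"
 shows "(A *v u) \<bullet> v = u \<bullet> (A *v v)"
 using dot_lmul_matrix[of u A v] transpose_matrix_vector[of A u] assms by simp

lemma norm_matrix_vector_le: "norm (A *v v) <= norm (A :: real ^ 'd ^ 'e::finite) * norm v"
proof -
 have "(norm w)\<^sup>2 = (\<Sum>i\<in>UNIV. (w $ i)\<^sup>2)" for w :: "real ^ 'e"
  unfolding power2_norm_eq_inner inner_vec_def by (simp add: power2_eq_square)
 then have "(norm (A *v v))\<^sup>2 = (\<Sum>i\<in>UNIV. (A $ i \<bullet> v)\<^sup>2)"
  by (simp add: matrix_vector_mul_component)
 also have "... <= (\<Sum>i\<in>UNIV. (norm (A $ i))\<^sup>2 * (norm v)\<^sup>2)"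
 proof (rule sum_mono)
  fix i
  have "\<bar>A $ i \<bullet> v\<bar> <= norm (A $ i) * norm v" by (rule Cauchy_Schwarz_ineq2)
  then have "\<bar>A $ i \<bullet> v\<bar>\<^sup>2 <= (norm (A $ i) * norm v)\<^sup>2" by (intro power_mono) auto
  then show "(A $ i \<bullet> v)\<^sup>2 <= (norm (A $ i))\<^sup>2 * (norm v)\<^sup>2" by (simp add: power_mult_distrib)
 qed
 also have "... = (norm A * norm v)\<^sup>2"
  by (simp add: sum_distrib_right[symmetric] power_mult_distrib power2_norm_eq_inner[of A] inner_vec_def[of A A] power2_norm_eq_inner[of "A $ _"])
 finally show ?thesis by (rule power2_le_imp_le) simp
qed

lemma matrix_diff_distrib:
 fixes A B C :: "real ^ 'd ^ 'd::finite"
 shows "A ** (B - C) = A ** B - A ** C" "(A - B) ** C = A ** C - B ** C" "(A + B) ** C = A ** C + B ** C"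
 by (simp_all add: matrix_matrix_mult_def vec_eq_iff right_diff_distrib left_diff_distrib distrib_right sum_subtractf sum.distrib)

lemma frobenius_columns:
 fixes A B :: "real ^ 'd ^ 'd::finite"
 shows "A \<bullet> B = (\<Sum>j\<in>UNIV. column j A \<bullet> column j B)"
 by (simp add: inner_vec_def column_def) (rule sum.swap)

lemma column_matrix_mult: "column j (A ** B) = (A :: real ^ 'd ^ 'd::finite) *v column j B"
 by (simp add: column_def matrix_matrix_mult_def matrix_vector_mult_def vec_eq_iff)

lemma frobenius_transpose: "transpose A \<bullet> transpose B = (A :: real ^ 'd ^ 'd::finite) \<bullet> B"
 by (simp add: inner_vec_def transpose_def) (rule sum.swap)

lemma norm_transpose: "norm (transpose (A :: real ^ 'd ^ 'd::finite)) = norm A"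
 by (simp add: norm_eq_sqrt_inner frobenius_transpose)

lemma norm_matrix_mult_le:
 fixes A B :: "real ^ 'd ^ 'd::finite"
 assumes q: "0 <= q" and A: "\<And>v. norm (A *v v) <= q * norm v"
 shows "norm (A ** B) <= q * norm B"
proof -
 have "(norm (A ** B))\<^sup>2 = (\<Sum>j\<in>UNIV. (norm (A *v column j B))\<^sup>2)"
  by (simp add: power2_norm_eq_inner frobenius_columns column_matrix_mult)
 also have "... <= (\<Sum>j\<in>UNIV. (q * norm (column j B))\<^sup>2)"
  using A by (intro sum_mono power_mono) auto
 also have "... = (q * norm B)\<^sup>2"
  by (simp add: power_mult_distrib sum_distrib_left[symmetric] power2_norm_eq_inner frobenius_columns)
 finally show ?thesis by (rule power2_le_imp_le) (use q in simp)
qed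

text \<open>The quadratic form of \<open>u + t *\<^sub>R v\<close> is nonnegative for all real \<open>t\<close>.\<close>

lemma psd_cauchy_schwarz:
 fixes A :: "real ^ 'd ^ 'd::finite"
 assumes A: "psd A"
 shows "(u \<bullet> (A *v v))\<^sup>2 <= (u \<bullet> (A *v u)) * (v \<bullet> (A *v v))"
proof -
 define a b c where "a = u \<bullet> (A *v u)" and "b = u \<bullet> (A *v v)" and "c = v \<bullet> (A *v v)"
 have nn: "0 <= w \<bullet> (A *v w)" for w using A by (simp add: psd_def)
 have vu: "v \<bullet> (A *v u) = b"
  using A inner_symmetric_matrix[of A v u] by (simp add: psd_def b_def inner_commute)
 have q: "0 <= a + 2 * b * t + c * t\<^sup>2" for t
 proof -
  have "(u + t *\<^sub>R v) \<bullet> (A *v (u + t *\<^sub>R v)) = a + 2 * b * t + c * t\<^sup>2"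
   using vu by (simp add: a_def b_def c_def matrix_vector_mult_add_rdistrib matrix_vector_mult_scaleR matrix_vector_right_distrib
     inner_add_left inner_add_right power2_eq_square algebra_simps)
  then show ?thesis using nn[of "u + t *\<^sub>R v"] by simp
 qed
 have "b\<^sup>2 <= a * c"
 proof (cases "c = 0")
  case True
  have "b = 0"
  proof (rule ccontr)
   assume "b \<noteq> 0"
   then have "2 * b * (- (a + 1) / (2 * b)) = - (a + 1)" by simp
   then show False using q[of "- (a + 1) / (2 * b)"] True by simp
  qed
  then show ?thesis using True by simp
 next
  case False
  then have c: "c > 0" using nn[of v] by (simp add: c_def less_le)
  have "0 <= (a + 2 * b * (- b / c) + c * (- b / c)\<^sup>2) * c" using q[of "- b / c"] c by (intro mult_nonneg_nonneg) auto
  also have "... = a * c - b\<^sup>2" using c by (simp add: field_simps power2_eq_square)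
  finally show ?thesis by simp
 qed
 then show ?thesis by (simp add: a_def b_def c_def)
qed

text \<open>For symmetric positive semidefinite matrices the operator norm is attained on the
quadratic form; this follows from the Cauchy-Schwarz inequality of the form.\<close>

lemma psd_contraction:
 fixes B :: "real ^ 'd ^ 'd::finite"
 assumes B: "psd B" and q: "\<And>v. v \<bullet> (B *v v) <= q * (norm v)\<^sup>2" "0 <= q"
 shows "norm (B *v v) <= q * norm v"
proof -
 define u where "u = B *v v"
 have "((norm u)\<^sup>2)\<^sup>2 = (u \<bullet> (B *v v))\<^sup>2" by (simp add: u_def power2_norm_eq_inner)
 also have "... <= (u \<bullet> (B *v u)) * (v \<bullet> (B *v v))" by (rule psd_cauchy_schwarz[OF B])
 also have "... <= (q * (norm u)\<^sup>2) * (q * (norm v)\<^sup>2)"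
  using q B by (intro mult_mono) (auto simp: psd_def)
 finally have *: "(norm u)\<^sup>2 * (norm u)\<^sup>2 <= (norm u)\<^sup>2 * (q * norm v)\<^sup>2" by (simp add: power2_eq_square mult_ac)
 have "norm u <= q * norm v"
 proof (cases "u = 0")
  case False
  then have "0 < (norm u)\<^sup>2" by simp
  with * have "(norm u)\<^sup>2 <= (q * norm v)\<^sup>2" using mult_le_cancel_left_pos by blast
  then show ?thesis by (rule power2_le_imp_le) (use q in simp)
 qed (use q in simp)
 then show ?thesis by (simp add: u_def)
qed

text \<open>With \<open>D = R - S\<close> and \<open>P = R + S\<close> one has
\<open>P ** D + D ** P = 2 (R ** R - S ** S)\<close>, and the Frobenius inner product of \<open>D\<close> with \<open>P ** D\<close> is at least
\<open>m\<close> times the squared norm of \<open>D\<close>. The bound gives both uniqueness and continuity of the square root.\<close>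

lemma psd_sqrt_lipschitz:
 fixes R S :: "real ^ 'd ^ 'd::finite"
 assumes R: "psd R" and S: "psd S" and m: "coercive m S"
 shows "m * norm (R - S) <= norm (R ** R - S ** S)"
proof -
 define D P where "D = R - S" and "P = R + S"
 have sym: "transpose D = D" "transpose P = P"
  using R S by (simp_all add: D_def P_def psd_def transpose_def vec_eq_iff)
 have P: "m * (norm v)\<^sup>2 <= v \<bullet> (P *v v)" for v
  using m R by (simp add: P_def coercive_def psd_def matrix_vector_mult_add_rdistrib inner_add_right add_increasing)
 have DPD: "m * (norm D)\<^sup>2 <= D \<bullet> (P ** D)"
 proof -
  have "m * (norm D)\<^sup>2 = (\<Sum>j\<in>UNIV. m * (norm (column j D))\<^sup>2)"
   by (simp add: power2_norm_eq_inner frobenius_columns sum_distrib_left)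
  also have "... <= (\<Sum>j\<in>UNIV. column j D \<bullet> (P *v column j D))" by (intro sum_mono P)
  also have "... = D \<bullet> (P ** D)" by (simp add: frobenius_columns column_matrix_mult)
  finally show ?thesis .
 qed
 have "D \<bullet> (D ** P) = transpose D \<bullet> transpose (D ** P)" by (simp add: frobenius_transpose)
 also have "... = D \<bullet> (P ** D)" by (simp add: matrix_transpose_mul sym)
 finally have "D \<bullet> (D ** P + P ** D) = 2 * (D \<bullet> (P ** D))" by (simp add: inner_add_right)
 moreover have "D ** P + P ** D = 2 *\<^sub>R (R ** R - S ** S)"
  unfolding D_def P_def matrix_diff_distrib matrix_add_ldistrib
  by (simp add: scaleR_2 algebra_simps)
 ultimately have "D \<bullet> (P ** D) = D \<bullet> (R ** R - S ** S)" by simp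
 also have "... <= norm D * norm (R ** R - S ** S)" by (rule norm_cauchy_schwarz)
 finally have *: "norm D * (m * norm D) <= norm D * norm (R ** R - S ** S)"
  using DPD by (simp add: power2_eq_square mult_ac)
 show ?thesis
 proof (cases "D = 0")
  case False
  then show ?thesis using * by (simp add: D_def[symmetric])
 qed (simp add: D_def[symmetric])
qed

text \<open>After scaling, \<open>A / L = 1 - B\<close> with a contraction \<open>B\<close>. A root of the form
\<open>1 - C\<close> satisfies \<open>C = (B + C ** C) / 2\<close>, which is a fixed point equation to which Banach's theorem applies, on the closed
set of symmetric matrices with the same contraction constant as \<open>B\<close>.\<close>

lemma psd_sqrt_exists:
 fixes A :: "real ^ 'd ^ 'd::finite"
 assumes sym: "transpose A = A" and m: "coercive m A" and mpos: "0 < m"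
 obtains R r where "psd R" "R ** R = A" "0 < r" "coercive r R"
proof -
 define L where "L = norm A + m + 1"
 have L: "L > 0" "m < L" unfolding L_def using mpos norm_ge_zero[of A] by linarith+
 have up: "v \<bullet> (A *v v) <= L * (norm v)\<^sup>2" for v
 proof -
  have "v \<bullet> (A *v v) <= norm v * norm (A *v v)" by (rule norm_cauchy_schwarz)
  also have "... <= norm v * (norm A * norm v)" by (intro mult_left_mono norm_matrix_vector_le) simp
  also have "... <= L * (norm v)\<^sup>2"
   using mpos by (simp add: L_def power2_eq_square algebra_simps)
  finally show ?thesis .
 qed
 define q where "q = 1 - m / L"
 have q: "0 <= q" "q < 1" using L mpos by (auto simp: q_def)
 define B where "B = mat 1 - (1 / L) *\<^sub>R A"
 have Bv: "B *v v = v - (1 / L) *\<^sub>R (A *v v)" for v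
  by (simp add: B_def matrix_vector_mult_diff_rdistrib scaleR_matrix_vector_assoc)
 have vBv: "v \<bullet> (B *v v) = (norm v)\<^sup>2 - (v \<bullet> (A *v v)) / L" for v
  by (simp add: Bv inner_diff_right power2_norm_eq_inner)
 have symB: "transpose B = B"
  using sym by (simp add: B_def transpose_def vec_eq_iff mat_def)
 have "psd B"
  using up L symB by (simp add: psd_def vBv field_simps)
 have Bq: "norm (B *v v) <= q * norm v" for v
 proof (rule psd_contraction[OF \<open>psd B\<close> _ q(1)])
  fix v
  have "m * (norm v)\<^sup>2 <= v \<bullet> (A *v v)" using m by (simp add: coercive_def)
  then have "m * (norm v)\<^sup>2 / L <= (v \<bullet> (A *v v)) / L" using L by (intro divide_right_mono) auto
  then show "v \<bullet> (B *v v) <= q * (norm v)\<^sup>2" by (simp add: vBv q_def algebra_simps)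
 qed
 define s where "s = {Y :: real ^ 'd ^ 'd. transpose Y = Y \<and> (\<forall>v. norm (Y *v v) <= q * norm v)}"
 define F where "F Y = (1 / 2) *\<^sub>R (B + Y ** Y)" for Y :: "real ^ 'd ^ 'd"
 have "closed s"
 proof -
  have "s = {Y. transpose Y = Y} \<inter> (\<Inter>v. {Y. norm (Y *v v) <= q * norm v})" by (auto simp: s_def)
  moreover have "linear (\<lambda>Y :: real ^ 'd ^ 'd. Y *v v)" for v
   by (rule linearI) (simp_all add: matrix_vector_mult_add_rdistrib scaleR_matrix_vector_assoc)
  then have "closed {Y :: real ^ 'd ^ 'd. norm (Y *v v) <= q * norm v}" for v
   by (intro closed_Collect_le continuous_on_norm continuous_on_const) (simp add: linear_continuous_on linear_linear)
  moreover have "linear (\<lambda>Y :: real ^ 'd ^ 'd. transpose Y)"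
   by (rule linearI) (simp_all add: transpose_def vec_eq_iff)
  then have "closed {Y :: real ^ 'd ^ 'd. transpose Y = Y}"
   by (intro closed_Collect_eq continuous_on_id) (simp add: linear_continuous_on linear_linear)
  ultimately show ?thesis by (auto intro!: closed_Int closed_INT)
 qed
 note cs = complete_eq_closed[THEN iffD2, OF this]
 have "0 \<in> s" using q by (simp add: s_def transpose_def vec_eq_iff)
 have Fs: "F ` s \<subseteq> s"
 proof (rule image_subsetI)
  fix Y assume Y: "Y \<in> s"
  have "transpose (F Y) = (1 / 2) *\<^sub>R (transpose B + transpose (Y ** Y))"
   by (simp add: F_def transpose_def vec_eq_iff)
  then have "transpose (F Y) = F Y" using Y symB by (simp add: s_def F_def matrix_transpose_mul)
  moreover have "norm (F Y *v v) <= q * norm v" for v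
  proof -
   have "F Y *v v = (1 / 2) *\<^sub>R (B *v v + Y *v (Y *v v))"
    by (simp add: F_def scaleR_matrix_vector_assoc[symmetric] matrix_vector_mult_add_rdistrib matrix_vector_mul_assoc)
   then have "norm (F Y *v v) <= (norm (B *v v) + norm (Y *v (Y *v v))) / 2"
    by (simp add: norm_triangle_ineq)
   also have "norm (Y *v (Y *v v)) <= q * (q * norm v)"
    using Y q order_trans[OF _ mult_left_mono[of "norm (Y *v v)" "q * norm v" q]] by (simp add: s_def)
   also have "q * (q * norm v) <= 1 * (q * norm v)" using q by (intro mult_right_mono) auto
   also have "norm (B *v v) <= q * norm v" by (rule Bq)
   finally show ?thesis by simp
  qed
  ultimately show "F Y \<in> s" by (simp add: s_def)
 qed
 have contr: "dist (F Y) (F Z) <= q * dist Y Z" if Y: "Y \<in> s" and Z: "Z \<in> s" for Y Z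
 proof -
  have symYZ: "transpose (Y - Z) = Y - Z" "transpose Z = Z"
   using Y Z by (auto simp: s_def transpose_def vec_eq_iff)
  have "F Y - F Z = (1 / 2) *\<^sub>R (Y ** Y - Z ** Z)" by (simp add: F_def algebra_simps)
  also have "Y ** Y - Z ** Z = Y ** (Y - Z) + (Y - Z) ** Z"
   by (simp add: matrix_diff_distrib)
  finally have "norm (F Y - F Z) <= (norm (Y ** (Y - Z)) + norm ((Y - Z) ** Z)) / 2"
   by (simp add: norm_triangle_ineq)
  also have "norm (Y ** (Y - Z)) <= q * norm (Y - Z)"
   using Y q by (intro norm_matrix_mult_le) (auto simp: s_def)
  also have "norm ((Y - Z) ** Z) = norm (transpose ((Y - Z) ** Z))" by (simp add: norm_transpose)
  also have "transpose ((Y - Z) ** Z) = Z ** (Y - Z)" by (simp add: matrix_transpose_mul symYZ)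
  also have "norm (Z ** (Y - Z)) <= q * norm (Y - Z)"
   using Z q by (intro norm_matrix_mult_le) (auto simp: s_def)
  finally show ?thesis by (simp add: dist_norm)
 qed
 have "\<exists>!Y\<in>s. F Y = Y"
 proof (rule Banach_fix[OF cs _ q])
  show "s \<noteq> {}" using \<open>0 \<in> s\<close> by blast
  show "F ` s \<subseteq> s" by (rule Fs)
  show "dist (F Y) (F Z) <= q * dist Y Z" if "Y \<in> s" "Z \<in> s" for Y Z using that by (rule contr)
 qed
 then obtain Y where Y: "Y \<in> s" "F Y = Y" by blast
 define T where "T = mat 1 - Y"
 have "2 *\<^sub>R F Y = B + Y ** Y" by (simp add: F_def)
 then have Yeq: "Y ** Y = Y + Y - B" using Y(2) by (simp add: scaleR_2 algebra_simps)
 have "T ** T = mat 1 - B"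
  by (simp add: T_def matrix_diff_distrib Yeq)
 then have TT: "T ** T = (1 / L) *\<^sub>R A" by (simp add: B_def)
 have symT: "transpose T = T" using Y(1) by (simp add: T_def s_def transpose_def vec_eq_iff mat_def)
 have Tc: "(1 - q) * (norm v)\<^sup>2 <= v \<bullet> (T *v v)" for v
 proof -
  have "v \<bullet> (Y *v v) <= norm v * norm (Y *v v)" by (rule norm_cauchy_schwarz)
  also have "... <= norm v * (q * norm v)" using Y(1) by (intro mult_left_mono) (auto simp: s_def)
  finally have "v \<bullet> (Y *v v) <= q * (norm v)\<^sup>2" by (simp add: power2_eq_square mult_ac)
  then show ?thesis
   by (simp add: T_def matrix_vector_mult_diff_rdistrib inner_diff_right power2_norm_eq_inner algebra_simps)
 qed
 define R where "R = sqrt L *\<^sub>R T"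
 have vRv: "v \<bullet> (R *v v) = sqrt L * (v \<bullet> (T *v v))" for v
  by (simp add: R_def scaleR_matrix_vector_assoc[symmetric])
 have c: "coercive (sqrt L * (1 - q)) R"
  unfolding coercive_def vRv using mult_left_mono[OF Tc, of "sqrt L"] L by (simp add: mult.assoc)
 have r: "0 < sqrt L * (1 - q)" using L q by simp
 show ?thesis
 proof (rule that[OF _ _ r c])
  have "transpose R = R" using symT by (simp add: R_def transpose_def vec_eq_iff)
  moreover have "0 <= v \<bullet> (R *v v)" for v
   using c r order_trans[of 0 "(sqrt L * (1 - q)) * (norm v)\<^sup>2"] by (simp add: coercive_def)
  ultimately show "psd R" by (simp add: psd_def)
  have "R ** R = (sqrt L * sqrt L) *\<^sub>R (T ** T)"
   by (simp add: R_def matrix_scalar_ac scalar_matrix_assoc[symmetric])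
  then show "R ** R = A" using L TT by simp
 qed
qed

lemma sqrt_mat_pd:
 fixes A :: "real ^ 'd ^ 'd::finite"
 assumes sym: "transpose A = A" and m: "coercive m A" and mpos: "0 < m"
 shows "psd (sqrt_mat A)" "sqrt_mat A ** sqrt_mat A = A" "\<exists>r>0. coercive r (sqrt_mat A)"
  "\<And>R. psd R ==> R ** R = A ==> sqrt_mat A = R"
proof -
 obtain R r where R: "psd R" "R ** R = A" "0 < r" "coercive r R"
  using psd_sqrt_exists[OF assms] .
 have uniq: "S = R" if "psd S" "S ** S = A" for S
 proof -
  have "r * norm (S - R) <= norm (S ** S - R ** R)" using that(1) R by (intro psd_sqrt_lipschitz)
  then show ?thesis using that R by (simp add: mult_le_0_iff)
 qed
 have eq: "sqrt_mat A = R"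
  unfolding sqrt_mat_def
 proof (rule the_equality)
  show "psd R \<and> R ** R = A" using R(1,2) by blast
  show "S = R" if "psd S \<and> S ** S = A" for S using uniq that by blast
 qed
 show "psd (sqrt_mat A)" "sqrt_mat A ** sqrt_mat A = A" by (simp_all only: eq R)
 show "\<exists>r>0. coercive r (sqrt_mat A)" unfolding eq using R(3,4) by blast
 show "sqrt_mat A = S" if "psd S" "S ** S = A" for S using uniq[OF that] eq by simp
qed

lemma coercive_perturb:
 fixes A B :: "real ^ 'd ^ 'd::finite"
 assumes "coercive m A" "norm (B - A) <= d"
 shows "coercive (m - d) B"
 unfolding coercive_def
proof
 fix v
 have "\<bar>v \<bullet> ((B - A) *v v)\<bar> <= norm v * norm ((B - A) *v v)" by (rule Cauchy_Schwarz_ineq2)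
 also have "... <= norm v * (d * norm v)"
  using assms(2) order_trans[OF norm_matrix_vector_le mult_right_mono[of "norm (B - A)" d "norm v"]]
  by (intro mult_left_mono) auto
 finally have "- (d * (norm v)\<^sup>2) <= v \<bullet> ((B - A) *v v)" by (simp add: power2_eq_square mult_ac abs_le_iff)
 moreover have "m * (norm v)\<^sup>2 <= v \<bullet> (A *v v)" using assms(1) by (simp add: coercive_def)
 ultimately show "(m - d) * (norm v)\<^sup>2 <= v \<bullet> (B *v v)"
  by (simp add: matrix_vector_mult_diff_rdistrib inner_diff_right algebra_simps)
qed

lemma matrix_inv_coercive:
 fixes A :: "real ^ 'd ^ 'd::finite"
 assumes m: "coercive m A" "0 < m"
 shows "A ** matrix_inv A = mat 1" "matrix_inv A ** A = mat 1" "norm (matrix_inv A *v v) <= norm v / m"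
  "\<And>C. C ** A = mat 1 ==> matrix_inv A = C"
proof -
 have lower: "m * norm v <= norm (A *v v)" for v
 proof (cases "v = 0")
  case False
  have "m * (norm v)\<^sup>2 <= v \<bullet> (A *v v)" using m by (simp add: coercive_def)
  also have "... <= norm v * norm (A *v v)" by (rule norm_cauchy_schwarz)
  finally show ?thesis using False by (simp add: power2_eq_square mult.left_commute[of m])
 qed simp
 have "inj ((*v) A)"
 proof (rule injI)
  fix u v assume "A *v u = A *v v"
  then have "A *v (u - v) = 0" by (simp add: matrix_vector_mult_diff_distrib)
  then show "u = v" using lower[of "u - v"] m by (simp add: mult_le_0_iff)
 qed
 then have "invertible A" by (simp add: invertible_left_inverse matrix_left_invertible_injective)
 then have "\<exists>A'. A ** A' = mat 1 \<and> A' ** A = mat 1" by (simp add: invertible_def)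
 then have inv: "A ** matrix_inv A = mat 1 \<and> matrix_inv A ** A = mat 1"
  unfolding matrix_inv_def by (rule someI_ex)
 then show 1: "A ** matrix_inv A = mat 1" "matrix_inv A ** A = mat 1" by auto
 have "m * norm (matrix_inv A *v v) <= norm v"
  using lower[of "matrix_inv A *v v"] 1 by (simp add: matrix_vector_mul_assoc)
 then show "norm (matrix_inv A *v v) <= norm v / m" using m by (simp add: field_simps)
 show "matrix_inv A = C" if "C ** A = mat 1" for C
  using that 1 by (metis matrix_mul_assoc matrix_mul_lid matrix_mul_rid)
qed

lemma matrix_inv_tendsto:
 fixes A :: "real ^ 'd ^ 'd::finite"
 assumes m: "coercive m A" "0 < m" and f: "(f \<longlongrightarrow> A) F"
 shows "((\<lambda>x. matrix_inv (f x)) \<longlongrightarrow> matrix_inv A) F"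
proof -
 have "\<forall>\<^sub>F x in F. dist (f x) A < m / 2" using m by (intro tendstoD[OF f]) simp
 then have ev: "\<forall>\<^sub>F x in F. norm (matrix_inv (f x) - matrix_inv A) <= norm (f x - A) * (norm (matrix_inv A) * 2 / m)"
 proof eventually_elim
  case (elim x)
  then have "coercive (m - m / 2) (f x)" by (intro coercive_perturb[OF m(1)]) (simp add: dist_norm)
  then have c: "coercive (m / 2) (f x)" by simp
  have "matrix_inv (f x) - matrix_inv A = matrix_inv (f x) ** ((A - f x) ** matrix_inv A)"
   using matrix_inv_coercive(1)[OF m] matrix_inv_coercive(2)[OF c] m
   by (simp add: matrix_diff_distrib matrix_mul_assoc[of _ "f x"])
  also have "norm ... <= (2 / m) * norm ((A - f x) ** matrix_inv A)"
   using matrix_inv_coercive(3)[OF c] m by (intro norm_matrix_mult_le) (auto simp: mult.commute)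
  also have "norm ((A - f x) ** matrix_inv A) <= norm (A - f x) * norm (matrix_inv A)"
   by (intro norm_matrix_mult_le norm_matrix_vector_le) simp
  finally show ?case using m by (simp add: norm_minus_commute mult_ac divide_right_mono mult_left_mono)
 qed
 have "((\<lambda>x. matrix_inv (f x) - matrix_inv A) \<longlongrightarrow> 0) F"
  by (rule Lim_null_comparison[OF ev]) (intro tendsto_mult_left_zero tendsto_norm_zero LIM_zero f)
 then show ?thesis by (rule LIM_zero_cancel)
qed

lemma sqrt_mat_tendsto:
 fixes A :: "real ^ 'd ^ 'd::finite"
 assumes sym: "transpose A = A" and m: "coercive m A" "0 < m"
  and f: "(f \<longlongrightarrow> A) F" and symf: "\<And>x. transpose (f x) = f x"
 shows "((\<lambda>x. sqrt_mat (f x)) \<longlongrightarrow> sqrt_mat A) F"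
proof -
 note A = sqrt_mat_pd[OF sym m]
 obtain r where r: "0 < r" "coercive r (sqrt_mat A)" using A(3) by blast
 have "\<forall>\<^sub>F x in F. dist (f x) A < m / 2" using m by (intro tendstoD[OF f]) simp
 then have ev: "\<forall>\<^sub>F x in F. norm (sqrt_mat (f x) - sqrt_mat A) <= norm (f x - A) * (1 / r)"
 proof eventually_elim
  case (elim x)
  then have "coercive (m - m / 2) (f x)" by (intro coercive_perturb[OF m(1)]) (simp add: dist_norm)
  then have c: "coercive (m / 2) (f x)" by simp
  have "0 < m / 2" using m by simp
  note X = sqrt_mat_pd[OF symf c this]
  have "r * norm (sqrt_mat (f x) - sqrt_mat A) <= norm (f x - A)"
   using psd_sqrt_lipschitz[OF X(1) A(1) r(2)] X(2) A(2) by simp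
  then show ?case using r by (simp add: field_simps)
 qed
 have "((\<lambda>x. sqrt_mat (f x) - sqrt_mat A) \<longlongrightarrow> 0) F"
  by (rule Lim_null_comparison[OF ev]) (intro tendsto_mult_left_zero tendsto_norm_zero LIM_zero f)
 then show ?thesis by (rule LIM_zero_cancel)
qed

lemma inverse_sqrt_scale:
 fixes A :: "real ^ 'd ^ 'd::finite"
 assumes sym: "transpose A = A" and m: "coercive m A" "0 < m" and c: "0 < c"
 shows "matrix_inv (sqrt_mat (c *\<^sub>R A)) = (1 / sqrt c) *\<^sub>R matrix_inv (sqrt_mat A)"
proof -
 note A = sqrt_mat_pd[OF sym m]
 obtain r where r: "0 < r" "coercive r (sqrt_mat A)" using A(3) by blast
 have "coercive (c * m) (c *\<^sub>R A)"
  using m c by (simp add: coercive_def scaleR_matrix_vector_assoc[symmetric] mult.assoc)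
 moreover have "transpose (c *\<^sub>R A) = c *\<^sub>R A" using sym by (simp add: transpose_def vec_eq_iff)
 moreover have "psd (sqrt c *\<^sub>R sqrt_mat A)"
  using A(1) c by (simp add: psd_def transpose_def vec_eq_iff scaleR_matrix_vector_assoc[symmetric])
 moreover have "(sqrt c *\<^sub>R sqrt_mat A) ** (sqrt c *\<^sub>R sqrt_mat A) = c *\<^sub>R A"
  using A(2) c by (simp add: matrix_scalar_ac scalar_matrix_assoc[symmetric])
 ultimately have eq: "sqrt_mat (c *\<^sub>R A) = sqrt c *\<^sub>R sqrt_mat A"
  using sqrt_mat_pd(4)[of "c *\<^sub>R A" "c * m"] m c by simp
 have "coercive (sqrt c * r) (sqrt c *\<^sub>R sqrt_mat A)"
  using r c by (simp add: coercive_def scaleR_matrix_vector_assoc[symmetric] mult.assoc)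
 then show ?thesis
  unfolding eq using r c matrix_inv_coercive(2)[OF r(2,1)]
  by (intro matrix_inv_coercive(4)[where m = "sqrt c * r"]) (simp_all add: matrix_scalar_ac scalar_matrix_assoc[symmetric])
qed

text \<open>This is where the identity covariance of the limit comes from.\<close>

lemma inverse_sqrt_whitens:
 fixes A :: "real ^ 'd ^ 'd::finite"
 assumes sym: "transpose A = A" and m: "coercive m A" "0 < m"
 defines "R \<equiv> matrix_inv (sqrt_mat A)"
 shows "(R *v u) \<bullet> (A *v (R *v v)) = u \<bullet> v" "transpose R = R"
proof -
 note A = sqrt_mat_pd[OF sym m]
 obtain r where r: "0 < r" "coercive r (sqrt_mat A)" using A(3) by blast
 note I = matrix_inv_coercive[OF r(2,1)]
 have "transpose R ** sqrt_mat A = transpose (sqrt_mat A ** R)"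
  using A(1) by (simp add: psd_def matrix_transpose_mul)
 also have "... = mat 1" using I(1) by (simp add: R_def transpose_mat)
 finally have "R = transpose R" unfolding R_def by (rule I(4))
 then show RT: "transpose R = R" by simp
 have "R ** (A ** R) = R ** ((sqrt_mat A ** sqrt_mat A) ** R)" by (simp only: A(2))
 also have "... = (R ** sqrt_mat A) ** (sqrt_mat A ** R)" by (simp only: matrix_mul_assoc)
 also have "... = mat 1" using I(1,2) by (simp add: R_def)
 finally have "R ** (A ** R) = mat 1" .
 then have "R *v (A *v (R *v v)) = v" by (metis matrix_vector_mul_assoc matrix_vector_mul_lid)
 then show "(R *v u) \<bullet> (A *v (R *v v)) = u \<bullet> v"
  by (simp only: inner_symmetric_matrix[OF RT, of u "A *v (R *v v)"])
qed

section \<open>The transition kernel of an INAR process\<close>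

text \<open>Convolution of laws on the natural numbers. It makes them a commutative monoid, so laws of sums of
independent variables are products over finite index sets.\<close>

definition conv_pmf :: "nat pmf => nat pmf => nat pmf" where
 "conv_pmf P Q = map_pmf (\<lambda>(a, b). a + b) (pair_pmf P Q)"

lemma conv_pmf_alt: "conv_pmf P Q = bind_pmf P (\<lambda>a. map_pmf (\<lambda>b. a + b) Q)"
 by (simp add: conv_pmf_def pair_pmf_def map_bind_pmf map_pmf_def bind_assoc_pmf bind_return_pmf)

global_interpretation conv: comm_monoid_set conv_pmf "return_pmf 0"
 defines conv_prod = conv.F
proof
 show "conv_pmf (conv_pmf a b) c = conv_pmf a (conv_pmf b c)" for a b c
  by (simp add: conv_pmf_alt map_pmf_def bind_assoc_pmf bind_return_pmf add.assoc)
 show "conv_pmf a b = conv_pmf b a" for a b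
  unfolding conv_pmf_alt map_pmf_def by (subst bind_commute_pmf) (simp add: add.commute)
 show "conv_pmf a (return_pmf 0) = a" for a
  by (simp add: conv_pmf_alt bind_return_pmf')
qed

lemma measurable_count_compose2:
 assumes "f \<in> measurable M (count_space (UNIV :: 'b::countable set))" "g \<in> measurable M (count_space (UNIV :: 'c::countable set))"
 shows "(\<lambda>w. h (f w) (g w)) \<in> measurable M (count_space UNIV)"
 by (rule measurable_compose_countable[OF _ assms(1)], rule measurable_compose[OF assms(2)]) simp

lemma measurable_nat_sum:
 fixes f :: "'i => 'a => nat"
 assumes "\<And>i. i \<in> I ==> f i \<in> measurable M (count_space UNIV)"
 shows "(\<lambda>w. \<Sum>i\<in>I. f i w) \<in> measurable M (count_space UNIV)"
 using assms by (induction I rule: infinite_finite_induct) (auto intro!: measurable_count_compose2[where h = "(+)"])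

context prob_space
begin

lemma distr_add_indep:
 fixes A B :: "'a => nat"
 assumes ind: "indep_var (count_space UNIV) A (count_space UNIV) B"
  and A: "distr M (count_space UNIV) A = measure_pmf P" and B: "distr M (count_space UNIV) B = measure_pmf Q"
 shows "distr M (count_space UNIV) (\<lambda>w. A w + B w) = measure_pmf (conv_pmf P Q)"
proof -
 note [measurable] = indep_var_rv1[OF ind] indep_var_rv2[OF ind]
 have AB: "(\<lambda>w. (A w, B w)) \<in> measurable M (count_space UNIV)"
  by (rule measurable_count_compose2[OF indep_var_rv1[OF ind] indep_var_rv2[OF ind]])
 have "distr M (count_space UNIV) (\<lambda>w. (A w, B w)) = measure_pmf (pair_pmf P Q)"
 proof (rule measure_eqI_countable[where A = UNIV])
  fix z :: "nat \<times> nat"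
  obtain a b where z: "z = (a, b)" by fastforce
  have "emeasure (distr M (count_space UNIV) (\<lambda>w. (A w, B w))) {z} =
    emeasure M ((\<lambda>x. (A x, B x)) -` ({a} \<times> {b}) \<inter> space M)"
   using AB by (subst emeasure_distr) (auto simp: z)
  also have "... = prob (A -` {a} \<inter> space M) * prob (B -` {b} \<inter> space M)"
   using indep_varD[OF ind, of "{a}" "{b}"] by (simp add: emeasure_eq_measure)
  also have "prob (A -` {a} \<inter> space M) = pmf P a"
   using arg_cong[OF A, of "\<lambda>N. measure N {a}"] by (simp add: measure_distr pmf.rep_eq)
  also have "prob (B -` {b} \<inter> space M) = pmf Q b"
   using arg_cong[OF B, of "\<lambda>N. measure N {b}"] by (simp add: measure_distr pmf.rep_eq)
  finally show "emeasure (distr M (count_space UNIV) (\<lambda>w. (A w, B w))) {z} = emeasure (measure_pmf (pair_pmf P Q)) {z}"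
   by (simp add: z emeasure_pmf_single pmf_pair)
 qed auto
 then have "distr (distr M (count_space UNIV) (\<lambda>w. (A w, B w))) (count_space UNIV) (\<lambda>(a, b). a + b) =
   distr (measure_pmf (pair_pmf P Q)) (count_space UNIV) (\<lambda>(a, b). a + b)" by simp
 then show ?thesis
  using AB by (subst (asm) distr_distr) (auto simp: conv_pmf_def map_pmf_rep_eq comp_def)
qed

lemma distr_sum_indep:
 fixes Z :: "'i => 'a => nat"
 assumes I: "finite I" and ind: "indep_vars (\<lambda>_. count_space UNIV) Z I"
  and law: "\<And>i. i \<in> I ==> distr M (count_space UNIV) (Z i) = measure_pmf (q i)"
 shows "distr M (count_space UNIV) (\<lambda>w. \<Sum>i\<in>I. Z i w) = measure_pmf (conv_prod q I)"
 using I ind law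
proof (induction I)
 case empty
 have "distr M (count_space UNIV) (\<lambda>w. 0) = return (count_space UNIV) (0::nat)"
  by (rule distr_const) simp
 then show ?case by (simp add: return_pmf.rep_eq)
next
 case (insert i I)
 have "indep_var (count_space UNIV) ((\<lambda>f. f i) \<circ> (\<lambda>w. restrict (\<lambda>j. Z j w) {i}))
   (count_space UNIV) ((\<lambda>f. \<Sum>j\<in>I. f j) \<circ> (\<lambda>w. restrict (\<lambda>j. Z j w) I))"
  using insert(1,2,4)
  by (intro indep_var_compose[OF indep_var_restrict[OF insert(4)]] measurable_nat_sum measurable_component_singleton) auto
 then have "indep_var (count_space UNIV) (Z i) (count_space UNIV) (\<lambda>w. \<Sum>j\<in>I. Z j w)"
  by (simp add: comp_def cong: sum.cong)
 moreover have "distr M (count_space UNIV) (\<lambda>w. \<Sum>j\<in>I. Z j w) = measure_pmf (conv_prod q I)"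
  using insert by (intro insert.IH indep_vars_subset[OF insert(4)]) auto
 ultimately show ?case
  using insert(1,2) insert(5)[of i] by (simp add: distr_add_indep)
qed

lemma distr_eq_pmf:
 fixes Z :: "'a => 'b::countable"
 assumes [measurable]: "Z \<in> measurable M (count_space UNIV)"
 shows "\<exists>P. distr M (count_space UNIV) Z = measure_pmf P"
proof -
 interpret D: prob_space "distr M (count_space UNIV) Z" by (rule prob_space_distr) simp
 have "AE x in distr M (count_space UNIV) Z. measure (distr M (count_space UNIV) Z) {x} \<noteq> 0"
  by (subst D.AE_support_countable) (simp_all add: exI[of _ UNIV])
 then have "measure_pmf (Abs_pmf (distr M (count_space UNIV) Z)) = distr M (count_space UNIV) Z"
  by (intro Abs_pmf_inverse) (auto simp: D.prob_space_axioms)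
 then show ?thesis by metis
qed

end

text \<open>The pairs \<open>(i, j)\<close> that index the thinning variables of one step: lag \<open>i\<close> contributes one Bernoulli
variable for each unit of the value at that lag. A state \<open>x\<close> holds the most recent value at index \<open>0\<close>, so lag
\<open>i\<close> is read at \<open>i - 1\<close>.\<close>

definition lag_units :: "nat => (nat => nat) => (nat \<times> nat) set" where
 "lag_units p x = (SIGMA i:{1..p}. {1..x (i - 1)})"

definition thin_law :: "nat => (nat => real) => (nat => nat) => nat pmf" where
 "thin_law p \<alpha> x = conv_prod (\<lambda>(i, j). map_pmf of_bool (bernoulli_pmf (\<alpha> i))) (lag_units p x)"

definition kernel :: "nat => (nat => real) => nat pmf => (nat => nat) => nat pmf" where
 "kernel p \<alpha> e x = conv_pmf e (thin_law p \<alpha> x)"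

lemma finite_lag_units [simp]: "finite (lag_units p x)"
 by (simp add: lag_units_def)

definition state_of :: "nat list => nat => nat" where
 "state_of h i = (if i < length h then h ! i else 0)"

context inar_process
begin

definition next_value :: "nat => (nat => nat) => (inar_source => nat) => nat" where
 "next_value k x f = (\<Sum>(i, j)\<in>lag_units p x. f (Thin i k j)) + f (Innov k)"

text \<open>All values up to time \<open>k\<close>, the most recent one first, including the initial ones. There are only countably
many histories, so conditioning on the past is conditioning on events of positive probability.\<close>

definition history :: "nat => 'a => nat list" where
 "history k w = map (\<lambda>i. X (int k - int i) w) [0..<k + p]"

lemma history_Suc: "history (Suc k) w = X (int (Suc k)) w # history k w"
proof -
 have "[0..<Suc (k + p)] = 0 # map Suc [0..<k + p]" by (simp add: map_Suc_upt upt_conv_Cons del: upt_Suc)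
 then show ?thesis by (simp add: history_def comp_def)
qed

lemma length_history [simp]: "length (history k w) = k + p" by (simp add: history_def)

lemma state_of_history: "state_of (history k w) i = (if i < k + p then X (int k - int i) w else 0)"
 by (simp add: state_of_def history_def)

lemma X_Suc:
 assumes "w \<in> space M"
 shows "X (int (Suc k)) w = next_value (Suc k) (state_of (history k w)) (\<lambda>s. inar_source_rv X \<xi> \<epsilon> s w)"
proof -
 have "state_of (history k w) (i - 1) = X (int (Suc k) - int i) w" if "i \<in> {1..p}" for i
  using that by (auto simp: state_of_history of_nat_diff algebra_simps)
 then have "(\<Sum>i=1..p. \<Sum>j=1..X (int (Suc k) - int i) w. \<xi> i (Suc k) j w) =
   (\<Sum>i=1..p. \<Sum>j=1..state_of (history k w) (i - 1). \<xi> i (Suc k) j w)"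
  by (intro sum.cong refl) simp
 also have "... = (\<Sum>(i, j)\<in>lag_units p (state_of (history k w)). \<xi> i (Suc k) j w)"
  by (simp add: lag_units_def sum.Sigma)
 finally show ?thesis
  using recursion[of "Suc k" w] assms by (simp add: next_value_def)
qed

lemma noise_measurable: "s \<in> inar_noise p ==> inar_source_rv X \<xi> \<epsilon> s \<in> measurable M (count_space UNIV)"
 using noise_indep unfolding indep_vars_def2 by blast

definition units_at :: "nat => (nat => nat) => inar_source set" where
 "units_at k x = insert (Innov k) ((\<lambda>(i, j). Thin i k j) ` lag_units p x)"

lemma units_at_noise: "1 <= k ==> units_at k x \<subseteq> inar_noise p"
 by (auto simp: units_at_def inar_noise_def lag_units_def)

lemma next_value_sum: "next_value k x f = (\<Sum>s\<in>units_at k x. f s)"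
proof -
 have "inj_on (\<lambda>(i, j). Thin i k j) (lag_units p x)" by (auto simp: inj_on_def)
 then have "(\<Sum>s\<in>(\<lambda>(i, j). Thin i k j) ` lag_units p x. f s) = (\<Sum>(i, j)\<in>lag_units p x. f (Thin i k j))"
  by (subst sum.reindex) (auto simp: case_prod_beta)
 moreover have "Innov k \<notin> (\<lambda>(i, j). Thin i k j) ` lag_units p x" by auto
 ultimately show ?thesis by (simp add: units_at_def next_value_def)
qed

definition innov_law :: "nat pmf" where
 "innov_law = (SOME P. distr M (count_space UNIV) (\<epsilon> 1) = measure_pmf P)"

lemma innov_law: "1 <= k ==> distr M (count_space UNIV) (\<epsilon> k) = measure_pmf innov_law"
proof -
 assume "1 <= k"
 have "\<epsilon> 1 \<in> measurable M (count_space UNIV)"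
  using noise_measurable[of "Innov 1"] by (simp add: inar_noise_def)
 then have "distr M (count_space UNIV) (\<epsilon> 1) = measure_pmf innov_law"
  unfolding innov_law_def by (intro someI_ex[of "\<lambda>P. distr M (count_space UNIV) (\<epsilon> 1) = measure_pmf P"] distr_eq_pmf)
 then show ?thesis using innovation_law[OF \<open>1 <= k\<close>] by simp
qed

lemma next_value_law:
 assumes k: "1 <= k"
 shows "distr M (count_space UNIV) (\<lambda>w. next_value k x (\<lambda>s. inar_source_rv X \<xi> \<epsilon> s w)) =
  measure_pmf (kernel p \<alpha> innov_law x)"
proof -
 define q where "q s = (case s of Thin i _ _ => map_pmf of_bool (bernoulli_pmf (\<alpha> i)) | _ => innov_law)" for s
 have "distr M (count_space UNIV) (\<lambda>w. \<Sum>s\<in>units_at k x. inar_source_rv X \<xi> \<epsilon> s w) =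
   measure_pmf (conv_prod q (units_at k x))"
 proof (rule distr_sum_indep)
  show "finite (units_at k x)" by (simp add: units_at_def)
  show "indep_vars (\<lambda>_. count_space UNIV) (inar_source_rv X \<xi> \<epsilon>) (units_at k x)"
   using noise_indep units_at_noise[OF k] by (rule indep_vars_subset)
  fix s assume s: "s \<in> units_at k x"
  then show "distr M (count_space UNIV) (inar_source_rv X \<xi> \<epsilon> s) = measure_pmf (q s)"
   using innov_law[OF k] thinning_law k
   by (auto simp: units_at_def q_def lag_units_def ext[of "inar_source_rv X \<xi> \<epsilon> (Innov k)" "\<epsilon> k"]
     ext[of "inar_source_rv X \<xi> \<epsilon> (Thin i k j)" "\<xi> i k j" for i j])
 qed
 moreover have "conv_prod q (units_at k x) = kernel p \<alpha> innov_law x"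
 proof -
  have inj: "inj_on (\<lambda>(i, j). Thin i k j) (lag_units p x)" by (auto simp: inj_on_def)
  have "q \<circ> (\<lambda>(i, j). Thin i k j) = (\<lambda>(i, j). map_pmf of_bool (bernoulli_pmf (\<alpha> i)))"
   by (auto simp: q_def fun_eq_iff)
  then have "conv_prod q ((\<lambda>(i, j). Thin i k j) ` lag_units p x) = thin_law p \<alpha> x"
   unfolding thin_law_def conv.reindex[OF inj] by simp
  moreover have "Innov k \<notin> (\<lambda>(i, j). Thin i k j) ` lag_units p x" by auto
  ultimately show ?thesis
   by (simp add: units_at_def kernel_def q_def[of "Innov k"] del: image_iff)
 qed
 ultimately show ?thesis by (simp add: next_value_sum)
qed

text \<open>The history up to time \<open>k\<close> equals \<open>h\<close> iff the initial values agree and the noise reproduces the recursion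
step by step along \<open>h\<close>. Along a fixed \<open>h\<close> the numbers of thinning variables in use are deterministic, so
this event involves only noise up to time \<open>k\<close>.\<close>

primrec noise_event :: "nat list => nat => (inar_source => nat) => bool" where
 "noise_event h 0 f \<longleftrightarrow> True"
| "noise_event h (Suc k) f \<longleftrightarrow> noise_event (tl h) k f \<and> next_value (Suc k) (state_of (tl h)) f = hd h"

lemma history_eq_iff:
 assumes "w \<in> space M"
 shows "length h = k + p ==> history k w = h \<longleftrightarrow>
  history 0 w = drop k h \<and> noise_event h k (\<lambda>s. inar_source_rv X \<xi> \<epsilon> s w)"
proof (induction k arbitrary: h)
 case (Suc k)
 then obtain y h' where h: "h = y # h'" "length h' = k + p" by (cases h) auto
 show ?case
  using Suc.IH[OF h(2)] X_Suc[OF assms, of k] by (auto simp: history_Suc h(1))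
qed simp

definition noise_upto :: "nat => inar_source set" where
 "noise_upto k = Innov ` {1..k} \<union> {Thin i l j |i l j. i \<in> {1..p} \<and> 1 <= l \<and> l <= k \<and> 1 <= j}"

lemma units_at_upto: "1 <= l ==> l <= k ==> units_at l x \<subseteq> noise_upto k"
 by (auto simp: units_at_def noise_upto_def lag_units_def)

lemma next_value_measurable:
 assumes "units_at k x \<subseteq> A"
 shows "next_value k x \<in> measurable (Pi\<^sub>M A (\<lambda>_. count_space UNIV)) (count_space UNIV)"
 unfolding next_value_sum[abs_def] using assms by (intro measurable_nat_sum measurable_component_singleton) auto

lemma noise_event_measurable:
 assumes "noise_upto k \<subseteq> A"
 shows "{f \<in> space (Pi\<^sub>M A (\<lambda>_. count_space UNIV)). noise_event h k f} \<in> sets (Pi\<^sub>M A (\<lambda>_. count_space UNIV))"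
 using assms
proof (induction k arbitrary: h)
 case (Suc k)
 let ?P = "Pi\<^sub>M A (\<lambda>_. count_space UNIV) :: (inar_source => nat) measure"
 have "noise_upto k \<subseteq> A" using Suc.prems by (auto simp: noise_upto_def)
 then have 1: "{f \<in> space ?P. noise_event (tl h) k f} \<in> sets ?P" by (rule Suc.IH)
 have "units_at (Suc k) (state_of (tl h)) \<subseteq> A"
  using units_at_upto[of "Suc k" "Suc k"] Suc.prems by auto
 from measurable_sets[OF next_value_measurable[OF this], of "{hd h}"]
 have "{f \<in> space ?P. next_value (Suc k) (state_of (tl h)) f = hd h} \<in> sets ?P"
  by (simp add: vimage_def Int_def conj_commute)
 from sets.Int[OF 1 this] show ?case by (simp add: Int_def conj_ac)
qed simp

lemma noise_event_cong:
 assumes "\<And>s. s \<in> noise_upto k ==> f s = g s"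
 shows "noise_event h k f \<longleftrightarrow> noise_event h k g"
 using assms
proof (induction k arbitrary: h)
 case (Suc k)
 have "noise_event (tl h) k f \<longleftrightarrow> noise_event (tl h) k g"
  using Suc.prems by (intro Suc.IH) (auto simp: noise_upto_def)
 moreover have "next_value (Suc k) (state_of (tl h)) f = next_value (Suc k) (state_of (tl h)) g"
  unfolding next_value_sum using units_at_upto[of "Suc k" "Suc k"] Suc.prems by (intro sum.cong) auto
 ultimately show ?case by simp
qed simp

text \<open>The initial values are independent of all noise, and the noise up to time \<open>k\<close> is independent of the
noise of the next step; hence the probability factorises.\<close>

lemma prob_history_step:
 assumes len: "length h = k + p"
 shows "{w \<in> space M. history k w = h} \<in> events"
  "prob {w \<in> space M. history (Suc k) w = y # h} =
   prob {w \<in> space M. history k w = h} * pmf (kernel p \<alpha> innov_law (state_of h)) y"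
proof -
 let ?s = "\<lambda>w s. inar_source_rv X \<xi> \<epsilon> s w"
 let ?P = "\<lambda>A. Pi\<^sub>M A (\<lambda>_. count_space UNIV) :: (inar_source => nat) measure"
 have hist0: "history 0 w = map (\<lambda>i. restrict (?s w) (inar_init p) (Init (- int i))) [0..<p]" for w
  by (auto simp: history_def inar_init_def)
 define A where "A = {f \<in> space (?P (inar_init p)). map (\<lambda>i. f (Init (- int i))) [0..<p] = drop k h}"
 have A: "A \<in> sets (?P (inar_init p))"
 proof -
  have "(\<lambda>f. map (\<lambda>i. f (Init (- int i))) L) \<in> measurable (?P (inar_init p)) (count_space UNIV)" if "set L \<subseteq> {..<p}" for L
   using that
  proof (induction L)
   case (Cons a L)
   then have "Init (- int a) \<in> inar_init p" by (auto simp: inar_init_def)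
   then have "(\<lambda>f. f (Init (- int a))) \<in> measurable (?P (inar_init p)) (count_space UNIV)"
    by (rule measurable_component_singleton)
   with Cons show ?case by (auto intro!: measurable_count_compose2[where h = "(#)"])
  qed simp
  from measurable_sets[OF this[of "[0..<p]"], of "{drop k h}"] show ?thesis
   by (simp add: A_def vimage_def Int_def conj_commute atLeast0LessThan)
 qed
 have A_iff: "restrict (?s w) (inar_init p) \<in> A \<longleftrightarrow> history 0 w = drop k h" for w
  by (auto simp: A_def hist0 space_PiM)
 let ?R = "\<lambda>S w. restrict (?s w) S"
 have upto: "noise_upto k \<subseteq> inar_noise p" by (auto simp: noise_upto_def inar_noise_def)
 have ev_restrict: "noise_event h k (?R S w) \<longleftrightarrow> noise_event h k (?s w)" if "noise_upto k \<subseteq> S" for S w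
  using that by (intro noise_event_cong) auto
 have nv_restrict: "next_value (Suc k) (state_of h) (?R S w) = next_value (Suc k) (state_of h) (?s w)"
  if "units_at (Suc k) (state_of h) \<subseteq> S" for S w
  unfolding next_value_sum using that by (intro sum.cong) auto
 define B where "B S = {f \<in> space (?P S). noise_event h k f}" for S
 define C where "C S = {f \<in> space (?P S). next_value (Suc k) (state_of h) f = y}" for S
 have B: "B S \<in> sets (?P S)" if "noise_upto k \<subseteq> S" for S
  unfolding B_def by (rule noise_event_measurable[OF that])
 have C: "C S \<in> sets (?P S)" if "units_at (Suc k) (state_of h) \<subseteq> S" for S
  using measurable_sets[OF next_value_measurable[OF that], of "{y}"]
  by (simp add: C_def vimage_def Int_def conj_commute)
 have B_iff: "?R S w \<in> B S \<longleftrightarrow> noise_event h k (?s w)" if "noise_upto k \<subseteq> S" for S w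
  using ev_restrict[OF that] by (simp add: B_def space_PiM)
 have C_iff: "?R S w \<in> C S \<longleftrightarrow> next_value (Suc k) (state_of h) (?s w) = y" if "units_at (Suc k) (state_of h) \<subseteq> S" for S w
  using nv_restrict[OF that] by (simp add: C_def space_PiM)
 have un: "units_at (Suc k) (state_of h) \<subseteq> inar_noise p" by (rule units_at_noise) simp
 define U where "U = units_at (Suc k) (state_of h)"
 have H: "prob {w \<in> space M. history 0 w = drop k h \<and> Q w} = prob {w \<in> space M. history 0 w = drop k h} * prob {w \<in> space M. Q w}"
  "{w \<in> space M. history 0 w = drop k h \<and> Q w} \<in> events"
  if D: "D \<in> sets (?P (inar_noise p))" "\<And>w. ?R (inar_noise p) w \<in> D \<longleftrightarrow> Q w" for D Q
 proof -
  have "prob ((\<lambda>w. (?R (inar_init p) w, ?R (inar_noise p) w)) -` (A \<times> D) \<inter> space M) =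
    prob (?R (inar_init p) -` A \<inter> space M) * prob (?R (inar_noise p) -` D \<inter> space M)"
   by (rule indep_varD[OF init_indep_noise A D(1)])
  then show "prob {w \<in> space M. history 0 w = drop k h \<and> Q w} = prob {w \<in> space M. history 0 w = drop k h} * prob {w \<in> space M. Q w}"
   by (simp add: vimage_def A_iff D(2) Int_def conj_commute)
  have "?R (inar_init p) -` A \<inter> space M \<in> events" "?R (inar_noise p) -` D \<inter> space M \<in> events"
   using measurable_sets[OF indep_var_rv1[OF init_indep_noise] A] measurable_sets[OF indep_var_rv2[OF init_indep_noise] D(1)] by auto
  from sets.Int[OF this] show "{w \<in> space M. history 0 w = drop k h \<and> Q w} \<in> events"
   by (simp add: vimage_def A_iff D(2) Int_def conj_ac)
 qed
 have h_iff: "{w \<in> space M. history k w = h} = {w \<in> space M. history 0 w = drop k h \<and> noise_event h k (?s w)}"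
  using history_eq_iff[OF _ len] by auto
 have yh_iff: "{w \<in> space M. history (Suc k) w = y # h} =
   {w \<in> space M. history 0 w = drop k h \<and> noise_event h k (?s w) \<and> next_value (Suc k) (state_of h) (?s w) = y}"
  using history_eq_iff[of _ "y # h" "Suc k"] len by auto
 note HB = H[OF B[OF upto] B_iff[OF upto]]
 show "{w \<in> space M. history k w = h} \<in> events" unfolding h_iff by (rule HB(2))
 have BC: "B (inar_noise p) \<inter> C (inar_noise p) \<in> sets (?P (inar_noise p))" using B[OF upto] C[OF un] by blast
 have BC_iff: "?R (inar_noise p) w \<in> B (inar_noise p) \<inter> C (inar_noise p) \<longleftrightarrow>
   noise_event h k (?s w) \<and> next_value (Suc k) (state_of h) (?s w) = y" for w
  using B_iff[OF upto] C_iff[OF un] by simp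
 have "prob {w \<in> space M. noise_event h k (?s w) \<and> next_value (Suc k) (state_of h) (?s w) = y} =
   prob {w \<in> space M. noise_event h k (?s w)} * prob {w \<in> space M. next_value (Suc k) (state_of h) (?s w) = y}"
 proof -
  have "indep_var (?P (noise_upto k)) (?R (noise_upto k)) (?P U) (?R U)"
   using noise_indep un upto
   by (intro indep_var_restrict[where M' = "\<lambda>_. count_space UNIV"]) (auto simp: U_def units_at_def noise_upto_def)
  from indep_varD[OF this B[OF order_refl] C[of U]] show ?thesis
   by (simp add: U_def vimage_def B_iff[OF order_refl] C_iff[OF order_refl] Int_def conj_ac)
 qed
 moreover have "prob {w \<in> space M. next_value (Suc k) (state_of h) (?s w) = y} = pmf (kernel p \<alpha> innov_law (state_of h)) y"
 proof -
  have "(\<lambda>w. next_value (Suc k) (state_of h) (?s w)) \<in> measurable M (count_space UNIV)"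
   unfolding next_value_sum using un by (intro measurable_nat_sum noise_measurable) auto
  then show ?thesis
   using arg_cong[OF next_value_law[of "Suc k" "state_of h"], of "\<lambda>N. measure N {y}"]
   by (simp add: measure_distr pmf.rep_eq vimage_def Int_def conj_commute)
 qed
 ultimately show "prob {w \<in> space M. history (Suc k) w = y # h} =
   prob {w \<in> space M. history k w = h} * pmf (kernel p \<alpha> innov_law (state_of h)) y"
  unfolding yh_iff h_iff using H(1)[OF BC BC_iff] HB(1) by simp
qed

end

section \<open>The Markov property and adapted random variables\<close>

lemma integral_bind_pmf_nonneg:
 fixes f :: "'b => real"
 assumes f: "integrable (measure_pmf (bind_pmf P q)) f" and nn: "\<And>y. 0 <= f y"
 shows "AE x in measure_pmf P. integrable (measure_pmf (q x)) f"
  "integrable (measure_pmf P) (\<lambda>x. \<integral>y. f y \<partial>measure_pmf (q x))"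
  "(\<integral>y. f y \<partial>measure_pmf (bind_pmf P q)) = (\<integral>x. \<integral>y. f y \<partial>measure_pmf (q x) \<partial>measure_pmf P)"
proof -
 have "(\<integral>\<^sup>+x. \<integral>\<^sup>+y. ennreal (f y) \<partial>measure_pmf (q x) \<partial>measure_pmf P) = (\<integral>\<^sup>+y. ennreal (f y) \<partial>measure_pmf (bind_pmf P q))"
  by simp
 also have eq: "... = ennreal (\<integral>y. f y \<partial>measure_pmf (bind_pmf P q))"
  using f nn by (intro nn_integral_eq_integral) auto
 finally have fin: "(\<integral>\<^sup>+x. \<integral>\<^sup>+y. ennreal (f y) \<partial>measure_pmf (q x) \<partial>measure_pmf P) = ennreal (\<integral>y. f y \<partial>measure_pmf (bind_pmf P q))" .
 then have "AE x in measure_pmf P. (\<integral>\<^sup>+y. ennreal (f y) \<partial>measure_pmf (q x)) \<noteq> \<infinity>"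
  by (intro nn_integral_PInf_AE) auto
 then show ae: "AE x in measure_pmf P. integrable (measure_pmf (q x)) f"
  by eventually_elim (auto intro!: integrableI_nonneg simp: nn less_top)
 have ae_eq: "AE x in measure_pmf P. (\<integral>\<^sup>+y. ennreal (f y) \<partial>measure_pmf (q x)) = ennreal (\<integral>y. f y \<partial>measure_pmf (q x))"
  using ae by eventually_elim (auto intro!: nn_integral_eq_integral simp: nn)
 have nn2: "(\<integral>\<^sup>+x. ennreal (\<integral>y. f y \<partial>measure_pmf (q x)) \<partial>measure_pmf P) = ennreal (\<integral>y. f y \<partial>measure_pmf (bind_pmf P q))"
  using nn_integral_cong_AE[OF ae_eq] fin by simp
 then show int: "integrable (measure_pmf P) (\<lambda>x. \<integral>y. f y \<partial>measure_pmf (q x))"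
  by (intro integrableI_nonneg) (auto simp: nn intro!: AE_I2 bochner_integral_nonneg)
 have "ennreal (\<integral>x. \<integral>y. f y \<partial>measure_pmf (q x) \<partial>measure_pmf P) = ennreal (\<integral>y. f y \<partial>measure_pmf (bind_pmf P q))"
  using nn_integral_eq_integral[OF int] nn2 nn by (simp add: bochner_integral_nonneg)
 then show "(\<integral>y. f y \<partial>measure_pmf (bind_pmf P q)) = (\<integral>x. \<integral>y. f y \<partial>measure_pmf (q x) \<partial>measure_pmf P)"
  using nn by (simp add: bochner_integral_nonneg)
qed

text \<open>The tower property for discrete laws.\<close>

lemma integral_bind_pmf:
 fixes f :: "'b => real"
 assumes f: "integrable (measure_pmf (bind_pmf P q)) f"
 shows "AE x in measure_pmf P. integrable (measure_pmf (q x)) f"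
  "integrable (measure_pmf P) (\<lambda>x. \<integral>y. f y \<partial>measure_pmf (q x))"
  "(\<integral>y. f y \<partial>measure_pmf (bind_pmf P q)) = (\<integral>x. \<integral>y. f y \<partial>measure_pmf (q x) \<partial>measure_pmf P)"
proof -
 define g h where "g y = max (f y) 0" and "h y = max (- f y) 0" for y
 have fgh: "f = (\<lambda>y. g y - h y)" by (auto simp: g_def h_def fun_eq_iff)
 have ig: "integrable (measure_pmf (bind_pmf P q)) g" and ih: "integrable (measure_pmf (bind_pmf P q)) h"
  unfolding g_def h_def using f by (auto intro!: bochner_integrable_max)
 have nn: "0 <= g y" "0 <= h y" for y by (auto simp: g_def h_def)
 note G = integral_bind_pmf_nonneg[OF ig nn(1)] and H = integral_bind_pmf_nonneg[OF ih nn(2)]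
 show "AE x in measure_pmf P. integrable (measure_pmf (q x)) f"
  unfolding fgh using G(1) H(1) by eventually_elim auto
 have ae: "AE x in measure_pmf P. (\<integral>y. g y \<partial>measure_pmf (q x)) - (\<integral>y. h y \<partial>measure_pmf (q x)) = (\<integral>y. f y \<partial>measure_pmf (q x))"
  unfolding fgh using G(1) H(1) by eventually_elim auto
 show "integrable (measure_pmf P) (\<lambda>x. \<integral>y. f y \<partial>measure_pmf (q x))"
  using bochner_integrable_diff[OF G(2) H(2)] by (rule integrable_cong_AE_imp) (use ae in \<open>auto elim: eventually_mono\<close>)
 have "(\<integral>y. f y \<partial>measure_pmf (bind_pmf P q)) = (\<integral>y. g y \<partial>measure_pmf (bind_pmf P q)) - (\<integral>y. h y \<partial>measure_pmf (bind_pmf P q))"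
  unfolding fgh using ig ih by (rule bochner_integral_diff)
 also have "... = (\<integral>x. (\<integral>y. g y \<partial>measure_pmf (q x)) - (\<integral>y. h y \<partial>measure_pmf (q x)) \<partial>measure_pmf P)"
  using G(2,3) H(2,3) by simp
 also have "... = (\<integral>x. \<integral>y. f y \<partial>measure_pmf (q x) \<partial>measure_pmf P)"
  by (rule integral_cong_AE) (use ae in auto)
 finally show "(\<integral>y. f y \<partial>measure_pmf (bind_pmf P q)) = (\<integral>x. \<integral>y. f y \<partial>measure_pmf (q x) \<partial>measure_pmf P)" .
qed

lemma state_of_Cons: "state_of (y # h) = case_nat y (state_of h)"
 by (auto simp: state_of_def fun_eq_iff split: nat.split)

context inar_process
begin

abbreviation K :: "(nat => nat) => nat pmf" where
 "K \<equiv> kernel p \<alpha> innov_law"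

definition state :: "nat => 'a => nat => nat" where
 "state k w = state_of (history k w)"

lemma state_lag: "1 <= k ==> i \<in> {1..p} ==> state (k - 1) w (i - 1) = X (int k - int i) w"
 by (auto simp: state_def state_of_history of_nat_diff algebra_simps)

lemma history_measurable: "history k \<in> measurable M (count_space UNIV)"
proof (subst measurable_count_space_eq2_countable; safe)
 fix h
 have "history k -` {h} \<inter> space M = {w \<in> space M. history k w = h}" by auto
 moreover have "{w \<in> space M. history k w = h} \<in> events"
 proof (cases "length h = k + p")
  case True
  then show ?thesis by (rule prob_history_step)
 next
  case False
  then have "{w \<in> space M. history k w = h} = {}" by auto
  then show ?thesis by (metis sets.empty_sets)
 qed
 ultimately show "history k -` {h} \<inter> space M \<in> events" by simp
qed auto

definition history_law :: "nat => nat list pmf" where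
 "history_law k = (SOME P. distr M (count_space UNIV) (history k) = measure_pmf P)"

lemma history_law: "distr M (count_space UNIV) (history k) = measure_pmf (history_law k)"
 unfolding history_law_def
 by (rule someI_ex[of "\<lambda>P. distr M (count_space UNIV) (history k) = measure_pmf P"], rule distr_eq_pmf, rule history_measurable)

lemma pmf_history_law: "pmf (history_law k) h = prob {w \<in> space M. history k w = h}"
 using arg_cong[OF history_law[of k], of "\<lambda>N. measure N {h}"] history_measurable[of k]
 by (simp add: measure_distr pmf.rep_eq vimage_def Int_def conj_commute)

lemma history_law_Suc:
 "history_law (Suc k) = bind_pmf (history_law k) (\<lambda>h. map_pmf (\<lambda>y. y # h) (K (state_of h)))"
proof (rule pmf_eqI)
 fix z
 show "pmf (history_law (Suc k)) z = pmf (bind_pmf (history_law k) (\<lambda>h. map_pmf (\<lambda>y. y # h) (K (state_of h)))) z"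
 proof (cases z)
  case Nil
  have "{w \<in> space M. history (Suc k) w = []} = {}" by (auto simp: history_Suc)
  then have "pmf (history_law (Suc k)) [] = 0" by (simp only: pmf_history_law measure_empty)
  moreover have "pmf (bind_pmf (history_law k) (\<lambda>h. map_pmf (\<lambda>y. y # h) (K (state_of h)))) [] = 0"
   by (auto simp: pmf_eq_0_set_pmf)
  ultimately show ?thesis using Nil by simp
 next
  case (Cons y h)
  have "ennreal (pmf (bind_pmf (history_law k) (\<lambda>h. map_pmf (\<lambda>y. y # h) (K (state_of h)))) z) =
    (\<integral>\<^sup>+h'. ennreal (pmf (map_pmf (\<lambda>y. y # h') (K (state_of h'))) z) \<partial>measure_pmf (history_law k))"
   by (rule ennreal_pmf_bind)
  also have "... = (\<integral>\<^sup>+h'. ennreal (pmf (K (state_of h)) y) * indicator {h} h' \<partial>measure_pmf (history_law k))"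
  proof (intro nn_integral_cong)
   fix h'
   have "pmf (map_pmf (\<lambda>y. y # h) (K (state_of h))) (y # h) = pmf (K (state_of h)) y"
    by (rule pmf_map_inj') (auto simp: inj_def)
   moreover have "pmf (map_pmf (\<lambda>y. y # h') (K (state_of h'))) (y # h) = 0" if "h' \<noteq> h"
    using that by (auto simp: pmf_eq_0_set_pmf)
   ultimately show "ennreal (pmf (map_pmf (\<lambda>y. y # h') (K (state_of h'))) z) = ennreal (pmf (K (state_of h)) y) * indicator {h} h'"
    using Cons by (cases "h' = h") auto
  qed
  also have "... = ennreal (pmf (K (state_of h)) y * pmf (history_law k) h)"
   by (simp add: nn_integral_cmult emeasure_pmf_single ennreal_mult)
  finally have rhs: "pmf (bind_pmf (history_law k) (\<lambda>h. map_pmf (\<lambda>y. y # h) (K (state_of h)))) z = pmf (K (state_of h)) y * pmf (history_law k) h"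
   by simp
  show ?thesis
  proof (cases "length h = k + p")
   case True
   then show ?thesis unfolding rhs using prob_history_step(2)[OF True, of y] Cons by (simp add: pmf_history_law)
  next
   case False
   then have "{w \<in> space M. history (Suc k) w = y # h} = {}" "{w \<in> space M. history k w = h} = {}"
    by (auto simp: history_Suc)
   then show ?thesis unfolding rhs by (simp only: Cons pmf_history_law measure_empty mult_zero_right)
  qed
 qed
qed

lemma one_step_nn:
 "(\<integral>\<^sup>+w. G (history k w) (X (int (Suc k)) w) \<partial>M) =
  (\<integral>\<^sup>+w. \<integral>\<^sup>+y. G (history k w) y \<partial>measure_pmf (K (state k w)) \<partial>M)"
proof -
 have "(\<integral>\<^sup>+w. G (history k w) (X (int (Suc k)) w) \<partial>M) = (\<integral>\<^sup>+w. (\<lambda>z. G (tl z) (hd z)) (history (Suc k) w) \<partial>M)"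
  by (simp add: history_Suc)
 also have "... = (\<integral>\<^sup>+z. G (tl z) (hd z) \<partial>distr M (count_space UNIV) (history (Suc k)))"
  by (rule nn_integral_distr[symmetric]) (auto intro: history_measurable)
 also have "... = (\<integral>\<^sup>+h. \<integral>\<^sup>+y. G h y \<partial>measure_pmf (K (state_of h)) \<partial>measure_pmf (history_law k))"
  by (simp add: history_law history_law_Suc)
 also have "... = (\<integral>\<^sup>+h. \<integral>\<^sup>+y. G h y \<partial>measure_pmf (K (state_of h)) \<partial>distr M (count_space UNIV) (history k))"
  by (simp add: history_law)
 also have "... = (\<integral>\<^sup>+w. \<integral>\<^sup>+y. G (history k w) y \<partial>measure_pmf (K (state k w)) \<partial>M)"
  by (subst nn_integral_distr) (auto simp: state_def intro: history_measurable)
 finally show ?thesis .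
qed

text \<open>Conditioning on the past: given the history, the next value has law \<open>K\<close>.\<close>

lemma one_step:
 fixes G :: "nat list => nat => real"
 assumes "integrable M (\<lambda>w. G (history k w) (X (int (Suc k)) w))"
 shows "integrable M (\<lambda>w. \<integral>y. G (history k w) y \<partial>measure_pmf (K (state k w)))"
  "(\<integral>w. G (history k w) (X (int (Suc k)) w) \<partial>M) = (\<integral>w. \<integral>y. G (history k w) y \<partial>measure_pmf (K (state k w)) \<partial>M)"
proof -
 define g where "g z = G (tl z) (hd z)" for z
 have gz: "G (history k w) (X (int (Suc k)) w) = g (history (Suc k) w)" for w
  by (simp add: g_def history_Suc)
 have "integrable (distr M (count_space UNIV) (history (Suc k))) g"
  using assms unfolding gz by (subst integrable_distr_eq) (auto intro: history_measurable)
 then have i: "integrable (measure_pmf (bind_pmf (history_law k) (\<lambda>h. map_pmf (\<lambda>y. y # h) (K (state_of h))))) g"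
  by (simp add: history_law history_law_Suc)
 have inner: "(\<integral>z. g z \<partial>measure_pmf (map_pmf (\<lambda>y. y # h) (K (state_of h)))) = (\<integral>y. G h y \<partial>measure_pmf (K (state_of h)))" for h
  by (simp add: g_def)
 have "integrable (distr M (count_space UNIV) (history k)) (\<lambda>h. \<integral>y. G h y \<partial>measure_pmf (K (state_of h)))"
  unfolding history_law using integral_bind_pmf(2)[OF i] unfolding inner .
 then show "integrable M (\<lambda>w. \<integral>y. G (history k w) y \<partial>measure_pmf (K (state k w)))"
  by (subst (asm) integrable_distr_eq) (auto simp: state_def intro: history_measurable)
 have "(\<integral>w. G (history k w) (X (int (Suc k)) w) \<partial>M) = (\<integral>z. g z \<partial>distr M (count_space UNIV) (history (Suc k)))"
  unfolding gz by (subst integral_distr) (auto intro: history_measurable)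
 also have "... = (\<integral>h. \<integral>y. G h y \<partial>measure_pmf (K (state_of h)) \<partial>distr M (count_space UNIV) (history k))"
  unfolding history_law history_law_Suc using integral_bind_pmf(3)[OF i] unfolding inner .
 also have "... = (\<integral>w. \<integral>y. G (history k w) y \<partial>measure_pmf (K (state k w)) \<partial>M)"
  by (subst integral_distr) (auto simp: state_def intro: history_measurable)
 finally show "(\<integral>w. G (history k w) (X (int (Suc k)) w) \<partial>M) = (\<integral>w. \<integral>y. G (history k w) y \<partial>measure_pmf (K (state k w)) \<partial>M)" .
qed

text \<open>A factorisation through the history instead of a sigma-algebra: the histories form a countable set, so
every such function is measurable, and the factorisation can be used directly in \<open>one_step\<close>.\<close>

definition adapted :: "nat => ('a => 'b) => bool" where
 "adapted k f \<longleftrightarrow> (\<exists>\<phi>. \<forall>w\<in>space M. f w = \<phi> (history k w))"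

lemma adaptedI: "(\<And>w. w \<in> space M ==> f w = \<phi> (history k w)) ==> adapted k f"
 unfolding adapted_def by blast

lemma adaptedE:
 assumes "adapted k f" obtains \<phi> where "\<And>w. w \<in> space M ==> f w = \<phi> (history k w)"
 using assms unfolding adapted_def by blast

lemma adapted_measurable:
 assumes "adapted k f" "f \<in> space M \<rightarrow> space N"
 shows "f \<in> measurable M N"
proof -
 obtain \<phi> where \<phi>: "\<And>w. w \<in> space M ==> f w = \<phi> (history k w)" using assms(1) by (rule adaptedE) blast
 show ?thesis
 proof (rule measurableI)
  fix A assume "A \<in> sets N"
  have "f -` A \<inter> space M = history k -` (\<phi> -` A) \<inter> space M" using \<phi> by auto
  also have "... \<in> sets M" by (rule measurable_sets[OF history_measurable]) simp
  finally show "f -` A \<inter> space M \<in> sets M" .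
 qed (use assms(2) in auto)
qed

lemma adapted_borel: "adapted k f ==> f \<in> borel_measurable M"
 by (rule adapted_measurable) auto

lemma adapted_const [intro, simp]: "adapted k (\<lambda>_. c)"
 by (rule adaptedI[where \<phi> = "\<lambda>_. c"]) simp

lemma adapted_comp: "adapted k f ==> adapted k (\<lambda>w. h (f w))"
 by (erule adaptedE) (rule adaptedI, simp)

lemma adapted_comp2:
 assumes "adapted k f" "adapted k g" shows "adapted k (\<lambda>w. h (f w) (g w))"
proof -
 obtain \<phi> \<psi> where "\<And>w. w \<in> space M ==> f w = \<phi> (history k w)" "\<And>w. w \<in> space M ==> g w = \<psi> (history k w)"
  using assms unfolding adapted_def by blast
 then show ?thesis by (intro adaptedI[where \<phi> = "\<lambda>z. h (\<phi> z) (\<psi> z)"]) simp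
qed

lemma adapted_fun:
 assumes "\<And>i. adapted k (f i)" shows "adapted k (\<lambda>w i. f i w)"
proof -
 have "\<forall>i. \<exists>\<phi>. \<forall>w\<in>space M. f i w = \<phi> (history k w)" using assms unfolding adapted_def by blast
 then obtain \<phi> where "\<And>i w. w \<in> space M ==> f i w = \<phi> i (history k w)" by metis
 then show ?thesis by (intro adaptedI[where \<phi> = "\<lambda>z i. \<phi> i z"]) auto
qed

lemma adapted_sum:
 fixes f :: "'i => 'a => 'b::comm_monoid_add"
 assumes "\<And>i. i \<in> I ==> adapted k (f i)"
 shows "adapted k (\<lambda>w. \<Sum>i\<in>I. f i w)"
 using assms by (induction I rule: infinite_finite_induct) (auto intro: adapted_comp2[where h = "(+)"])

lemma adapted_mono:
 assumes "adapted k f" "k <= l" shows "adapted l f"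
proof -
 have drop: "history k w = drop (l - k) (history l w)" for w
  using \<open>k <= l\<close>
 proof (induction rule: dec_induct)
  case (step n)
  then show ?case by (simp add: history_Suc Suc_diff_le)
 qed simp
 from assms(1) show ?thesis by (rule adaptedE) (rule adaptedI[where \<phi> = "\<lambda>z. _ (drop (l - k) z)"], simp add: drop[symmetric])
qed

lemma adapted_history: "adapted k (history k)"
 by (rule adaptedI[where \<phi> = "\<lambda>z. z"]) simp

lemma adapted_state: "adapted k (state k)"
 unfolding state_def[abs_def] by (rule adapted_comp[OF adapted_history])

lemma adapted_X:
 assumes "- int p < j" "j <= int k" shows "adapted k (X j)"
proof (rule adaptedI)
 fix w
 have "nat (int k - j) < k + p" "int k - int (nat (int k - j)) = j" using assms by auto
 then show "X j w = history k w ! nat (int k - j)" by (simp add: history_def)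
qed

end

section \<open>Conditional moments of the next value\<close>

lemma abs_power_le_one_plus:
 fixes x :: real assumes "a <= b" shows "\<bar>x\<bar> ^ a <= 1 + \<bar>x\<bar> ^ b"
proof (cases "\<bar>x\<bar> <= 1")
 case True
 then have "\<bar>x\<bar> ^ a <= 1" by (simp add: power_le_one)
 then show ?thesis using zero_le_power[of "\<bar>x\<bar>" b] by linarith
next
 case False
 then have "\<bar>x\<bar> ^ a <= \<bar>x\<bar> ^ b" using assms by (intro power_increasing) auto
 then show ?thesis by simp
qed

lemma sum_power6_le:
 fixes a :: "'i => real"
 assumes "finite I" "\<And>i. i \<in> I ==> 0 <= a i"
 shows "(\<Sum>i\<in>I. a i) ^ 6 <= real (card I) ^ 6 * (\<Sum>i\<in>I. a i ^ 6)"
proof (cases "I = {}")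
 case False
 define m where "m = Max (a ` I)"
 have m: "a i <= m" if "i \<in> I" for i using assms(1) that by (simp add: m_def)
 have "m \<in> a ` I" using assms(1) False unfolding m_def by (intro Max_in) auto
 then obtain k where k: "k \<in> I" "m = a k" by auto
 have "(\<Sum>i\<in>I. a i) <= real (card I) * m" using m by (rule sum_bounded_above)
 then have "(\<Sum>i\<in>I. a i) ^ 6 <= (real (card I) * m) ^ 6"
  using assms by (intro power_mono sum_nonneg) auto
 also have "... = real (card I) ^ 6 * a k ^ 6" using k by (simp add: power_mult_distrib)
 also have "a k ^ 6 <= (\<Sum>i\<in>I. a i ^ 6)" using assms k by (intro member_le_sum) auto
 finally show ?thesis by (simp add: mult_left_mono)
qed simp

context prob_space
begin

lemma integrable_lower_power:
 fixes f :: "'a => real"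
 assumes "integrable M (\<lambda>w. \<bar>f w\<bar> ^ b)" "f \<in> borel_measurable M" "a <= b"
 shows "integrable M (\<lambda>w. f w ^ a)"
proof (rule bochner_integrable_bound[where f = "\<lambda>w. 1 + \<bar>f w\<bar> ^ b"])
 show "AE w in M. norm (f w ^ a) <= norm (1 + \<bar>f w\<bar> ^ b)"
  using abs_power_le_one_plus[OF assms(3)] by (intro AE_I2) (simp add: power_abs)
qed (use assms in auto)

lemma indep_power_expectation:
 fixes Z S :: "'a => real"
 assumes ind: "indep_var borel Z borel S"
  and "integrable M (\<lambda>w. Z w ^ a)" "integrable M (\<lambda>w. S w ^ b)"
 shows "integrable M (\<lambda>w. Z w ^ a * S w ^ b)"
  "\<E> (\<lambda>w. Z w ^ a * S w ^ b) = \<E> (\<lambda>w. Z w ^ a) * \<E> (\<lambda>w. S w ^ b)"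
proof -
 have "indep_var borel ((\<lambda>x. x ^ a) \<circ> Z) borel ((\<lambda>x. x ^ b) \<circ> S)"
  by (rule indep_var_compose[OF ind]) auto
 then have ind: "indep_var borel (\<lambda>w. Z w ^ a) borel (\<lambda>w. S w ^ b)" by (simp add: comp_def)
 show "integrable M (\<lambda>w. Z w ^ a * S w ^ b)"
  "\<E> (\<lambda>w. Z w ^ a * S w ^ b) = \<E> (\<lambda>w. Z w ^ a) * \<E> (\<lambda>w. S w ^ b)"
  using indep_var_integrable[OF ind assms(2,3)] indep_var_lebesgue_integral[OF ind assms(2,3)] by auto
qed

text \<open>In the fourth moment of a sum of independent centred variables all mixed terms with a
single factor vanish, so it grows only quadratically in the number of summands.\<close>

lemma indep_sum_moments:
 fixes \<zeta> :: "'i => 'a => real"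
 assumes I: "finite I" and ind: "indep_vars (\<lambda>_. borel) \<zeta> I"
  and int: "\<And>i. i \<in> I ==> integrable M (\<lambda>w. \<bar>\<zeta> i w\<bar> ^ 4)"
  and mean: "\<And>i. i \<in> I ==> \<E> (\<zeta> i) = 0"
  and c: "\<And>i. i \<in> I ==> \<E> (\<lambda>w. \<zeta> i w ^ 4) <= c" "1 <= c"
 shows "integrable M (\<lambda>w. \<bar>\<Sum>i\<in>I. \<zeta> i w\<bar> ^ 4) \<and> \<E> (\<lambda>w. \<Sum>i\<in>I. \<zeta> i w) = 0 \<and>
  \<E> (\<lambda>w. (\<Sum>i\<in>I. \<zeta> i w)\<^sup>2) = (\<Sum>i\<in>I. \<E> (\<lambda>w. (\<zeta> i w)\<^sup>2)) \<and>
  \<E> (\<lambda>w. (\<Sum>i\<in>I. \<zeta> i w)\<^sup>2) <= c * card I \<and>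
  \<E> (\<lambda>w. (\<Sum>i\<in>I. \<zeta> i w) ^ 4) <= 3 * c\<^sup>2 * (real (card I))\<^sup>2"
 using I ind int mean c(1)
proof (induction I)
 case (insert i I)
 define Z where "Z = \<zeta> i"
 define S where "S = (\<lambda>w. \<Sum>j\<in>I. \<zeta> j w)"
 define n where "n = real (card I)"
 have ZS: "indep_var borel Z borel S"
  unfolding Z_def S_def using insert.hyps insert.prems(1) by (rule indep_vars_sum)
 have [measurable]: "Z \<in> borel_measurable M" "S \<in> borel_measurable M"
  using indep_var_rv1[OF ZS] indep_var_rv2[OF ZS] by auto
 have sub: "indep_vars (\<lambda>_. borel) \<zeta> I" by (rule indep_vars_subset[OF insert.prems(1)]) auto
 have IH: "integrable M (\<lambda>w. \<bar>S w\<bar> ^ 4)" "\<E> S = 0"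
  "\<E> (\<lambda>w. (S w)\<^sup>2) = (\<Sum>i\<in>I. \<E> (\<lambda>w. (\<zeta> i w)\<^sup>2))"
  "\<E> (\<lambda>w. (S w)\<^sup>2) <= c * n" "\<E> (\<lambda>w. (S w) ^ 4) <= 3 * c\<^sup>2 * n\<^sup>2"
  using insert.IH[OF sub insert.prems(2,3,4)] unfolding S_def n_def by blast+
 have Z: "integrable M (\<lambda>w. \<bar>Z w\<bar> ^ 4)" "\<E> Z = 0" "\<E> (\<lambda>w. Z w ^ 4) <= c"
  using insert.prems(2,3,4)[of i] unfolding Z_def by auto
 have iZ: "integrable M (\<lambda>w. Z w ^ a)" and iS: "integrable M (\<lambda>w. S w ^ a)" if "a <= 4" for a
  using integrable_lower_power[OF Z(1) _ that] integrable_lower_power[OF IH(1) _ that] by auto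
 have EZ2: "\<E> (\<lambda>w. (Z w)\<^sup>2) <= c"
 proof -
  have "\<E> (\<lambda>w. (Z w)\<^sup>2) <= \<E> (\<lambda>w. (1 + Z w ^ 4) / 2)"
  proof (rule integral_mono)
   fix w
   have "0 <= ((Z w)\<^sup>2 - 1)\<^sup>2" by simp
   then show "(Z w)\<^sup>2 <= (1 + Z w ^ 4) / 2" by (simp add: power2_diff power_mult[symmetric])
  qed (use iZ in auto)
  also have "... = (1 + \<E> (\<lambda>w. Z w ^ 4)) / 2" using iZ by (simp add: prob_space)
  finally show ?thesis using Z(3) c(2) by simp
 qed
 note P = indep_power_expectation[OF ZS]
 have i11: "integrable M (\<lambda>w. Z w * S w)" and e11: "\<E> (\<lambda>w. Z w * S w) = 0"
  using P[of 1 1] iZ[of 1] iS[of 1] Z(2) IH(2) by auto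
 have i31: "integrable M (\<lambda>w. Z w ^ 3 * S w)" and e31: "\<E> (\<lambda>w. Z w ^ 3 * S w) = 0"
  using P[of 3 1] iZ[of 3] iS[of 1] Z(2) IH(2) by auto
 have i13: "integrable M (\<lambda>w. Z w * S w ^ 3)" and e13: "\<E> (\<lambda>w. Z w * S w ^ 3) = 0"
  using P[of 1 3] iZ[of 1] iS[of 3] Z(2) IH(2) by auto
 have i22: "integrable M (\<lambda>w. (Z w)\<^sup>2 * (S w)\<^sup>2)"
  and e22: "\<E> (\<lambda>w. (Z w)\<^sup>2 * (S w)\<^sup>2) = \<E> (\<lambda>w. (Z w)\<^sup>2) * \<E> (\<lambda>w. (S w)\<^sup>2)"
  using P[of 2 2] iZ[of 2] iS[of 2] by auto
 have eq: "(\<Sum>j\<in>insert i I. \<zeta> j w) = Z w + S w" for w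
  using insert.hyps by (simp add: Z_def S_def)
 have sq: "(Z w + S w)\<^sup>2 = (Z w)\<^sup>2 + 2 * (Z w * S w) + (S w)\<^sup>2" for w
  by (simp add: power2_eq_square algebra_simps)
 have p4: "(Z w + S w) ^ 4 = Z w ^ 4 + 4 * (Z w ^ 3 * S w) + 6 * ((Z w)\<^sup>2 * (S w)\<^sup>2) + 4 * (Z w * S w ^ 3) + S w ^ 4" for w
  by (simp add: power2_eq_square power3_eq_cube power4_eq_xxxx algebra_simps)
 have "integrable M (\<lambda>w. (Z w + S w) ^ 4)"
  unfolding p4 using iZ[of 4] iS[of 4] i31 i22 i13 by simp
 then have 1: "integrable M (\<lambda>w. \<bar>Z w + S w\<bar> ^ 4)" by (simp add: power_even_abs)
 have 2: "\<E> (\<lambda>w. Z w + S w) = 0" using iZ[of 1] iS[of 1] Z(2) IH(2) by simp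
 have E2: "\<E> (\<lambda>w. (Z w + S w)\<^sup>2) = \<E> (\<lambda>w. (Z w)\<^sup>2) + \<E> (\<lambda>w. (S w)\<^sup>2)"
  unfolding sq using iZ[of 2] iS[of 2] i11 e11 by simp
 have "\<E> (\<lambda>w. (Z w + S w) ^ 4) = \<E> (\<lambda>w. Z w ^ 4) +
   6 * (\<E> (\<lambda>w. (Z w)\<^sup>2) * \<E> (\<lambda>w. (S w)\<^sup>2)) + \<E> (\<lambda>w. S w ^ 4)"
  unfolding p4 using iZ[of 4] iS[of 4] i31 i22 i13 e31 e22 e13 by simp
 also have "... <= c + 6 * (c * (c * n)) + 3 * c\<^sup>2 * n\<^sup>2"
  using Z(3) IH(4,5) EZ2 c(2) by (intro add_mono mult_left_mono mult_mono) auto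
 also have "... <= 3 * c\<^sup>2 * (n + 1)\<^sup>2"
 proof -
  have "c * 1 <= c * c" using c(2) by (intro mult_left_mono) auto
  moreover have "0 <= c * c" by simp
  ultimately have "c <= 3 * (c * c)" by linarith
  then show ?thesis by (simp add: power2_eq_square algebra_simps)
 qed
 finally have E4: "\<E> (\<lambda>w. (Z w + S w) ^ 4) <= 3 * c\<^sup>2 * (n + 1)\<^sup>2" .
 show ?case
  unfolding eq using insert.hyps 1 2 E2 E4 IH(3,4) EZ2
  by (simp add: n_def Z_def algebra_simps)
qed simp

end

locale stable_inar = inar_process +
 assumes init_moment: "\<And>k. k \<in> {- int p + 1..0} ==> integrable M (\<lambda>w. real (X k w) ^ 6)"
  and innovation_moment: "integrable M (\<lambda>w. real (\<epsilon> 1 w) ^ 6)"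
  and stable: "(\<Sum>i=1..p. \<alpha> i) < 1"
  and mean_pos: "\<mu> > 0"
  and nondegenerate: "(\<Sum>i=1..p. \<alpha> i) > 0 \<or> \<sigma>\<^sup>2 > 0"
begin

definition total :: "(nat => nat) => real" where
 "total x = (\<Sum>i=1..p. real (x (i - 1)))"

definition thin_mean :: "(nat => nat) => real" where
 "thin_mean x = (\<Sum>i=1..p. \<alpha> i * real (x (i - 1)))"

definition cmean :: "(nat => nat) => real" where
 "cmean x = thin_mean x + \<mu>"

definition cvar :: "(nat => nat) => real" where
 "cvar x = (\<Sum>i=1..p. \<alpha> i * (1 - \<alpha> i) * real (x (i - 1))) + \<sigma>\<^sup>2"

text \<open>The distance to criticality, distributed evenly over the \<open>p\<close> lags.\<close>

definition gap :: real where "gap = (1 - (\<Sum>i=1..p. \<alpha> i)) / real p"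

text \<open>The weights are chosen such that one step of the process lowers the expectation
of \<open>lyap\<close> by \<open>gap * total x\<close>, up to a constant: the weight of a lag is the mass of the coefficients
that it still meets, plus a linear reserve.\<close>

definition weight :: "nat => real" where
 "weight i = (\<Sum>l\<in>{Suc i..p}. \<alpha> l) + gap * (real p - real i)"

definition lyap :: "(nat => nat) => real" where
 "lyap x = (\<Sum>i<p. weight i * real (x i))"

lemma alpha: "i \<in> {1..p} ==> 0 <= \<alpha> i" "i \<in> {1..p} ==> \<alpha> i <= 1"
 using coeff_range by auto

lemma gap: "0 < gap" "gap <= 1"
proof -
 have p: "1 <= real p" using order_pos by simp
 then show "0 < gap" using stable by (simp add: gap_def)
 have "0 <= (\<Sum>i=1..p. \<alpha> i)" using alpha by (intro sum_nonneg) auto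
 then have "(1 - (\<Sum>i=1..p. \<alpha> i)) / real p <= 1 / 1" using p stable by (intro frac_le) auto
 then show "gap <= 1" by (simp add: gap_def)
qed

lemma weight_0: "weight 0 = 1"
 using order_pos by (simp add: weight_def gap_def)

lemma weight_step: "i \<in> {1..p} ==> weight (i - 1) = weight i + \<alpha> i + gap"
 by (auto simp: weight_def of_nat_diff algebra_simps sum.atLeast_Suc_atMost[of i p])

lemma weight_lower: "i < p ==> gap <= weight i"
proof -
 assume i: "i < p"
 have "0 <= (\<Sum>l\<in>{Suc i..p}. \<alpha> l)" using alpha by (intro sum_nonneg) auto
 moreover have "gap * 1 <= gap * (real p - real i)" using i gap by (intro mult_left_mono) auto
 ultimately show ?thesis by (simp add: weight_def)
qed

lemma weight_upper: "i < p ==> weight i <= 1"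
proof (induction i)
 case (Suc i)
 then have "weight i = weight (Suc i) + \<alpha> (Suc i) + gap" using weight_step[of "Suc i"] by simp
 moreover have "0 <= \<alpha> (Suc i)" using Suc alpha by simp
 ultimately show ?case using Suc gap by simp
qed (simp add: weight_0)

lemma total_alt: "total x = (\<Sum>i<p. real (x i))"
 unfolding total_def by (rule sum.reindex_bij_witness[of _ Suc "\<lambda>i. i - 1"]) auto

lemma lyap_alt: "lyap x = (\<Sum>i=1..p. weight (i - 1) * real (x (i - 1)))"
 unfolding lyap_def by (rule sum.reindex_bij_witness[of _ "\<lambda>i. i - 1" Suc]) auto

lemma lyap_le_total: "lyap x <= total x"
 unfolding lyap_def total_alt by (intro sum_mono) (metis lessThan_iff mult_1 of_nat_0_le_iff weight_upper mult_right_mono)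

lemma total_le_lyap: "total x <= lyap x / gap"
proof -
 have "gap * total x <= lyap x"
  unfolding lyap_def total_alt sum_distrib_left using weight_lower by (intro sum_mono mult_right_mono) auto
 then show ?thesis using gap by (simp add: field_simps)
qed

lemma total_nonneg: "0 <= total x" by (simp add: total_def sum_nonneg)

lemma lyap_nonneg: "0 <= lyap x"
 unfolding lyap_def using weight_lower gap by (intro sum_nonneg mult_nonneg_nonneg) (auto intro: order_trans[of 0 gap])

lemma lag_le_lyap: "i < p ==> real (x i) <= lyap x / gap"
proof -
 assume "i < p"
 then have "real (x i) <= total x" unfolding total_alt by (intro member_le_sum) auto
 then show ?thesis using total_le_lyap[of x] by simp
qed

text \<open>Moving every value by one lag costs \<open>thin_mean\<close> plus \<open>gap * total\<close>, by \<open>weight_step\<close>; the new value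
enters with weight one.\<close>

lemma lyap_shift: "lyap (case_nat y x) = lyap x - gap * total x + (real y - thin_mean x)"
proof -
 have "weight p = 0" by (simp add: weight_def)
 then have "lyap (case_nat y x) = (\<Sum>i\<in>{0..p}. weight i * real (case_nat y x i))"
  by (simp add: lyap_def atLeast0AtMost lessThan_Suc_atMost[symmetric])
 also have "... = real y + (\<Sum>i=1..p. weight i * real (x (i - 1)))"
  by (subst sum.atLeast_Suc_atMost) (auto simp: weight_0 intro!: sum.cong split: nat.split)
 also have "(\<Sum>i=1..p. weight i * real (x (i - 1))) = (\<Sum>i=1..p. (weight (i - 1) - \<alpha> i - gap) * real (x (i - 1)))"
  using weight_step by (intro sum.cong) auto
 also have "... = lyap x - thin_mean x - gap * total x"
  by (simp add: lyap_alt thin_mean_def total_def sum_distrib_left sum_subtractf[symmetric] algebra_simps)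
 finally show ?thesis by simp
qed

lemma card_lag_units: "real (card (lag_units p x)) = total x"
 by (simp add: lag_units_def total_def)

lemma thinning_expectation:
 fixes h :: "nat => real"
 assumes "i \<in> {1..p}" "1 <= k" "1 <= j"
 shows "integrable M (\<lambda>w. h (\<xi> i k j w))" "\<E> (\<lambda>w. h (\<xi> i k j w)) = (1 - \<alpha> i) * h 0 + \<alpha> i * h 1"
proof -
 have m: "\<xi> i k j \<in> measurable M (count_space UNIV)"
  using noise_measurable[of "Thin i k j"] assms by (simp add: inar_noise_def)
 have "\<E> (\<lambda>w. h (\<xi> i k j w)) = (\<integral>y. h y \<partial>distr M (count_space UNIV) (\<xi> i k j))"
  using m by (simp add: integral_distr)
 also have "... = (1 - \<alpha> i) * h 0 + \<alpha> i * h 1"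
  unfolding thinning_law[OF assms] using alpha[OF assms(1)] by (simp add: algebra_simps)
 finally show "\<E> (\<lambda>w. h (\<xi> i k j w)) = (1 - \<alpha> i) * h 0 + \<alpha> i * h 1" .
 have "integrable (distr M (count_space UNIV) (\<xi> i k j)) h"
  unfolding thinning_law[OF assms] by (rule integrable_measure_pmf_finite) simp
 then show "integrable M (\<lambda>w. h (\<xi> i k j w))" using m by (simp add: integrable_distr_eq)
qed

definition source_mean :: "inar_source => real" where
 "source_mean s = (case s of Thin i _ _ => \<alpha> i | _ => \<mu>)"

text \<open>At least one, so that it also bounds the fourth central moments of the Bernoulli variables.\<close>

definition c4 :: real where "c4 = max 1 (\<E> (\<lambda>w. (real (\<epsilon> 1 w) - \<mu>) ^ 4))"

lemma eps_measurable[measurable]: "\<epsilon> 1 \<in> measurable M (count_space UNIV)"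
 using noise_measurable[of "Innov 1"] by (simp add: inar_noise_def)

lemma eps_integrable: "a <= 6 ==> integrable M (\<lambda>w. real (\<epsilon> 1 w) ^ a)"
 by (rule integrable_lower_power[of "\<lambda>w. real (\<epsilon> 1 w)" 6]) (use innovation_moment measurable_compose[OF eps_measurable, of real borel] in simp_all)

lemma eps_centered_integrable: "integrable M (\<lambda>w. \<bar>real (\<epsilon> 1 w) - \<mu>\<bar> ^ 4)"
proof -
 have "(\<lambda>w. \<bar>real (\<epsilon> 1 w) - \<mu>\<bar> ^ 4) = (\<lambda>w. real (\<epsilon> 1 w) ^ 4 - 4 * \<mu> * real (\<epsilon> 1 w) ^ 3 + 6 * \<mu>\<^sup>2 * real (\<epsilon> 1 w) ^ 2 - 4 * \<mu> ^ 3 * real (\<epsilon> 1 w) ^ 1 + \<mu> ^ 4)"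
  by (simp add: power_even_abs power2_eq_square power3_eq_cube power4_eq_xxxx algebra_simps)
 then show ?thesis
  by (simp only:) (intro bochner_integrable_add bochner_integrable_diff integrable_mult_right eps_integrable integrable_const; simp)
qed

lemma centered_sources:
 fixes x :: "nat => nat"
 defines "\<zeta> \<equiv> \<lambda>s w. real (inar_source_rv X \<xi> \<epsilon> s w) - source_mean s"
 assumes s: "s \<in> units_at 1 x"
 shows "integrable M (\<lambda>w. \<bar>\<zeta> s w\<bar> ^ 4)" "\<E> (\<zeta> s) = 0"
  "\<E> (\<lambda>w. \<zeta> s w ^ 4) <= (case s of Innov _ => c4 | _ => 1)"
  "\<E> (\<lambda>w. (\<zeta> s w)\<^sup>2) = (case s of Thin i _ _ => \<alpha> i * (1 - \<alpha> i) | _ => \<sigma>\<^sup>2)"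
proof -
 consider "s = Innov 1" | i j where "s = Thin i 1 j" "i \<in> {1..p}" "1 <= j"
  using s by (auto simp: units_at_def lag_units_def)
 then have "integrable M (\<lambda>w. \<bar>\<zeta> s w\<bar> ^ 4) \<and> \<E> (\<zeta> s) = 0 \<and>
  \<E> (\<lambda>w. \<zeta> s w ^ 4) <= (case s of Innov _ => c4 | _ => 1) \<and>
  \<E> (\<lambda>w. (\<zeta> s w)\<^sup>2) = (case s of Thin i _ _ => \<alpha> i * (1 - \<alpha> i) | _ => \<sigma>\<^sup>2)"
 proof cases
  case 1
  have "\<E> (\<lambda>w. real (\<epsilon> 1 w) - \<mu>) = 0"
   using eps_integrable[of 1] innovation_mean by (simp add: prob_space)
  moreover have "\<E> (\<lambda>w. (real (\<epsilon> 1 w) - \<mu>)\<^sup>2) = \<sigma>\<^sup>2"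
   using innovation_variance unfolding innovation_mean .
  ultimately show ?thesis
   using eps_centered_integrable by (simp add: 1 \<zeta>_def source_mean_def c4_def)
 next
  case 2
  have a: "0 <= \<alpha> i" "\<alpha> i <= 1" using alpha 2 by auto
  have E: "\<E> (\<lambda>w. h (\<xi> i 1 j w)) = (1 - \<alpha> i) * h 0 + \<alpha> i * h 1" "integrable M (\<lambda>w. h (\<xi> i 1 j w))" for h
   using thinning_expectation[of i 1 j h] 2 by auto
  have "(1 - \<alpha> i) * (- \<alpha> i) ^ 4 + \<alpha> i * (1 - \<alpha> i) ^ 4 <= (1 - \<alpha> i) * 1 + \<alpha> i * 1"
   using a by (intro add_mono mult_left_mono) (auto simp: power_le_one)
  then show ?thesis
   using E(1)[of "\<lambda>y. real y - \<alpha> i"] E(1)[of "\<lambda>y. (real y - \<alpha> i) ^ 4"] E(1)[of "\<lambda>y. (real y - \<alpha> i)\<^sup>2"] E(2)[of "\<lambda>y. \<bar>real y - \<alpha> i\<bar> ^ 4"]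
   by (simp add: 2 \<zeta>_def source_mean_def power2_eq_square algebra_simps)
 qed
 then show "integrable M (\<lambda>w. \<bar>\<zeta> s w\<bar> ^ 4)" "\<E> (\<zeta> s) = 0"
  "\<E> (\<lambda>w. \<zeta> s w ^ 4) <= (case s of Innov _ => c4 | _ => 1)"
  "\<E> (\<lambda>w. (\<zeta> s w)\<^sup>2) = (case s of Thin i _ _ => \<alpha> i * (1 - \<alpha> i) | _ => \<sigma>\<^sup>2)"
  by auto
qed

lemma centered_indep:
 assumes "S \<subseteq> units_at 1 x"
 shows "indep_vars (\<lambda>_. borel) (\<lambda>s w. real (inar_source_rv X \<xi> \<epsilon> s w) - source_mean s) S"
 by (rule indep_vars_compose2[OF indep_vars_subset[OF noise_indep order_trans[OF assms units_at_noise]]]) auto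

lemma sum_units_at:
 "(\<Sum>s\<in>units_at k x. f s) = (\<Sum>(i, j)\<in>lag_units p x. f (Thin i k j)) + (f (Innov k) :: 'c::comm_monoid_add)"
proof -
 have "inj_on (\<lambda>(i, j). Thin i k j) (lag_units p x)" by (auto simp: inj_on_def)
 then have "(\<Sum>s\<in>(\<lambda>(i, j). Thin i k j) ` lag_units p x. f s) = (\<Sum>(i, j)\<in>lag_units p x. f (Thin i k j))"
  by (subst sum.reindex) (auto simp: case_prod_beta)
 moreover have "Innov k \<notin> (\<lambda>(i, j). Thin i k j) ` lag_units p x" by auto
 ultimately show ?thesis by (simp add: units_at_def add.commute)
qed

lemma sum_lag_units: "(\<Sum>(i, j)\<in>lag_units p x. f i) = (\<Sum>i=1..p. f i * real (x (i - 1)))"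
 unfolding lag_units_def by (subst sum.Sigma[symmetric]) (auto simp: mult.commute)

abbreviation next1 :: "(nat => nat) => 'a => nat" where
 "next1 x w \<equiv> next_value 1 x (\<lambda>s. inar_source_rv X \<xi> \<epsilon> s w)"

lemma next1_measurable: "next1 x \<in> measurable M (count_space UNIV)"
 unfolding next_value_sum using units_at_noise[of 1 x] by (intro measurable_nat_sum noise_measurable) auto

lemma kernel_expectation:
 fixes h :: "nat => real"
 shows "integrable (measure_pmf (K x)) h \<longleftrightarrow> integrable M (\<lambda>w. h (next1 x w))"
  "(\<integral>y. h y \<partial>measure_pmf (K x)) = \<E> (\<lambda>w. h (next1 x w))"
 unfolding next_value_law[of 1 x, symmetric, simplified]
 using next1_measurable[of x] by (simp_all add: integrable_distr_eq integral_distr)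

lemma next1_centered:
 "real (next1 x w) - cmean x = (\<Sum>s\<in>units_at 1 x. real (inar_source_rv X \<xi> \<epsilon> s w) - source_mean s)"
proof -
 have "(\<Sum>s\<in>units_at 1 x. source_mean s) = cmean x"
  using sum_lag_units[of \<alpha> x] by (simp add: sum_units_at source_mean_def cmean_def thin_mean_def)
 then show ?thesis by (simp add: next_value_sum sum_subtractf)
qed

text \<open>The next value minus its conditional mean is a sum of independent centred variables, one for the
innovation and one for each thinned unit.\<close>

lemma kernel_moments:
 "integrable (measure_pmf (K x)) (\<lambda>y. \<bar>real y - cmean x\<bar> ^ 4)"
 "(\<integral>y. real y - cmean x \<partial>measure_pmf (K x)) = 0"
 "(\<integral>y. (real y - cmean x)\<^sup>2 \<partial>measure_pmf (K x)) = cvar x"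
 "(\<integral>y. (real y - cmean x) ^ 4 \<partial>measure_pmf (K x)) <= 3 * c4\<^sup>2 * (total x + 1)\<^sup>2"
proof -
 have c: "(case s of Innov _ => c4 | _ => 1) <= c4" for s by (auto simp: c4_def split: inar_source.split)
 have fin: "finite (units_at 1 x)" by (simp add: units_at_def)
 have "1 <= c4" by (simp add: c4_def)
 note mom = indep_sum_moments[OF fin centered_indep[OF order_refl] centered_sources(1,2) order_trans[OF centered_sources(3) c] this]
 have "card (units_at 1 x) = card (lag_units p x) + 1"
  using sum_units_at[of "\<lambda>_. 1 :: nat" 1 x] by simp
 then have card: "real (card (units_at 1 x)) = total x + 1" using card_lag_units[of x] by simp
 have var: "(\<Sum>s\<in>units_at 1 x. \<E> (\<lambda>w. (real (inar_source_rv X \<xi> \<epsilon> s w) - source_mean s)\<^sup>2)) = cvar x"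
 proof -
  have "(\<Sum>s\<in>units_at 1 x. \<E> (\<lambda>w. (real (inar_source_rv X \<xi> \<epsilon> s w) - source_mean s)\<^sup>2)) =
   (\<Sum>s\<in>units_at 1 x. (case s of Thin i _ _ => \<alpha> i * (1 - \<alpha> i) | _ => \<sigma>\<^sup>2))"
   by (intro sum.cong refl centered_sources(4))
  also have "... = cvar x" using sum_lag_units[of "\<lambda>i. \<alpha> i * (1 - \<alpha> i)" x] by (simp add: sum_units_at cvar_def)
  finally show ?thesis .
 qed
 show "integrable (measure_pmf (K x)) (\<lambda>y. \<bar>real y - cmean x\<bar> ^ 4)"
  "(\<integral>y. real y - cmean x \<partial>measure_pmf (K x)) = 0"
  "(\<integral>y. (real y - cmean x)\<^sup>2 \<partial>measure_pmf (K x)) = cvar x"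
  "(\<integral>y. (real y - cmean x) ^ 4 \<partial>measure_pmf (K x)) <= 3 * c4\<^sup>2 * (total x + 1)\<^sup>2"
  unfolding kernel_expectation next1_centered using mom unfolding card var by auto
qed

end

section \<open>Bounded sixth moments\<close>

text \<open>Convexity, with the weights \<open>1 - g\<close> and \<open>g\<close>.\<close>

lemma power6_convex_bound:
 fixes L R g :: real
 assumes g: "0 < g" "g <= 1" and "0 <= L" "0 <= R"
 shows "((1 - g) * L + R) ^ 6 <= (1 - g) * L ^ 6 + R ^ 6 / g ^ 5"
proof -
 have c: "convex_on UNIV (\<lambda>x :: real. x ^ 6)" by (rule convex_power_even) simp
 have "((1 - g) *\<^sub>R L + g *\<^sub>R (R / g)) ^ 6 <= (1 - g) * L ^ 6 + g * (R / g) ^ 6"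
  using g by (intro convex_onD[OF c]) auto
 moreover have "g * (R / g) ^ 6 = R ^ 6 / g ^ 5"
  using g by (simp add: power_divide power_numeral_reduce)
 ultimately show ?thesis using g by simp
qed

lemma power4_absorb:
 fixes A d L :: real
 assumes "0 <= A" "0 < d" "0 <= L"
 shows "A * L ^ 4 <= d * L ^ 6 + A ^ 3 / d\<^sup>2"
proof (cases "A <= d * L\<^sup>2")
 case True
 then have "A * L ^ 4 <= (d * L\<^sup>2) * L ^ 4" by (intro mult_right_mono) auto
 also have "... = d * L ^ 6" by (simp add: power_add[symmetric])
 finally show ?thesis using assms by (simp add: add_increasing2)
next
 case False
 then have "L\<^sup>2 <= A / d" using assms by (simp add: field_simps)
 then have "(L\<^sup>2)\<^sup>2 <= (A / d)\<^sup>2" by (intro power_mono) auto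
 then have "A * L ^ 4 <= A * (A / d)\<^sup>2" using assms by (intro mult_left_mono) (auto simp: power_mult[symmetric])
 also have "... = A ^ 3 / d\<^sup>2" by (simp add: power_divide power3_eq_cube power2_eq_square)
 finally show ?thesis using assms by (simp add: add_increasing)
qed

context stable_inar
begin

definition thin_centered :: "(nat => nat) => 'a => real" where
 "thin_centered x w = (\<Sum>(i, j)\<in>lag_units p x. real (\<xi> i 1 j w) - \<alpha> i)"

lemma thin_centered_eq:
 "thin_centered x w = (\<Sum>s\<in>(\<lambda>(i, j). Thin i 1 j) ` lag_units p x. real (inar_source_rv X \<xi> \<epsilon> s w) - source_mean s)"
proof -
 have "inj_on (\<lambda>(i, j). Thin i 1 j) (lag_units p x)" by (auto simp: inj_on_def)
 then show ?thesis
  unfolding thin_centered_def by (subst sum.reindex) (auto simp: source_mean_def intro!: sum.cong)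
qed

lemma next1_decomp: "real (next1 x w) - thin_mean x = thin_centered x w + real (\<epsilon> 1 w)"
 using next1_centered[of x w]
 by (simp add: sum_units_at thin_centered_def source_mean_def cmean_def)

lemma thin_centered_measurable[measurable]: "thin_centered x \<in> borel_measurable M"
proof -
 have eq: "thin_centered x = (\<lambda>w. real (next1 x w) - thin_mean x - real (\<epsilon> 1 w))"
  using next1_decomp[of x] by (auto simp: fun_eq_iff algebra_simps)
 have "(\<lambda>w. real (next1 x w)) \<in> borel_measurable M" "(\<lambda>w. real (\<epsilon> 1 w)) \<in> borel_measurable M"
  by (rule measurable_compose[OF next1_measurable] measurable_compose[OF eps_measurable], simp)+
 then show ?thesis unfolding eq by (intro borel_measurable_diff borel_measurable_const)
qed

text \<open>The sixth moment is dominated by \<open>(total x)\<^sup>2\<close> times the fourth because every summand is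
at most one in absolute value. The power four instead of six is what the drift condition needs.\<close>

lemma thin_centered_moment:
 "integrable M (\<lambda>w. thin_centered x w ^ 6)"
 "\<E> (\<lambda>w. thin_centered x w ^ 6) <= 3 * total x ^ 4"
 "AE w in M. \<bar>thin_centered x w\<bar> <= total x"
proof -
 let ?S = "(\<lambda>(i, j). Thin i 1 j) ` lag_units p x"
 have sub: "?S \<subseteq> units_at 1 x" by (auto simp: units_at_def)
 have fin: "finite ?S" by simp
 have "inj_on (\<lambda>(i, j). Thin i 1 j) (lag_units p x)" by (auto simp: inj_on_def)
 then have card: "real (card ?S) = total x" by (simp add: card_image card_lag_units)
 have m: "\<E> (\<lambda>w. (real (inar_source_rv X \<xi> \<epsilon> s w) - source_mean s) ^ 4) <= 1" if "s \<in> ?S" for s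
  using centered_sources(3)[of s x] that sub by auto
 have m12: "integrable M (\<lambda>w. \<bar>real (inar_source_rv X \<xi> \<epsilon> s w) - source_mean s\<bar> ^ 4)"
  "\<E> (\<lambda>w. real (inar_source_rv X \<xi> \<epsilon> s w) - source_mean s) = 0" if "s \<in> ?S" for s
  using centered_sources(1,2)[OF subsetD[OF sub that]] .
 note mom = indep_sum_moments[OF fin centered_indep[OF sub] m12 m order_refl]
 have T4: "integrable M (\<lambda>w. thin_centered x w ^ 4)" "\<E> (\<lambda>w. thin_centered x w ^ 4) <= 3 * (total x)\<^sup>2"
  using mom unfolding thin_centered_eq card by (auto simp: power_even_abs)
 have "AE w in M. \<forall>z\<in>lag_units p x. \<xi> (fst z) 1 (snd z) w \<in> {0, 1}"
 proof (rule AE_finite_allI)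
  fix z assume "z \<in> lag_units p x"
  then have i: "fst z \<in> {1..p}" "1 <= snd z" by (auto simp: lag_units_def)
  have m: "\<xi> (fst z) 1 (snd z) \<in> measurable M (count_space UNIV)"
   using noise_measurable[of "Thin (fst z) 1 (snd z)"] i by (simp add: inar_noise_def)
  have "AE y in distr M (count_space UNIV) (\<xi> (fst z) 1 (snd z)). y \<in> {0, 1}"
   unfolding thinning_law[OF i(1) order_refl i(2)] by (auto simp: AE_measure_pmf_iff)
  then show "AE w in M. \<xi> (fst z) 1 (snd z) w \<in> {0, 1}" using m by (subst (asm) AE_distr_iff) auto
 qed simp
 then show ae: "AE w in M. \<bar>thin_centered x w\<bar> <= total x"
 proof eventually_elim
  case (elim w)
  have "\<bar>thin_centered x w\<bar> <= (\<Sum>z\<in>lag_units p x. \<bar>case z of (i, j) => real (\<xi> i 1 j w) - \<alpha> i\<bar>)"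
   unfolding thin_centered_def by (rule sum_abs)
  also have "... <= (\<Sum>z\<in>lag_units p x. 1)"
  proof (intro sum_mono)
   fix z assume z: "z \<in> lag_units p x"
   obtain i j where ij: "z = (i, j)" by fastforce
   then have "i \<in> {1..p}" "\<xi> i 1 j w \<in> {0, 1}" using bspec[OF elim z] z by (auto simp: lag_units_def)
   then show "\<bar>case z of (i, j) => real (\<xi> i 1 j w) - \<alpha> i\<bar> <= 1" using alpha[of i] by (auto simp: ij)
  qed
  also have "... = total x" by (simp add: card_lag_units)
  finally show ?case .
 qed
 then have ae6: "AE w in M. thin_centered x w ^ 6 <= (total x)\<^sup>2 * thin_centered x w ^ 4"
 proof eventually_elim
  case (elim w)
  then have "\<bar>thin_centered x w\<bar>\<^sup>2 <= (total x)\<^sup>2" by (intro power_mono) auto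
  then have "(thin_centered x w)\<^sup>2 * thin_centered x w ^ 4 <= (total x)\<^sup>2 * thin_centered x w ^ 4"
   by (intro mult_right_mono) auto
  then show ?case by (simp add: power_add[symmetric])
 qed
 show int6: "integrable M (\<lambda>w. thin_centered x w ^ 6)"
  by (rule bochner_integrable_bound[where f = "\<lambda>w. (total x)\<^sup>2 * thin_centered x w ^ 4"])
   (use T4(1) ae6 in auto)
 have "\<E> (\<lambda>w. thin_centered x w ^ 6) <= \<E> (\<lambda>w. (total x)\<^sup>2 * thin_centered x w ^ 4)"
  using int6 T4(1) ae6 by (intro integral_mono_AE) auto
 also have "... <= (total x)\<^sup>2 * (3 * (total x)\<^sup>2)" using T4(2) by (simp add: mult_left_mono)
 also have "... = 3 * total x ^ 4" by (simp add: power_add[symmetric])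
 finally show "\<E> (\<lambda>w. thin_centered x w ^ 6) <= 3 * total x ^ 4" .
qed

text \<open>A drift condition. By convexity the deterministic contraction keeps \<open>1 - gap\<close> of the
sixth power; the noise adds a term of order \<open>lyap x ^ 4\<close> by \<open>thin_centered_moment\<close>, and half of
the gap absorbs it.\<close>

lemma kernel_lyap6:
 obtains C where "0 <= C" "\<And>x. integrable (measure_pmf (K x)) (\<lambda>y. lyap (case_nat y x) ^ 6)"
  "\<And>x. (\<integral>y. lyap (case_nat y x) ^ 6 \<partial>measure_pmf (K x)) <= (1 - gap / 2) * lyap x ^ 6 + C"
proof
 \<comment> \<open>192 is 64 times 3, from the sixth power of a sum of two terms and the fourth moment bound; one factor \<open>gap ^ 5\<close> comes from convexity and \<open>gap ^ 4\<close> from \<open>total x \<le> lyap x / gap\<close>.\<close>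
 define A where "A = 192 / gap ^ 9"
 define E where "E = \<E> (\<lambda>w. real (\<epsilon> 1 w) ^ 6)"
 define C where "C = A ^ 3 / (gap / 2)\<^sup>2 + 64 / gap ^ 5 * E"
 have E0: "0 <= E" by (simp add: E_def)
 then show "0 <= C" using gap by (simp add: C_def A_def)
 fix x
 define F where "F w = (1 - gap) * lyap x ^ 6 + 64 / gap ^ 5 * (thin_centered x w ^ 6 + real (\<epsilon> 1 w) ^ 6)" for w
 have bound: "lyap (case_nat (next1 x w) x) ^ 6 <= F w" for w
 proof -
  define R where "R = \<bar>thin_centered x w\<bar> + real (\<epsilon> 1 w)"
  have "gap * lyap x <= gap * total x" using gap lyap_le_total by (intro mult_left_mono) auto
  then have "lyap (case_nat (next1 x w) x) <= (1 - gap) * lyap x + R"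
   unfolding lyap_shift next1_decomp R_def by (simp add: algebra_simps)
  then have "lyap (case_nat (next1 x w) x) ^ 6 <= ((1 - gap) * lyap x + R) ^ 6"
   by (intro power_mono lyap_nonneg)
  also have "... <= (1 - gap) * lyap x ^ 6 + R ^ 6 / gap ^ 5"
   using gap lyap_nonneg by (intro power6_convex_bound) (auto simp: R_def)
  also have "R ^ 6 <= 64 * (thin_centered x w ^ 6 + real (\<epsilon> 1 w) ^ 6)"
   using sum_power6_le[of UNIV "case_bool \<bar>thin_centered x w\<bar> (real (\<epsilon> 1 w))"]
   by (simp add: R_def UNIV_bool add.commute power_even_abs split: bool.split)
  finally show ?thesis using gap by (simp add: F_def divide_right_mono)
 qed
 have intF: "integrable M F" unfolding F_def using thin_centered_moment(1) innovation_moment by simp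
 have meas: "(\<lambda>w. lyap (case_nat (next1 x w) x) ^ 6) \<in> borel_measurable M"
  by (rule measurable_compose[OF next1_measurable]) simp
 have int: "integrable M (\<lambda>w. lyap (case_nat (next1 x w) x) ^ 6)"
  by (rule bochner_integrable_bound[OF intF meas]) (auto intro!: AE_I2 order_trans[OF bound abs_ge_self] simp del: One_nat_def)
 then show "integrable (measure_pmf (K x)) (\<lambda>y. lyap (case_nat y x) ^ 6)" by (simp add: kernel_expectation)
 have "(\<integral>y. lyap (case_nat y x) ^ 6 \<partial>measure_pmf (K x)) <= \<E> F"
  unfolding kernel_expectation using int intF bound by (intro integral_mono) auto
 also have "... = (1 - gap) * lyap x ^ 6 + 64 / gap ^ 5 * (\<E> (\<lambda>w. thin_centered x w ^ 6) + E)"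
  unfolding F_def E_def using thin_centered_moment(1) innovation_moment by (simp add: prob_space)
 also have "... <= (1 - gap) * lyap x ^ 6 + 64 / gap ^ 5 * (3 * (lyap x / gap) ^ 4 + E)"
 proof -
  have "total x ^ 4 <= (lyap x / gap) ^ 4" by (intro power_mono total_le_lyap total_nonneg)
  then have "\<E> (\<lambda>w. thin_centered x w ^ 6) <= 3 * (lyap x / gap) ^ 4"
   using thin_centered_moment(2)[of x] by linarith
  then show ?thesis using gap by (intro add_left_mono mult_left_mono) auto
 qed
 also have "... = (1 - gap) * lyap x ^ 6 + (A * lyap x ^ 4 + 64 / gap ^ 5 * E)"
  using gap by (simp add: A_def power_divide field_simps power_add[symmetric])
 also have "... <= (1 - gap) * lyap x ^ 6 + ((gap / 2) * lyap x ^ 6 + A ^ 3 / (gap / 2)\<^sup>2 + 64 / gap ^ 5 * E)"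
  using gap lyap_nonneg power4_absorb[of A "gap / 2" "lyap x"] by (simp add: A_def)
 also have "... = (1 - gap / 2) * lyap x ^ 6 + C" by (simp add: C_def algebra_simps)
 finally show "(\<integral>y. lyap (case_nat y x) ^ 6 \<partial>measure_pmf (K x)) <= (1 - gap / 2) * lyap x ^ 6 + C" .
qed

lemma adapted_state_comp: "adapted k (\<lambda>w. h (state k w))"
 by (rule adapted_comp[OF adapted_state])

lemma lyap_moment_bounded:
 obtains B where "0 <= B" "\<And>k. integrable M (\<lambda>w. lyap (state k w) ^ 6)" "\<And>k. \<E> (\<lambda>w. lyap (state k w) ^ 6) <= B"
proof -
 obtain C where C: "0 <= C" "\<And>x. integrable (measure_pmf (K x)) (\<lambda>y. lyap (case_nat y x) ^ 6)"
  "\<And>x. (\<integral>y. lyap (case_nat y x) ^ 6 \<partial>measure_pmf (K x)) <= (1 - gap / 2) * lyap x ^ 6 + C"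
  by (rule kernel_lyap6) blast
 have meas: "(\<lambda>w. lyap (state k w) ^ 6) \<in> borel_measurable M" for k
  by (rule adapted_borel[OF adapted_state_comp])
 have int0: "integrable M (\<lambda>w. lyap (state 0 w) ^ 6)"
 proof (rule bochner_integrable_bound[OF _ meas])
  have "- int i \<in> {- int p + 1..0}" if "i < p" for i using that by auto
  then show "integrable M (\<lambda>w. real p ^ 6 * (\<Sum>i<p. real (X (- int i) w) ^ 6))"
   by (intro integrable_mult_right bochner_integrable_sum init_moment) auto
  have "lyap (state 0 w) ^ 6 <= real p ^ 6 * (\<Sum>i<p. real (X (- int i) w) ^ 6)" for w
  proof -
   have "lyap (state 0 w) ^ 6 <= total (state 0 w) ^ 6" by (intro power_mono lyap_le_total lyap_nonneg)
   also have "... <= real (card {..<p}) ^ 6 * (\<Sum>i<p. real (state 0 w i) ^ 6)"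
    unfolding total_alt by (rule sum_power6_le) auto
   finally show ?thesis by (simp add: state_def state_of_history)
  qed
  then show "AE w in M. norm (lyap (state 0 w) ^ 6) <= norm (real p ^ 6 * (\<Sum>i<p. real (X (- int i) w) ^ 6))"
   by (intro AE_I2) (simp add: sum_nonneg)
 qed
 define B where "B = max (\<E> (\<lambda>w. lyap (state 0 w) ^ 6)) (2 * C / gap)"
 have B0: "0 <= B" using C(1) gap by (simp add: B_def le_max_iff_disj)
 have nn: "(\<integral>\<^sup>+w. ennreal (lyap (state k w) ^ 6) \<partial>M) <= ennreal B" for k
 proof (induction k)
  case 0
  show ?case using int0 by (subst nn_integral_eq_integral) (auto simp: B_def ennreal_leI)
 next
  case (Suc k)
  have "(\<integral>\<^sup>+w. ennreal (lyap (state (Suc k) w) ^ 6) \<partial>M) =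
    (\<integral>\<^sup>+w. ennreal (lyap (case_nat (X (int (Suc k)) w) (state_of (history k w))) ^ 6) \<partial>M)"
   by (simp only: state_def history_Suc state_of_Cons)
  also have "... = (\<integral>\<^sup>+w. \<integral>\<^sup>+y. ennreal (lyap (case_nat y (state k w)) ^ 6) \<partial>measure_pmf (K (state k w)) \<partial>M)"
   using one_step_nn[of "\<lambda>h y. ennreal (lyap (case_nat y (state_of h)) ^ 6)" k] by (simp add: state_def)
  also have "... <= (\<integral>\<^sup>+w. ennreal ((1 - gap / 2) * lyap (state k w) ^ 6 + C) \<partial>M)"
   using C by (intro nn_integral_mono) (simp add: nn_integral_eq_integral ennreal_leI)
  also have "... = ennreal (1 - gap / 2) * (\<integral>\<^sup>+w. ennreal (lyap (state k w) ^ 6) \<partial>M) + ennreal C"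
   using gap C(1) meas
   by (simp add: ennreal_plus ennreal_mult nn_integral_add nn_integral_cmult emeasure_space_1 lyap_nonneg del: ennreal_plus[symmetric])
  also have "... <= ennreal (1 - gap / 2) * ennreal B + ennreal C"
   by (intro add_right_mono mult_left_mono Suc) simp
  also have "... = ennreal ((1 - gap / 2) * B + C)"
   using gap B0 C(1) by (simp add: ennreal_mult[symmetric] ennreal_plus[symmetric] del: ennreal_plus)
  also have "... <= ennreal B"
  proof (rule ennreal_leI)
   have "2 * C / gap <= B" by (simp add: B_def)
   then show "(1 - gap / 2) * B + C <= B" using gap by (simp add: field_simps)
  qed
  finally show ?case .
 qed
 have int: "integrable M (\<lambda>w. lyap (state k w) ^ 6)" for k
  using meas[of k] nn[of k] by (intro integrableI_nonneg) (auto simp: lyap_nonneg less_top[symmetric] top_unique)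
 moreover have "\<E> (\<lambda>w. lyap (state k w) ^ 6) <= B" for k
  using nn[of k] int[of k] B0 by (subst (asm) nn_integral_eq_integral) (auto simp: lyap_nonneg)
 ultimately show ?thesis using B0 that by blast
qed

text \<open>A single random variable that dominates all regressors of one step; moments up to order
six are bounded uniformly in time, and the whole asymptotic theory is expressed through this envelope.\<close>

definition env :: "nat => 'a => real" where "env k w = 1 + lyap (state k w) / gap"

lemma env_ge: "1 <= env k w" "i < p ==> real (state k w i) <= env k w" "total (state k w) + 1 <= env k w"
 using lyap_nonneg[of "state k w"] lag_le_lyap[of i "state k w"] total_le_lyap[of "state k w"] gap
 by (auto simp: env_def)

lemma adapted_env: "adapted k (env k)"
 unfolding env_def[abs_def] by (rule adapted_state_comp)

lemma env_moment:
 obtains B where "1 <= B" "\<And>k a. a <= 6 ==> integrable M (\<lambda>w. env k w ^ a)" "\<And>k a. a <= 6 ==> \<E> (\<lambda>w. env k w ^ a) <= B"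
proof -
 obtain B where B: "0 <= B" "\<And>k. integrable M (\<lambda>w. lyap (state k w) ^ 6)" "\<And>k. \<E> (\<lambda>w. lyap (state k w) ^ 6) <= B"
  by (rule lyap_moment_bounded) blast
 define F where "F k w = 64 * (1 + lyap (state k w) ^ 6 / gap ^ 6)" for k w
 have le: "env k w ^ 6 <= F k w" for k w
  using sum_power6_le[of UNIV "case_bool 1 (lyap (state k w) / gap)"] gap lyap_nonneg
  by (simp add: env_def F_def UNIV_bool add.commute power_divide split: bool.split)
 have intF: "integrable M (F k)" for k unfolding F_def using B(2) by simp
 have EF: "\<E> (F k) <= 64 * (1 + B / gap ^ 6)" for k
  unfolding F_def using B(2) B(3)[of k] gap by (simp add: prob_space divide_right_mono)
 have int6: "integrable M (\<lambda>w. env k w ^ 6)" for k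
  by (rule bochner_integrable_bound[OF intF[of k] adapted_borel[OF adapted_comp[OF adapted_env]]])
   (auto intro!: AE_I2 order_trans[OF le abs_ge_self])
 have E6: "\<E> (\<lambda>w. env k w ^ 6) <= 64 * (1 + B / gap ^ 6)" for k
  using integral_mono[OF int6[of k] intF[of k] le] EF[of k] by linarith
 have a6: "env k w ^ a <= env k w ^ 6" if "a <= 6" for k w a
  using env_ge(1) that by (intro power_increasing) auto
 have inta: "integrable M (\<lambda>w. env k w ^ a)" if "a <= 6" for k a
  by (rule bochner_integrable_bound[OF int6[of k] adapted_borel[OF adapted_comp[OF adapted_env]]])
   (use a6[OF that] order_trans[OF zero_le_one env_ge(1)] in \<open>auto intro!: AE_I2 simp: abs_of_nonneg\<close>)
 have "\<E> (\<lambda>w. env k w ^ a) <= 64 * (1 + B / gap ^ 6)" if "a <= 6" for k a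
  using integral_mono[OF inta[OF that, of k] int6[of k] a6[OF that]] E6[of k] by linarith
 moreover have "1 <= 64 * (1 + B / gap ^ 6)" using B(1) gap by simp
 ultimately show ?thesis using inta that by blast
qed

definition mdiff :: "nat => 'a => real" where
 "mdiff k w = real (X (int k) w) - cmean (state (k - 1) w)"

lemma adapted_mdiff: "1 <= k ==> adapted k (mdiff k)"
 unfolding mdiff_def[abs_def]
 by (intro adapted_comp2[where h = "\<lambda>a b. real a - cmean b"] adapted_X adapted_mono[OF adapted_state]) (use order_pos in auto)

lemma mdiff_expectation:
 assumes a: "adapted k a" and int: "integrable M (\<lambda>w. a w * mdiff (Suc k) w)"
 shows "\<E> (\<lambda>w. a w * mdiff (Suc k) w) = 0"
proof -
 obtain \<phi> where \<phi>: "\<And>w. w \<in> space M ==> a w = \<phi> (history k w)" using a by (rule adaptedE) blast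
 define G where "G h y = (\<phi> h :: real) * (real y - cmean (state_of h))" for h y
 have eq: "a w * mdiff (Suc k) w = G (history k w) (X (int (Suc k)) w)" if "w \<in> space M" for w
  using \<phi>[OF that] by (simp add: G_def mdiff_def state_def)
 have "integrable M (\<lambda>w. G (history k w) (X (int (Suc k)) w))"
  using int by (simp only: bochner_integrable_cong[OF refl eq])
 from one_step(2)[OF this] have "\<E> (\<lambda>w. G (history k w) (X (int (Suc k)) w)) = 0"
  using kernel_moments(2) by (simp add: G_def state_def)
 with bochner_integral_cong[OF refl eq] show ?thesis by (rule trans)
qed

lemma mdiff_fourth_moment:
 assumes a: "adapted k a" and nn: "\<And>w. 0 <= a w" and int: "integrable M (\<lambda>w. a w * (env k w)\<^sup>2)"
 shows "integrable M (\<lambda>w. a w * mdiff (Suc k) w ^ 4)"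
  "\<E> (\<lambda>w. a w * mdiff (Suc k) w ^ 4) <= 3 * c4\<^sup>2 * \<E> (\<lambda>w. a w * (env k w)\<^sup>2)"
proof -
 obtain \<phi> where \<phi>: "\<And>w. w \<in> space M ==> a w = \<phi> (history k w)" using a by (rule adaptedE) blast
 have "(\<integral>\<^sup>+w. ennreal (a w * mdiff (Suc k) w ^ 4) \<partial>M) =
   (\<integral>\<^sup>+w. ennreal (\<phi> (history k w) * (real (X (int (Suc k)) w) - cmean (state_of (history k w))) ^ 4) \<partial>M)"
  by (intro nn_integral_cong) (simp add: \<phi> mdiff_def state_def)
 also have "... = (\<integral>\<^sup>+w. \<integral>\<^sup>+y. ennreal (\<phi> (history k w) * (real y - cmean (state k w)) ^ 4) \<partial>measure_pmf (K (state k w)) \<partial>M)"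
  using one_step_nn[of "\<lambda>h y. ennreal (\<phi> h * (real y - cmean (state_of h)) ^ 4)" k] by (simp add: state_def)
 also have "... <= (\<integral>\<^sup>+w. ennreal (3 * c4\<^sup>2 * (a w * (env k w)\<^sup>2)) \<partial>M)"
 proof (intro nn_integral_mono)
  fix w assume sp: "w \<in> space M"
  have p: "0 <= \<phi> (history k w)" using \<phi>[OF sp] nn[of w] by simp
  have i: "integrable (measure_pmf (K (state k w))) (\<lambda>y. (real y - cmean (state k w)) ^ 4)"
   using kernel_moments(1)[of "state k w"] by (simp add: power_even_abs)
  have "(\<integral>\<^sup>+y. ennreal (\<phi> (history k w) * (real y - cmean (state k w)) ^ 4) \<partial>measure_pmf (K (state k w))) =
    ennreal (\<integral>y. \<phi> (history k w) * (real y - cmean (state k w)) ^ 4 \<partial>measure_pmf (K (state k w)))"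
   using i p by (intro nn_integral_eq_integral) auto
  also have "... = ennreal (\<phi> (history k w) * (\<integral>y. (real y - cmean (state k w)) ^ 4 \<partial>measure_pmf (K (state k w))))"
   by simp
  also have "... <= ennreal (3 * c4\<^sup>2 * (a w * (env k w)\<^sup>2))"
  proof (rule ennreal_leI)
   have "(total (state k w) + 1)\<^sup>2 <= (env k w)\<^sup>2" using env_ge(3) total_nonneg by (intro power_mono) auto
   then have "3 * c4\<^sup>2 * (total (state k w) + 1)\<^sup>2 <= 3 * c4\<^sup>2 * (env k w)\<^sup>2" by (intro mult_left_mono) auto
   then have "(\<integral>y. (real y - cmean (state k w)) ^ 4 \<partial>measure_pmf (K (state k w))) <= 3 * c4\<^sup>2 * (env k w)\<^sup>2"
    using kernel_moments(4)[of "state k w"] by linarith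
   from mult_left_mono[OF this p]
   show "\<phi> (history k w) * (\<integral>y. (real y - cmean (state k w)) ^ 4 \<partial>measure_pmf (K (state k w))) <= 3 * c4\<^sup>2 * (a w * (env k w)\<^sup>2)"
    by (simp add: \<phi>[OF sp] mult_ac)
  qed
  finally show "(\<integral>\<^sup>+y. ennreal (\<phi> (history k w) * (real y - cmean (state k w)) ^ 4) \<partial>measure_pmf (K (state k w))) <= ennreal (3 * c4\<^sup>2 * (a w * (env k w)\<^sup>2))" .
 qed
 also have "... = ennreal (3 * c4\<^sup>2 * \<E> (\<lambda>w. a w * (env k w)\<^sup>2))"
  using int nn by (subst nn_integral_eq_integral) auto
 finally have le: "(\<integral>\<^sup>+w. ennreal (a w * mdiff (Suc k) w ^ 4) \<partial>M) <= ennreal (3 * c4\<^sup>2 * \<E> (\<lambda>w. a w * (env k w)\<^sup>2))" .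
 have meas: "(\<lambda>w. a w * mdiff (Suc k) w ^ 4) \<in> borel_measurable M"
  by (rule adapted_borel[of "Suc k"], rule adapted_comp2[where h = "\<lambda>a b. a * b ^ 4"], rule adapted_mono[OF a], simp, rule adapted_mdiff, simp)
 show i: "integrable M (\<lambda>w. a w * mdiff (Suc k) w ^ 4)"
  using meas le nn by (intro integrableI_nonneg) (auto simp: less_top[symmetric] top_unique)
 show "\<E> (\<lambda>w. a w * mdiff (Suc k) w ^ 4) <= 3 * c4\<^sup>2 * \<E> (\<lambda>w. a w * (env k w)\<^sup>2)"
  using le i nn by (subst (asm) nn_integral_eq_integral) (auto simp: bochner_integral_nonneg)
qed

end

section \<open>A law of large numbers by coupling with a branching process\<close>

primrec iterk :: "nat => (nat => real) => nat pmf => nat => (nat => nat) => (nat => nat) pmf" where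
 "iterk p \<alpha> e 0 x = return_pmf x"
| "iterk p \<alpha> e (Suc m) x = bind_pmf (kernel p \<alpha> e x) (\<lambda>y. iterk p \<alpha> e m (case_nat y x))"

lemma conv_power_add:
 "conv_prod (\<lambda>_. q) {1..n + m :: nat} = conv_pmf (conv_prod (\<lambda>_. q) {1..n}) (conv_prod (\<lambda>_. q) {1..m})"
 by (induction m) (simp_all add: atLeastAtMostSuc_conv conv.left_commute)

lemma thin_law_add: "thin_law p \<alpha> (\<lambda>i. x i + z i) = conv_pmf (thin_law p \<alpha> x) (thin_law p \<alpha> z)"
proof -
 have *: "thin_law p \<alpha> u = conv_prod (\<lambda>i. conv_prod (\<lambda>_. map_pmf of_bool (bernoulli_pmf (\<alpha> i))) {1..u (i - 1)}) {1..p}" for u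
  unfolding thin_law_def lag_units_def by (subst conv.Sigma) auto
 show ?thesis unfolding * conv_power_add conv.distrib ..
qed

lemma kernel_add: "kernel p \<alpha> e (\<lambda>i. x i + z i) = conv_pmf (kernel p \<alpha> e x) (thin_law p \<alpha> z)"
 by (simp add: kernel_def thin_law_add conv.assoc)

lemma kernel_no_innovation: "kernel p \<alpha> (return_pmf 0) z = thin_law p \<alpha> z"
 by (simp add: kernel_def)

text \<open>The branching property: units reproduce independently, so adding \<open>z\<close> to the
starting state adds an independent process without innovations started at \<open>z\<close>.\<close>

lemma iterk_add:
 "iterk p \<alpha> e m (\<lambda>i. x i + z i) =
  map_pmf (\<lambda>(a, b) i. a i + b i) (pair_pmf (iterk p \<alpha> e m x) (iterk p \<alpha> (return_pmf 0) m z))"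
proof (induction m arbitrary: x z)
 case 0
 show ?case by simp
next
 case (Suc m)
 have shift: "case_nat (a + b) (\<lambda>i. x i + z i) = (\<lambda>i. case_nat a x i + case_nat b z i)" for a b :: nat
  by (auto simp: fun_eq_iff split: nat.split)
 have "iterk p \<alpha> e (Suc m) (\<lambda>i. x i + z i) =
   bind_pmf (kernel p \<alpha> e x) (\<lambda>a. bind_pmf (thin_law p \<alpha> z) (\<lambda>b. iterk p \<alpha> e m (\<lambda>i. case_nat a x i + case_nat b z i)))"
  by (simp add: kernel_add conv_pmf_alt bind_assoc_pmf bind_map_pmf shift)
 also have "... = bind_pmf (kernel p \<alpha> e x) (\<lambda>a. bind_pmf (thin_law p \<alpha> z) (\<lambda>b.
   bind_pmf (iterk p \<alpha> e m (case_nat a x)) (\<lambda>u. bind_pmf (iterk p \<alpha> (return_pmf 0) m (case_nat b z)) (\<lambda>v. return_pmf (\<lambda>i. u i + v i)))))"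
  by (simp add: Suc pair_pmf_def map_bind_pmf)
 also have "... = bind_pmf (kernel p \<alpha> e x) (\<lambda>a. bind_pmf (iterk p \<alpha> e m (case_nat a x)) (\<lambda>u. bind_pmf (thin_law p \<alpha> z) (\<lambda>b.
   bind_pmf (iterk p \<alpha> (return_pmf 0) m (case_nat b z)) (\<lambda>v. return_pmf (\<lambda>i. u i + v i)))))"
  by (subst (2) bind_commute_pmf) (rule refl)
 also have "... = map_pmf (\<lambda>(a, b) i. a i + b i) (pair_pmf (iterk p \<alpha> e (Suc m) x) (iterk p \<alpha> (return_pmf 0) (Suc m) z))"
  by (simp add: pair_pmf_def map_bind_pmf bind_assoc_pmf kernel_no_innovation)
 finally show ?case .
qed

lemma nn_mean_conv:
 "(\<integral>\<^sup>+y. ennreal (real y) \<partial>measure_pmf (conv_pmf P Q)) =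
  (\<integral>\<^sup>+y. ennreal (real y) \<partial>measure_pmf P) + (\<integral>\<^sup>+y. ennreal (real y) \<partial>measure_pmf Q)"
proof -
 have "(\<integral>\<^sup>+y. ennreal (real y) \<partial>measure_pmf (conv_pmf P Q)) =
   (\<integral>\<^sup>+a. \<integral>\<^sup>+b. ennreal (real a) + ennreal (real b) \<partial>measure_pmf Q \<partial>measure_pmf P)"
  by (simp add: conv_pmf_def nn_integral_pair_pmf' ennreal_plus)
 also have "... = (\<integral>\<^sup>+y. ennreal (real y) \<partial>measure_pmf P) + (\<integral>\<^sup>+y. ennreal (real y) \<partial>measure_pmf Q)"
  by (simp add: nn_integral_add measure_pmf.emeasure_space_1)
 finally show ?thesis .
qed

lemma nn_mean_conv_prod:
 "finite I ==> (\<integral>\<^sup>+y. ennreal (real y) \<partial>measure_pmf (conv_prod q I)) = (\<Sum>i\<in>I. \<integral>\<^sup>+y. ennreal (real y) \<partial>measure_pmf (q i))"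
 by (induction I rule: finite_induct) (simp_all add: nn_mean_conv)

text \<open>The approximating constants form a Cauchy sequence. This avoids identifying
the limit as an integral with respect to a stationary law.\<close>

lemma L1_limit_from_approx:
 fixes A :: "nat => 'a => real"
 assumes "prob_space M" and int: "\<And>n. integrable M (A n)"
  and approx: "\<And>e. 0 < e ==> \<exists>a. \<forall>\<^sub>F n in sequentially. (\<integral>w. \<bar>A n w - a\<bar> \<partial>M) <= e"
 shows "\<exists>a. (\<lambda>n. \<integral>w. \<bar>A n w - a\<bar> \<partial>M) \<longlonglongrightarrow> 0"
proof -
 interpret prob_space M by fact
 define \<epsilon> where "\<epsilon> i = inverse (real (Suc i))" for i :: nat
 have epos: "0 < \<epsilon> i" for i by (simp add: \<epsilon>_def)
 have elim: "\<epsilon> \<longlonglongrightarrow> 0" unfolding \<epsilon>_def by (rule LIMSEQ_inverse_real_of_nat)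
 have "\<forall>i. \<exists>a. \<forall>\<^sub>F n in sequentially. (\<integral>w. \<bar>A n w - a\<bar> \<partial>M) <= \<epsilon> i" using approx[OF epos] by blast
 then obtain a where a: "\<And>i. \<forall>\<^sub>F n in sequentially. (\<integral>w. \<bar>A n w - a i\<bar> \<partial>M) <= \<epsilon> i" by metis
 have diff: "\<bar>a i - a j\<bar> <= \<epsilon> i + \<epsilon> j" for i j
 proof -
  obtain n where n: "(\<integral>w. \<bar>A n w - a i\<bar> \<partial>M) <= \<epsilon> i" "(\<integral>w. \<bar>A n w - a j\<bar> \<partial>M) <= \<epsilon> j"
   using eventually_happens'[OF sequentially_bot eventually_conj[OF a[of i] a[of j]]] by blast
  have "\<bar>a i - a j\<bar> = (\<integral>w. \<bar>a i - a j\<bar> \<partial>M)" by (simp add: prob_space)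
  also have "... <= (\<integral>w. \<bar>A n w - a i\<bar> + \<bar>A n w - a j\<bar> \<partial>M)" using int by (intro integral_mono) auto
  also have "... <= \<epsilon> i + \<epsilon> j" using int n by simp
  finally show ?thesis .
 qed
 have "Cauchy a"
 proof (rule metric_CauchyI)
  fix e :: real assume e: "0 < e"
  then have "\<forall>\<^sub>F i in sequentially. \<epsilon> i < e / 2" using elim by (intro order_tendstoD) auto
  then obtain N where N: "\<And>i. i \<ge> N ==> \<epsilon> i < e / 2" by (auto simp: eventually_sequentially)
  have "dist (a i) (a j) < e" if "i \<ge> N" "j \<ge> N" for i j
   using diff[of i j] N[OF that(1)] N[OF that(2)] unfolding dist_real_def by linarith
  then show "\<exists>N. \<forall>i\<ge>N. \<forall>j\<ge>N. dist (a i) (a j) < e" by blast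
 qed
 then obtain b where b: "a \<longlonglongrightarrow> b" using Cauchy_convergent_iff convergent_def by blast
 have ab: "\<bar>a i - b\<bar> <= \<epsilon> i" for i
 proof (rule LIMSEQ_le)
  show "(\<lambda>j. \<bar>a i - a j\<bar>) \<longlonglongrightarrow> \<bar>a i - b\<bar>" by (intro tendsto_intros b)
  show "(\<lambda>j. \<epsilon> i + \<epsilon> j) \<longlonglongrightarrow> \<epsilon> i" using tendsto_add[OF tendsto_const elim, of "\<epsilon> i"] by simp
 qed (use diff in blast)
 have "(\<lambda>n. \<integral>w. \<bar>A n w - b\<bar> \<partial>M) \<longlonglongrightarrow> 0"
 proof (rule LIMSEQ_I)
  fix e :: real assume e: "0 < e"
  then have "\<forall>\<^sub>F i in sequentially. \<epsilon> i < e / 2" using elim by (intro order_tendstoD) auto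
  then obtain i where i: "\<epsilon> i < e / 2" by (auto simp: eventually_sequentially)
  obtain N where N: "\<And>n. n \<ge> N ==> (\<integral>w. \<bar>A n w - a i\<bar> \<partial>M) <= \<epsilon> i" using a[of i] by (auto simp: eventually_sequentially)
  have "norm ((\<integral>w. \<bar>A n w - b\<bar> \<partial>M) - 0) < e" if "n \<ge> N" for n
  proof -
   have "(\<integral>w. \<bar>A n w - b\<bar> \<partial>M) <= (\<integral>w. \<bar>A n w - a i\<bar> + \<bar>a i - b\<bar> \<partial>M)" using int by (intro integral_mono) auto
   also have "... = (\<integral>w. \<bar>A n w - a i\<bar> \<partial>M) + \<bar>a i - b\<bar>" using int by (simp add: prob_space)
   finally have "(\<integral>w. \<bar>A n w - b\<bar> \<partial>M) < e" using N[OF that] ab[of i] i by linarith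
   moreover have "0 <= (\<integral>w. \<bar>A n w - b\<bar> \<partial>M)" by simp
   ultimately show ?thesis by simp
  qed
  then show "\<exists>N. \<forall>n\<ge>N. norm ((\<integral>w. \<bar>A n w - b\<bar> \<partial>M) - 0) < e" by blast
 qed
 then show ?thesis by blast
qed

context stable_inar
begin

lemma thin_law_mean: "(\<integral>\<^sup>+y. ennreal (real y) \<partial>measure_pmf (thin_law p \<alpha> x)) = ennreal (thin_mean x)"
proof -
 have "(\<integral>\<^sup>+y. ennreal (real y) \<partial>measure_pmf (map_pmf of_bool (bernoulli_pmf (\<alpha> i)))) = ennreal (\<alpha> i)"
  if "i \<in> {1..p}" for i
  using alpha[OF that] by (simp add: nn_integral_bernoulli_pmf)
 then have "(\<integral>\<^sup>+y. ennreal (real y) \<partial>measure_pmf (thin_law p \<alpha> x)) = (\<Sum>(i, j)\<in>lag_units p x. ennreal (\<alpha> i))"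
  unfolding thin_law_def by (subst nn_mean_conv_prod) (auto intro!: sum.cong simp: lag_units_def)
 also have "... = ennreal (\<Sum>(i, j)\<in>lag_units p x. \<alpha> i)"
  unfolding case_prod_beta by (rule sum_ennreal) (use alpha in \<open>auto simp: lag_units_def\<close>)
 finally show ?thesis using sum_lag_units[of \<alpha> x] by (simp add: thin_mean_def)
qed

text \<open>Without innovations \<open>lyap\<close> is a supermartingale that contracts by \<open>1 - gap\<close> in each step.\<close>

lemma branching_decay:
 "(\<integral>\<^sup>+b. ennreal (lyap b) \<partial>measure_pmf (iterk p \<alpha> (return_pmf 0) m z)) <= ennreal ((1 - gap) ^ m * lyap z)"
proof (induction m arbitrary: z)
 case (Suc m)
 have g: "0 <= (1 - gap) ^ m" using gap by simp
 have split: "lyap (case_nat y z) = lyap (case_nat 0 z) + real y" for y by (simp add: lyap_shift)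
 have "(\<integral>\<^sup>+b. ennreal (lyap b) \<partial>measure_pmf (iterk p \<alpha> (return_pmf 0) (Suc m) z)) =
   (\<integral>\<^sup>+y. \<integral>\<^sup>+b. ennreal (lyap b) \<partial>measure_pmf (iterk p \<alpha> (return_pmf 0) m (case_nat y z)) \<partial>measure_pmf (thin_law p \<alpha> z))"
  by (simp add: kernel_no_innovation)
 also have "... <= (\<integral>\<^sup>+y. ennreal ((1 - gap) ^ m * lyap (case_nat y z)) \<partial>measure_pmf (thin_law p \<alpha> z))"
  by (intro nn_integral_mono Suc)
 also have "... = (\<integral>\<^sup>+y. ennreal ((1 - gap) ^ m) * (ennreal (lyap (case_nat 0 z)) + ennreal (real y)) \<partial>measure_pmf (thin_law p \<alpha> z))"
 proof (intro nn_integral_cong)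
  fix y
  show "ennreal ((1 - gap) ^ m * lyap (case_nat y z)) = ennreal ((1 - gap) ^ m) * (ennreal (lyap (case_nat 0 z)) + ennreal (real y))"
   unfolding split[of y] using g lyap_nonneg[of "case_nat 0 z"] by (simp only: ennreal_mult' ennreal_plus of_nat_0_le_iff)
 qed
 also have "... = ennreal ((1 - gap) ^ m) * (ennreal (lyap (case_nat 0 z)) + ennreal (thin_mean z))"
  by (simp add: nn_integral_cmult nn_integral_add measure_pmf.emeasure_space_1 thin_law_mean)
 also have "... = ennreal ((1 - gap) ^ m * (lyap z - gap * total z))"
 proof -
  have "0 <= thin_mean z" using alpha by (auto simp: thin_mean_def intro!: sum_nonneg mult_nonneg_nonneg)
  then have "ennreal (lyap (case_nat 0 z)) + ennreal (thin_mean z) = ennreal (lyap (case_nat 0 z) + thin_mean z)"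
   using lyap_nonneg by (simp add: ennreal_plus)
  also have "lyap (case_nat 0 z) + thin_mean z = lyap z - gap * total z" by (simp add: lyap_shift)
  finally show ?thesis using g by (simp add: ennreal_mult')
 qed
 also have "... <= ennreal ((1 - gap) ^ Suc m * lyap z)"
 proof (rule ennreal_leI)
  have "gap * lyap z <= gap * total z" using gap lyap_le_total by (intro mult_left_mono) auto
  then have "lyap z - gap * total z <= (1 - gap) * lyap z" by (simp add: algebra_simps)
  then have "(1 - gap) ^ m * (lyap z - gap * total z) <= (1 - gap) ^ m * ((1 - gap) * lyap z)" using g by (rule mult_left_mono)
  then show "(1 - gap) ^ m * (lyap z - gap * total z) <= (1 - gap) ^ Suc m * lyap z" by (simp add: mult_ac)
 qed
 finally show ?case .
qed simp

text \<open>Depends only on the last \<open>p\<close> values; the sequences that represent states are longer.\<close>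

definition local :: "((nat => nat) => 'c) => bool" where
 "local F \<longleftrightarrow> (\<forall>x y. (\<forall>i<p. x i = y i) \<longrightarrow> F x = F y)"

text \<open>The transition operator of \<open>m\<close> steps.\<close>

definition forward :: "nat => ((nat => nat) => real) => (nat => nat) => real" where
 "forward m F x = (\<integral>y. F y \<partial>measure_pmf (iterk p \<alpha> innov_law m x))"

lemma integrable_pmf_bounded:
 fixes F :: "'c => real"
 assumes "\<And>x. \<bar>F x\<bar> <= b" shows "integrable (measure_pmf P) F"
 by (rule measure_pmf.integrable_const_bound[where B = b]) (use assms in auto)

lemma forward_bound:
 assumes "\<And>x. \<bar>F x\<bar> <= b" shows "\<bar>forward m F x\<bar> <= b"
proof -
 have "\<bar>forward m F x\<bar> <= (\<integral>y. \<bar>F y\<bar> \<partial>measure_pmf (iterk p \<alpha> innov_law m x))"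
  unfolding forward_def by (rule integral_abs_bound)
 also have "... <= b" by (rule measure_pmf.integral_le_const) (use assms in \<open>auto intro!: integrable_pmf_bounded[of _ b]\<close>)
 finally show ?thesis .
qed

text \<open>By the branching property the two expectations differ only on the event
that the descendants of \<open>x\<close> are still present after \<open>m\<close> steps, whose probability is bounded by Markov's
inequality and \<open>branching_decay\<close>.\<close>

lemma forward_contraction:
 assumes F: "local F" "\<And>x. \<bar>F x\<bar> <= b"
 shows "\<bar>forward m F x - forward m F (\<lambda>_. 0)\<bar> <= 2 * b / gap * (1 - gap) ^ m * lyap x"
proof -
 define P Q where "P = iterk p \<alpha> innov_law m (\<lambda>_. 0)" and "Q = iterk p \<alpha> (return_pmf 0) m x"
 define h :: "(nat => nat) => real" where "h z = (if \<exists>i<p. z i \<noteq> 0 then 1 else 0)" for z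
 have b: "0 <= b" using F(2)[of "\<lambda>_. 0"] by linarith
 have law: "iterk p \<alpha> innov_law m x = map_pmf (\<lambda>(a, b) i. a i + b i) (pair_pmf P Q)"
  using iterk_add[of p \<alpha> innov_law m "\<lambda>_. 0" x] by (simp add: P_def Q_def)
 have "forward m F x = (\<integral>z. F (\<lambda>i. fst z i + snd z i) \<partial>measure_pmf (pair_pmf P Q))"
  by (simp add: forward_def law case_prod_beta)
 moreover have "forward m F (\<lambda>_. 0) = (\<integral>z. F (fst z) \<partial>measure_pmf (pair_pmf P Q))"
  by (simp add: forward_def P_def[symmetric])
 ultimately have "\<bar>forward m F x - forward m F (\<lambda>_. 0)\<bar> = \<bar>\<integral>z. F (\<lambda>i. fst z i + snd z i) - F (fst z) \<partial>measure_pmf (pair_pmf P Q)\<bar>"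
  by (subst bochner_integral_diff) (auto intro!: integrable_pmf_bounded[of _ b] F)
 also have "... <= (\<integral>z. \<bar>F (\<lambda>i. fst z i + snd z i) - F (fst z)\<bar> \<partial>measure_pmf (pair_pmf P Q))"
  by (rule integral_abs_bound)
 also have "... <= (\<integral>z. 2 * b * h (snd z) \<partial>measure_pmf (pair_pmf P Q))"
 proof (rule integral_mono)
  have "\<bar>F u - F v\<bar> <= 2 * b" for u v using F(2)[of u] F(2)[of v] by linarith
  then show "integrable (measure_pmf (pair_pmf P Q)) (\<lambda>z. \<bar>F (\<lambda>i. fst z i + snd z i) - F (fst z)\<bar>)"
   by (intro integrable_pmf_bounded[of _ "2 * b"]) auto
  show "integrable (measure_pmf (pair_pmf P Q)) (\<lambda>z. 2 * b * h (snd z))"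
   by (intro integrable_pmf_bounded[of _ "2 * b"]) (auto simp: h_def b)
  fix z
  show "\<bar>F (\<lambda>i. fst z i + snd z i) - F (fst z)\<bar> <= 2 * b * h (snd z)"
  proof (cases "\<exists>i<p. snd z i \<noteq> 0")
   case True
   then show ?thesis using F(2)[of "\<lambda>i. fst z i + snd z i"] F(2)[of "fst z"] by (simp add: h_def)
  next
   case False
   then have "F (\<lambda>i. fst z i + snd z i) = F (fst z)" using F(1) unfolding local_def by auto
   then show ?thesis using b by (simp add: h_def)
  qed
 qed
 also have "... = 2 * b * (\<integral>z. h z \<partial>measure_pmf Q)" by simp
 also have "... <= 2 * b * ((1 - gap) ^ m * lyap x / gap)"
 proof (intro mult_left_mono)
  have h_le: "h z <= lyap z / gap" for z
  proof (cases "\<exists>i<p. z i \<noteq> 0")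
   case True
   then obtain i where i: "i < p" "1 <= real (z i)" by force
   then show ?thesis using lag_le_lyap[OF i(1), of z] by (simp add: h_def)
  next
   case False
   then show ?thesis unfolding h_def if_not_P[OF False] using lyap_nonneg[of z] gap by simp
  qed
  have "ennreal (\<integral>z. h z \<partial>measure_pmf Q) = (\<integral>\<^sup>+z. ennreal (h z) \<partial>measure_pmf Q)"
   by (rule nn_integral_eq_integral[symmetric]) (auto simp: h_def intro!: integrable_pmf_bounded[of _ 1])
  also have "... <= (\<integral>\<^sup>+z. ennreal (1 / gap) * ennreal (lyap z) \<partial>measure_pmf Q)"
   using h_le gap lyap_nonneg by (intro nn_integral_mono) (simp add: ennreal_mult[symmetric] ennreal_leI)
  also have "... = ennreal (1 / gap) * (\<integral>\<^sup>+z. ennreal (lyap z) \<partial>measure_pmf Q)" by (rule nn_integral_cmult) simp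
  also have "... <= ennreal (1 / gap) * ennreal ((1 - gap) ^ m * lyap x)"
   unfolding Q_def by (intro mult_left_mono branching_decay) simp
  also have "... = ennreal ((1 - gap) ^ m * lyap x / gap)"
   using gap lyap_nonneg by (simp add: ennreal_mult[symmetric])
  finally show "(\<integral>z. h z \<partial>measure_pmf Q) <= (1 - gap) ^ m * lyap x / gap" using gap lyap_nonneg[of x] by (subst (asm) ennreal_le_iff) auto
 qed (use b in simp)
 finally show ?thesis by (simp add: mult_ac)
qed

lemma multi_step:
 assumes f: "adapted k f" "\<And>w. \<bar>f w\<bar> <= c" and F: "\<And>x. \<bar>F x\<bar> <= b"
 shows "\<E> (\<lambda>w. f w * F (state (k + m) w)) = \<E> (\<lambda>w. f w * forward m F (state k w))"
 using f
proof (induction m arbitrary: k)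
 case 0
 then show ?case by (simp add: forward_def)
next
 case (Suc m)
 obtain \<phi> where \<phi>: "\<And>w. w \<in> space M ==> f w = \<phi> (history k w)" using Suc.prems(1) by (rule adaptedE) blast
 define G where "G h y = (\<phi> h :: real) * forward m F (case_nat y (state_of h))" for h y
 have eq: "f w * forward m F (state (Suc k) w) = G (history k w) (X (int (Suc k)) w)" if "w \<in> space M" for w
  by (simp only: \<phi>[OF that] G_def state_def history_Suc state_of_Cons)
 have meas: "(\<lambda>w. f w * forward m F (state (Suc k) w)) \<in> borel_measurable M"
  by (rule adapted_borel[of "Suc k"], rule adapted_comp2[where h = "(*)"], rule adapted_mono[OF Suc.prems(1)], simp, rule adapted_state_comp)
 have c: "0 <= c" using Suc.prems(2) order_trans[OF abs_ge_zero] by blast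
 have "\<bar>f w * forward m F (state (Suc k) w)\<bar> <= c * b" for w
  unfolding abs_mult using Suc.prems(2) c by (intro mult_mono forward_bound F) auto
 then have "integrable M (\<lambda>w. f w * forward m F (state (Suc k) w))"
  using meas by (intro integrable_const_bound[where B = "c * b"]) auto
 then have "integrable M (\<lambda>w. G (history k w) (X (int (Suc k)) w))"
  by (simp only: bochner_integrable_cong[OF refl eq])
 note one = one_step(2)[OF this]
 have inner: "(\<integral>y. G h y \<partial>measure_pmf (K (state_of h))) = \<phi> h * forward (Suc m) F (state_of h)" for h
  unfolding G_def forward_def iterk.simps
  by (subst integral_bind_pmf(3)) (auto intro!: integrable_pmf_bounded[of _ b] F)
 have "\<E> (\<lambda>w. f w * F (state (k + Suc m) w)) = \<E> (\<lambda>w. f w * forward m F (state (Suc k) w))"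
  using Suc.IH[of "Suc k"] Suc.prems adapted_mono[OF Suc.prems(1), of "Suc k"] by simp
 also have "... = \<E> (\<lambda>w. G (history k w) (X (int (Suc k)) w))"
  by (intro bochner_integral_cong refl eq)
 also have "... = \<E> (\<lambda>w. \<phi> (history k w) * forward (Suc m) F (state k w))"
  unfolding one by (simp only: inner[of "history k w" for w, folded state_def])
 also have "... = \<E> (\<lambda>w. f w * forward (Suc m) F (state k w))"
  by (intro bochner_integral_cong refl) (simp add: \<phi>)
 finally show ?case .
qed

lemma abs_le_square_bound: "0 < c ==> \<bar>u :: real\<bar> <= (u\<^sup>2 / c + c) / 2"
proof -
 assume c: "0 < c"
 have "0 <= (\<bar>u\<bar> - c)\<^sup>2" by simp
 then have "2 * \<bar>u\<bar> * c <= u\<^sup>2 + c\<^sup>2" by (simp add: power2_diff)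
 then have "\<bar>u\<bar> <= (u\<^sup>2 + c\<^sup>2) / (2 * c)" using c by (simp add: field_simps)
 also have "... = (u\<^sup>2 / c + c) / 2" using c by (simp add: field_simps power2_eq_square)
 finally show ?thesis .
qed

text \<open>The increments \<open>D i\<close> and \<open>D j\<close> are uncorrelated as soon as \<open>i\<close> and \<open>j\<close>
are at least \<open>m\<close> apart, so only a band of width \<open>2 * m\<close> contributes.\<close>

lemma lagged_increments_square:
 fixes F :: "(nat => nat) => real" and m n :: nat
 assumes F: "\<And>x. \<bar>F x\<bar> <= b"
 defines "D \<equiv> \<lambda>j w. F (state (j + m) w) - forward m F (state j w)"
 shows "\<E> (\<lambda>w. (\<Sum>j<n. D j w)\<^sup>2) <= real n * (2 * real m * (4 * b\<^sup>2))"
proof -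
 have Db: "\<bar>D j w\<bar> <= 2 * b" for j w
  using F[of "state (j + m) w"] forward_bound[where F = F and b = b and m = m and x = "state j w", OF F] unfolding D_def by linarith
 have adD: "adapted (j + m) (D j)" for j
  unfolding D_def by (intro adapted_comp2[where h = "(-)"] adapted_state_comp adapted_mono[OF adapted_state_comp]) auto
 have DDb: "\<bar>D i w * D j w\<bar> <= 4 * b\<^sup>2" for i j w
 proof -
  have "\<bar>D i w\<bar> * \<bar>D j w\<bar> <= (2 * b) * (2 * b)" using Db order_trans[OF abs_ge_zero Db] by (intro mult_mono) auto
  then show ?thesis by (simp add: abs_mult power2_eq_square)
 qed
 have int: "integrable M (\<lambda>w. D i w * D j w)" for i j
  by (rule integrable_const_bound[where B = "4 * b\<^sup>2"])
   (use DDb in \<open>auto intro!: borel_measurable_times adapted_borel[OF adD]\<close>)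
 have zero: "\<E> (\<lambda>w. D i w * D j w) = 0" if "i + m <= j" for i j
 proof -
  have a: "adapted j (D i)" by (rule adapted_mono[OF adD that])
  have i1: "integrable M (\<lambda>w. D i w * F (state (j + m) w))"
   by (rule integrable_const_bound[where B = "2 * b * b"])
    (use Db F order_trans[OF abs_ge_zero Db] in \<open>auto simp: abs_mult intro!: mult_mono borel_measurable_times adapted_borel[OF adD] adapted_borel[OF adapted_state_comp]\<close>)
  have i2: "integrable M (\<lambda>w. D i w * forward m F (state j w))"
   by (rule integrable_const_bound[where B = "2 * b * b"])
    (use Db forward_bound[OF F] order_trans[OF abs_ge_zero Db] in \<open>auto simp: abs_mult intro!: mult_mono borel_measurable_times adapted_borel[OF adD] adapted_borel[OF adapted_state_comp]\<close>)
  have Dj: "D j w = F (state (j + m) w) - forward m F (state j w)" for w by (simp add: D_def)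
  have "\<E> (\<lambda>w. D i w * D j w) =
    \<E> (\<lambda>w. D i w * F (state (j + m) w)) - \<E> (\<lambda>w. D i w * forward m F (state j w))"
   unfolding Dj right_diff_distrib using i1 i2 by (rule bochner_integral_diff)
  then show ?thesis using multi_step[where f = "D i" and k = j and m = m and F = F, OF a Db F] by simp
 qed
 have "\<E> (\<lambda>w. (\<Sum>j<n. D j w)\<^sup>2) = (\<Sum>i<n. \<Sum>j<n. \<E> (\<lambda>w. D i w * D j w))"
  unfolding power2_eq_square sum_product using int by (simp add: bochner_integral_sum bochner_integrable_sum)
 also have "... <= (\<Sum>i<n. 2 * real m * (4 * b\<^sup>2))"
 proof (rule sum_mono)
  fix i assume "i \<in> {..<n}"
  have "(\<Sum>j<n. \<E> (\<lambda>w. D i w * D j w)) <= (\<Sum>j\<in>{..<n} \<inter> {j. j < i + m \<and> i < j + m}. 4 * b\<^sup>2)"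
  proof -
   have "\<E> (\<lambda>w. D i w * D j w) <= (if j < i + m \<and> i < j + m then 4 * b\<^sup>2 else 0)" for j
   proof (cases "j < i + m \<and> i < j + m")
    case True
    have "\<E> (\<lambda>w. D i w * D j w) <= 4 * b\<^sup>2"
     using DDb by (intro integral_le_const int AE_I2) (auto simp: abs_le_iff)
    then show ?thesis using True by simp
   next
    case False
    then have "\<E> (\<lambda>w. D i w * D j w) = 0"
     using zero[of i j] zero[of j i] by (auto simp: mult.commute not_less)
    then show ?thesis using False by simp
   qed
   then have "(\<Sum>j<n. \<E> (\<lambda>w. D i w * D j w)) <= (\<Sum>j<n. if j < i + m \<and> i < j + m then 4 * b\<^sup>2 else 0)" by (rule sum_mono)
   also have "... = (\<Sum>j\<in>{..<n} \<inter> {j. j < i + m \<and> i < j + m}. 4 * b\<^sup>2)"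
    by (subst sum.inter_restrict) (auto intro!: sum.cong)
   finally show ?thesis .
  qed
  also have "... <= 2 * real m * (4 * b\<^sup>2)"
  proof -
   have "{..<n} \<inter> {j. j < i + m \<and> i < j + m} \<subseteq> {i - m..<i + m}" by auto
   then have "card ({..<n} \<inter> {j. j < i + m \<and> i < j + m}) <= card {i - m..<i + m}" by (intro card_mono) auto
   then have "real (card ({..<n} \<inter> {j. j < i + m \<and> i < j + m})) <= 2 * real m" by simp
   from mult_right_mono[OF this, of "4 * b\<^sup>2"] show ?thesis by simp
  qed
  finally show "(\<Sum>j<n. \<E> (\<lambda>w. D i w * D j w)) <= 2 * real m * (4 * b\<^sup>2)" .
 qed
 finally show ?thesis by simp
qed

text \<open>Replace \<open>F\<close> at time \<open>j + m\<close> by its conditional expectation at time \<open>j\<close>. For large \<open>m\<close> this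
expectation hardly depends on the state at time \<open>j\<close>, and for fixed \<open>m\<close> the error of the
replacement averages out.\<close>

lemma bounded_average_approx:
 assumes F: "local F" "\<And>x. \<bar>F x\<bar> <= b" and e: "0 < e"
 shows "\<exists>a. \<forall>\<^sub>F n in sequentially. \<E> (\<lambda>w. \<bar>(\<Sum>k<n. F (state k w)) / real n - a\<bar>) <= e"
proof -
 obtain B where B: "1 <= B" "\<And>k a. a <= 6 ==> integrable M (\<lambda>w. env k w ^ a)" "\<And>k a. a <= 6 ==> \<E> (\<lambda>w. env k w ^ a) <= B"
  by (rule env_moment) blast
 have b: "0 <= b" using F(2)[of "\<lambda>_. 0"] by linarith
 have "(\<lambda>m. 2 * b * (1 - gap) ^ m * B) \<longlonglongrightarrow> 2 * b * 0 * B"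
  using gap by (intro tendsto_intros LIMSEQ_power_zero) auto
 then have "\<forall>\<^sub>F m in sequentially. 2 * b * (1 - gap) ^ m * B < e / 4" using e by (intro order_tendstoD) auto
 then obtain m where m: "2 * b * (1 - gap) ^ m * B < e / 4" using eventually_happens'[OF sequentially_bot] by blast
 define a where "a = forward m F (\<lambda>_. 0)"
 define D where "D = (\<lambda>j w. F (state (j + m) w) - forward m F (state j w))"
 define E where "E = (\<lambda>j w. forward m F (state j w) - a)"
 have intF: "integrable M (\<lambda>w. F (state k w))" for k
  by (rule integrable_const_bound[where B = b]) (use F(2) in \<open>auto intro!: adapted_borel[OF adapted_state_comp]\<close>)
 have intfw: "integrable M (\<lambda>w. forward m F (state k w))" for k
  by (rule integrable_const_bound[where B = b]) (use forward_bound[OF F(2)] in \<open>auto intro!: adapted_borel[OF adapted_state_comp]\<close>)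
 have intE: "integrable M (E j)" and intD: "integrable M (D j)" for j unfolding E_def D_def using intF intfw by simp_all
 have EE: "\<E> (\<lambda>w. \<bar>E j w\<bar>) <= e / 4" for j
 proof -
  have env1: "integrable M (env j)" "\<E> (env j) <= B" using B(2)[of 1 j] B(3)[of 1 j] by auto
  have "\<bar>E j w\<bar> <= 2 * b * (1 - gap) ^ m * env j w" for w
  proof -
   have "\<bar>E j w\<bar> <= 2 * b / gap * (1 - gap) ^ m * lyap (state j w)"
    unfolding E_def a_def by (rule forward_contraction[OF F])
   also have "... = 2 * b * (1 - gap) ^ m * (lyap (state j w) / gap)" by simp
   also have "... <= 2 * b * (1 - gap) ^ m * env j w"
    using b gap by (intro mult_left_mono) (auto simp: env_def)
   finally show ?thesis .
  qed
  then have "\<E> (\<lambda>w. \<bar>E j w\<bar>) <= \<E> (\<lambda>w. 2 * b * (1 - gap) ^ m * env j w)"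
   using intE env1 by (intro integral_mono) auto
  also have "... = 2 * b * (1 - gap) ^ m * \<E> (env j)" by simp
  also have "... <= 2 * b * (1 - gap) ^ m * B" using env1 b gap by (intro mult_left_mono) auto
  finally show ?thesis using m by simp
 qed
 define c where "c = 2 * real m * (4 * b\<^sup>2)"
 have intSD2: "integrable M (\<lambda>w. (\<Sum>j<l. D j w)\<^sup>2)" for l
 proof (rule integrable_const_bound[where B = "(real l * (2 * b))\<^sup>2"])
  have "\<bar>D j w\<bar> <= 2 * b" for j w
   using F(2)[of "state (j + m) w"] forward_bound[where F = F and b = b and m = m and x = "state j w", OF F(2)] unfolding D_def by linarith
  then have "\<bar>\<Sum>j<l. D j w\<bar> <= real l * (2 * b)" for w
   using order_trans[OF sum_abs sum_bounded_above[of "{..<l}" "\<lambda>j. \<bar>D j w\<bar>" "2 * b"]] by simp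
  then show "AE w in M. norm ((\<Sum>j<l. D j w)\<^sup>2) <= (real l * (2 * b))\<^sup>2"
   using power_mono[of "\<bar>\<Sum>j<l. D j w\<bar>" "real l * (2 * b)" 2 for w] by (intro AE_I2) simp
 qed (use intD in measurable)
 have SD: "\<E> (\<lambda>w. \<bar>\<Sum>j<l. D j w\<bar>) <= (real l * c / (real n * e / 2) + real n * e / 2) / 2" if n: "0 < n" for l n
 proof -
  have pos: "0 < real n * e / 2" using e n by simp
  have "\<E> (\<lambda>w. \<bar>\<Sum>j<l. D j w\<bar>) <= \<E> (\<lambda>w. ((\<Sum>j<l. D j w)\<^sup>2 / (real n * e / 2) + real n * e / 2) / 2)"
   using intD intSD2 abs_le_square_bound[OF pos] by (intro integral_mono) auto
  also have "... = (\<E> (\<lambda>w. (\<Sum>j<l. D j w)\<^sup>2) / (real n * e / 2) + real n * e / 2) / 2"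
   using intSD2 by (simp add: prob_space)
  also have "... <= (real l * c / (real n * e / 2) + real n * e / 2) / 2"
   using lagged_increments_square[where F = F and b = b and m = m and n = l, OF F(2)] pos unfolding c_def D_def by (intro divide_right_mono add_right_mono) auto
  finally show ?thesis .
 qed
 have bound: "\<E> (\<lambda>w. \<bar>(\<Sum>k<n. F (state k w)) / real n - a\<bar>) <= (real m * (2 * b) + c / e) / real n + e / 2"
  if n: "m < n" for n
 proof -
  define l where "l = n - m"
  have nl: "n = m + l" using n by (simp add: l_def)
  have split: "(\<Sum>k<n. F (state k w)) - real n * a = (\<Sum>k<m. F (state k w) - a) + (\<Sum>j<l. D j w) + (\<Sum>j<l. E j w)" for w
  proof -
   have "(\<Sum>k<n. F (state k w)) - real n * a = (\<Sum>k<n. F (state k w) - a)" by (simp add: sum_subtractf)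
   also have "... = (\<Sum>k<m. F (state k w) - a) + (\<Sum>j<l. F (state (j + m) w) - a)"
    unfolding nl by (induction l) (simp_all add: add.commute)
   also have "(\<Sum>j<l. F (state (j + m) w) - a) = (\<Sum>j<l. D j w) + (\<Sum>j<l. E j w)"
    by (simp add: D_def E_def sum.distrib[symmetric])
   finally show ?thesis by simp
  qed
  have ab: "\<bar>a\<bar> <= b" unfolding a_def by (rule forward_bound[OF F(2)])
  have pw: "\<bar>(\<Sum>k<n. F (state k w)) - real n * a\<bar> <= real m * (2 * b) + \<bar>\<Sum>j<l. D j w\<bar> + (\<Sum>j<l. \<bar>E j w\<bar>)" for w
  proof -
   have "\<bar>F (state k w) - a\<bar> <= 2 * b" for k using F(2)[of "state k w"] ab by linarith
   then have "\<bar>\<Sum>k<m. F (state k w) - a\<bar> <= real m * (2 * b)"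
    using order_trans[OF sum_abs sum_bounded_above[of "{..<m}" "\<lambda>k. \<bar>F (state k w) - a\<bar>" "2 * b"]] by simp
   moreover have "\<bar>\<Sum>j<l. E j w\<bar> <= (\<Sum>j<l. \<bar>E j w\<bar>)" by (rule sum_abs)
   ultimately show ?thesis unfolding split by linarith
  qed
  have "real n * \<E> (\<lambda>w. \<bar>(\<Sum>k<n. F (state k w)) / real n - a\<bar>) = \<E> (\<lambda>w. \<bar>(\<Sum>k<n. F (state k w)) - real n * a\<bar>)"
  proof -
   have "real n * \<bar>u / real n - a\<bar> = \<bar>u - real n * a\<bar>" for u
   proof -
    have "u - real n * a = real n * (u / real n - a)" using n by (simp add: right_diff_distrib)
    then show ?thesis by (simp only: abs_mult abs_of_nat)
   qed
   then show ?thesis by (simp flip: bochner_integral_mult_right_zero)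
  qed
  also have "... <= \<E> (\<lambda>w. real m * (2 * b) + \<bar>\<Sum>j<l. D j w\<bar> + (\<Sum>j<l. \<bar>E j w\<bar>))"
   using intF intD intE pw by (intro integral_mono) auto
  also have "... = real m * (2 * b) + \<E> (\<lambda>w. \<bar>\<Sum>j<l. D j w\<bar>) + (\<Sum>j<l. \<E> (\<lambda>w. \<bar>E j w\<bar>))"
   using intD intE by (simp add: prob_space)
  also have "... <= real m * (2 * b) + (real n * c / (real n * e / 2) + real n * e / 2) / 2 + real n * (e / 4)"
  proof (intro add_mono order_refl)
   have "0 <= c" by (simp add: c_def)
   then have "real l * c / (real n * e / 2) <= real n * c / (real n * e / 2)"
    using e n nl by (intro divide_right_mono mult_right_mono) auto
   then show "\<E> (\<lambda>w. \<bar>\<Sum>j<l. D j w\<bar>) <= (real n * c / (real n * e / 2) + real n * e / 2) / 2"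
    by (intro order_trans[OF SD[OF order.strict_trans1[OF le0 n]] divide_right_mono[OF add_right_mono]]) simp_all
   have "(\<Sum>j<l. \<E> (\<lambda>w. \<bar>E j w\<bar>)) <= real l * (e / 4)"
    using sum_bounded_above[of "{..<l}" "\<lambda>j. \<E> (\<lambda>w. \<bar>E j w\<bar>)" "e / 4"] EE by simp
   also have "... <= real n * (e / 4)" using e nl by (intro mult_right_mono) auto
   finally show "(\<Sum>j<l. \<E> (\<lambda>w. \<bar>E j w\<bar>)) <= real n * (e / 4)" .
  qed
  also have "... = real n * ((real m * (2 * b) + c / e) / real n + e / 2)"
   using n e by (simp add: field_simps)
  finally show ?thesis using n by simp
 qed
 have "(\<lambda>n. (real m * (2 * b) + c / e) / real n + e / 2) \<longlonglongrightarrow> 0 + e / 2"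
  by (intro tendsto_add tendsto_const lim_const_over_n)
 then have "\<forall>\<^sub>F n in sequentially. (real m * (2 * b) + c / e) / real n + e / 2 < e"
  using e by (elim order_tendstoD(2)) simp
 then have "\<forall>\<^sub>F n in sequentially. \<E> (\<lambda>w. \<bar>(\<Sum>k<n. F (state k w)) / real n - a\<bar>) <= e"
  using eventually_gt_at_top[of m] by eventually_elim (use bound in fastforce)
 then show ?thesis by blast
qed

text \<open>Truncation reduces the claim to bounded functions; bounded second moments make the truncation error small
uniformly in time.\<close>

theorem law_of_large_numbers:
 assumes F: "local F" and int: "\<And>k. integrable M (\<lambda>w. (F (state k w))\<^sup>2)"
  and B: "\<And>k. \<E> (\<lambda>w. (F (state k w))\<^sup>2) <= B"
 shows "\<exists>a. (\<lambda>n. \<E> (\<lambda>w. \<bar>(\<Sum>k<n. F (state k w)) / real n - a\<bar>)) \<longlonglongrightarrow> 0"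
proof (rule L1_limit_from_approx[OF prob_space_axioms])
 have B0: "0 <= B" using order_trans[OF _ B[of 0]] by simp
 have intF: "integrable M (\<lambda>w. F (state k w))" for k
  using int by (rule square_integrable_imp_integrable[OF adapted_borel[OF adapted_state_comp]])
 then show "integrable M (\<lambda>w. (\<Sum>k<n. F (state k w)) / real n)" for n by simp
 fix e :: real assume e: "0 < e"
 \<comment> \<open>At this level the truncation error is at most \<open>B / c \<le> e / 2\<close>.\<close>
 define c where "c = 2 * B / e + 1"
 have c: "0 < c" using B0 e by (simp add: c_def add_nonneg_pos)
 define Fc where "Fc x = max (- c) (min c (F x))" for x
 have Fcb: "\<bar>Fc x\<bar> <= c" for x using c by (auto simp: Fc_def)
 have Fcl: "local Fc" using F unfolding local_def Fc_def by metis
 obtain a where a: "\<forall>\<^sub>F n in sequentially. \<E> (\<lambda>w. \<bar>(\<Sum>k<n. Fc (state k w)) / real n - a\<bar>) <= e / 2"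
  using bounded_average_approx[OF Fcl Fcb, of "e / 2"] e by auto
 have intFc: "integrable M (\<lambda>w. Fc (state k w))" for k
  by (rule integrable_const_bound[where B = c]) (use Fcb in \<open>auto intro!: adapted_borel[OF adapted_state_comp]\<close>)
 have trunc: "\<bar>F x - Fc x\<bar> <= (F x)\<^sup>2 / c" for x
 proof (cases "\<bar>F x\<bar> <= c")
  case True
  then show ?thesis using c by (simp add: Fc_def)
 next
  case False
  then have "\<bar>F x - Fc x\<bar> <= \<bar>F x\<bar>" using c by (auto simp: Fc_def abs_if)
  also have "\<bar>F x\<bar> * c <= \<bar>F x\<bar> * \<bar>F x\<bar>" using False by (intro mult_left_mono) auto
  then have "\<bar>F x\<bar> <= (F x)\<^sup>2 / c" using c by (simp add: field_simps power2_eq_square)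
  finally show ?thesis .
 qed
 have Etr: "\<E> (\<lambda>w. \<bar>F (state k w) - Fc (state k w)\<bar>) <= e / 2" for k
 proof -
  have "\<E> (\<lambda>w. \<bar>F (state k w) - Fc (state k w)\<bar>) <= \<E> (\<lambda>w. (F (state k w))\<^sup>2 / c)"
   using intF intFc int trunc by (intro integral_mono) auto
  also have "... <= B / c" using B c by (simp add: divide_right_mono)
  also have "... <= e / 2" using c e B0 by (simp add: c_def field_simps)
  finally show ?thesis .
 qed
 show "\<exists>a. \<forall>\<^sub>F n in sequentially. \<E> (\<lambda>w. \<bar>(\<Sum>k<n. F (state k w)) / real n - a\<bar>) <= e"
 proof (rule exI[of _ a])
  from a eventually_gt_at_top[of 0]
  show "\<forall>\<^sub>F n in sequentially. \<E> (\<lambda>w. \<bar>(\<Sum>k<n. F (state k w)) / real n - a\<bar>) <= e"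
  proof eventually_elim
   case (elim n)
   have pw: "\<bar>(\<Sum>k<n. F (state k w)) / real n - a\<bar> <= (\<Sum>k<n. \<bar>F (state k w) - Fc (state k w)\<bar>) / real n + \<bar>(\<Sum>k<n. Fc (state k w)) / real n - a\<bar>" for w
   proof -
    have "(\<Sum>k<n. F (state k w)) / real n - a = (\<Sum>k<n. F (state k w) - Fc (state k w)) / real n + ((\<Sum>k<n. Fc (state k w)) / real n - a)"
     by (simp add: sum_subtractf diff_divide_distrib)
    moreover have "\<bar>(\<Sum>k<n. F (state k w) - Fc (state k w)) / real n\<bar> <= (\<Sum>k<n. \<bar>F (state k w) - Fc (state k w)\<bar>) / real n"
     by (simp add: divide_right_mono sum_abs)
    ultimately show ?thesis by linarith
   qed
   have "\<E> (\<lambda>w. \<bar>(\<Sum>k<n. F (state k w)) / real n - a\<bar>) \<le>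
     \<E> (\<lambda>w. (\<Sum>k<n. \<bar>F (state k w) - Fc (state k w)\<bar>) / real n + \<bar>(\<Sum>k<n. Fc (state k w)) / real n - a\<bar>)"
    using pw intF intFc by (intro integral_mono) auto
   also have "... = (\<Sum>k<n. \<E> (\<lambda>w. \<bar>F (state k w) - Fc (state k w)\<bar>)) / real n + \<E> (\<lambda>w. \<bar>(\<Sum>k<n. Fc (state k w)) / real n - a\<bar>)"
    using intF intFc by simp
   also have "(\<Sum>k<n. \<E> (\<lambda>w. \<bar>F (state k w) - Fc (state k w)\<bar>)) / real n <= (real n * (e / 2)) / real n"
    using sum_bounded_above[of "{..<n}" "\<lambda>k. \<E> (\<lambda>w. \<bar>F (state k w) - Fc (state k w)\<bar>)" "e / 2"] Etr
    by (intro divide_right_mono) auto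
   finally show ?case using elim by simp
  qed
 qed
qed

end

section \<open>Convergence in probability as a filter\<close>

text \<open>With high probability: \<open>P\<close> holds eventually along this filter iff, for every \<open>e > 0\<close> and all large \<open>n\<close>,
\<open>P (n, w)\<close> holds for all \<open>w\<close> outside an event of probability at most \<open>e\<close>. Convergence in probability
of \<open>f n\<close> is then a limit of \<open>\<lambda>(n, w). f n w\<close> along \<open>whp\<close>, which is meaningful without measurability and
makes the general limit rules available.\<close>

definition whp :: "'a measure => (nat \<times> 'a) filter" where
 "whp M = Abs_filter (\<lambda>P. \<forall>e>0. \<forall>\<^sub>F n in sequentially.
  \<exists>A\<in>sets M. measure M A <= e \<and> (\<forall>w\<in>space M - A. P (n, w)))"

lemma eventually_whp:
 "eventually P (whp M) \<longleftrightarrow> (\<forall>e>0. \<forall>\<^sub>F n in sequentially.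
  \<exists>A\<in>sets M. measure M A <= e \<and> (\<forall>w\<in>space M - A. P (n, w)))"
proof -
 let ?T = "\<lambda>P e. \<forall>\<^sub>F n in sequentially. \<exists>A\<in>sets M. measure M A <= e \<and> (\<forall>w\<in>space M - A. P (n, w))"
 show ?thesis unfolding whp_def
 proof (rule eventually_Abs_filter, rule is_filter.intro)
  show "\<forall>e>0. ?T (\<lambda>_. True) e"
   by (auto intro!: always_eventually bexI[of _ "{}"])
 next
  fix P Q :: "nat \<times> 'a => bool"
  assume P: "\<forall>e>0. ?T P e"
   and Q: "\<forall>e>0. ?T Q e"
  show "\<forall>e>0. ?T (\<lambda>z. P z \<and> Q z) e"
  proof (intro allI impI)
   fix e :: real assume "0 < e"
   then have e: "0 < e / 2" by simp
   from P[rule_format, OF e] Q[rule_format, OF e]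
   show "?T (\<lambda>z. P z \<and> Q z) e"
   proof eventually_elim
    case (elim n)
    then obtain A B where "A \<in> sets M" "measure M A <= e / 2" "\<forall>w\<in>space M - A. P (n, w)"
     "B \<in> sets M" "measure M B <= e / 2" "\<forall>w\<in>space M - B. Q (n, w)" by blast
    then show ?case using measure_Un_le[of A M B] by (intro bexI[of _ "A \<union> B"]) auto
   qed
  qed
 next
  fix P Q :: "nat \<times> 'a => bool"
  assume PQ: "\<forall>x. P x \<longrightarrow> Q x"
   and P: "\<forall>e>0. ?T P e"
  show "\<forall>e>0. ?T Q e"
  proof (intro allI impI)
   fix e :: real assume "0 < e"
   with P have "?T P e" by blast
   then show "?T Q e"
    by eventually_elim (use PQ in blast)
  qed
 qed
qed

lemma eventually_whp_sure:
 "\<forall>\<^sub>F n in sequentially. \<forall>w\<in>space M. P (n, w) ==> eventually P (whp M)"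
 unfolding eventually_whp by (auto elim!: eventually_mono intro!: bexI[of _ "{}"])

lemma tendsto_whp_deterministic:
 "(f \<longlongrightarrow> c) sequentially ==> ((\<lambda>z. f (fst z)) \<longlongrightarrow> c) (whp M)"
 by (rule topological_tendstoI, rule eventually_whp_sure) (auto dest: topological_tendstoD elim: eventually_mono)

context prob_space
begin

lemma whp_Markov:
 fixes f :: "nat => 'a => real"
 assumes int: "\<And>n. integrable M (f n)" and nn: "\<And>n w. 0 <= f n w" and d: "0 < d"
  and lim: "(\<lambda>n. \<E> (f n)) \<longlonglongrightarrow> 0"
 shows "\<forall>\<^sub>F z in whp M. f (fst z) (snd z) < d"
 unfolding eventually_whp
proof (intro allI impI)
 fix e :: real assume "0 < e"
 then have "\<forall>\<^sub>F n in sequentially. \<E> (f n) < d * e" using d lim by (intro order_tendstoD(2)) auto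
 then show "\<forall>\<^sub>F n in sequentially. \<exists>A\<in>events. prob A <= e \<and> (\<forall>w\<in>space M - A. f (fst (n, w)) (snd (n, w)) < d)"
 proof eventually_elim
  case (elim n)
  have m: "f n \<in> borel_measurable M" using int by simp
  have "prob {w \<in> space M. d <= f n w} <= \<E> (f n) / d"
   by (rule integral_Markov_inequality_measure[OF int sets.top _ d]) (use nn in auto)
  also have "... <= e" using elim d by (simp add: field_simps)
  finally show ?case using m by (intro bexI[of _ "{w \<in> space M. d <= f n w}"]) auto
 qed
qed

lemma tendsto_whp_L1:
 fixes f :: "nat => 'a => real"
 assumes int: "\<And>n. integrable M (f n)" and lim: "(\<lambda>n. \<E> (\<lambda>w. \<bar>f n w - c\<bar>)) \<longlonglongrightarrow> 0"
 shows "((\<lambda>z. f (fst z) (snd z)) \<longlongrightarrow> c) (whp M)"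
proof (rule tendstoI)
 fix d :: real assume "0 < d"
 then show "\<forall>\<^sub>F z in whp M. dist (f (fst z) (snd z)) c < d"
  unfolding dist_real_def by (intro whp_Markov[where f = "\<lambda>n w. \<bar>f n w - c\<bar>"] lim) (use int in auto)
qed

lemma whp_bounded_convergence:
 fixes f :: "nat => 'a => real"
 assumes meas: "\<And>n. f n \<in> borel_measurable M" and bound: "\<And>n w. w \<in> space M ==> \<bar>f n w\<bar> <= B"
  and lim: "((\<lambda>z. f (fst z) (snd z)) \<longlongrightarrow> 0) (whp M)"
 shows "(\<lambda>n. \<E> (\<lambda>w. \<bar>f n w\<bar>)) \<longlonglongrightarrow> 0"
proof (rule tendstoI)
 fix e :: real assume e: "0 < e"
 obtain w0 where "w0 \<in> space M" using not_empty by blast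
 then have B: "0 <= B" using bound[of w0 0] by linarith
 have int: "integrable M (\<lambda>w. \<bar>f n w\<bar>)" for n
  by (rule integrable_const_bound[where B = B]) (use meas bound in auto)
 define d where "d = e / (2 * (B + 1))"
 have d: "0 < d" using e B by (simp add: d_def)
 have "\<forall>\<^sub>F z in whp M. dist (f (fst z) (snd z)) 0 < e / 2" using lim e by (intro tendstoD) auto
 then have "\<forall>\<^sub>F n in sequentially. \<exists>A\<in>events. prob A <= d \<and> (\<forall>w\<in>space M - A. \<bar>f n w\<bar> < e / 2)"
  using d unfolding eventually_whp by (simp add: dist_real_def)
 then show "\<forall>\<^sub>F n in sequentially. dist (\<E> (\<lambda>w. \<bar>f n w\<bar>)) 0 < e"
 proof eventually_elim
  case (elim n)
  then obtain A where A: "A \<in> events" "prob A <= d" "\<And>w. w \<in> space M - A ==> \<bar>f n w\<bar> < e / 2" by blast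
  have "\<E> (\<lambda>w. \<bar>f n w\<bar>) <= \<E> (\<lambda>w. e / 2 + B * indicator A w)"
  proof (rule integral_mono[OF int])
   show "integrable M (\<lambda>w. e / 2 + B * indicator A w)"
    using A(1) by (intro bochner_integrable_add integrable_const integrable_mult_right integrable_real_indicator)
     (auto simp: emeasure_eq_measure less_top)
   show "\<bar>f n w\<bar> <= e / 2 + B * indicator A w" if "w \<in> space M" for w
    using A(3)[of w] bound[OF that, of n] that e by (cases "w \<in> A") auto
  qed
  also have "... = e / 2 + B * prob A"
  proof -
   have "integrable M (indicat_real A)"
    using A(1) by (intro integrable_real_indicator) (auto simp: emeasure_eq_measure less_top)
   then show ?thesis using sets.sets_into_space[OF A(1)] by (simp add: prob_space Int_absorb2)
  qed
  also have "... <= e / 2 + B * d" using A(2) B by (simp add: mult_left_mono)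
  also have "B * d < e / 2" using B e by (simp add: d_def field_simps)
  finally show ?case by simp
 qed
qed

end

lemma abs_cube_times_le: "\<bar>x ^ 3 * y\<bar> <= x ^ 4 + y ^ 4" for x y :: real
proof -
 have "\<bar>x\<bar> ^ 3 * \<bar>y\<bar> <= \<bar>x\<bar> ^ 4 + \<bar>y\<bar> ^ 4"
 proof (cases "\<bar>y\<bar> <= \<bar>x\<bar>")
  case True
  then have "\<bar>x\<bar> ^ 3 * \<bar>y\<bar> <= \<bar>x\<bar> ^ 3 * \<bar>x\<bar>" by (intro mult_left_mono) auto
  also have "... = \<bar>x\<bar> ^ 4" by (simp add: power_numeral_reduce)
  finally show ?thesis by (simp add: add_increasing2)
 next
  case False
  then have "\<bar>x\<bar> ^ 3 * \<bar>y\<bar> <= \<bar>y\<bar> ^ 3 * \<bar>y\<bar>" by (intro mult_right_mono power_mono) auto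
  also have "... = \<bar>y\<bar> ^ 4" by (simp add: power_numeral_reduce)
  finally show ?thesis by (simp add: add_increasing)
 qed
 then show ?thesis by (simp add: abs_mult power_abs power_even_abs)
qed

text \<open>Young's inequality with a weight that depends on \<open>n\<close>: summing these bounds over \<open>n\<close>
steps yields quadratic growth of fourth moments.\<close>

lemma power4_sum_refined:
 fixes x y n :: real
 assumes "0 < n"
 shows "(x + y) ^ 4 <= (1 + 1 / n) * x ^ 4 + 4 * (x ^ 3 * y) + (16 * n + 3) * y ^ 4"
proof -
 have "0 <= (x\<^sup>2 - 4 * n * y\<^sup>2)\<^sup>2 / n + 2 * (y * (x - y))\<^sup>2" using assms by (intro add_nonneg_nonneg divide_nonneg_pos) auto
 also have "... = (1 + 1 / n) * x ^ 4 + 4 * (x ^ 3 * y) + (16 * n + 3) * y ^ 4 - (x + y) ^ 4"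
  using assms by (simp add: field_simps power_numeral_reduce)
 finally show ?thesis by simp
qed

lemma power4_sum_le: "(x + y) ^ 4 <= 8 * (x ^ 4 + y ^ 4)" for x y :: real
proof -
 have "(x + y)\<^sup>2 <= 2 * (x\<^sup>2 + y\<^sup>2)" using sum_squares_bound[of x y] by (simp add: power2_sum)
 then have "((x + y)\<^sup>2)\<^sup>2 <= (2 * (x\<^sup>2 + y\<^sup>2))\<^sup>2" by (intro power_mono) auto
 also have "... <= 8 * ((x\<^sup>2)\<^sup>2 + (y\<^sup>2)\<^sup>2)" using sum_squares_bound[of "x\<^sup>2" "y\<^sup>2"] by (simp add: power2_sum power_mult_distrib)
 finally show ?thesis by (simp add: power_mult[symmetric])
qed

lemma power4_tangent: "x ^ 4 + 4 * (x ^ 3 * y) <= (x + y) ^ 4" for x y :: real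
proof -
 have "0 <= y\<^sup>2 * (2 * x\<^sup>2 + (2 * x + y)\<^sup>2)" by simp
 also have "... = (x + y) ^ 4 - (x ^ 4 + 4 * (x ^ 3 * y))" by (simp add: algebra_simps power_numeral_reduce)
 finally show ?thesis by simp
qed

section \<open>Moment inequalities for martingales\<close>

locale filtered_prob_space = prob_space M for M :: "'a measure" +
 fixes F :: "nat => 'a measure"
 assumes subalgebra_filtration: "subalgebra M (F k)"
  and filtration_mono: "k <= l ==> subalgebra (F l) (F k)"
begin

lemma measurable_filtration_mono:
 "f \<in> borel_measurable (F k) ==> k <= l ==> f \<in> borel_measurable (F l)"
 by (rule measurable_from_subalg[OF filtration_mono])

lemma measurable_filtration: "f \<in> borel_measurable (F k) ==> f \<in> borel_measurable M"
 by (rule measurable_from_subalg[OF subalgebra_filtration])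

lemma space_filtration[simp]: "space (F k) = space M"
 using subalgebra_filtration by (simp add: subalgebra_def)

text \<open>The conditional expectation of \<open>d\<close> given \<open>F k\<close> vanishes, expressed by orthogonality. Unbounded test
functions are admitted because the fourth moment bound tests with powers of the martingale.\<close>

definition centred :: "nat => ('a => real) => bool" where
 "centred k d \<longleftrightarrow> (\<forall>a\<in>borel_measurable (F k). integrable M (\<lambda>w. a w * d w) \<longrightarrow> \<E> (\<lambda>w. a w * d w) = 0)"

lemma centredD:
 "centred k d ==> a \<in> borel_measurable (F k) ==> integrable M (\<lambda>w. a w * d w) ==> \<E> (\<lambda>w. a w * d w) = 0"
 by (simp add: centred_def)

lemma measurable_partial_sum:
 assumes "\<And>k. d k \<in> borel_measurable (F (Suc k))"
 shows "(\<lambda>w. \<Sum>k\<in>{a..<a + n}. d k w :: real) \<in> borel_measurable (F (a + n))"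
 by (intro borel_measurable_sum measurable_filtration_mono[OF assms]) auto

lemma martingale_square_moment:
 fixes d :: "nat => 'a => real"
 assumes meas: "\<And>k. d k \<in> borel_measurable (F (Suc k))" and cent: "\<And>k. centred k (d k)"
  and int: "\<And>k. integrable M (\<lambda>w. (d k w)\<^sup>2)" and K: "\<And>k. \<E> (\<lambda>w. (d k w)\<^sup>2) <= K"
 shows "integrable M (\<lambda>w. (\<Sum>k<n. d k w)\<^sup>2)" "\<E> (\<lambda>w. (\<Sum>k<n. d k w)\<^sup>2) <= K * real n"
proof (induction n)
 case (Suc n)
 let ?S = "\<lambda>w. \<Sum>k<n. d k w"
 have mS: "?S \<in> borel_measurable (F n)"
  using measurable_partial_sum[of d 0 n, OF meas] by (simp add: lessThan_atLeast0)
 note mS' = measurable_filtration[OF mS] and mD = measurable_filtration[OF meas[of n]]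
 have iSd: "integrable M (\<lambda>w. ?S w * d n w)"
 proof (rule bochner_integrable_bound)
  show "integrable M (\<lambda>w. (?S w)\<^sup>2 + (d n w)\<^sup>2)" using Suc(1) int by (rule bochner_integrable_add)
  show "(\<lambda>w. ?S w * d n w) \<in> borel_measurable M" using mS' mD by simp
  have "\<bar>x * y\<bar> <= x\<^sup>2 + y\<^sup>2" for x y :: real
   using sum_squares_bound[of "\<bar>x\<bar>" "\<bar>y\<bar>"] mult_nonneg_nonneg[OF abs_ge_zero abs_ge_zero, of x y]
   by (simp only: abs_mult power2_abs mult.assoc)
  then show "AE w in M. norm (?S w * d n w) <= norm ((?S w)\<^sup>2 + (d n w)\<^sup>2)" by simp
 qed
 have eq: "(\<Sum>k<Suc n. d k w)\<^sup>2 = (?S w)\<^sup>2 + 2 * (?S w * d n w) + (d n w)\<^sup>2" for w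
  by (simp add: power2_sum)
 show "integrable M (\<lambda>w. (\<Sum>k<Suc n. d k w)\<^sup>2)" unfolding eq using Suc(1) iSd int by simp
 have "\<E> (\<lambda>w. (\<Sum>k<Suc n. d k w)\<^sup>2) = \<E> (\<lambda>w. (?S w)\<^sup>2) + \<E> (\<lambda>w. (d n w)\<^sup>2)"
  unfolding eq using Suc(1) iSd int centredD[OF cent mS iSd] by simp
 then show "\<E> (\<lambda>w. (\<Sum>k<Suc n. d k w)\<^sup>2) <= K * real (Suc n)" using Suc(2) K[of n] by (simp add: algebra_simps)
qed simp_all

text \<open>Induction on \<open>n\<close> with \<open>power4_sum_refined\<close>; the cubic cross term has expectation zero.\<close>

lemma martingale_fourth_moment:
 fixes d :: "nat => 'a => real"
 assumes meas: "\<And>k. d k \<in> borel_measurable (F (Suc k))" and cent: "\<And>k. centred k (d k)"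
  and int: "\<And>k. integrable M (\<lambda>w. d k w ^ 4)" and K: "\<And>k. \<E> (\<lambda>w. d k w ^ 4) <= K"
 shows "integrable M (\<lambda>w. (\<Sum>k\<in>{a..<a + n}. d k w) ^ 4)"
  "\<E> (\<lambda>w. (\<Sum>k\<in>{a..<a + n}. d k w) ^ 4) <= 16 * K * (real n)\<^sup>2"
proof (induction n)
 case (Suc n)
 let ?S = "\<lambda>w. \<Sum>k\<in>{a..<a + n}. d k w"
 have K0: "0 <= K" using order_trans[OF _ K[of 0]] by simp
 have mS: "?S \<in> borel_measurable (F (a + n))" by (rule measurable_partial_sum[OF meas])
 note mS' = measurable_filtration[OF mS] and mD = measurable_filtration[OF meas[of "a + n"]]
 have iSd: "integrable M (\<lambda>w. ?S w ^ 3 * d (a + n) w)"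
 proof (rule bochner_integrable_bound)
  show "integrable M (\<lambda>w. ?S w ^ 4 + d (a + n) w ^ 4)" using Suc(1) int by (rule bochner_integrable_add)
  show "(\<lambda>w. ?S w ^ 3 * d (a + n) w) \<in> borel_measurable M" using mS' mD by simp
  show "AE w in M. norm (?S w ^ 3 * d (a + n) w) <= norm (?S w ^ 4 + d (a + n) w ^ 4)"
   using abs_cube_times_le by simp
 qed
 have sum_Suc: "(\<Sum>k\<in>{a..<a + Suc n}. d k w) = ?S w + d (a + n) w" for w by simp
 show int': "integrable M (\<lambda>w. (\<Sum>k\<in>{a..<a + Suc n}. d k w) ^ 4)"
  unfolding sum_Suc
 proof (rule bochner_integrable_bound)
  show "integrable M (\<lambda>w. 8 * (?S w ^ 4 + d (a + n) w ^ 4))" using Suc(1) int by simp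
  show "(\<lambda>w. (?S w + d (a + n) w) ^ 4) \<in> borel_measurable M" using mS' mD by simp
  show "AE w in M. norm ((?S w + d (a + n) w) ^ 4) <= norm (8 * (?S w ^ 4 + d (a + n) w ^ 4))"
   using power4_sum_le by simp
 qed
 show "\<E> (\<lambda>w. (\<Sum>k\<in>{a..<a + Suc n}. d k w) ^ 4) <= 16 * K * (real (Suc n))\<^sup>2"
 proof (cases "n = 0")
  case True
  then show ?thesis using K[of a] K0 by simp
 next
  case False
  then have n: "0 < real n" by simp
  have "\<E> (\<lambda>w. (\<Sum>k\<in>{a..<a + Suc n}. d k w) ^ 4) \<le>
    \<E> (\<lambda>w. (1 + 1 / real n) * ?S w ^ 4 + 4 * (?S w ^ 3 * d (a + n) w) + (16 * real n + 3) * d (a + n) w ^ 4)"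
   unfolding sum_Suc using Suc(1) int iSd int'[unfolded sum_Suc] power4_sum_refined[OF n] by (intro integral_mono) auto
  also have "... = (1 + 1 / real n) * \<E> (\<lambda>w. ?S w ^ 4) + (16 * real n + 3) * \<E> (\<lambda>w. d (a + n) w ^ 4)"
   using Suc(1) int iSd centredD[OF cent, of "\<lambda>w. ?S w ^ 3" "a + n", OF borel_measurable_power[OF mS] iSd] by simp
  also have "... <= (1 + 1 / real n) * (16 * K * (real n)\<^sup>2) + (16 * real n + 3) * K"
   using Suc(2) K[of "a + n"] n by (intro add_mono mult_left_mono) auto
  also have "... <= 16 * K * (real (Suc n))\<^sup>2"
   using n K0 by (simp add: field_simps power2_eq_square)
  finally show ?thesis .
 qed
qed simp_all

text \<open>Doob's argument: split the event according to the first passage of the level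
\<open>l\<close>. On the event of first passage at time \<open>k\<close> the fourth power of the final value lies above the tangent at
the value at time \<open>k\<close>, and the linear term has expectation zero.\<close>

lemma martingale_maximal_inequality:
 fixes d :: "nat => 'a => real"
 assumes meas: "\<And>k. d k \<in> borel_measurable (F (Suc k))" and cent: "\<And>k. centred k (d k)"
  and int: "\<And>k. integrable M (\<lambda>w. d k w ^ 4)" and K: "\<And>k. \<E> (\<lambda>w. d k w ^ 4) <= K" and l: "0 < l"
 shows "{w \<in> space M. \<exists>k\<le>n. l < \<bar>\<Sum>j\<in>{a..<a + k}. d j w\<bar>} \<in> events"
  "prob {w \<in> space M. \<exists>k\<le>n. l < \<bar>\<Sum>j\<in>{a..<a + k}. d j w\<bar>} <= 16 * K * (real n)\<^sup>2 / l ^ 4"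
proof -
 let ?S = "\<lambda>k w. \<Sum>j\<in>{a..<a + k}. d j w"
 let ?E = "{w \<in> space M. \<exists>k\<le>n. l < \<bar>?S k w\<bar>}"
 define A where "A k = {w \<in> space M. l < \<bar>?S k w\<bar> \<and> (\<forall>i<k. \<bar>?S i w\<bar> <= l)}" for k
 note four = martingale_fourth_moment[OF meas cent int K]
 have mS: "?S i \<in> borel_measurable (F (a + k))" if "i <= k" for i k
  by (rule measurable_filtration_mono[OF measurable_partial_sum[OF meas]]) (use that in simp)
 have mSM: "?S k \<in> borel_measurable M" for k by (rule measurable_filtration[OF mS[OF order_refl]])
 show E: "?E \<in> events" using mSM by measurable
 have AF: "A k \<in> sets (F (a + k))" for k
 proof -
  have G: "{w \<in> space (F (a + k)). l < \<bar>?S i w\<bar>} \<in> sets (F (a + k))" if "i <= k" for i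
   by (rule borel_measurable_less[OF borel_measurable_const borel_measurable_abs[OF mS[OF that]]])
  have "A k = {w \<in> space (F (a + k)). l < \<bar>?S k w\<bar>} - (\<Union>i\<in>{..<k}. {w \<in> space (F (a + k)). l < \<bar>?S i w\<bar>})"
   unfolding A_def space_filtration by (auto simp only: not_less)
  also have "... \<in> sets (F (a + k))" by (intro sets.Diff sets.finite_UN G) (auto intro: less_imp_le)
  finally show ?thesis .
 qed
 then have AM: "A k \<in> events" for k using subalgebra_filtration[of "a + k"] unfolding subalgebra_def by blast
 have indF: "(\<lambda>w. indicator (A k) w * ?S k w ^ 3 :: real) \<in> borel_measurable (F (a + k))" for k
  by (rule borel_measurable_times[OF borel_measurable_indicator[OF AF] borel_measurable_power[OF mS[OF order_refl]]])
 have cross_int: "integrable M (\<lambda>w. (indicator (A k) w * ?S k w ^ 3) * d j w)" for k j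
 proof (rule bochner_integrable_bound)
  show "integrable M (\<lambda>w. ?S k w ^ 4 + d j w ^ 4)" using four(1) int by (rule bochner_integrable_add)
  show "(\<lambda>w. indicator (A k) w * ?S k w ^ 3 * d j w) \<in> borel_measurable M"
   using measurable_filtration[OF indF] measurable_filtration[OF meas] by (rule borel_measurable_times)
  show "AE w in M. norm (indicator (A k) w * ?S k w ^ 3 * d j w) <= norm (?S k w ^ 4 + d j w ^ 4)"
   using abs_cube_times_le by (auto simp: indicator_def)
 qed
 have cross: "\<E> (\<lambda>w. (indicator (A k) w * ?S k w ^ 3) * d j w) = 0" if "a + k <= j" for k j
  by (rule centredD[OF cent measurable_filtration_mono[OF indF that] cross_int])
 have disj: "disjoint_family_on A {..n}"
  unfolding disjoint_family_on_def
 proof (intro ballI impI)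
  fix i j :: nat assume "i \<noteq> j"
  then have "i < j \<or> j < i" by auto
  then show "A i \<inter> A j = {}" by (auto simp: A_def)
 qed
 have cover: "?E = (\<Union>k\<le>n. A k)"
 proof
  show "?E \<subseteq> (\<Union>k\<le>n. A k)"
  proof
   fix w assume w: "w \<in> ?E"
   then obtain k where k: "k <= n" "l < \<bar>?S k w\<bar>" by blast
   define k0 where "k0 = (LEAST k. l < \<bar>?S k w\<bar>)"
   have "l < \<bar>?S k0 w\<bar>" unfolding k0_def by (rule LeastI[of "\<lambda>k. l < \<bar>?S k w\<bar>", OF k(2)])
   moreover have "k0 <= k" unfolding k0_def by (rule Least_le[of "\<lambda>k. l < \<bar>?S k w\<bar>", OF k(2)])
   moreover have "\<bar>?S i w\<bar> <= l" if "i < k0" for i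
    using not_less_Least[of i "\<lambda>k. l < \<bar>?S k w\<bar>"] that unfolding k0_def by simp
   ultimately show "w \<in> (\<Union>k\<le>n. A k)" using w k(1) by (auto simp: A_def)
  qed
 qed (auto simp: A_def)
 have pw: "l ^ 4 * (\<Sum>k\<le>n. indicator (A k) w) + 4 * (\<Sum>k\<le>n. \<Sum>j\<in>{a + k..<a + n}. (indicator (A k) w * ?S k w ^ 3) * d j w) <= ?S n w ^ 4" for w
 proof -
  have one: "l ^ 4 * indicator (A k) w + 4 * (\<Sum>j\<in>{a + k..<a + n}. (indicator (A k) w * ?S k w ^ 3) * d j w) <= ?S n w ^ 4 * indicator (A k) w"
   if "k <= n" for k
  proof (cases "w \<in> A k")
   case True
   then have "l <= \<bar>?S k w\<bar>" by (simp add: A_def)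
   then have "l ^ 4 <= \<bar>?S k w\<bar> ^ 4" using l by (intro power_mono) auto
   then have "l ^ 4 <= ?S k w ^ 4" by (simp add: power_even_abs)
   moreover have "?S n w = ?S k w + (\<Sum>j\<in>{a + k..<a + n}. d j w)"
    using that by (subst sum.atLeastLessThan_concat) auto
   ultimately show ?thesis
    using True power4_tangent[of "?S k w" "\<Sum>j\<in>{a + k..<a + n}. d j w"] by (simp add: sum_distrib_left[symmetric])
  qed simp
  have "(\<Sum>k\<le>n. l ^ 4 * indicator (A k) w + 4 * (\<Sum>j\<in>{a + k..<a + n}. (indicator (A k) w * ?S k w ^ 3) * d j w)) <= (\<Sum>k\<le>n. ?S n w ^ 4 * indicator (A k) w)"
   by (intro sum_mono one) simp
  also have "... = ?S n w ^ 4 * indicator (\<Union>k\<le>n. A k) w"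
  proof -
   have "indicator (\<Union>k\<le>n. A k) w = (\<Sum>k\<le>n. indicator (A k) w :: real)"
    by (rule indicator_UN_disjoint[OF _ disj]) simp
   then show ?thesis by (simp only: sum_distrib_left)
  qed
  also have "... <= ?S n w ^ 4" by (simp add: indicator_def)
  finally show ?thesis by (simp add: sum.distrib sum_distrib_left)
 qed
 let ?I = "\<lambda>w. \<Sum>k\<le>n. indicat_real (A k) w"
 let ?C = "\<lambda>w. \<Sum>k\<le>n. \<Sum>j\<in>{a + k..<a + n}. (indicator (A k) w * ?S k w ^ 3) * d j w"
 have iA: "integrable M (indicat_real (A k))" for k
  using AM[of k] by (intro integrable_real_indicator) (auto simp: emeasure_eq_measure less_top)
 have EA: "\<E> (indicat_real (A k)) = prob (A k)" for k
  using sets.sets_into_space[OF AM[of k]] by (simp add: Int_absorb2)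
 have iI: "integrable M ?I" by (rule bochner_integrable_sum, rule iA)
 have iC: "integrable M ?C" by (intro bochner_integrable_sum cross_int)
 have EI: "\<E> ?I = prob ?E"
 proof -
  have "\<E> ?I = (\<Sum>k\<le>n. prob (A k))" by (simp only: bochner_integral_sum iA EA)
  also have "... = prob (\<Union>k\<le>n. A k)" using AM disj by (intro finite_measure_finite_Union[symmetric]) auto
  finally show ?thesis unfolding cover .
 qed
 have EC: "\<E> ?C = 0"
 proof -
  have "\<E> ?C = (\<Sum>k\<le>n. \<Sum>j\<in>{a + k..<a + n}. \<E> (\<lambda>w. (indicator (A k) w * ?S k w ^ 3) * d j w))"
   by (simp only: bochner_integral_sum bochner_integrable_sum cross_int)
  also have "... = 0" by (intro sum.neutral ballI) (rule cross, simp)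
  finally show ?thesis .
 qed
 have i4: "integrable M (\<lambda>w. l ^ 4 * ?I w)" "integrable M (\<lambda>w. 4 * ?C w)"
  by (rule integrable_mult_right[OF iI], rule integrable_mult_right[OF iC])
 have "l ^ 4 * prob ?E = \<E> (\<lambda>w. l ^ 4 * ?I w) + \<E> (\<lambda>w. 4 * ?C w)"
  unfolding integral_mult_right_zero EI EC by simp
 also have "... = \<E> (\<lambda>w. l ^ 4 * ?I w + 4 * ?C w)" by (rule bochner_integral_add[OF i4, symmetric])
 also have "... <= \<E> (\<lambda>w. ?S n w ^ 4)"
  by (rule integral_mono[OF bochner_integrable_add[OF i4] four(1) pw])
 also have "... <= 16 * K * (real n)\<^sup>2" by (rule four(2))
 finally show "prob ?E <= 16 * K * (real n)\<^sup>2 / l ^ 4" using l by (simp add: field_simps)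
qed

end

section \<open>A martingale central limit theorem\<close>

text \<open>The upper bound follows from \<open>(1 - u + u\<^sup>2 / 2) * (1 + u + u\<^sup>2 / 2) \<ge> 1\<close>.\<close>

lemma exp_neg_quadratic_bound:
 fixes u :: real assumes "0 <= u"
 shows "\<bar>exp (- u) - 1 + u\<bar> <= u\<^sup>2 / 2"
proof -
 have q: "1 + u + u\<^sup>2 / 2 <= exp u" using assms by (rule exp_lower_Taylor_quadratic)
 have p: "0 < 1 - u + u\<^sup>2 / 2"
 proof -
  have "1 - u + u\<^sup>2 / 2 = ((u - 1)\<^sup>2 + 1) / 2" by (simp add: power2_diff field_simps)
  moreover have "0 < ((u - 1)\<^sup>2 + 1) / 2" by (simp add: add_nonneg_pos)
  ultimately show ?thesis by (simp only:)
 qed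
 have "1 <= (1 - u + u\<^sup>2 / 2) * (1 + u + u\<^sup>2 / 2)"
 proof -
  have "(1 - u + u\<^sup>2 / 2) * (1 + u + u\<^sup>2 / 2) = 1 + (u\<^sup>2)\<^sup>2 / 4" by (simp add: field_simps power2_eq_square)
  moreover have "1 <= 1 + (u\<^sup>2)\<^sup>2 / 4" by simp
  ultimately show ?thesis by (simp only:)
 qed
 also have "... <= (1 - u + u\<^sup>2 / 2) * exp u" using q p by (intro mult_left_mono) auto
 finally have "exp (- u) <= 1 - u + u\<^sup>2 / 2" by (simp add: exp_minus field_simps)
 moreover have "1 - u <= exp (- u)" using exp_ge_add_one_self[of "- u"] by simp
 ultimately show ?thesis by (simp add: abs_le_iff)
qed

context filtered_prob_space
begin

lemma centred_complex:
 fixes a :: "'a => complex"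
 assumes c: "centred k g" and g: "integrable M g" and a: "a \<in> borel_measurable (F k)" "\<And>w. w \<in> space M ==> norm (a w) <= A"
 shows "integrable M (\<lambda>w. a w * of_real (g w))" "\<E> (\<lambda>w. a w * of_real (g w)) = 0"
proof -
 have am: "a \<in> borel_measurable M" by (rule measurable_from_subalg[OF subalgebra_filtration a(1)])
 have A: "0 <= A" using a(2) not_empty norm_ge_zero order_trans by blast
 show int: "integrable M (\<lambda>w. a w * of_real (g w))"
 proof (rule bochner_integrable_bound)
  show "integrable M (\<lambda>w. A * g w)" using g by simp
  show "(\<lambda>w. a w * of_real (g w)) \<in> borel_measurable M" using am g by simp
  show "AE w in M. norm (a w * of_real (g w)) <= norm (A * g w)"
   using a(2) A by (intro AE_I2) (auto simp: norm_mult abs_mult intro!: mult_right_mono)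
 qed
 have "Re (\<E> (\<lambda>w. a w * of_real (g w))) = \<E> (\<lambda>w. Re (a w) * g w)"
  using integral_Re[OF int] by simp
 also have "... = 0"
 proof (rule centredD[OF c])
  show "(\<lambda>w. Re (a w)) \<in> borel_measurable (F k)" using a(1) by simp
  show "integrable M (\<lambda>w. Re (a w) * g w)" using integrable_Re[OF int] by simp
 qed
 finally have re: "Re (\<E> (\<lambda>w. a w * of_real (g w))) = 0" .
 have "Im (\<E> (\<lambda>w. a w * of_real (g w))) = \<E> (\<lambda>w. Im (a w) * g w)"
  using integral_Im[OF int] by simp
 also have "... = 0"
 proof (rule centredD[OF c])
  show "(\<lambda>w. Im (a w)) \<in> borel_measurable (F k)" using a(1) by simp
  show "integrable M (\<lambda>w. Im (a w) * g w)" using integrable_Im[OF int] by simp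
 qed
 finally show "\<E> (\<lambda>w. a w * of_real (g w)) = 0" using re by (simp add: complex_eq_iff)
qed

text \<open>Both exponentials agree up to second order in conditional expectation, as
\<open>d\<close> is centred and \<open>v\<close> is the conditional variance. The factor \<open>a\<close> contains everything known at time \<open>k\<close>.\<close>

lemma characteristic_step:
 fixes a :: "'a => complex" and d v :: "'a => real"
 assumes d: "d \<in> borel_measurable M" "centred k d" "integrable M (\<lambda>w. \<bar>d w\<bar> ^ 3)"
  and v: "v \<in> borel_measurable M" "\<And>w. 0 <= v w" "integrable M (\<lambda>w. (v w)\<^sup>2)"
  and dv: "centred k (\<lambda>w. (d w)\<^sup>2 - v w)"
  and a: "a \<in> borel_measurable (F k)" "\<And>w. w \<in> space M ==> norm (a w) <= A"
 shows "norm (\<E> (\<lambda>w. a w * (iexp (d w) - of_real (exp (- v w / 2))))) \<le>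
  A * (\<E> (\<lambda>w. \<bar>d w\<bar> ^ 3) / 6 + \<E> (\<lambda>w. (v w)\<^sup>2) / 8)"
proof -
 have am[measurable]: "a \<in> borel_measurable M" by (rule measurable_from_subalg[OF subalgebra_filtration a(1)])
 note [measurable] = d(1) v(1)
 have A: "0 <= A" using a(2) not_empty norm_ge_zero order_trans by blast
 have low: "\<bar>x\<bar> ^ j <= 1 + \<bar>x\<bar> ^ 3" if "j <= 3" for x :: real and j
  using that by (rule abs_power_le_one_plus)
 have d1: "integrable M d"
  by (rule bochner_integrable_bound[OF bochner_integrable_add[OF integrable_const[of 1] d(3)]])
   (use low[of 1] in auto)
 have d2: "integrable M (\<lambda>w. (d w)\<^sup>2)"
  by (rule bochner_integrable_bound[OF bochner_integrable_add[OF integrable_const[of 1] d(3)]])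
   (use low[of 2] in auto)
 have v1: "integrable M v" using v(1,3) by (rule square_integrable_imp_integrable)
 define R where "R w = (iexp (d w) - (\<Sum>j\<le>2. (\<i> * of_real (d w)) ^ j / fact j)) - of_real (exp (- v w / 2) - 1 + v w / 2)" for w
 have Rb: "norm (R w) <= \<bar>d w\<bar> ^ 3 / 6 + (v w)\<^sup>2 / 8" for w
 proof -
  have "norm (iexp (d w) - (\<Sum>j\<le>2. (\<i> * of_real (d w)) ^ j / fact j)) <= \<bar>d w\<bar> ^ 3 / 6"
   using iexp_approx1[of "d w" 2] by (simp add: eval_nat_numeral)
  moreover have "norm (complex_of_real (exp (- v w / 2) - 1 + v w / 2)) <= (v w)\<^sup>2 / 8"
   using exp_neg_quadratic_bound[of "v w / 2"] v(2)[of w] by (simp only: norm_of_real) (simp add: power_divide)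
  ultimately show ?thesis unfolding R_def by (rule order_trans[OF norm_triangle_ineq4 add_mono])
 qed
 have Rm[measurable]: "R \<in> borel_measurable M" unfolding R_def[abs_def] by measurable
 have eq: "a w * (iexp (d w) - of_real (exp (- v w / 2))) =
   \<i> * (a w * of_real (d w)) - (a w * of_real ((d w)\<^sup>2 - v w)) / 2 + a w * R w" for w
  by (simp add: R_def eval_nat_numeral field_simps)
 have dvi: "integrable M (\<lambda>w. (d w)\<^sup>2 - v w)" using d2 v1 by simp
 note i1 = centred_complex[OF d(2) d1 a] and i2 = centred_complex[OF dv dvi a]
 have bi: "integrable M (\<lambda>w. A * (\<bar>d w\<bar> ^ 3 / 6 + (v w)\<^sup>2 / 8))" using d(3) v(3) by simp
 have aRb: "norm (a w * R w) <= A * (\<bar>d w\<bar> ^ 3 / 6 + (v w)\<^sup>2 / 8)" if "w \<in> space M" for w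
  unfolding norm_mult using a(2)[OF that] Rb[of w] A by (intro mult_mono) auto
 have i3: "integrable M (\<lambda>w. a w * R w)"
  by (rule bochner_integrable_bound[OF bi]) (use aRb in \<open>auto intro!: order_trans[OF _ abs_ge_self]\<close>)
 have "\<E> (\<lambda>w. a w * (iexp (d w) - of_real (exp (- v w / 2)))) = \<E> (\<lambda>w. a w * R w)"
  unfolding eq using i1 i2 i3 by simp
 also have "norm ... <= \<E> (\<lambda>w. A * (\<bar>d w\<bar> ^ 3 / 6 + (v w)\<^sup>2 / 8))"
  by (rule norm_integral_le[OF i3 bi aRb])
 also have "... = A * (\<E> (\<lambda>w. \<bar>d w\<bar> ^ 3) / 6 + \<E> (\<lambda>w. (v w)\<^sup>2) / 8)" using d(3) v(3) by simp
 finally show ?thesis .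
qed

text \<open>The martingale is stopped before the accumulated variance exceeds \<open>C\<close>; the correction
factor \<open>exp (T / 2)\<close> is then bounded, and the expectation of \<open>W\<close> changes by a small amount in each step.\<close>

lemma characteristic_truncated:
 fixes d v :: "nat => 'a => real" and C :: real
 assumes d: "\<And>k. d k \<in> borel_measurable (F (Suc k))" "\<And>k. centred k (d k)" "\<And>k. integrable M (\<lambda>w. \<bar>d k w\<bar> ^ 3)"
  and v: "\<And>k. v k \<in> borel_measurable (F k)" "\<And>k w. 0 <= v k w" "\<And>k. integrable M (\<lambda>w. (v k w)\<^sup>2)"
  and dv: "\<And>k. centred k (\<lambda>w. (d k w)\<^sup>2 - v k w)" and C: "0 <= C"
 defines "keep \<equiv> \<lambda>k w. (of_bool ((\<Sum>j\<le>k. v j w) <= C) :: real)"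
 defines "W \<equiv> \<lambda>k w. iexp (\<Sum>j<k. keep j w * d j w) * of_real (exp ((\<Sum>j<k. keep j w * v j w) / 2))"
 shows "W k \<in> borel_measurable M" "norm (W k w) <= exp (C / 2)"
  "norm (\<E> (W n) - 1) <= exp (C / 2) * (\<Sum>k<n. \<E> (\<lambda>w. \<bar>d k w\<bar> ^ 3) / 6 + \<E> (\<lambda>w. (v k w)\<^sup>2) / 8)"
proof -
 have vF: "v j \<in> borel_measurable (F k)" if "j <= k" for j k by (rule measurable_filtration_mono[OF v(1) that])
 have dF: "d j \<in> borel_measurable (F k)" if "j < k" for j k by (rule measurable_filtration_mono[OF d(1)]) (use that in simp)
 have keepF: "keep j \<in> borel_measurable (F k)" if "j <= k" for j k
 proof -
  have [measurable]: "(\<lambda>w. \<Sum>i\<le>j. v i w) \<in> borel_measurable (F k)" by (intro borel_measurable_sum vF) (use that in auto)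
  show ?thesis unfolding keep_def by measurable
 qed
 have WF: "W k \<in> borel_measurable (F k)" for k
 proof -
  have [measurable]: "(\<lambda>w. \<Sum>j<k. keep j w * d j w) \<in> borel_measurable (F k)" "(\<lambda>w. \<Sum>j<k. keep j w * v j w) \<in> borel_measurable (F k)"
   by (intro borel_measurable_sum borel_measurable_times keepF dF vF; simp)+
  show ?thesis unfolding W_def by measurable
 qed
 show WM: "W k \<in> borel_measurable M" for k by (rule measurable_from_subalg[OF subalgebra_filtration WF])
 have TC: "(\<Sum>j<k. keep j w * v j w) <= C" for k w
 proof (induction k)
  case (Suc k)
  show ?case
  proof (cases "(\<Sum>j\<le>k. v j w) <= C")
   case True
   have "(\<Sum>j<Suc k. keep j w * v j w) <= (\<Sum>j<Suc k. v j w)"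
    using v(2) by (intro sum_mono) (auto simp: keep_def)
   also have "... <= C" using True by (simp only: lessThan_Suc_atMost)
   finally show ?thesis .
  next
   case False
   then show ?thesis using Suc by (simp add: keep_def)
  qed
 qed (use C in simp)
 have nW: "norm (W k w) = exp ((\<Sum>j<k. keep j w * v j w) / 2)" for k w by (simp add: W_def norm_mult)
 show Wb: "norm (W k w) <= exp (C / 2)" for k w unfolding nW using TC[of w k] by simp
 have Wi: "integrable M (W k)" for k
  by (rule integrable_const_bound[where B = "exp (C / 2)"]) (use Wb WM in auto)
 define a where "a k w = W k w * of_real (exp (keep k w * v k w / 2) * keep k w)" for k w
 have step: "W (Suc k) w - W k w = a k w * (iexp (d k w) - of_real (exp (- v k w / 2)))" for k w
 proof (cases "(\<Sum>j\<le>k. v j w) <= C")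
  case True
  then have keep: "keep k w = 1" by (simp add: keep_def)
  have "W (Suc k) w = W k w * iexp (d k w) * of_real (exp (v k w / 2))"
   by (simp add: W_def keep add_divide_distrib exp_add distrib_left mult_ac)
  moreover have "complex_of_real (exp (v k w / 2)) * of_real (exp (- v k w / 2)) = 1"
   by (simp flip: of_real_mult exp_add)
  ultimately show ?thesis by (simp add: a_def keep right_diff_distrib mult.assoc)
 next
  case False
  then have "keep k w = 0" by (simp add: keep_def)
  then show ?thesis by (simp add: a_def W_def)
 qed
 have aF: "a k \<in> borel_measurable (F k)" for k
 proof -
  note [measurable] = WF[of k] keepF[OF order_refl, of k] v(1)[of k]
  show ?thesis unfolding a_def[abs_def] by measurable
 qed
 have ab: "norm (a k w) <= exp (C / 2)" for k w
 proof -
  have "norm (a k w) = exp ((\<Sum>j<Suc k. keep j w * v j w) / 2) * keep k w"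
   unfolding a_def norm_mult nW norm_of_real by (simp add: keep_def add_divide_distrib exp_add)
  also have "... <= exp (C / 2) * 1" using TC[of w "Suc k"] by (intro mult_mono) (auto simp: keep_def)
  finally show ?thesis by simp
 qed
 have one: "norm (\<E> (W (Suc k)) - \<E> (W k)) <= exp (C / 2) * (\<E> (\<lambda>w. \<bar>d k w\<bar> ^ 3) / 6 + \<E> (\<lambda>w. (v k w)\<^sup>2) / 8)" for k
 proof -
  have "\<E> (W (Suc k)) - \<E> (W k) = \<E> (\<lambda>w. a k w * (iexp (d k w) - of_real (exp (- v k w / 2))))"
   unfolding step[symmetric] by (rule bochner_integral_diff[OF Wi Wi, symmetric])
  also have "norm ... <= exp (C / 2) * (\<E> (\<lambda>w. \<bar>d k w\<bar> ^ 3) / 6 + \<E> (\<lambda>w. (v k w)\<^sup>2) / 8)"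
   by (rule characteristic_step[OF measurable_filtration[OF d(1)] d(2,3) measurable_filtration[OF v(1)] v(2,3) dv aF ab])
  finally show ?thesis .
 qed
 have "\<E> (W n) - 1 = (\<Sum>k<n. \<E> (W (Suc k)) - \<E> (W k))"
  by (subst sum_lessThan_telescope) (simp add: W_def prob_space)
 also have "norm ... <= (\<Sum>k<n. exp (C / 2) * (\<E> (\<lambda>w. \<bar>d k w\<bar> ^ 3) / 6 + \<E> (\<lambda>w. (v k w)\<^sup>2) / 8))"
  by (rule sum_norm_le) (rule one)
 finally show "norm (\<E> (W n) - 1) <= exp (C / 2) * (\<Sum>k<n. \<E> (\<lambda>w. \<bar>d k w\<bar> ^ 3) / 6 + \<E> (\<lambda>w. (v k w)\<^sup>2) / 8)"
  by (simp only: sum_distrib_left)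
qed

text \<open>By \<open>characteristic_truncated\<close> the corrected exponential has expectation close to one. With high
probability nothing is stopped and the correction factor is close to \<open>exp (s / 2)\<close>.\<close>

theorem martingale_central_limit:
 fixes d v :: "nat => nat => 'a => real" and s :: real
 assumes d: "\<And>n k. d n k \<in> borel_measurable (F (Suc k))" "\<And>n k. centred k (d n k)" "\<And>n k. integrable M (\<lambda>w. \<bar>d n k w\<bar> ^ 3)"
  and v: "\<And>n k. v n k \<in> borel_measurable (F k)" "\<And>n k w. 0 <= v n k w" "\<And>n k. integrable M (\<lambda>w. (v n k w)\<^sup>2)"
  and dv: "\<And>n k. centred k (\<lambda>w. (d n k w)\<^sup>2 - v n k w)"
  and lim3: "(\<lambda>n. \<Sum>k<n. \<E> (\<lambda>w. \<bar>d n k w\<bar> ^ 3)) \<longlonglongrightarrow> 0"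
  and limv: "(\<lambda>n. \<Sum>k<n. \<E> (\<lambda>w. (v n k w)\<^sup>2)) \<longlonglongrightarrow> 0"
  and cv: "((\<lambda>z. \<Sum>k<fst z. v (fst z) k (snd z)) \<longlongrightarrow> s) (whp M)"
 shows "(\<lambda>n. \<E> (\<lambda>w. iexp (\<Sum>k<n. d n k w))) \<longlonglongrightarrow> of_real (exp (- s / 2))"
proof -
 define C where "C = \<bar>s\<bar> + 1"
 have C: "0 <= C" "s < C" by (auto simp: C_def)
 define keep where "keep n k w = (of_bool ((\<Sum>j\<le>k. v n j w) <= C) :: real)" for n k w
 define W where "W n w = iexp (\<Sum>j<n. keep n j w * d n j w) * of_real (exp ((\<Sum>j<n. keep n j w * v n j w) / 2))" for n w
 note trunc = characteristic_truncated[where d = "d n" and v = "v n" and C = C for n, OF d v dv C(1)]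
 have tr1: "W n \<in> borel_measurable M" for n unfolding W_def[abs_def] keep_def by (rule trunc(1))
 have tr2: "norm (W n w) <= exp (C / 2)" for n w unfolding W_def keep_def by (rule trunc(2))
 have tr3: "norm (\<E> (W n) - 1) <= exp (C / 2) * (\<Sum>k<n. \<E> (\<lambda>w. \<bar>d n k w\<bar> ^ 3) / 6 + \<E> (\<lambda>w. (v n k w)\<^sup>2) / 8)" for n
  unfolding W_def[abs_def] keep_def by (rule trunc(3))
 have limW: "(\<lambda>n. \<E> (W n)) \<longlonglongrightarrow> 1"
 proof (rule Lim_transform2[OF tendsto_const])
  have "(\<lambda>n. exp (C / 2) * ((\<Sum>k<n. \<E> (\<lambda>w. \<bar>d n k w\<bar> ^ 3)) / 6 + (\<Sum>k<n. \<E> (\<lambda>w. (v n k w)\<^sup>2)) / 8)) \<longlonglongrightarrow> exp (C / 2) * (0 / 6 + 0 / 8)"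
   by (intro tendsto_intros lim3 limv) auto
  then have lim: "(\<lambda>n. exp (C / 2) * ((\<Sum>k<n. \<E> (\<lambda>w. \<bar>d n k w\<bar> ^ 3)) / 6 + (\<Sum>k<n. \<E> (\<lambda>w. (v n k w)\<^sup>2)) / 8)) \<longlonglongrightarrow> 0"
   by simp
  show "(\<lambda>n. 1 - \<E> (W n)) \<longlonglongrightarrow> 0"
  proof (rule Lim_null_comparison[OF always_eventually lim], rule allI)
   fix n
   show "norm (1 - \<E> (W n)) <= exp (C / 2) * ((\<Sum>k<n. \<E> (\<lambda>w. \<bar>d n k w\<bar> ^ 3)) / 6 + (\<Sum>k<n. \<E> (\<lambda>w. (v n k w)\<^sup>2)) / 8)"
    using tr3[of n] by (simp add: norm_minus_commute sum.distrib sum_divide_distrib)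
  qed
 qed
 define S where "S n w = iexp (\<Sum>k<n. d n k w)" for n w
 have dM: "d n k \<in> borel_measurable M" for n k by (rule measurable_filtration[OF d(1)])
 have SM: "S n \<in> borel_measurable M" for n unfolding S_def[abs_def] using dM by measurable
 define f where "f n w = norm (S n w - of_real (exp (- s / 2)) * W n w)" for n w
 have fM: "f n \<in> borel_measurable M" for n unfolding f_def[abs_def] using SM tr1 by measurable
 have fb: "\<bar>f n w\<bar> <= 1 + exp (- s / 2) * exp (C / 2)" for n w
 proof -
  have "f n w <= norm (S n w) + norm (of_real (exp (- s / 2)) * W n w)" unfolding f_def by (rule norm_triangle_ineq4)
  also have "... <= 1 + exp (- s / 2) * exp (C / 2)"
   using tr2[of n w] by (simp add: S_def norm_mult)
  finally show ?thesis by (simp add: f_def)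
 qed
 have "((\<lambda>z. f (fst z) (snd z)) \<longlongrightarrow> 0) (whp M)"
 proof (rule Lim_transform_eventually)
  let ?T = "\<lambda>z. \<Sum>k<fst z. v (fst z) k (snd z)"
  have "((\<lambda>z. \<bar>1 - exp ((?T z - s) / 2)\<bar>) \<longlongrightarrow> \<bar>1 - exp ((s - s) / 2)\<bar>) (whp M)"
   by (intro tendsto_intros cv) auto
  then show "((\<lambda>z. \<bar>1 - exp ((?T z - s) / 2)\<bar>) \<longlongrightarrow> 0) (whp M)" by simp
  have "\<forall>\<^sub>F z in whp M. ?T z < C" using cv C(2) by (rule order_tendstoD)
  then show "\<forall>\<^sub>F z in whp M. \<bar>1 - exp ((?T z - s) / 2)\<bar> = f (fst z) (snd z)"
  proof eventually_elim
   case (elim z)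
   obtain n w where z: "z = (n, w)" by fastforce
   have T: "(\<Sum>k<n. v n k w) < C" using elim by (simp add: z)
   have keep: "keep n k w = 1" if "k < n" for k
   proof -
    have "(\<Sum>j\<le>k. v n j w) <= (\<Sum>j<n. v n j w)" using that v(2) by (intro sum_mono2) auto
    then show ?thesis using T by (simp add: keep_def)
   qed
   have "W n w = S n w * of_real (exp ((\<Sum>j<n. v n j w) / 2))" unfolding W_def S_def using keep by simp
   then have "f n w = norm (S n w * of_real (1 - exp (- s / 2) * exp ((\<Sum>j<n. v n j w) / 2)))"
    unfolding f_def by (simp add: algebra_simps)
   also have "... = \<bar>1 - exp (- s / 2) * exp ((\<Sum>j<n. v n j w) / 2)\<bar>" by (simp only: norm_mult norm_of_real) (simp add: S_def)
   also have "exp (- s / 2) * exp ((\<Sum>j<n. v n j w) / 2) = exp (((\<Sum>j<n. v n j w) - s) / 2)"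
    by (simp add: diff_divide_distrib flip: exp_add)
   finally show ?case by (simp add: z)
  qed
 qed
 from whp_bounded_convergence[OF fM fb this] have Ef: "(\<lambda>n. \<E> (\<lambda>w. \<bar>f n w\<bar>)) \<longlonglongrightarrow> 0" .
 have Si: "integrable M (S n)" for n by (rule integrable_const_bound[where B = 1]) (use SM in \<open>auto simp: S_def\<close>)
 have Wi: "integrable M (W n)" for n by (rule integrable_const_bound[where B = "exp (C / 2)"]) (use tr1 tr2 in auto)
 have diff: "(\<lambda>n. \<E> (S n) - of_real (exp (- s / 2)) * \<E> (W n)) \<longlonglongrightarrow> 0"
 proof (rule Lim_null_comparison[OF always_eventually Ef], rule allI)
  fix n
  have "\<E> (S n) - of_real (exp (- s / 2)) * \<E> (W n) = \<E> (\<lambda>w. S n w - of_real (exp (- s / 2)) * W n w)"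
   using Si Wi by simp
  also have "norm ... <= \<E> (\<lambda>w. norm (S n w - of_real (exp (- s / 2)) * W n w))" by (rule integral_norm_bound)
  finally show "norm (\<E> (S n) - of_real (exp (- s / 2)) * \<E> (W n)) <= \<E> (\<lambda>w. \<bar>f n w\<bar>)"
   by (simp add: f_def)
 qed
 have "(\<lambda>n. (\<E> (S n) - of_real (exp (- s / 2)) * \<E> (W n)) + of_real (exp (- s / 2)) * \<E> (W n)) \<longlonglongrightarrow> 0 + of_real (exp (- s / 2)) * 1"
  by (intro tendsto_add diff tendsto_mult tendsto_const limW)
 then show ?thesis by (simp add: S_def[abs_def])
qed

end

section \<open>The INAR martingale differences\<close>

context stable_inar
begin

text \<open>The filtration generated by the histories; for it, measurability is the same as \<open>adapted\<close>.\<close>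

definition past :: "nat => 'a measure" where
 "past k = vimage_algebra (space M) (history k) (count_space UNIV)"

lemma adapted_past:
 assumes "adapted k f" shows "f \<in> borel_measurable (past k)"
proof -
 obtain \<phi> where \<phi>: "\<And>w. w \<in> space M ==> f w = \<phi> (history k w)" using assms by (rule adaptedE) blast
 have "(\<lambda>w. \<phi> (history k w)) \<in> borel_measurable (past k)"
  unfolding past_def by (rule measurable_compose[OF measurable_vimage_algebra1]) auto
 then show ?thesis by (rule measurable_cong[THEN iffD2, rotated]) (simp add: \<phi> past_def)
qed

lemma past_adapted:
 fixes f :: "'a => 'b::t1_space"
 assumes f: "f \<in> borel_measurable (past k)" shows "adapted k f"
proof (rule adaptedI)
 fix w assume w: "w \<in> space M"
 let ?u = "SOME u. u \<in> space M \<and> history k u = history k w"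
 have u: "?u \<in> space M" "history k ?u = history k w"
  using someI[of "\<lambda>u. u \<in> space M \<and> history k u = history k w" w] w by auto
 have "f -` {f w} \<inter> space (past k) \<in> sets (past k)" using f by (rule measurable_sets) simp
 then obtain A where A: "f -` {f w} \<inter> space M = history k -` A \<inter> space M"
  by (auto simp: past_def sets_vimage_algebra2)
 have "w \<in> history k -` A \<inter> space M" unfolding A[symmetric] using w by simp
 then have "?u \<in> history k -` A \<inter> space M" using u by simp
 then show "f w = (\<lambda>h. f (SOME u. u \<in> space M \<and> history k u = h)) (history k w)"
  unfolding A[symmetric] by simp
qed

sublocale filtered_prob_space M past
proof
 show "subalgebra M (past k)" for k
  using history_measurable[of k]
  by (auto simp: subalgebra_def past_def sets_vimage_algebra2 dest: measurable_sets)
 show "subalgebra (past l) (past k)" if kl: "k <= l" for k l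
  unfolding subalgebra_def
 proof
  show "space (past k) = space (past l)" by (simp add: past_def)
  show "sets (past k) \<subseteq> sets (past l)"
  proof
   fix S assume "S \<in> sets (past k)"
   then obtain A where A: "S = history k -` A \<inter> space M" by (auto simp: past_def sets_vimage_algebra2)
   obtain \<phi> where \<phi>: "\<And>w. w \<in> space M ==> history k w = \<phi> (history l w)"
    using adapted_mono[OF adapted_history kl] by (rule adaptedE) blast
   have "S = history l -` (\<phi> -` A) \<inter> space M" using \<phi> by (auto simp: A)
   then show "S \<in> sets (past l)" unfolding past_def by (auto simp: sets_vimage_algebra2)
  qed
 qed
qed

lemma centred_mdiff: "adapted k h ==> centred k (\<lambda>w. h w * mdiff (Suc k) w)"
 unfolding centred_def
proof (intro ballI impI)
 fix a :: "'a => real" assume h: "adapted k h" and a: "a \<in> borel_measurable (past k)" and int: "integrable M (\<lambda>w. a w * (h w * mdiff (Suc k) w))"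
 have "adapted k (\<lambda>w. a w * h w)" using past_adapted[OF a] h by (rule adapted_comp2)
 from mdiff_expectation[OF this] int show "\<E> (\<lambda>w. a w * (h w * mdiff (Suc k) w)) = 0" by (simp add: mult.assoc)
qed

text \<open>Conditionally on the past the squared martingale difference has mean \<open>cvar\<close>.\<close>

lemma centred_mdiff_square: 
 assumes h: "adapted k h" shows "centred k (\<lambda>w. h w * ((mdiff (Suc k) w)\<^sup>2 - cvar (state k w)))"
 unfolding centred_def
proof (intro ballI impI)
 fix a :: "'a => real" assume a: "a \<in> borel_measurable (past k)"
  and int: "integrable M (\<lambda>w. a w * (h w * ((mdiff (Suc k) w)\<^sup>2 - cvar (state k w))))"
 have "adapted k (\<lambda>w. a w * h w)" using past_adapted[OF a] h by (rule adapted_comp2)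
 then obtain \<phi> where \<phi>: "\<And>w. w \<in> space M ==> a w * h w = \<phi> (history k w)" by (rule adaptedE) blast
 define G where "G z y = (\<phi> z :: real) * ((real y - cmean (state_of z))\<^sup>2 - cvar (state_of z))" for z y
 have eq: "a w * (h w * ((mdiff (Suc k) w)\<^sup>2 - cvar (state k w))) = G (history k w) (X (int (Suc k)) w)" if "w \<in> space M" for w
  by (simp add: mult.assoc[symmetric] \<phi>[OF that] G_def mdiff_def state_def)
 have inner: "(\<integral>y. G z y \<partial>measure_pmf (K (state_of z))) = 0" for z
 proof -
  have "integrable (measure_pmf (K x)) (\<lambda>y. (real y - cmean x)\<^sup>2)" for x
   by (rule bochner_integrable_bound[OF bochner_integrable_add[OF measure_pmf.integrable_const[of _ 1] kernel_moments(1)[of x]]])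
    (use abs_power_le_one_plus[of 2 4] in \<open>auto simp: power_even_abs\<close>)
  then show ?thesis by (simp add: G_def kernel_moments(3))
 qed
 have "integrable M (\<lambda>w. G (history k w) (X (int (Suc k)) w))"
  using int by (simp only: bochner_integrable_cong[OF refl eq])
 from one_step(2)[OF this] have "\<E> (\<lambda>w. G (history k w) (X (int (Suc k)) w)) = 0"
  by (simp add: state_def inner)
 with bochner_integral_cong[OF refl eq]
 show "\<E> (\<lambda>w. a w * (h w * ((mdiff (Suc k) w)\<^sup>2 - cvar (state k w)))) = 0" by (rule trans)
qed

definition env_bound :: real where
 "env_bound = (SOME B. 1 <= B \<and> (\<forall>k. \<forall>a\<le>6. integrable M (\<lambda>w. env k w ^ a) \<and> \<E> (\<lambda>w. env k w ^ a) <= B))"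

lemma env_bound:
 "1 <= env_bound" "a <= 6 ==> integrable M (\<lambda>w. env k w ^ a)" "a <= 6 ==> \<E> (\<lambda>w. env k w ^ a) <= env_bound"
proof -
 let ?P = "\<lambda>B. 1 <= B \<and> (\<forall>k. \<forall>a\<le>6. integrable M (\<lambda>w. env k w ^ a) \<and> \<E> (\<lambda>w. env k w ^ a) <= B)"
 have "\<exists>B. ?P B" by (rule env_moment) (rule exI, intro conjI allI impI, assumption+)
 then have "?P env_bound" unfolding env_bound_def by (rule someI_ex)
 then show "1 <= env_bound" "a <= 6 ==> integrable M (\<lambda>w. env k w ^ a)" "a <= 6 ==> \<E> (\<lambda>w. env k w ^ a) <= env_bound"
  by blast+
qed

lemma cvar_nonneg: "0 <= cvar x"
proof -
 have a: "0 <= \<alpha> i * (1 - \<alpha> i)" if "i \<in> {1..p}" for i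
  using coeff_range[OF that] by auto
 show ?thesis unfolding cvar_def by (intro add_nonneg_nonneg sum_nonneg mult_nonneg_nonneg[OF a]) auto
qed

lemma cvar_le_env: "cvar (state k w) <= (1 + \<sigma>\<^sup>2) * env k w"
proof -
 have a: "\<alpha> i * (1 - \<alpha> i) <= 1" if "i \<in> {1..p}" for i
  using coeff_range[OF that] by (auto intro: mult_le_one)
 have "(\<Sum>i=1..p. \<alpha> i * (1 - \<alpha> i) * real (state k w (i - 1))) <= (\<Sum>i=1..p. 1 * real (state k w (i - 1)))"
  using a by (intro sum_mono mult_right_mono) auto
 also have "... <= env k w" using env_ge(3)[where k = k and w = w] by (simp add: total_def)
 finally have "cvar (state k w) <= env k w + \<sigma>\<^sup>2" by (simp add: cvar_def)
 also have "\<sigma>\<^sup>2 <= \<sigma>\<^sup>2 * env k w" using env_ge(1)[where k = k and w = w] by (simp add: mult_le_cancel_left1)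
 finally show ?thesis by (simp add: algebra_simps)
qed

lemma env_dominated:
 assumes f: "adapted k f" "\<And>w. w \<in> space M ==> \<bar>f w\<bar> <= c * env k w ^ a" and a: "a <= 6"
 shows "integrable M f"
proof (rule bochner_integrable_bound)
 show "integrable M (\<lambda>w. c * env k w ^ a)" by (rule integrable_mult_right[OF env_bound(2)[OF a]])
 show "f \<in> borel_measurable M" by (rule adapted_borel[OF f(1)])
 show "AE w in M. norm (f w) <= norm (c * env k w ^ a)" 
  unfolding real_norm_def by (rule AE_I2, rule order_trans[OF f(2) abs_ge_self])
qed

text \<open>The conditional fourth moment is at most a constant times the squared envelope, and the
factor \<open>h\<close> contributes four further powers: six in total.\<close>

lemma mdiff_weighted_fourth:
 assumes h: "adapted k h" "\<And>w. w \<in> space M ==> \<bar>h w\<bar> <= c * env k w"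
 shows "integrable M (\<lambda>w. (h w * mdiff (Suc k) w) ^ 4)"
  "\<E> (\<lambda>w. (h w * mdiff (Suc k) w) ^ 4) <= 3 * c4\<^sup>2 * (c ^ 4 * env_bound)"
proof -
  have a: "adapted k (\<lambda>w. h w ^ 4)" by (rule adapted_comp[OF h(1)])
  have le: "h w ^ 4 * (env k w)\<^sup>2 <= c ^ 4 * env k w ^ 6" if "w \<in> space M" for w
  proof -
   have "\<bar>h w\<bar> ^ 4 <= (c * env k w) ^ 4" using h(2)[OF that] by (intro power_mono) auto
   then have "h w ^ 4 * (env k w)\<^sup>2 <= (c * env k w) ^ 4 * (env k w)\<^sup>2" by (intro mult_right_mono) (auto simp: power_even_abs)
   also have "... = c ^ 4 * env k w ^ 6" by (simp add: power_mult_distrib mult.assoc flip: power_add)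
   finally show ?thesis .
  qed
  have int: "integrable M (\<lambda>w. h w ^ 4 * (env k w)\<^sup>2)"
  proof (rule env_dominated[where c = "c ^ 4" and a = 6])
   show "adapted k (\<lambda>w. h w ^ 4 * (env k w)\<^sup>2)" by (rule adapted_comp2[OF a adapted_comp[OF adapted_env]])
   show "\<bar>h w ^ 4 * (env k w)\<^sup>2\<bar> <= c ^ 4 * env k w ^ 6" if "w \<in> space M" for w using le[OF that] by simp
  qed simp
  have eq: "(h w * mdiff (Suc k) w) ^ 4 = h w ^ 4 * mdiff (Suc k) w ^ 4" for w by (rule power_mult_distrib)
  show "integrable M (\<lambda>w. (h w * mdiff (Suc k) w) ^ 4)" unfolding eq by (rule mdiff_fourth_moment[OF a _ int]) simp
  have "\<E> (\<lambda>w. h w ^ 4 * (env k w)\<^sup>2) <= \<E> (\<lambda>w. c ^ 4 * env k w ^ 6)"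
   using le env_bound(2)[of 6 k] int by (intro integral_mono) auto
  also have "... <= c ^ 4 * env_bound" using env_bound(3)[of 6 k] by (simp add: mult_left_mono)
  finally have "3 * c4\<^sup>2 * \<E> (\<lambda>w. h w ^ 4 * (env k w)\<^sup>2) <= 3 * c4\<^sup>2 * (c ^ 4 * env_bound)" by (intro mult_left_mono) auto
  moreover have "\<E> (\<lambda>w. h w ^ 4 * mdiff (Suc k) w ^ 4) <= 3 * c4\<^sup>2 * \<E> (\<lambda>w. h w ^ 4 * (env k w)\<^sup>2)"
   by (rule mdiff_fourth_moment[OF a _ int]) simp
  ultimately show "\<E> (\<lambda>w. (h w * mdiff (Suc k) w) ^ 4) <= 3 * c4\<^sup>2 * (c ^ 4 * env_bound)" unfolding eq by (rule order_trans[rotated])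
qed

lemma weighted_score_clt:
 fixes h :: "nat => nat => (nat => nat) => real"
 assumes c: "0 <= c" "\<And>n k w. \<bar>h n k (state k w)\<bar> <= c * env k w"
  and lim: "((\<lambda>z. (\<Sum>k<fst z. (h (fst z) k (state k (snd z)))\<^sup>2 * cvar (state k (snd z))) / real (fst z)) \<longlongrightarrow> s) (whp M)"
 shows "(\<lambda>n. \<E> (\<lambda>w. iexp ((\<Sum>k<n. h n k (state k w) * mdiff (Suc k) w) / sqrt (real n)))) \<longlonglongrightarrow> of_real (exp (- s / 2))"
proof -
 define C where "C = 3 * c4\<^sup>2 * (c ^ 4 * env_bound)"
 define b where "b = 1 + \<sigma>\<^sup>2"
 have b: "0 <= b" "\<And>k w. 0 <= cvar (state k w)" "\<And>k w. cvar (state k w) <= b * env k w"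
  by (simp_all add: b_def cvar_nonneg cvar_le_env)
 define e where "e n k w = h n k (state k w) * mdiff (Suc k) w" for n k w
 define u where "u n k w = (h n k (state k w))\<^sup>2 * cvar (state k w)" for n k w
 define d where "d n k w = e n k w / sqrt (real n)" for n k w
 define v where "v n k w = u n k w / real n" for n k w
 have wad: "adapted k (\<lambda>w. h n k (state k w))" for n k by (rule adapted_state_comp)
 have e4: "integrable M (\<lambda>w. e n k w ^ 4)" "\<E> (\<lambda>w. e n k w ^ 4) <= C" for n k
  unfolding e_def C_def by (rule mdiff_weighted_fourth[OF wad c(2)])+
 have ead: "adapted (Suc k) (e n k)" for n k
  unfolding e_def[abs_def] by (rule adapted_comp2[OF adapted_mono[OF wad] adapted_mdiff]) auto
 have em: "e n k \<in> borel_measurable M" for n k by (rule adapted_borel[OF ead])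
 have e3: "integrable M (\<lambda>w. \<bar>e n k w\<bar> ^ 3)" "\<E> (\<lambda>w. \<bar>e n k w\<bar> ^ 3) <= 1 + C" for n k
 proof -
  have le: "\<bar>e n k w\<bar> ^ 3 <= 1 + e n k w ^ 4" for w using abs_power_le_one_plus[of 3 4 "e n k w"] by (simp add: power_even_abs)
  have i: "integrable M (\<lambda>w. 1 + e n k w ^ 4)" using e4 by simp
  show i3: "integrable M (\<lambda>w. \<bar>e n k w\<bar> ^ 3)"
  proof (rule bochner_integrable_bound[OF i])
   show "(\<lambda>w. \<bar>e n k w\<bar> ^ 3) \<in> borel_measurable M" using em by measurable
   show "AE w in M. norm (\<bar>e n k w\<bar> ^ 3) <= norm (1 + e n k w ^ 4)"
    unfolding real_norm_def using le by (intro AE_I2) (simp add: order_trans[OF le abs_ge_self])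
  qed
  have "\<E> (\<lambda>w. \<bar>e n k w\<bar> ^ 3) <= \<E> (\<lambda>w. 1 + e n k w ^ 4)" by (rule integral_mono[OF i3 i le])
  also have "... <= 1 + C" using e4 by (simp add: prob_space)
  finally show "\<E> (\<lambda>w. \<bar>e n k w\<bar> ^ 3) <= 1 + C" .
 qed
 have uad: "adapted k (u n k)" for n k unfolding u_def[abs_def] by (rule adapted_state_comp)
 have u2: "integrable M (\<lambda>w. (u n k w)\<^sup>2)" "\<E> (\<lambda>w. (u n k w)\<^sup>2) <= c ^ 4 * b\<^sup>2 * env_bound" for n k
 proof -
  have le: "(u n k w)\<^sup>2 <= c ^ 4 * b\<^sup>2 * env k w ^ 6" for w
  proof -
   have "\<bar>h n k (state k w)\<bar> ^ 2 <= (c * env k w) ^ 2" using c(2) by (intro power_mono) auto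
   then have "u n k w <= (c * env k w)\<^sup>2 * (b * env k w)" unfolding u_def using b by (intro mult_mono) auto
   moreover have "0 <= u n k w" unfolding u_def using b by simp
   ultimately have "(u n k w)\<^sup>2 <= ((c * env k w)\<^sup>2 * (b * env k w))\<^sup>2" by (intro power_mono)
   also have "... = c ^ 4 * b\<^sup>2 * env k w ^ 6" by (simp add: power_mult_distrib power_mult[symmetric] mult_ac flip: power_add)
   finally show ?thesis .
  qed
  show i: "integrable M (\<lambda>w. (u n k w)\<^sup>2)"
   by (rule env_dominated[OF adapted_comp[OF uad], where a = 6]) (use le in auto)
  have "\<E> (\<lambda>w. (u n k w)\<^sup>2) <= \<E> (\<lambda>w. c ^ 4 * b\<^sup>2 * env k w ^ 6)"
   using i env_bound(2)[of 6 k] le by (intro integral_mono) auto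
  also have "... <= c ^ 4 * b\<^sup>2 * env_bound" using env_bound(3)[of 6 k] by (simp add: mult_left_mono)
  finally show "\<E> (\<lambda>w. (u n k w)\<^sup>2) <= c ^ 4 * b\<^sup>2 * env_bound" .
 qed
 have "(\<lambda>n. \<E> (\<lambda>w. iexp (\<Sum>k<n. d n k w))) \<longlonglongrightarrow> of_real (exp (- s / 2))"
 proof (rule martingale_central_limit[where v = v])
  show "d n k \<in> borel_measurable (past (Suc k))" for n k
   unfolding d_def[abs_def] by (rule adapted_past, rule adapted_comp[OF ead])
  show "centred k (d n k)" for n k
   using centred_mdiff[OF adapted_comp[OF wad, of k "\<lambda>x. x / sqrt (real n)" n]] by (simp add: d_def[abs_def] e_def)
  have d3: "\<bar>d n k w\<bar> ^ 3 = \<bar>e n k w\<bar> ^ 3 / sqrt (real n) ^ 3" for n k w by (simp add: d_def power_divide)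
  show "integrable M (\<lambda>w. \<bar>d n k w\<bar> ^ 3)" for n k unfolding d3 using e3 by simp
  show "v n k \<in> borel_measurable (past k)" for n k
   unfolding v_def[abs_def] by (rule adapted_past, rule adapted_comp[OF uad])
  show "0 <= v n k w" for n k w unfolding v_def u_def using b by simp
  have v2: "(v n k w)\<^sup>2 = (u n k w)\<^sup>2 / (real n)\<^sup>2" for n k w by (simp add: v_def power_divide)
  show "integrable M (\<lambda>w. (v n k w)\<^sup>2)" for n k unfolding v2 using u2 by simp
  have "(d n k w)\<^sup>2 - v n k w = (h n k (state k w))\<^sup>2 / real n * ((mdiff (Suc k) w)\<^sup>2 - cvar (state k w))" for n k w
   by (simp add: d_def v_def e_def u_def power_mult_distrib power_divide right_diff_distrib diff_divide_distrib)
  then show "centred k (\<lambda>w. (d n k w)\<^sup>2 - v n k w)" for n k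
   by (simp only:) (rule centred_mdiff_square, rule adapted_state_comp)
  have sq: "(\<lambda>n. (1 + C) / sqrt (real n)) \<longlonglongrightarrow> 0"
   by (rule tendsto_divide_0[OF tendsto_const filterlim_at_top_imp_at_infinity[OF filterlim_compose[OF sqrt_at_top filterlim_real_sequentially]]])
  show "(\<lambda>n. \<Sum>k<n. \<E> (\<lambda>w. \<bar>d n k w\<bar> ^ 3)) \<longlonglongrightarrow> 0"
  proof (rule Lim_null_comparison[OF always_eventually sq], rule allI)
   fix n
   have "(\<Sum>k<n. \<E> (\<lambda>w. \<bar>d n k w\<bar> ^ 3)) <= (\<Sum>k<n. (1 + C) / sqrt (real n) ^ 3)"
    unfolding d3 using e3 by (intro sum_mono) (simp add: divide_right_mono)
   also have "... = (1 + C) / sqrt (real n)"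
    by (cases "n = 0") (simp_all add: power3_eq_cube)
   finally show "norm (\<Sum>k<n. \<E> (\<lambda>w. \<bar>d n k w\<bar> ^ 3)) <= (1 + C) / sqrt (real n)"
    by (simp add: sum_nonneg)
  qed
  show "(\<lambda>n. \<Sum>k<n. \<E> (\<lambda>w. (v n k w)\<^sup>2)) \<longlonglongrightarrow> 0"
  proof (rule Lim_null_comparison[OF always_eventually lim_const_over_n[of "c ^ 4 * b\<^sup>2 * env_bound"]], rule allI)
   fix n
   have "(\<Sum>k<n. \<E> (\<lambda>w. (v n k w)\<^sup>2)) <= (\<Sum>k<n. (c ^ 4 * b\<^sup>2 * env_bound) / (real n)\<^sup>2)"
    unfolding v2 using u2 by (intro sum_mono) (simp add: divide_right_mono)
   also have "... = c ^ 4 * b\<^sup>2 * env_bound / real n" by (cases "n = 0") (simp_all add: power2_eq_square)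
   finally show "norm (\<Sum>k<n. \<E> (\<lambda>w. (v n k w)\<^sup>2)) <= c ^ 4 * b\<^sup>2 * env_bound / real n"
    by (simp add: sum_nonneg)
  qed
  show "((\<lambda>z. \<Sum>k<fst z. v (fst z) k (snd z)) \<longlongrightarrow> s) (whp M)"
   using lim by (simp add: v_def u_def sum_divide_distrib)
 qed
 then show ?thesis by (simp add: d_def e_def sum_divide_distrib)
qed

end

section \<open>Ergodic means, uniformly in time\<close>

context prob_space
begin

lemma whp_not_bot: "whp M \<noteq> bot"
proof
 assume "whp M = bot"
 then have "\<forall>\<^sub>F z in whp M. False" by simp
 then have "\<forall>\<^sub>F n in sequentially. \<exists>A\<in>events. prob A <= 1 / 2 \<and> space M \<subseteq> A" by (auto simp: eventually_whp elim!: allE[of _ "1/2"])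
 then obtain A where A: "A \<in> events" "prob A <= 1 / 2" "space M \<subseteq> A"
  using eventually_happens'[OF sequentially_bot] by blast
 then have "A = space M" using sets.sets_into_space by blast
 then show False using A(2) by (simp add: prob_space)
qed

text \<open>Partial sums of nonnegative variables are monotone in time, and so is \<open>k * a\<close> up to its sign; hence
it suffices to control finitely many times \<open>n * j div m\<close>.\<close>

lemma uniform_partial_sums:
 fixes f :: "nat => 'a => real"
 assumes int: "\<And>k. integrable M (f k)" and nn: "\<And>k w. 0 <= f k w"
  and lim: "(\<lambda>n. \<E> (\<lambda>w. \<bar>(\<Sum>k<n. f k w) / real n - a\<bar>)) \<longlonglongrightarrow> 0" and d: "0 < d"
 shows "\<forall>\<^sub>F z in whp M. \<forall>k\<le>fst z. \<bar>(\<Sum>j<k. f j (snd z)) - real k * a\<bar> <= d * real (fst z)"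
proof -
 define A where "A k w = (\<Sum>j<k. f j w)" for k w
 have intA: "integrable M (A k)" for k unfolding A_def[abs_def] using int by simp
 have mono: "A k w <= A l w" if "k <= l" for k l w
  unfolding A_def using that nn by (intro sum_mono2) auto
 \<comment> \<open>The mesh is so fine that \<open>k * a\<close> moves by at most about \<open>d * n / 3\<close> between grid times.\<close>
 obtain m :: nat where m: "3 * \<bar>a\<bar> / d < real m" using reals_Archimedean2 by blast
 have m0: "0 < m" using m d by (cases m) (auto simp: divide_less_0_iff)
 have am: "\<bar>a\<bar> / real m <= d / 3" using m m0 d by (simp add: field_simps)
 define b where "b n = \<E> (\<lambda>w. \<bar>A n w - real n * a\<bar>)" for n
 have b_eq: "b n = real n * \<E> (\<lambda>w. \<bar>A n w / real n - a\<bar>)" if "0 < n" for n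
 proof -
  have "real n * \<bar>u / real n - a\<bar> = \<bar>u - real n * a\<bar>" for u
  proof -
   have "u - real n * a = real n * (u / real n - a)" using that by (simp add: right_diff_distrib)
   then show ?thesis by (simp only: abs_mult abs_of_nat)
  qed
  then show ?thesis unfolding b_def by (simp flip: bochner_integral_mult_right_zero)
 qed
 have b0: "0 <= b n" for n by (simp add: b_def)
 have grid: "\<forall>\<^sub>F z in whp M. \<bar>A (fst z * j div m) (snd z) - real (fst z * j div m) * a\<bar> / real (fst z) < d / 3" if j: "j <= m" for j
 proof (rule whp_Markov[where f = "\<lambda>n w. \<bar>A (n * j div m) w - real (n * j div m) * a\<bar> / real n"])
  show "integrable M (\<lambda>w. \<bar>A (n * j div m) w - real (n * j div m) * a\<bar> / real n)" for n using intA by simp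
  have E: "\<E> (\<lambda>w. \<bar>A (n * j div m) w - real (n * j div m) * a\<bar> / real n) = b (n * j div m) / real n" for n
   by (simp add: b_def)
  show "(\<lambda>n. \<E> (\<lambda>w. \<bar>A (n * j div m) w - real (n * j div m) * a\<bar> / real n)) \<longlonglongrightarrow> 0"
   unfolding E
  proof (cases "j = 0")
   case True
   then show "(\<lambda>n. b (n * j div m) / real n) \<longlonglongrightarrow> 0" by (simp add: b_def A_def)
  next
   case False
   have top: "filterlim (\<lambda>n. n * j div m) sequentially sequentially"
    unfolding filterlim_at_top
   proof (rule allI)
    fix Z :: nat
    show "\<forall>\<^sub>F n in sequentially. Z <= n * j div m"
    proof (rule eventually_mono[OF eventually_ge_at_top[of "Z * m"]])
     fix n assume "Z * m <= n"
     also have "n <= n * j" using False by simp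
     finally show "Z <= n * j div m" using m0 by (simp add: less_eq_div_iff_mult_less_eq)
    qed
   qed
   have l: "(\<lambda>n. \<E> (\<lambda>w. \<bar>A (n * j div m) w / real (n * j div m) - a\<bar>)) \<longlonglongrightarrow> 0"
    using filterlim_compose[OF lim top] by (simp add: A_def)
   show "(\<lambda>n. b (n * j div m) / real n) \<longlonglongrightarrow> 0"
   proof (rule Lim_null_comparison[OF always_eventually l], rule allI)
    fix n
    show "norm (b (n * j div m) / real n) <= \<E> (\<lambda>w. \<bar>A (n * j div m) w / real (n * j div m) - a\<bar>)"
    proof (cases "n * j div m = 0")
     case True
     then show ?thesis by (simp add: b_def A_def)
    next
     case False
     have le: "n * j div m <= n"
     proof -
      have "n * j div m <= n * m div m" using j by (intro div_le_mono) simp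
      then show ?thesis using m0 by simp
     qed
     then have n: "0 < n" using False by (cases n) auto
     have "b (n * j div m) <= real n * \<E> (\<lambda>w. \<bar>A (n * j div m) w / real (n * j div m) - a\<bar>)"
      using False le by (subst b_eq) (auto intro!: mult_right_mono)
     then show ?thesis using n b0[of "n * j div m"] by (simp add: field_simps)
    qed
   qed
  qed
 qed (use d in auto)
 have all: "\<forall>\<^sub>F z in whp M. \<forall>j\<in>{..m}. \<bar>A (fst z * j div m) (snd z) - real (fst z * j div m) * a\<bar> / real (fst z) < d / 3"
  using grid by (intro eventually_ball_finite ballI) (simp_all only: finite_atMost atMost_iff)
 obtain N :: nat where N: "3 * \<bar>a\<bar> / d < real N" using reals_Archimedean2 by blast
 have big: "\<forall>\<^sub>F z in whp M. N + 1 <= fst z"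
  by (rule eventually_whp_sure, rule eventually_mono[OF eventually_ge_at_top[of "N + 1"]]) simp
 from all big show ?thesis
 proof eventually_elim
  case (elim z)
  obtain n w where z: "z = (n, w)" by fastforce
  have n: "0 < n" "real N <= real n" using elim(2) by (auto simp: z)
  have an: "\<bar>a\<bar> <= d / 3 * real n"
  proof -
   have "3 * \<bar>a\<bar> / d < real n" using N n(2) by linarith
   then show ?thesis using d by (simp add: field_simps)
  qed
  have near: "\<bar>A (n * j div m) w - real (n * j div m) * a\<bar> <= d / 3 * real n" if "j <= m" for j
   using elim(1) that n by (auto simp: z field_simps intro: less_imp_le)
  show ?case unfolding z fst_conv snd_conv A_def[symmetric]
  proof (intro allI impI)
   fix k assume k: "k <= n"
   show "\<bar>A k w - real k * a\<bar> <= d * real n"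
   proof (cases "k = n")
    case True
    have "\<bar>A n w - real n * a\<bar> <= d / 3 * real n" using near[of m] m0 by simp
    also have "... <= d * real n" using d by (intro mult_right_mono) auto
    finally show ?thesis using True by simp
   next
    case False
    define j where "j = k * m div n"
    define l u where "l = n * j div m" and "u = n * Suc j div m"
    have j: "Suc j <= m"
    proof -
     have "k * m < m * n" using False k m0 by simp
     then show ?thesis unfolding j_def using n by (simp add: less_mult_imp_div_less Suc_le_eq)
    qed
    have lk: "l <= k"
    proof -
     have "n * j <= k * m" unfolding j_def by simp
     then have "l <= k * m div m" unfolding l_def by (rule div_le_mono)
     then show ?thesis using m0 by simp
    qed
    have ku: "k <= u"
    proof -
     have "k * m < n * Suc j" unfolding j_def using dividend_less_times_div[OF n(1), of "k * m"] by simp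
     then show ?thesis unfolding u_def using m0 by (simp add: less_eq_div_iff_mult_less_eq)
    qed
    have "real u - real l <= real n / real m + 1"
    proof -
     have "u * m <= n * Suc j" unfolding u_def by simp
     moreover have "n * j < (l + 1) * m" unfolding l_def using dividend_less_times_div[OF m0, of "n * j"] by (simp add: algebra_simps)
     ultimately have "real (u * m) <= real (n * Suc j)" "real (n * j) <= real ((l + 1) * m)" by (simp_all only: of_nat_le_iff less_imp_le)
     then have "(real u - real l) * real m <= real n + real m" by (simp add: algebra_simps)
     then show ?thesis using m0 by (simp add: field_simps)
    qed
    then have ul: "(real u - real l) * \<bar>a\<bar> <= (real n / real m + 1) * \<bar>a\<bar>" by (intro mult_right_mono) auto
    have "(real n / real m + 1) * \<bar>a\<bar> = real n * (\<bar>a\<bar> / real m) + \<bar>a\<bar>" by (simp add: algebra_simps)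
    also have "... <= real n * (d / 3) + d / 3 * real n" using am an by (intro add_mono mult_left_mono) auto
    also have "... = 2 * (d / 3) * real n" by simp
    finally have gap: "(real u - real l) * \<bar>a\<bar> <= 2 * (d / 3) * real n" by (rule order_trans[OF ul])
    have du: "\<bar>(real u - real k) * a\<bar> <= 2 * (d / 3) * real n"
    proof -
     have "(real u - real k) * \<bar>a\<bar> <= (real u - real l) * \<bar>a\<bar>" using lk by (intro mult_right_mono) auto
     then show ?thesis using gap ku by (simp add: abs_mult)
    qed
    have dl: "\<bar>(real k - real l) * a\<bar> <= 2 * (d / 3) * real n"
    proof -
     have "(real k - real l) * \<bar>a\<bar> <= (real u - real l) * \<bar>a\<bar>" using ku by (intro mult_right_mono) auto
     then show ?thesis using gap lk by (simp add: abs_mult)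
    qed
    have "A k w - real k * a <= (A u w - real u * a) + (real u - real k) * a"
     using mono[OF ku, of w] by (simp add: algebra_simps)
    moreover have "(A l w - real l * a) - (real k - real l) * a <= A k w - real k * a"
     using mono[OF lk, of w] by (simp add: algebra_simps)
    moreover have "\<bar>A u w - real u * a\<bar> <= d / 3 * real n" "\<bar>A l w - real l * a\<bar> <= d / 3 * real n"
     unfolding u_def l_def using near[of "Suc j"] near[of j] j by auto
    moreover have "d * real n = d / 3 * real n + 2 * (d / 3) * real n" by simp
    ultimately show ?thesis using du dl unfolding abs_le_iff by linarith
   qed
  qed
 qed
qed

end

context stable_inar
begin

definition average :: "((nat => nat) => real) => nat => 'a => real" where
 "average F n w = (\<Sum>k<n. F (state k w)) / real n"

text \<open>Growth at most cubic in the envelope, so that the square has bounded expectation.\<close>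

definition tame :: "((nat => nat) => real) => bool" where
 "tame F \<longleftrightarrow> local F \<and> (\<exists>c. \<forall>k w. \<bar>F (state k w)\<bar> <= c * env k w ^ 3)"

definition ergodic_mean :: "((nat => nat) => real) => real" where
 "ergodic_mean F = (SOME a. (\<lambda>n. \<E> (\<lambda>w. \<bar>average F n w - a\<bar>)) \<longlonglongrightarrow> 0)"

lemma tame_integrable:
 assumes "tame F" shows "integrable M (\<lambda>w. F (state k w))"
proof -
 obtain c where c: "\<And>k w. \<bar>F (state k w)\<bar> <= c * env k w ^ 3" using assms unfolding tame_def by blast
 show ?thesis by (rule env_dominated[OF adapted_state_comp c]) simp
qed

lemma average_L1:
 assumes "tame F" shows "(\<lambda>n. \<E> (\<lambda>w. \<bar>average F n w - ergodic_mean F\<bar>)) \<longlonglongrightarrow> 0"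
proof -
 obtain c where c: "\<And>k w. \<bar>F (state k w)\<bar> <= c * env k w ^ 3" using assms unfolding tame_def by blast
 have le: "(F (state k w))\<^sup>2 <= c\<^sup>2 * env k w ^ 6" for k w
 proof -
  have "\<bar>F (state k w)\<bar>\<^sup>2 <= (c * env k w ^ 3)\<^sup>2" using c by (intro power_mono) auto
  then show ?thesis by (simp add: power_mult_distrib flip: power_mult)
 qed
 have i: "integrable M (\<lambda>w. (F (state k w))\<^sup>2)" for k
  by (rule env_dominated[where c = "c\<^sup>2" and a = 6 and k = k]) (use le in \<open>auto intro: adapted_state_comp\<close>)
 have "\<E> (\<lambda>w. (F (state k w))\<^sup>2) <= c\<^sup>2 * env_bound" for k
 proof -
  have "\<E> (\<lambda>w. (F (state k w))\<^sup>2) <= \<E> (\<lambda>w. c\<^sup>2 * env k w ^ 6)"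
   using i env_bound(2)[of 6 k] le by (intro integral_mono) auto
  also have "... <= c\<^sup>2 * env_bound" using env_bound(3)[of 6 k] by (simp add: mult_left_mono)
  finally show ?thesis .
 qed
 with i have "\<exists>a. (\<lambda>n. \<E> (\<lambda>w. \<bar>average F n w - a\<bar>)) \<longlonglongrightarrow> 0"
  unfolding average_def using assms unfolding tame_def by (intro law_of_large_numbers) auto
 then show ?thesis unfolding ergodic_mean_def by (rule someI_ex)
qed

lemma average_integrable: "tame F ==> integrable M (average F n)"
 unfolding average_def[abs_def] using tame_integrable by simp

lemma average_tendsto: "tame F ==> ((\<lambda>z. average F (fst z) (snd z)) \<longlongrightarrow> ergodic_mean F) (whp M)"
 by (rule tendsto_whp_L1[OF average_integrable average_L1])

lemma ergodic_mean_eqI: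
 "tame F ==> ((\<lambda>z. average F (fst z) (snd z)) \<longlongrightarrow> l) (whp M) ==> ergodic_mean F = l"
 by (rule tendsto_unique[OF whp_not_bot average_tendsto])

lemma average_uniform:
 assumes "tame F" "\<And>x. 0 <= F x" "0 < d"
 shows "\<forall>\<^sub>F z in whp M. \<forall>k\<le>fst z. \<bar>(\<Sum>j<k. F (state j (snd z))) - real k * ergodic_mean F\<bar> <= d * real (fst z)"
 using average_L1[OF assms(1)] unfolding average_def
 by (intro uniform_partial_sums tame_integrable assms)

lemma ergodic_mean_lower:
 assumes F: "tame F" "\<And>x. 0 <= F x" and low: "\<And>k. m <= k ==> c <= \<E> (\<lambda>w. F (state k w))"
 shows "c <= ergodic_mean F"
proof (rule LIMSEQ_le)
 have E: "\<E> (average F n) = (\<Sum>k<n. \<E> (\<lambda>w. F (state k w))) / real n" for n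
  unfolding average_def using tame_integrable[OF F(1)] by simp
 show "(\<lambda>n. \<E> (average F n)) \<longlonglongrightarrow> ergodic_mean F"
 proof (rule Lim_transform2[OF tendsto_const], rule Lim_null_comparison[OF always_eventually average_L1[OF F(1)]], rule allI)
  fix n
  have "ergodic_mean F - \<E> (average F n) = \<E> (\<lambda>w. ergodic_mean F - average F n w)"
   using average_integrable[OF F(1)] by (simp add: prob_space)
  also have "norm ... <= \<E> (\<lambda>w. \<bar>average F n w - ergodic_mean F\<bar>)"
   using integral_abs_bound[of M "\<lambda>w. ergodic_mean F - average F n w"] by (simp add: abs_minus_commute)
  finally show "norm (ergodic_mean F - \<E> (average F n)) <= \<E> (\<lambda>w. \<bar>average F n w - ergodic_mean F\<bar>)" .
 qed
 show "(\<lambda>n. c - real m * c / real n) \<longlonglongrightarrow> c" using tendsto_diff[OF tendsto_const lim_const_over_n[of "real m * c"], of c] by simp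
 show "\<exists>N. \<forall>n\<ge>N. c - real m * c / real n <= \<E> (average F n)"
 proof (intro exI allI impI)
  fix n assume n: "Suc m <= n"
  have "(real n - real m) * c = (\<Sum>k\<in>{m..<n}. c)" using n by (simp add: of_nat_diff)
  also have "... <= (\<Sum>k\<in>{m..<n}. \<E> (\<lambda>w. F (state k w)))" using low by (intro sum_mono) auto
  also have "... <= (\<Sum>k<n. \<E> (\<lambda>w. F (state k w)))"
   using F(2) by (intro sum_mono2) (auto intro: bochner_integral_nonneg)
  finally have "(real n - real m) * c / real n <= \<E> (average F n)" unfolding E by (rule divide_right_mono) simp
  moreover have "(real n - real m) * c / real n = c - real m * c / real n" using n by (simp add: field_simps)
  ultimately show "c - real m * c / real n <= \<E> (average F n)" by simp
 qed
qed

end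

section \<open>Scores and nondegeneracy\<close>

lemma square_diff_le: "(x - y)\<^sup>2 <= 2 * x\<^sup>2 + 2 * y\<^sup>2" for x y :: real
proof -
 have "0 <= (x + y)\<^sup>2" by simp
 then show ?thesis by (simp add: power2_sum power2_diff)
qed

context stable_inar
begin

definition score :: "((nat => nat) => real) => nat => 'a => real" where
 "score h n w = (\<Sum>k<n. h (state k w) * mdiff (Suc k) w)"

lemma score_term:
 fixes h :: "(nat => nat) => real" and c :: real
 assumes h: "\<And>k w. \<bar>h (state k w)\<bar> <= c * env k w"
 defines "d \<equiv> \<lambda>k w. h (state k w) * mdiff (Suc k) w"
 shows "adapted (Suc k) (d k)" "d k \<in> borel_measurable (past (Suc k))" "centred k (d k)" "integrable M (\<lambda>w. d k w ^ 4)"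
  "\<E> (\<lambda>w. d k w ^ 4) <= 3 * c4\<^sup>2 * (c ^ 4 * env_bound)"
proof -
 show a: "adapted (Suc k) (d k)"
  unfolding d_def by (rule adapted_comp2[OF adapted_mono[OF adapted_state_comp] adapted_mdiff]) auto
 show "d k \<in> borel_measurable (past (Suc k))" by (rule adapted_past[OF a])
 show "centred k (d k)" unfolding d_def by (rule centred_mdiff[OF adapted_state_comp])
 show "integrable M (\<lambda>w. d k w ^ 4)" "\<E> (\<lambda>w. d k w ^ 4) <= 3 * c4\<^sup>2 * (c ^ 4 * env_bound)"
  unfolding d_def by (rule mdiff_weighted_fourth[OF adapted_state_comp h])+
qed

lemma score_maximal:
 assumes h: "\<And>k w. \<bar>h (state k w)\<bar> <= c * env k w" and l: "0 < l"
 shows "{w \<in> space M. \<exists>k\<le>n. l < \<bar>score h (a + k) w - score h a w\<bar>} \<in> events"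
  "prob {w \<in> space M. \<exists>k\<le>n. l < \<bar>score h (a + k) w - score h a w\<bar>} <= 16 * (3 * c4\<^sup>2 * (c ^ 4 * env_bound)) * (real n)\<^sup>2 / l ^ 4"
proof -
 have eq: "score h (a + k) w - score h a w = (\<Sum>j\<in>{a..<a + k}. h (state j w) * mdiff (Suc j) w)" for k w
  unfolding score_def lessThan_atLeast0 using sum.atLeastLessThan_concat[of 0 a "a + k" "\<lambda>j. h (state j w) * mdiff (Suc j) w"] by simp
 note m = martingale_maximal_inequality[OF score_term(2-5)[OF h] l, of n a]
 show "{w \<in> space M. \<exists>k\<le>n. l < \<bar>score h (a + k) w - score h a w\<bar>} \<in> events"
  unfolding eq by (rule m(1))
 show "prob {w \<in> space M. \<exists>k\<le>n. l < \<bar>score h (a + k) w - score h a w\<bar>} <= 16 * (3 * c4\<^sup>2 * (c ^ 4 * env_bound)) * (real n)\<^sup>2 / l ^ 4"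
  unfolding eq by (rule m(2))
qed

text \<open>The fourth moment of the score grows quadratically in \<open>n\<close>, but it is divided by \<open>n ^ 4\<close>.\<close>

lemma score_average_null:
 assumes h: "\<And>k w. \<bar>h (state k w)\<bar> <= c * env k w"
 shows "((\<lambda>z. score h (fst z) (snd z) / real (fst z)) \<longlongrightarrow> 0) (whp M)"
proof (rule tendstoI)
 fix e :: real assume e: "0 < e"
 define C where "C = 3 * c4\<^sup>2 * (c ^ 4 * env_bound)"
 note four = martingale_fourth_moment[OF score_term(2-5)[OF h], of 0, folded C_def]
 have S: "integrable M (\<lambda>w. score h n w ^ 4)" "\<E> (\<lambda>w. score h n w ^ 4) <= 16 * C * (real n)\<^sup>2" for n
  using four[of n] by (simp_all add: score_def lessThan_atLeast0)
 have "\<forall>\<^sub>F z in whp M. (score h (fst z) (snd z) / real (fst z)) ^ 4 < e ^ 4"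
 proof (rule whp_Markov)
  show "integrable M (\<lambda>w. (score h n w / real n) ^ 4)" for n using S by (simp add: power_divide)
  show "(\<lambda>n. \<E> (\<lambda>w. (score h n w / real n) ^ 4)) \<longlonglongrightarrow> 0"
  proof (rule Lim_null_comparison[OF always_eventually], rule allI)
   show "(\<lambda>n. 16 * C / real n) \<longlonglongrightarrow> 0" by (rule lim_const_over_n)
   fix n
   have C: "0 <= C" using env_bound(1) by (simp add: C_def)
   have "\<E> (\<lambda>w. (score h n w / real n) ^ 4) <= 16 * C * (real n)\<^sup>2 / real n ^ 4"
    using S[of n] by (simp add: power_divide divide_right_mono)
   also have "... <= 16 * C / real n"
   proof (cases "n = 0")
    case False
    then have "16 * C * (real n)\<^sup>2 / real n ^ 4 = 16 * C / real n / real n" by (simp add: power_numeral_reduce)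
    also have "... <= 16 * C / real n / 1" using False C by (intro divide_left_mono) auto
    finally show ?thesis by simp
   qed simp
   finally show "norm (\<E> (\<lambda>w. (score h n w / real n) ^ 4)) <= 16 * C / real n" by simp
  qed
 qed (use e in auto)
 then show "\<forall>\<^sub>F z in whp M. dist (score h (fst z) (snd z) / real (fst z)) 0 < e"
 proof eventually_elim
  case (elim z)
  then have "\<bar>score h (fst z) (snd z) / real (fst z)\<bar> ^ 4 < e ^ 4" by (subst power_even_abs) simp_all
  then show ?case using power_less_imp_less_base[of "\<bar>score h (fst z) (snd z) / real (fst z)\<bar>" 4 e] e by (simp add: dist_real_def)
 qed
qed

lemma square_average_null:
 "((\<lambda>z. (\<Sum>k<fst z. (mdiff (Suc k) (snd z))\<^sup>2 - cvar (state k (snd z))) / real (fst z)) \<longlongrightarrow> 0) (whp M)"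
proof (rule tendstoI)
 fix e :: real assume e: "0 < e"
 define d where "d k w = (mdiff (Suc k) w)\<^sup>2 - cvar (state k w)" for k w
 define C where "C = 2 * (3 * c4\<^sup>2 * (1 ^ 4 * env_bound)) + 2 * ((1 + \<sigma>\<^sup>2)\<^sup>2 * env_bound)"
 have d_ad: "adapted (Suc k) (d k)" for k
  unfolding d_def[abs_def] by (rule adapted_comp2[where h = "\<lambda>x y. x\<^sup>2 - y", OF adapted_mdiff adapted_mono[OF adapted_state_comp]]) auto
 have "centred k (\<lambda>w. 1 * d k w)" for k unfolding d_def by (rule centred_mdiff_square) simp
 then have cent: "centred k (d k)" for k by simp
 have four: "integrable M (\<lambda>w. mdiff (Suc k) w ^ 4)" "\<E> (\<lambda>w. mdiff (Suc k) w ^ 4) <= 3 * c4\<^sup>2 * (1 ^ 4 * env_bound)" for k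
  using mdiff_weighted_fourth[of k "\<lambda>_. 1" 1] env_ge(1) by auto
 have cv: "(cvar (state k w))\<^sup>2 <= (1 + \<sigma>\<^sup>2)\<^sup>2 * (env k w)\<^sup>2" for k w
  using power_mono[OF cvar_le_env cvar_nonneg, of k w 2] by (simp add: power_mult_distrib)
 have cvi: "integrable M (\<lambda>w. (1 + \<sigma>\<^sup>2)\<^sup>2 * (env k w)\<^sup>2)" for k using env_bound(2)[of 2 k] by simp
 have le: "(d k w)\<^sup>2 <= 2 * mdiff (Suc k) w ^ 4 + 2 * ((1 + \<sigma>\<^sup>2)\<^sup>2 * (env k w)\<^sup>2)" for k w
 proof -
  from square_diff_le[of "(mdiff (Suc k) w)\<^sup>2" "cvar (state k w)"] show ?thesis
   unfolding d_def using cv[of k w] by (simp add: power_mult[symmetric])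
 qed
 have ri: "integrable M (\<lambda>w. 2 * mdiff (Suc k) w ^ 4 + 2 * ((1 + \<sigma>\<^sup>2)\<^sup>2 * (env k w)\<^sup>2))" for k
  by (rule bochner_integrable_add[OF integrable_mult_right[OF four(1)] integrable_mult_right[OF cvi]])
 have d2: "integrable M (\<lambda>w. (d k w)\<^sup>2)" for k
 proof (rule bochner_integrable_bound[OF ri])
  show "(\<lambda>w. (d k w)\<^sup>2) \<in> borel_measurable M" by (rule adapted_borel[OF adapted_comp[OF d_ad]])
  show "AE w in M. norm ((d k w)\<^sup>2) <= norm (2 * mdiff (Suc k) w ^ 4 + 2 * ((1 + \<sigma>\<^sup>2)\<^sup>2 * (env k w)\<^sup>2))"
   unfolding real_norm_def using le by (intro AE_I2) (simp only: abs_power2 order_trans[OF le abs_ge_self])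
 qed
 have Ed2: "\<E> (\<lambda>w. (d k w)\<^sup>2) <= C" for k
 proof -
  have "\<E> (\<lambda>w. (d k w)\<^sup>2) <= \<E> (\<lambda>w. 2 * mdiff (Suc k) w ^ 4 + 2 * ((1 + \<sigma>\<^sup>2)\<^sup>2 * (env k w)\<^sup>2))"
   by (rule integral_mono[OF d2 ri le])
  also have "... = 2 * \<E> (\<lambda>w. mdiff (Suc k) w ^ 4) + 2 * ((1 + \<sigma>\<^sup>2)\<^sup>2 * \<E> (\<lambda>w. (env k w)\<^sup>2))"
   using four(1)[of k] env_bound(2)[of 2 k] by simp
  also have "... <= C" unfolding C_def using four(2)[of k] env_bound(3)[of 2 k] by (intro add_mono mult_left_mono) auto
  finally show ?thesis .
 qed
 note sq = martingale_square_moment[OF adapted_past[OF d_ad] cent d2 Ed2]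
 have "\<forall>\<^sub>F z in whp M. ((\<Sum>k<fst z. d k (snd z)) / real (fst z))\<^sup>2 < e\<^sup>2"
 proof (rule whp_Markov[where f = "\<lambda>n w. ((\<Sum>k<n. d k w) / real n)\<^sup>2"])
  show "integrable M (\<lambda>w. ((\<Sum>k<n. d k w) / real n)\<^sup>2)" for n using sq(1) by (simp add: power_divide)
  show "(\<lambda>n. \<E> (\<lambda>w. ((\<Sum>k<n. d k w) / real n)\<^sup>2)) \<longlonglongrightarrow> 0"
  proof (rule Lim_null_comparison[OF always_eventually lim_const_over_n[of C]], rule allI)
   fix n
   have "\<E> (\<lambda>w. ((\<Sum>k<n. d k w) / real n)\<^sup>2) <= C * real n / (real n)\<^sup>2"
    using sq(2)[of n] by (simp add: power_divide divide_right_mono)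
   also have "... = C / real n" by (cases "n = 0") (simp_all add: power2_eq_square)
   finally show "norm (\<E> (\<lambda>w. ((\<Sum>k<n. d k w) / real n)\<^sup>2)) <= C / real n" by simp
  qed
 qed (use e in auto)
 then show "\<forall>\<^sub>F z in whp M. dist ((\<Sum>k<fst z. (mdiff (Suc k) (snd z))\<^sup>2 - cvar (state k (snd z))) / real (fst z)) 0 < e"
 proof eventually_elim
  case (elim z)
  then have "\<bar>(\<Sum>k<fst z. d k (snd z)) / real (fst z)\<bar>\<^sup>2 < e\<^sup>2" by (simp only: power2_abs)
  then have "\<bar>(\<Sum>k<fst z. d k (snd z)) / real (fst z)\<bar> < e" by (rule power_less_imp_less_base) (use e in simp)
  then show ?case by (simp add: dist_real_def d_def)
 qed
qed

lemma state_at: "i < p ==> state k w i = X (int k - int i) w"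
 using state_lag[of "Suc k" "Suc i" w] by simp

text \<open>If the innovations have positive variance, it is a lower bound. Otherwise they are almost
surely equal to \<open>\<mu> > 0\<close>, thus at least one, all later values are at least one, and the thinning of any lag
with a positive coefficient contributes; its coefficient is less than one by stability.\<close>

lemma cvar_lower:
 obtains c where "0 < c" "\<And>k. p <= k ==> AE w in M. c <= cvar (state k w)"
proof (cases "\<sigma>\<^sup>2 > 0")
 case True
 have nn: "0 <= \<alpha> i * (1 - \<alpha> i)" if "i \<in> {1..p}" for i using coeff_range[OF that] by auto
 have "\<sigma>\<^sup>2 <= cvar (state k w)" for k w
  unfolding cvar_def using sum_nonneg[of "{1..p}" "\<lambda>i. \<alpha> i * (1 - \<alpha> i) * real (state k w (i - 1))"]
  by (simp add: mult_nonneg_nonneg[OF nn])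
 then show ?thesis using True by (intro that[of "\<sigma>\<^sup>2"]) auto
next
 case False
 then have s0: "\<sigma>\<^sup>2 = 0" by simp
 then have apos: "(\<Sum>i=1..p. \<alpha> i) > 0" using nondegenerate by simp
 have "\<exists>i\<in>{1..p}. 0 < \<alpha> i"
 proof (rule ccontr)
  assume "\<not> ?thesis"
  then have "(\<Sum>i=1..p. \<alpha> i) <= 0" by (intro sum_nonpos) (auto simp: not_less)
  then show False using apos by simp
 qed
 then obtain i where i: "i \<in> {1..p}" "0 < \<alpha> i" by blast
 have nn: "0 <= \<alpha> j" if "j \<in> {1..p}" for j using coeff_range[OF that] by auto
 have "\<alpha> i <= (\<Sum>i=1..p. \<alpha> i)" using i nn by (intro member_le_sum) auto
 then have i1: "\<alpha> i < 1" using stable by simp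
 have eps_ae: "AE w in M. 1 <= \<epsilon> 1 w"
 proof -
  have int: "integrable M (\<lambda>w. (real (\<epsilon> 1 w) - \<mu>)\<^sup>2)"
  proof -
   have i1: "integrable M (\<lambda>w. real (\<epsilon> 1 w))"
    by (rule square_integrable_imp_integrable[OF _ innovation_square_integrable]) (rule measurable_compose[OF eps_measurable], simp)
   have "(real (\<epsilon> 1 w) - \<mu>)\<^sup>2 = (real (\<epsilon> 1 w))\<^sup>2 - 2 * \<mu> * real (\<epsilon> 1 w) + \<mu>\<^sup>2" for w by (simp add: power2_diff)
   then show ?thesis using innovation_square_integrable i1 by simp
  qed
  have "\<E> (\<lambda>w. (real (\<epsilon> 1 w) - \<mu>)\<^sup>2) = 0" using innovation_variance s0 unfolding innovation_mean by (simp only:)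
  then have "AE w in M. (real (\<epsilon> 1 w) - \<mu>)\<^sup>2 = 0" using int by (subst (asm) integral_nonneg_eq_0_iff_AE) auto
  then show ?thesis by eventually_elim (use mean_pos in \<open>auto simp: Suc_le_eq intro!: gr0I\<close>)
 qed
 have epsk: "AE w in M. 1 <= \<epsilon> k w" if k: "1 <= k" for k
 proof -
  have m: "\<epsilon> j \<in> measurable M (count_space UNIV)" if "1 <= j" for j
   using noise_measurable[of "Innov j"] that by (simp add: inar_noise_def)
  have "AE y in distr M (count_space UNIV) (\<epsilon> 1). 1 <= y" using m[of 1] eps_ae by (subst AE_distr_iff) auto
  then have "AE y in distr M (count_space UNIV) (\<epsilon> k). 1 <= y" by (simp only: innovation_law[OF k])
  then show ?thesis using m[OF k] by (subst (asm) AE_distr_iff) auto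
 qed
 have Xk: "AE w in M. 1 <= X (int k) w" if "1 <= k" for k
  using epsk[OF that] AE_space by eventually_elim (simp add: recursion[OF that])
 show ?thesis
 proof (rule that[of "\<alpha> i * (1 - \<alpha> i)"])
  show "0 < \<alpha> i * (1 - \<alpha> i)" using i i1 by simp
  fix k assume k: "p <= k"
  have i': "i - 1 < p" "i - 1 <= k" using i k by auto
  have "1 <= k - (i - 1)" using i k by auto
  from Xk[OF this] show "AE w in M. \<alpha> i * (1 - \<alpha> i) <= cvar (state k w)"
  proof eventually_elim
   case (elim w)
   have "1 <= state k w (i - 1)" using elim i' by (simp add: state_at of_nat_diff)
   then have "\<alpha> i * (1 - \<alpha> i) * 1 <= \<alpha> i * (1 - \<alpha> i) * real (state k w (i - 1))"
    using i i1 by (intro mult_left_mono) auto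
   also have "... <= (\<Sum>j=1..p. \<alpha> j * (1 - \<alpha> j) * real (state k w (j - 1)))"
   proof (rule member_le_sum[OF i(1)])
    fix j assume "j \<in> {1..p} - {i}"
    then have "\<alpha> j \<in> {0..1}" using coeff_range by auto
    then show "0 <= \<alpha> j * (1 - \<alpha> j) * real (state k w (j - 1))" by simp
   qed simp
   finally show ?case by (simp add: cvar_def s0)
  qed
 qed
qed

definition affine :: "(nat => real) => real => (nat => nat) => real" where
 "affine u b x = (\<Sum>i<p. u i * real (x i)) + b"

lemma affine_le_env: "\<bar>affine u b (state k w)\<bar> <= ((\<Sum>i<p. \<bar>u i\<bar>) + \<bar>b\<bar>) * env k w"
proof -
 have "\<bar>affine u b (state k w)\<bar> <= \<bar>\<Sum>i<p. u i * real (state k w i)\<bar> + \<bar>b\<bar>" unfolding affine_def by (rule abs_triangle_ineq)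
 also have "\<bar>\<Sum>i<p. u i * real (state k w i)\<bar> <= (\<Sum>i<p. \<bar>u i * real (state k w i)\<bar>)" by (rule sum_abs)
 also have "... <= (\<Sum>i<p. \<bar>u i\<bar> * env k w)"
  by (intro sum_mono) (simp add: abs_mult mult_left_mono env_ge(2))
 also have "\<bar>b\<bar> <= \<bar>b\<bar> * env k w" using env_ge(1)[of k w] mult_left_mono[OF env_ge(1), of "\<bar>b\<bar>" k w] by simp
 finally show ?thesis by (simp add: distrib_right sum_distrib_right)
qed

lemma affine_square_integrable: "integrable M (\<lambda>w. (affine u b (state k w))\<^sup>2)"
proof (rule env_dominated[where a = 2])
 show "\<bar>(affine u b (state k w))\<^sup>2\<bar> <= ((\<Sum>i<p. \<bar>u i\<bar>) + \<bar>b\<bar>)\<^sup>2 * (env k w)\<^sup>2" for w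
  using power_mono[OF affine_le_env abs_ge_zero, of u b k w 2] by (simp add: power_mult_distrib)
qed (auto intro: adapted_state_comp)

text \<open>Let \<open>i\<close> be the most recent lag with a nonzero coefficient. The value at this lag contains a martingale
difference that is uncorrelated with everything before, and with all other terms of the affine function.\<close>

lemma affine_nondegenerate:
 assumes ub: "b \<noteq> 0 \<or> (\<exists>i<p. u i \<noteq> 0)"
 obtains c where "0 < c" "\<And>k. 2 * p <= k ==> c <= \<E> (\<lambda>w. (affine u b (state k w))\<^sup>2)"
proof (cases "\<exists>i<p. u i \<noteq> 0")
 case False
 then have "affine u b x = b" for x by (simp add: affine_def)
 then show ?thesis using ub False by (intro that[of "b\<^sup>2"]) (auto simp: prob_space)
next
 case True
 define i where "i = (LEAST i. i < p \<and> u i \<noteq> 0)"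
 have i: "i < p" "u i \<noteq> 0" using LeastI_ex[OF True[unfolded Bex_def]] by (auto simp: i_def)
 have below: "u j = 0" if "j < i" for j using not_less_Least[of j "\<lambda>i. i < p \<and> u i \<noteq> 0"] that i by (auto simp: i_def)
 obtain c where c: "0 < c" "\<And>k. p <= k ==> AE w in M. c <= cvar (state k w)" using cvar_lower by blast
 show ?thesis
 proof (rule that[of "(u i)\<^sup>2 * c"])
  show "0 < (u i)\<^sup>2 * c" using i c by simp
  fix k assume k: "2 * p <= k"
  \<comment> \<open>The value at lag \<open>i\<close> is generated in the step after time \<open>l\<close>.\<close>
  define l where "l = k - Suc i"
  have l: "p <= l" "k = Suc l + i" using k i by (auto simp: l_def)
  define R where "R w = affine u b (state k w) - u i * mdiff (Suc l) w" for w
  have R_eq: "R w = u i * cmean (state l w) + ((\<Sum>j\<in>{i<..<p}. u j * real (X (int k - int j) w)) + b)" for w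
  proof -
   have "(\<Sum>j<p. u j * real (state k w j)) = (\<Sum>j\<in>{i..<p}. u j * real (state k w j))"
    using below by (intro sum.mono_neutral_right) (auto simp: not_le)
   also have "{i..<p} = insert i {i<..<p}" using i by auto
   also have "(\<Sum>j\<in>insert i {i<..<p}. u j * real (state k w j)) = u i * real (state k w i) + (\<Sum>j\<in>{i<..<p}. u j * real (state k w j))" by simp
   also have "state k w i = X (int (Suc l)) w" using i l by (simp add: state_at)
   also have "(\<Sum>j\<in>{i<..<p}. u j * real (state k w j)) = (\<Sum>j\<in>{i<..<p}. u j * real (X (int k - int j) w))"
    by (intro sum.cong) (auto simp: state_at)
   finally show ?thesis unfolding R_def affine_def mdiff_def by (simp add: algebra_simps)
  qed
  have Rad: "adapted l R"
   unfolding R_eq[abs_def]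
  proof (rule adapted_comp2[where h = "\<lambda>x y. u i * x + (y + b)"])
   show "adapted l (\<lambda>w. cmean (state l w))" by (rule adapted_state_comp)
   show "adapted l (\<lambda>w. \<Sum>j\<in>{i<..<p}. u j * real (X (int k - int j) w))"
    by (intro adapted_sum adapted_comp[where h = "\<lambda>x. _ * real x"] adapted_X) (use l in auto)
  qed
  have G2: "integrable M (\<lambda>w. (affine u b (state k w))\<^sup>2)" by (rule affine_square_integrable)
  have mm: "mdiff (Suc l) \<in> borel_measurable M" by (rule adapted_borel[OF adapted_mdiff]) simp
  have m2: "integrable M (\<lambda>w. (mdiff (Suc l) w)\<^sup>2)"
  proof -
   have "integrable M (\<lambda>w. (1 * mdiff (Suc l) w) ^ 4)" by (rule mdiff_weighted_fourth(1)[where c = 1]) (use env_ge(1) in auto)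
   then have "integrable M (\<lambda>w. \<bar>mdiff (Suc l) w\<bar> ^ 4)" by (simp add: power_even_abs)
   then show ?thesis by (rule integrable_lower_power[OF _ mm]) simp
  qed
  have R2: "integrable M (\<lambda>w. (R w)\<^sup>2)"
  proof (rule bochner_integrable_bound)
   show "integrable M (\<lambda>w. 2 * (affine u b (state k w))\<^sup>2 + 2 * ((u i)\<^sup>2 * (mdiff (Suc l) w)\<^sup>2))"
    by (rule bochner_integrable_add[OF integrable_mult_right[OF G2] integrable_mult_right[OF integrable_mult_right[OF m2]]])
   show "(\<lambda>w. (R w)\<^sup>2) \<in> borel_measurable M" by (rule adapted_borel[OF adapted_comp[OF Rad]])
   have le: "(R w)\<^sup>2 <= 2 * (affine u b (state k w))\<^sup>2 + 2 * ((u i)\<^sup>2 * (mdiff (Suc l) w)\<^sup>2)" for w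
    using square_diff_le[of "affine u b (state k w)" "u i * mdiff (Suc l) w"] unfolding R_def power_mult_distrib .
   show "AE w in M. norm ((R w)\<^sup>2) <= norm (2 * (affine u b (state k w))\<^sup>2 + 2 * ((u i)\<^sup>2 * (mdiff (Suc l) w)\<^sup>2))"
    unfolding real_norm_def abs_power2 by (rule AE_I2, rule order_trans[OF le abs_ge_self])
  qed
  have Rm: "R \<in> borel_measurable M" by (rule adapted_borel[OF Rad])
  have Rmd: "integrable M (\<lambda>w. R w * mdiff (Suc l) w)"
  proof (rule bochner_integrable_bound[OF bochner_integrable_add[OF R2 m2]])
   show "(\<lambda>w. R w * mdiff (Suc l) w) \<in> borel_measurable M" using Rm mm by simp
   have "\<bar>x * y\<bar> <= x\<^sup>2 + y\<^sup>2" for x y :: real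
    using sum_squares_bound[of "\<bar>x\<bar>" "\<bar>y\<bar>"] mult_nonneg_nonneg[OF abs_ge_zero abs_ge_zero, of x y]
    by (simp only: abs_mult power2_abs mult.assoc)
   then show "AE w in M. norm (R w * mdiff (Suc l) w) <= norm ((R w)\<^sup>2 + (mdiff (Suc l) w)\<^sup>2)" by simp
  qed
  have cvi: "integrable M (\<lambda>w. cvar (state l w))"
   by (rule env_dominated[where a = 1 and c = "1 + \<sigma>\<^sup>2"]) (use cvar_nonneg cvar_le_env in \<open>auto intro: adapted_state_comp\<close>)
  have dv: "\<E> (\<lambda>w. (mdiff (Suc l) w)\<^sup>2) = \<E> (\<lambda>w. cvar (state l w))"
   using centredD[OF centred_mdiff_square[of l "\<lambda>_. 1"], of "\<lambda>_. 1"] m2 cvi by simp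
  have cc: "c <= \<E> (\<lambda>w. cvar (state l w))"
  proof -
   have "\<E> (\<lambda>w. c) <= \<E> (\<lambda>w. cvar (state l w))"
    using c(2)[OF l(1)] cvi by (intro integral_mono_AE) auto
   then show ?thesis by (simp add: prob_space)
  qed
  have "(u i)\<^sup>2 * c <= (u i)\<^sup>2 * \<E> (\<lambda>w. (mdiff (Suc l) w)\<^sup>2) + \<E> (\<lambda>w. (R w)\<^sup>2)"
   using cc unfolding dv by (intro add_increasing2 mult_left_mono) auto
  also have "... = \<E> (\<lambda>w. (u i)\<^sup>2 * (mdiff (Suc l) w)\<^sup>2 + 2 * u i * (R w * mdiff (Suc l) w) + (R w)\<^sup>2)"
   using m2 R2 Rmd mdiff_expectation[OF Rad Rmd] by simp
  also have "... = \<E> (\<lambda>w. (affine u b (state k w))\<^sup>2)"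
  proof (rule bochner_integral_cong[OF refl])
   fix w
   have "affine u b (state k w) = u i * mdiff (Suc l) w + R w" by (simp add: R_def)
   then show "(u i)\<^sup>2 * (mdiff (Suc l) w)\<^sup>2 + 2 * u i * (R w * mdiff (Suc l) w) + (R w)\<^sup>2 = (affine u b (state k w))\<^sup>2"
    by (simp add: power2_sum power_mult_distrib mult_ac)
  qed
  finally show "(u i)\<^sup>2 * c <= \<E> (\<lambda>w. (affine u b (state k w))\<^sup>2)" .
 qed
qed

lemma cvar_affine_nondegenerate:
 assumes ub: "b \<noteq> 0 \<or> (\<exists>i<p. u i \<noteq> 0)"
 obtains c where "0 < c" "\<And>k. 2 * p <= k ==> c <= \<E> (\<lambda>w. cvar (state k w) * (affine u b (state k w))\<^sup>2)"
proof -
 obtain c where c: "0 < c" "\<And>k. 2 * p <= k ==> c <= \<E> (\<lambda>w. (affine u b (state k w))\<^sup>2)"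
  using affine_nondegenerate[OF ub] by blast
 obtain v where v: "0 < v" "\<And>k. p <= k ==> AE w in M. v <= cvar (state k w)" using cvar_lower by blast
 show ?thesis
 proof (rule that[of "v * c"])
  show "0 < v * c" using v c by simp
  fix k assume k: "2 * p <= k"
  have i: "integrable M (\<lambda>w. cvar (state k w) * (affine u b (state k w))\<^sup>2)"
  proof (rule env_dominated[where a = 3])
   show "adapted k (\<lambda>w. cvar (state k w) * (affine u b (state k w))\<^sup>2)" by (rule adapted_state_comp)
   fix w
   let ?C = "(\<Sum>i<p. \<bar>u i\<bar>) + \<bar>b\<bar>"
   have "(affine u b (state k w))\<^sup>2 <= (?C * env k w)\<^sup>2"
    using power_mono[OF affine_le_env abs_ge_zero, of u b k w 2] by simp
   then have "cvar (state k w) * (affine u b (state k w))\<^sup>2 <= ((1 + \<sigma>\<^sup>2) * env k w) * (?C * env k w)\<^sup>2"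
    using cvar_le_env cvar_nonneg env_ge(1)[of k w] by (intro mult_mono) (auto intro: mult_nonneg_nonneg)
   also have "... = ((1 + \<sigma>\<^sup>2) * ?C\<^sup>2) * env k w ^ 3" by (simp add: power_mult_distrib power_numeral_reduce)
   finally show "\<bar>cvar (state k w) * (affine u b (state k w))\<^sup>2\<bar> <= ((1 + \<sigma>\<^sup>2) * ?C\<^sup>2) * env k w ^ 3"
    using cvar_nonneg by simp
  qed simp
  have "v * c <= v * \<E> (\<lambda>w. (affine u b (state k w))\<^sup>2)" using c(2)[OF k] v(1) by simp
  also have "... = \<E> (\<lambda>w. v * (affine u b (state k w))\<^sup>2)" by simp
  also have "... <= \<E> (\<lambda>w. cvar (state k w) * (affine u b (state k w))\<^sup>2)"
   using i affine_square_integrable[of u b k] v(2)[of k] k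
   by (intro integral_mono_AE) (auto elim!: eventually_mono intro!: mult_right_mono)
  finally show "v * c <= \<E> (\<lambda>w. cvar (state k w) * (affine u b (state k w))\<^sup>2)" .
 qed
qed

end

section \<open>Gram matrices of the regressors\<close>

lemma outer_nth: "outer u v $ a $ b = u $ a * v $ b"
 by (simp add: outer_def)

lemma outer_mult_vec: "outer u v *v w = (v \<bullet> w) *\<^sub>R (u :: real ^ 'd::finite)"
 by (simp add: vec_eq_iff matrix_vector_mult_def outer_nth inner_vec_def sum_distrib_left mult_ac)

lemma bounded_bilinear_matrix_vector:
 "bounded_bilinear (\<lambda>(A :: real ^ 'd ^ 'e::finite) (v :: real ^ 'd::finite). A *v v)"
proof
 show "\<exists>K. \<forall>(A :: real ^ 'd ^ 'e) (v :: real ^ 'd). norm (A *v v) <= norm A * norm v * K"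
  by (rule exI[of _ 1]) (simp add: norm_matrix_vector_le)
qed (simp_all add: matrix_vector_mult_add_rdistrib matrix_vector_right_distrib scaleR_matrix_vector_assoc matrix_vector_mult_scaleR)

lemmas tendsto_matrix_vector = bounded_bilinear.tendsto[OF bounded_bilinear_matrix_vector]
lemmas matrix_vector_sum_left = bounded_bilinear.sum_left[OF bounded_bilinear_matrix_vector]

lemma norm_matrix_le_entries: "norm (A :: real ^ 'd::finite ^ 'e::finite) <= (\<Sum>a\<in>UNIV. \<Sum>b\<in>UNIV. \<bar>A $ a $ b\<bar>)"
proof -
 have "norm A <= (\<Sum>a\<in>UNIV. norm (A $ a))" unfolding norm_vec_def[of A] by (rule L2_set_le_sum) simp
 also have "... <= (\<Sum>a\<in>UNIV. \<Sum>b\<in>UNIV. \<bar>A $ a $ b\<bar>)" by (intro sum_mono norm_le_l1_cart)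
 finally show ?thesis .
qed

text \<open>The quadratic form attains its minimum on the compact unit sphere.\<close>

lemma positive_definite_coercive:
 fixes A :: "real ^ 'd ^ 'd::finite"
 assumes "\<And>v. v \<noteq> 0 ==> 0 < v \<bullet> (A *v v)"
 obtains m where "0 < m" "coercive m A"
proof -
 let ?S = "sphere (0 :: real ^ 'd) 1"
 have "continuous_on ?S (\<lambda>v. v \<bullet> (A *v v))"
  by (intro continuous_on_inner continuous_on_id linear_continuous_on bounded_bilinear.bounded_linear_right[OF bounded_bilinear_matrix_vector])
 moreover have "?S \<noteq> {}" by (simp add: sphere_eq_empty)
 ultimately obtain u where u: "u \<in> ?S" "\<And>v. v \<in> ?S ==> u \<bullet> (A *v u) <= v \<bullet> (A *v v)"
  using continuous_attains_inf[OF compact_sphere] by blast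
 show ?thesis
 proof (rule that[of "u \<bullet> (A *v u)"])
  show "0 < u \<bullet> (A *v u)" using u(1) by (intro assms) auto
  show "coercive (u \<bullet> (A *v u)) A"
   unfolding coercive_def
  proof
   fix v :: "real ^ 'd"
   show "u \<bullet> (A *v u) * (norm v)\<^sup>2 <= v \<bullet> (A *v v)"
   proof (cases "v = 0")
    case False
    define w where "w = (1 / norm v) *\<^sub>R v"
    have "u \<bullet> (A *v u) <= w \<bullet> (A *v w)" using False by (intro u(2)) (simp add: w_def)
    then have "u \<bullet> (A *v u) * (norm v)\<^sup>2 <= w \<bullet> (A *v w) * (norm v)\<^sup>2" by (intro mult_right_mono) auto
    also have "... = v \<bullet> (A *v v)" using False by (simp add: w_def matrix_vector_mult_scaleR power2_eq_square)
    finally show ?thesis .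
   qed simp
  qed
 qed
qed

lemma sum_lag: "(\<Sum>i\<in>UNIV. f (lag (i :: 'p::{finite,linorder}))) = (\<Sum>l=1..CARD('p). f l)"
 by (rule sum.reindex_bij_betw[OF bij_betw_lag])

lemma lag_range: "lag (i :: 'p::{finite,linorder}) \<in> {1..CARD('p)}"
 using bij_betw_lag by (auto simp: bij_betw_def)

lemma sum_option: "(\<Sum>c\<in>UNIV. f (c :: 'p::finite option)) = f None + (\<Sum>i\<in>UNIV. f (Some i))"
 by (simp add: UNIV_option_conv sum.reindex)

text \<open>The type argument fixes the dimension of the estimators.\<close>

locale inar_estimation = stable_inar M "CARD('p::{finite,linorder})" \<alpha> \<mu> \<sigma> X \<xi> \<epsilon>
 for M :: "'a measure" and \<alpha> \<mu> \<sigma> X \<xi> \<epsilon> +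
 fixes dim :: "'p::{finite,linorder} itself"
begin

definition yvec :: "(nat => nat) => real ^ 'p option" where
 "yvec x = (\<chi> c. case c of Some i => real (x (lag i - 1)) | None => 1)"

definition theta :: "real ^ 'p option" where
 "theta = (\<chi> c. case c of Some i => \<alpha> (lag i) | None => \<mu>)"

lemma yvec_nth: "yvec x $ None = 1" "yvec x $ Some i = real (x (lag i - 1))"
 by (simp_all add: yvec_def)

lemma theta_nth: "theta $ None = \<mu>" "theta $ Some i = \<alpha> (lag i)"
 by (simp_all add: theta_def)

lemma inar_Y_Suc: "inar_Y X (Suc k) w = yvec (state k w)"
proof -
 have "X (int (Suc k) - int (lag i)) w = state k w (lag i - 1)" for i :: 'p
  using state_lag[of "Suc k" "lag i" w, OF _ lag_range] by simp
 then show ?thesis unfolding inar_Y_def yvec_def by (simp only:)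
qed

lemma inner_yvec:
 "v \<bullet> yvec x = affine (\<lambda>j. v $ Some (inv_into UNIV lag (Suc j))) (v $ None) x"
proof -
 have inv: "inv_into UNIV lag (lag i) = i" for i :: 'p
  using bij_betw_lag[where ?'p = 'p] by (intro inv_into_f_f) (auto simp: bij_betw_def)
 have "v \<bullet> yvec x = v $ None + (\<Sum>i\<in>UNIV. v $ Some i * real (x (lag i - 1)))"
  by (simp add: inner_vec_def sum_option yvec_nth)
 also have "(\<Sum>i\<in>UNIV. v $ Some i * real (x (lag i - 1))) = (\<Sum>i\<in>UNIV. (\<lambda>l. v $ Some (inv_into UNIV lag l) * real (x (l - 1))) (lag (i :: 'p)))"
  by (simp add: inv)
 also have "... = (\<Sum>l=1..CARD('p). v $ Some (inv_into UNIV lag l) * real (x (l - 1)))" by (rule sum_lag)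
 also have "... = (\<Sum>j<CARD('p). v $ Some (inv_into UNIV lag (Suc j)) * real (x j))"
  by (simp add: sum.atLeast1_atMost_eq)
 finally show ?thesis by (simp add: affine_def)
qed

lemma cmean_eq: "cmean x = theta \<bullet> yvec x"
 unfolding cmean_def thin_mean_def
 using sum_lag[of "\<lambda>l. \<alpha> l * real (x (l - 1))", where ?'p = 'p]
 by (simp add: inner_vec_def sum_option yvec_nth theta_nth)

lemma cvar_eq: "cvar x = (\<Sum>i\<in>UNIV. theta $ Some i * (1 - theta $ Some i) * yvec x $ Some i) + \<sigma>\<^sup>2"
 unfolding cvar_def
 using sum_lag[of "\<lambda>l. \<alpha> l * (1 - \<alpha> l) * real (x (l - 1))", where ?'p = 'p]
 by (simp add: yvec_nth theta_nth)

lemma yvec_nonneg: "0 <= yvec x $ c"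
 by (cases c) (simp_all add: yvec_nth)

lemma yvec_le_env: "yvec (state k w) $ c <= env k w"
proof (cases c)
 case None
 then show ?thesis using env_ge(1) by (simp add: yvec_nth)
next
 case (Some i)
 have "lag i - 1 < CARD('p)" using lag_range[of i] by auto
 then show ?thesis using env_ge(2) Some by (simp add: yvec_nth)
qed

lemma local_yvec: "local yvec"
proof -
 have "lag i - Suc 0 < CARD('p)" for i :: 'p using lag_range[of i] by auto
 then show ?thesis by (auto simp: local_def vec_eq_iff yvec_def split: option.split)
qed

lemma local_yvec_comp: "local (\<lambda>x. h (yvec x))"
 unfolding local_def
proof (intro allI impI)
 fix x y :: "nat => nat" assume "\<forall>i<CARD('p). x i = y i"
 then have "yvec x = yvec y" using local_yvec unfolding local_def by blast
 then show "h (yvec x) = h (yvec y)" by simp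
qed

text \<open>The weights of the Gram matrices that occur: one, the lagged values, and the conditional variance.\<close>

definition admissible :: "((nat => nat) => real) => bool" where
 "admissible g \<longleftrightarrow> local g \<and> (\<forall>x. 0 <= g x) \<and> (\<exists>c. \<forall>k w. g (state k w) <= c * env k w)"

lemma admissible_one: "admissible (\<lambda>_. 1)"
 unfolding admissible_def by (auto simp: local_def intro!: exI[of _ 1] env_ge)

lemma admissible_lag: "admissible (\<lambda>x. yvec x $ Some i)"
 unfolding admissible_def
 by (intro conjI allI exI[of _ 1] local_yvec_comp yvec_nonneg) (simp add: yvec_le_env)

lemma local_cvar: "local cvar"
 unfolding cvar_eq[abs_def] by (rule local_yvec_comp)

lemma admissible_cvar: "admissible cvar"
 unfolding admissible_def using local_cvar cvar_nonneg cvar_le_env by blast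

definition gram_sum :: "((nat => nat) => real) => nat => 'a => real ^ 'p option ^ 'p option" where
 "gram_sum g n w = (\<Sum>k<n. g (state k w) *\<^sub>R outer (yvec (state k w)) (yvec (state k w)))"

text \<open>For the weight one this is the limit \<open>Q\<close> of the normalised design matrix, for the weight \<open>cvar\<close> the
limit \<open>I\<close> of the normalised information matrix.\<close>

definition gram :: "((nat => nat) => real) => real ^ 'p option ^ 'p option" where
 "gram g = (\<chi> a b. ergodic_mean (\<lambda>x. g x * (yvec x $ a * yvec x $ b)))"

lemma gram_sum_nth: "gram_sum g n w $ a $ b = (\<Sum>k<n. g (state k w) * (yvec (state k w) $ a * yvec (state k w) $ b))"
 by (simp add: gram_sum_def outer_nth)

lemma tame_quadratic:
 assumes g: "admissible g" and h: "local h" "\<And>k w. \<bar>h (state k w)\<bar> <= c * (env k w)\<^sup>2"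
 shows "tame (\<lambda>x. g x * h x)"
proof -
 obtain d where d: "\<And>k w. g (state k w) <= d * env k w" using g unfolding admissible_def by blast
 have lg: "local g" using g unfolding admissible_def by blast
 have "local (\<lambda>x. g x * h x)"
  unfolding local_def
 proof (intro allI impI)
  fix x y :: "nat => nat" assume xy: "\<forall>i<CARD('p). x i = y i"
  have "g x = g y" "h x = h y" using lg h(1) xy unfolding local_def by blast+
  then show "g x * h x = g y * h y" by simp
 qed
 moreover have "\<bar>g (state k w) * h (state k w)\<bar> <= (d * c) * env k w ^ 3" for k w
 proof -
  have nn: "0 <= g (state k w)" using g unfolding admissible_def by blast
  have "\<bar>g (state k w) * h (state k w)\<bar> = g (state k w) * \<bar>h (state k w)\<bar>" using nn by (simp add: abs_mult)
  also have "... <= (d * env k w) * (c * (env k w)\<^sup>2)"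
   by (intro mult_mono d h(2)) (use nn order_trans[OF nn d] in auto)
  finally show ?thesis by (simp add: power_numeral_reduce mult_ac)
 qed
 ultimately show ?thesis unfolding tame_def by blast
qed

lemma tame_gram: "admissible g ==> tame (\<lambda>x. g x * (yvec x $ a * yvec x $ b))"
proof (rule tame_quadratic)
 show "local (\<lambda>x. yvec x $ a * yvec x $ b)" by (rule local_yvec_comp)
 show "\<bar>yvec (state k w) $ a * yvec (state k w) $ b\<bar> <= 1 * (env k w)\<^sup>2" for k w
 proof -
  have "yvec (state k w) $ a * yvec (state k w) $ b <= env k w * env k w"
   by (rule mult_mono[OF yvec_le_env yvec_le_env order_trans[OF yvec_nonneg yvec_le_env] yvec_nonneg])
  then show ?thesis by (simp add: power2_eq_square yvec_nonneg)
 qed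
qed

lemma gram_sum_tendsto:
 assumes "admissible g"
 shows "((\<lambda>z. (1 / real (fst z)) *\<^sub>R gram_sum g (fst z) (snd z)) \<longlongrightarrow> gram g) (whp M)"
proof (intro vec_tendstoI)
 fix a b
 show "((\<lambda>z. ((1 / real (fst z)) *\<^sub>R gram_sum g (fst z) (snd z)) $ a $ b) \<longlongrightarrow> gram g $ a $ b) (whp M)"
  using average_tendsto[OF tame_gram[OF assms, of a b]] by (simp add: gram_sum_nth gram_def average_def)
qed

lemma gram_sum_uniform:
 assumes g: "admissible g" and d: "0 < d"
 shows "\<forall>\<^sub>F z in whp M. \<forall>k\<le>fst z. norm (gram_sum g k (snd z) - real k *\<^sub>R gram g) <= d * real (fst z)"
proof -
 let ?N = "real CARD('p option)"
 have N: "0 < ?N" by simp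
 define e where "e = d / (?N * ?N)"
 have e: "0 < e" using d N by (simp add: e_def del: of_nat_0_less_iff)
 have nn: "0 <= g x * (yvec x $ a * yvec x $ b)" for x a b using g yvec_nonneg unfolding admissible_def by simp
 have "\<forall>\<^sub>F z in whp M. \<forall>a\<in>UNIV. \<forall>b\<in>UNIV. \<forall>k\<le>fst z. \<bar>gram_sum g k (snd z) $ a $ b - real k * gram g $ a $ b\<bar> <= e * real (fst z)"
  unfolding gram_sum_nth gram_def vec_lambda_beta
  by (intro eventually_ball_finite finite ballI average_uniform tame_gram g nn e)
 then show ?thesis
 proof eventually_elim
  case (elim z)
  show ?case
  proof (intro allI impI)
   fix k assume k: "k <= fst z"
   have "norm (gram_sum g k (snd z) - real k *\<^sub>R gram g) <= (\<Sum>a\<in>UNIV. \<Sum>b\<in>UNIV. \<bar>gram_sum g k (snd z) $ a $ b - real k * gram g $ a $ b\<bar>)"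
    using norm_matrix_le_entries[of "gram_sum g k (snd z) - real k *\<^sub>R gram g"] by simp
   also have "... <= (\<Sum>a\<in>(UNIV :: 'p option set). \<Sum>b\<in>(UNIV :: 'p option set). e * real (fst z))"
    using elim k by (intro sum_mono) auto
   also have "... = ?N * ?N * e * real (fst z)" by (simp only: sum_constant mult.assoc)
   also have "?N * ?N * e = d" unfolding e_def using N by (simp del: of_nat_0_less_iff)
   finally show "norm (gram_sum g k (snd z) - real k *\<^sub>R gram g) <= d * real (fst z)" .
  qed
 qed
qed

lemma transpose_gram: "transpose (gram g) = gram g"
 by (simp add: transpose_def gram_def vec_eq_iff mult.commute)

lemma transpose_gram_sum: "transpose (gram_sum g n w) = gram_sum g n w"
 by (simp add: transpose_def vec_eq_iff gram_sum_nth mult.commute)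

lemma tame_inner_square:
 assumes "admissible g" shows "tame (\<lambda>x. g x * (v \<bullet> yvec x)\<^sup>2)"
proof (rule tame_quadratic[OF assms])
 show "local (\<lambda>x. (v \<bullet> yvec x)\<^sup>2)" by (rule local_yvec_comp)
 show "\<bar>(v \<bullet> yvec (state k w))\<^sup>2\<bar> <= ((\<Sum>j<CARD('p). \<bar>v $ Some (inv_into UNIV lag (Suc j))\<bar>) + \<bar>v $ None\<bar>)\<^sup>2 * (env k w)\<^sup>2" for k w
  unfolding inner_yvec using power_mono[OF affine_le_env abs_ge_zero, of _ _ k w 2] by (simp add: power_mult_distrib)
qed

text \<open>Both sides are limits of the same averages, and limits along \<open>whp\<close> are unique.\<close>

lemma gram_quadratic_form:
 assumes "admissible g"
 shows "v \<bullet> (gram g *v v) = ergodic_mean (\<lambda>x. g x * (v \<bullet> yvec x)\<^sup>2)"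
proof (rule ergodic_mean_eqI[OF tame_inner_square[OF assms], symmetric])
 have "((\<lambda>z. v \<bullet> (((1 / real (fst z)) *\<^sub>R gram_sum g (fst z) (snd z)) *v v)) \<longlongrightarrow> v \<bullet> (gram g *v v)) (whp M)"
  by (intro tendsto_inner tendsto_const tendsto_matrix_vector gram_sum_tendsto assms)
 moreover have "v \<bullet> (((1 / real n) *\<^sub>R gram_sum g n w) *v v) = average (\<lambda>x. g x * (v \<bullet> yvec x)\<^sup>2) n w" for n w
 proof -
  have "gram_sum g n w *v v = (\<Sum>k<n. g (state k w) *\<^sub>R ((yvec (state k w) \<bullet> v) *\<^sub>R yvec (state k w)))"
   unfolding gram_sum_def matrix_vector_sum_left by (simp add: outer_mult_vec flip: scaleR_matrix_vector_assoc)
  then show ?thesis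
   by (simp add: average_def inner_sum_right power2_eq_square inner_commute mult.assoc flip: scaleR_matrix_vector_assoc)
 qed
 ultimately show "((\<lambda>z. average (\<lambda>x. g x * (v \<bullet> yvec x)\<^sup>2) (fst z) (snd z)) \<longlongrightarrow> v \<bullet> (gram g *v v)) (whp M)" by simp
qed

lemma inner_yvec_nontrivial:
 assumes "v \<noteq> 0"
 shows "v $ None \<noteq> 0 \<or> (\<exists>j<CARD('p). v $ Some (inv_into UNIV lag (Suc j) :: 'p) \<noteq> 0)"
proof (rule ccontr)
 assume z: "\<not> ?thesis"
 have "v $ Some i = 0" for i
 proof -
  have l: "lag i \<in> {1..CARD('p)}" by (rule lag_range)
  have "inv_into UNIV lag (lag i) = i"
   using bij_betw_lag[where ?'p = 'p] by (intro inv_into_f_f) (auto simp: bij_betw_def)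
  moreover have "v $ Some (inv_into UNIV lag (Suc (lag i - 1)) :: 'p) = 0"
   using z l by (metis (no_types, lifting) Suc_diff_1 Suc_le_lessD atLeastAtMost_iff less_le_trans diff_less zero_less_one One_nat_def)
  ultimately show ?thesis using l by simp
 qed
 then have "v $ c = 0" for c using z by (cases c) auto
 then show False using assms by (simp add: vec_eq_iff)
qed

lemma gram_one_coercive: obtains m where "0 < m" "coercive m (gram (\<lambda>_. 1))"
proof (rule positive_definite_coercive)
 fix v :: "real ^ 'p option" assume v: "v \<noteq> 0"
 obtain c where c: "0 < c" "\<And>k. 2 * CARD('p) <= k ==> c <= \<E> (\<lambda>w. (v \<bullet> yvec (state k w))\<^sup>2)"
  using affine_nondegenerate[OF inner_yvec_nontrivial[OF v]] unfolding inner_yvec by blast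
 have "c <= ergodic_mean (\<lambda>x. 1 * (v \<bullet> yvec x)\<^sup>2)"
  by (rule ergodic_mean_lower[OF tame_inner_square[OF admissible_one]]) (use c(2) in auto)
 then show "0 < v \<bullet> (gram (\<lambda>_. 1) *v v)" using c(1) unfolding gram_quadratic_form[OF admissible_one] by linarith
qed (rule that)

lemma gram_cvar_coercive: obtains m where "0 < m" "coercive m (gram cvar)"
proof (rule positive_definite_coercive)
 fix v :: "real ^ 'p option" assume v: "v \<noteq> 0"
 obtain c where c: "0 < c" "\<And>k. 2 * CARD('p) <= k ==> c <= \<E> (\<lambda>w. cvar (state k w) * (v \<bullet> yvec (state k w))\<^sup>2)"
  using cvar_affine_nondegenerate[OF inner_yvec_nontrivial[OF v]] unfolding inner_yvec by blast
 have "c <= ergodic_mean (\<lambda>x. cvar x * (v \<bullet> yvec x)\<^sup>2)"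
  by (rule ergodic_mean_lower[OF tame_inner_square[OF admissible_cvar]]) (use c(2) cvar_nonneg in auto)
 then show "0 < v \<bullet> (gram cvar *v v)" using c(1) unfolding gram_quadratic_form[OF admissible_cvar] by linarith
qed (rule that)

lemma gram_sum_cvar:
 "gram_sum cvar n w = (\<Sum>i\<in>UNIV. (theta $ Some i * (1 - theta $ Some i)) *\<^sub>R gram_sum (\<lambda>x. yvec x $ Some i) n w) + \<sigma>\<^sup>2 *\<^sub>R gram_sum (\<lambda>_. 1) n w"
proof -
 have "(\<Sum>i\<in>UNIV. (theta $ Some i * (1 - theta $ Some i)) *\<^sub>R gram_sum (\<lambda>x. yvec x $ Some i) n w) =
   (\<Sum>k<n. (\<Sum>i\<in>UNIV. theta $ Some i * (1 - theta $ Some i) * yvec (state k w) $ Some i) *\<^sub>R outer (yvec (state k w)) (yvec (state k w)))"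
  unfolding gram_sum_def scaleR_sum_left scaleR_sum_right scaleR_scaleR by (rule sum.swap)
 then show ?thesis
  unfolding gram_sum_def cvar_eq by (simp add: scaleR_left_distrib sum.distrib scaleR_sum_right)
qed

lemma gram_cvar:
 "gram cvar = (\<Sum>i\<in>UNIV. (theta $ Some i * (1 - theta $ Some i)) *\<^sub>R gram (\<lambda>x. yvec x $ Some i)) + \<sigma>\<^sup>2 *\<^sub>R gram (\<lambda>_. 1)"
proof (rule tendsto_unique[OF whp_not_bot gram_sum_tendsto[OF admissible_cvar]])
 have "((\<lambda>z. (\<Sum>i\<in>UNIV. (theta $ Some i * (1 - theta $ Some i)) *\<^sub>R ((1 / real (fst z)) *\<^sub>R gram_sum (\<lambda>x. yvec x $ Some i) (fst z) (snd z))) + \<sigma>\<^sup>2 *\<^sub>R ((1 / real (fst z)) *\<^sub>R gram_sum (\<lambda>_. 1) (fst z) (snd z)))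
   \<longlongrightarrow> (\<Sum>i\<in>UNIV. (theta $ Some i * (1 - theta $ Some i)) *\<^sub>R gram (\<lambda>x. yvec x $ Some i)) + \<sigma>\<^sup>2 *\<^sub>R gram (\<lambda>_. 1)) (whp M)"
  by (intro tendsto_add tendsto_sum tendsto_scaleR tendsto_const gram_sum_tendsto admissible_lag admissible_one)
 moreover have "(\<Sum>i\<in>UNIV. (theta $ Some i * (1 - theta $ Some i)) *\<^sub>R (c *\<^sub>R gram_sum (\<lambda>x. yvec x $ Some i) n w)) + \<sigma>\<^sup>2 *\<^sub>R (c *\<^sub>R gram_sum (\<lambda>_. 1) n w) = c *\<^sub>R gram_sum cvar n w" for c n w
  unfolding gram_sum_cvar by (simp add: scaleR_right_distrib scaleR_sum_right mult.commute)
 ultimately show "((\<lambda>z. (1 / real (fst z)) *\<^sub>R gram_sum cvar (fst z) (snd z)) \<longlongrightarrow>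
   (\<Sum>i\<in>UNIV. (theta $ Some i * (1 - theta $ Some i)) *\<^sub>R gram (\<lambda>x. yvec x $ Some i)) + \<sigma>\<^sup>2 *\<^sub>R gram (\<lambda>_. 1)) (whp M)"
  by (simp only:)
qed

section \<open>Consistency of the estimators\<close>

definition score_vec :: "nat => 'a => real ^ 'p option" where
 "score_vec n w = (\<Sum>k<n. mdiff (Suc k) w *\<^sub>R yvec (state k w))"

definition cls_error :: "nat => 'a => real ^ 'p option" where
 "cls_error n w = cls_theta X n w - theta"

lemma score_vec_nth: "score_vec n w $ c = score (\<lambda>x. yvec x $ c) n w"
 by (simp add: score_vec_def score_def mult.commute)

lemma score_vec_average: "((\<lambda>z. (1 / real (fst z)) *\<^sub>R score_vec (fst z) (snd z)) \<longlongrightarrow> 0) (whp M)"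
proof (rule vec_tendstoI)
 fix c
 have "\<bar>yvec (state k w) $ c\<bar> <= 1 * env k w" for k w using yvec_nonneg yvec_le_env by simp
 from score_average_null[OF this]
 show "((\<lambda>z. ((1 / real (fst z)) *\<^sub>R score_vec (fst z) (snd z)) $ c) \<longlongrightarrow> 0 $ c) (whp M)"
  by (simp add: score_vec_nth)
qed

lemma X_Suc_eq: "real (X (int (Suc k)) w) = theta \<bullet> yvec (state k w) + mdiff (Suc k) w"
 by (simp add: mdiff_def cmean_eq)

lemma inar_Q_eq: "inar_Q X n w = gram_sum (\<lambda>_. 1) n w"
 unfolding inar_Q_def gram_sum_def One_nat_def sum.atLeast1_atMost_eq inar_Y_Suc by simp

lemma gram_sum_one_mult: "gram_sum (\<lambda>_. 1) n w *v v = (\<Sum>k<n. (v \<bullet> yvec (state k w)) *\<^sub>R yvec (state k w))"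
 unfolding gram_sum_def matrix_vector_sum_left by (simp add: outer_mult_vec inner_commute)

lemma sum_X_Y: "(\<Sum>k=1..n. real (X (int k) w) *\<^sub>R inar_Y X k w) = gram_sum (\<lambda>_. 1) n w *v theta + score_vec n w"
 unfolding gram_sum_one_mult score_vec_def One_nat_def sum.atLeast1_atMost_eq inar_Y_Suc X_Suc_eq
 by (simp add: scaleR_left_distrib sum.distrib)

lemma residual_Suc: "residual X (cls_theta X n w :: real ^ 'p option) (Suc k) w = mdiff (Suc k) w - cls_error n w \<bullet> yvec (state k w)"
 unfolding residual_def inar_Y_Suc X_Suc_eq cls_error_def by (simp add: inner_diff_left)

lemma sum_residual_Y:
 "(\<Sum>k=1..m. residual X (cls_theta X n w :: real ^ 'p option) k w *\<^sub>R inar_Y X k w) = score_vec m w - gram_sum (\<lambda>_. 1) m w *v cls_error n w"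
 unfolding gram_sum_one_mult score_vec_def One_nat_def sum.atLeast1_atMost_eq inar_Y_Suc residual_Suc
 by (simp add: scaleR_left_diff_distrib sum_subtractf)

lemma thinning_variance_Suc: "thinning_variance X v (Suc k) w = (\<Sum>i\<in>UNIV. v $ Some i * (1 - v $ Some i) * yvec (state k w) $ Some i)"
proof -
 have "X (int (Suc k) - int (lag i)) w = state k w (lag i - 1)" for i :: 'p
  using state_lag[of "Suc k" "lag i" w, OF _ lag_range] by simp
 then show ?thesis unfolding thinning_variance_def yvec_nth by (simp only:)
qed

lemma eventually_positive: "\<forall>\<^sub>F z in whp M. 0 < fst z"
 by (rule eventually_whp_sure, rule eventually_mono[OF eventually_gt_at_top[of 0]]) simp

lemma eventually_coercive:
 assumes "coercive m A" "0 < m" and lim: "(f \<longlongrightarrow> A) F"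
 shows "\<forall>\<^sub>F z in F. coercive (m / 2) (f z)"
proof -
 have "\<forall>\<^sub>F z in F. dist (f z) A < m / 2" using lim assms(2) by (intro tendstoD) auto
 then show ?thesis
 proof eventually_elim
  case (elim z)
  then have "norm (f z - A) <= m / 2" by (simp add: dist_norm)
  from coercive_perturb[OF assms(1) this] show ?case by simp
 qed
qed

text \<open>Inserting \<open>X = theta \<bullet> Y + d\<close> into the normal equations leaves the score.\<close>

lemma cls_error_eq:
 assumes c: "coercive m ((1 / real n) *\<^sub>R gram_sum (\<lambda>_. 1) n w)" "0 < m" and n: "0 < n"
 shows "cls_error n w = matrix_inv ((1 / real n) *\<^sub>R gram_sum (\<lambda>_. 1) n w) *v ((1 / real n) *\<^sub>R score_vec n w)"
proof -
 let ?Q = "gram_sum (\<lambda>_. 1) n w"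
 have "coercive (real n * m) ?Q"
  unfolding coercive_def
 proof
  fix v
  have "real n * (m * (norm v)\<^sup>2) <= real n * (v \<bullet> (((1 / real n) *\<^sub>R ?Q) *v v))"
   using c(1) unfolding coercive_def by (intro mult_left_mono) auto
  also have "... = v \<bullet> (?Q *v v)" using n by (simp flip: scaleR_matrix_vector_assoc)
  finally show "real n * m * (norm v)\<^sup>2 <= v \<bullet> (?Q *v v)" by (simp add: mult.assoc)
 qed
 moreover have "0 < real n * m" using n c(2) by simp
 ultimately have inv: "matrix_inv ?Q ** ?Q = mat 1" "?Q ** matrix_inv ?Q = mat 1" by (rule matrix_inv_coercive)+
 have "cls_error n w = matrix_inv ?Q *v (?Q *v theta + score_vec n w) - theta"
  unfolding cls_error_def cls_theta_def sum_X_Y inar_Q_eq ..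
 also have "... = matrix_inv ?Q *v score_vec n w"
  by (simp add: matrix_vector_right_distrib matrix_vector_mul_assoc inv(1))
 finally have "?Q *v cls_error n w = score_vec n w" by (simp add: matrix_vector_mul_assoc inv(2))
 then have "((1 / real n) *\<^sub>R ?Q) *v cls_error n w = (1 / real n) *\<^sub>R score_vec n w"
  by (simp flip: scaleR_matrix_vector_assoc)
 then have "matrix_inv ((1 / real n) *\<^sub>R ?Q) *v ((1 / real n) *\<^sub>R score_vec n w) =
   (matrix_inv ((1 / real n) *\<^sub>R ?Q) ** ((1 / real n) *\<^sub>R ?Q)) *v cls_error n w"
  by (simp only: matrix_vector_mul_assoc[symmetric])
 then show ?thesis unfolding matrix_inv_coercive(2)[OF c] by simp
qed

lemma cls_error_whp:
 "\<forall>\<^sub>F z in whp M. cls_error (fst z) (snd z) =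
  matrix_inv ((1 / real (fst z)) *\<^sub>R gram_sum (\<lambda>_. 1) (fst z) (snd z)) *v ((1 / real (fst z)) *\<^sub>R score_vec (fst z) (snd z))"
proof -
 obtain m where m: "0 < m" "coercive m (gram (\<lambda>_. 1))" using gram_one_coercive by blast
 show ?thesis
  using eventually_coercive[OF m(2,1) gram_sum_tendsto[OF admissible_one]] eventually_positive
  by eventually_elim (rule cls_error_eq[where m = "m / 2"], use m(1) in auto)
qed

lemma inverse_gram_tendsto:
 "((\<lambda>z. matrix_inv ((1 / real (fst z)) *\<^sub>R gram_sum (\<lambda>_. 1) (fst z) (snd z))) \<longlongrightarrow> matrix_inv (gram (\<lambda>_. 1))) (whp M)"
proof -
 obtain m where m: "0 < m" "coercive m (gram (\<lambda>_. 1))" using gram_one_coercive by blast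
 show ?thesis by (rule matrix_inv_tendsto[OF m(2,1) gram_sum_tendsto[OF admissible_one]])
qed

lemma cls_consistent: "((\<lambda>z. cls_error (fst z) (snd z)) \<longlongrightarrow> 0) (whp M)"
proof (rule Lim_transform_eventually)
 show "((\<lambda>z. matrix_inv ((1 / real (fst z)) *\<^sub>R gram_sum (\<lambda>_. 1) (fst z) (snd z)) *v ((1 / real (fst z)) *\<^sub>R score_vec (fst z) (snd z))) \<longlongrightarrow> 0) (whp M)"
  using tendsto_matrix_vector[OF inverse_gram_tendsto score_vec_average] by simp
 show "\<forall>\<^sub>F z in whp M. matrix_inv ((1 / real (fst z)) *\<^sub>R gram_sum (\<lambda>_. 1) (fst z) (snd z)) *v ((1 / real (fst z)) *\<^sub>R score_vec (fst z) (snd z)) = cls_error (fst z) (snd z)"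
  using cls_error_whp by eventually_elim simp
qed

lemma cls_theta_tendsto: "((\<lambda>z. cls_theta X (fst z) (snd z)) \<longlongrightarrow> theta) (whp M)"
 using tendsto_add[OF tendsto_const cls_consistent, of theta] by (simp add: cls_error_def)

lemma tame_lag: "tame (\<lambda>x. yvec x $ Some i)"
 using tame_gram[OF admissible_one, of "Some i" None] by (simp add: yvec_nth)

text \<open>Expansion of the squared residuals. Every term except \<open>\<sigma>\<^sup>2\<close> tends to zero.\<close>

lemma sigma2_est_eq:
 assumes n: "0 < n"
 shows "sigma2_est X (cls_theta X n w :: real ^ 'p option) n w =
  (\<Sum>k<n. (mdiff (Suc k) w)\<^sup>2 - cvar (state k w)) / real n + \<sigma>\<^sup>2
  + (\<Sum>i\<in>UNIV. (theta $ Some i * (1 - theta $ Some i) - cls_theta X n w $ Some i * (1 - cls_theta X n w $ Some i)) * average (\<lambda>x. yvec x $ Some i) n w)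
  - 2 * (cls_error n w \<bullet> ((1 / real n) *\<^sub>R score_vec n w))
  + cls_error n w \<bullet> (((1 / real n) *\<^sub>R gram_sum (\<lambda>_. 1) n w) *v cls_error n w)"
proof -
 let ?D = "cls_error n w" and ?v = "cls_theta X n w :: real ^ 'p option"
 define A where "A i = (\<Sum>k<n. yvec (state k w) $ Some i)" for i
 have tv: "(\<Sum>k<n. \<Sum>i\<in>UNIV. f i * yvec (state k w) $ Some i) = (\<Sum>i\<in>UNIV. f i * A i)" for f
  unfolding A_def sum_distrib_left by (rule sum.swap)
 have cv: "(\<Sum>k<n. cvar (state k w)) = (\<Sum>i\<in>UNIV. theta $ Some i * (1 - theta $ Some i) * A i) + real n * \<sigma>\<^sup>2"
  unfolding cvar_eq sum.distrib tv by simp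
 have sq: "(\<Sum>k<n. (mdiff (Suc k) w - ?D \<bullet> yvec (state k w))\<^sup>2) =
   (\<Sum>k<n. (mdiff (Suc k) w)\<^sup>2) - 2 * (?D \<bullet> score_vec n w) + ?D \<bullet> (gram_sum (\<lambda>_. 1) n w *v ?D)"
 proof -
  have "(x - y)\<^sup>2 = x\<^sup>2 - 2 * (x * y) + y * y" for x y :: real by (simp add: power2_eq_square algebra_simps)
  then show ?thesis
   unfolding gram_sum_one_mult score_vec_def inner_sum_right by (simp add: sum.distrib sum_subtractf sum_distrib_left)
 qed
 have "sigma2_est X ?v n w = (1 / real n) * ((\<Sum>k<n. (mdiff (Suc k) w - ?D \<bullet> yvec (state k w))\<^sup>2) - (\<Sum>i\<in>UNIV. ?v $ Some i * (1 - ?v $ Some i) * A i))"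
  unfolding sigma2_est_def One_nat_def sum.atLeast1_atMost_eq residual_Suc thinning_variance_Suc sum_subtractf tv ..
 also have "... = (1 / real n) * ((\<Sum>k<n. (mdiff (Suc k) w)\<^sup>2 - cvar (state k w)) + real n * \<sigma>\<^sup>2
   + (\<Sum>i\<in>UNIV. (theta $ Some i * (1 - theta $ Some i) - ?v $ Some i * (1 - ?v $ Some i)) * A i)
   - 2 * (?D \<bullet> score_vec n w) + ?D \<bullet> (gram_sum (\<lambda>_. 1) n w *v ?D))"
  unfolding sq sum_subtractf cv by (simp add: left_diff_distrib sum_subtractf)
 also have "... = (\<Sum>k<n. (mdiff (Suc k) w)\<^sup>2 - cvar (state k w)) / real n + \<sigma>\<^sup>2
   + (\<Sum>i\<in>UNIV. (theta $ Some i * (1 - theta $ Some i) - ?v $ Some i * (1 - ?v $ Some i)) * (A i / real n))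
   - 2 * (?D \<bullet> ((1 / real n) *\<^sub>R score_vec n w)) + ?D \<bullet> (((1 / real n) *\<^sub>R gram_sum (\<lambda>_. 1) n w) *v ?D)"
  using n by (simp add: distrib_left right_diff_distrib add_divide_distrib diff_divide_distrib sum_divide_distrib flip: scaleR_matrix_vector_assoc)
 finally show ?thesis by (simp add: A_def average_def)
qed

lemma sigma2_tendsto: "((\<lambda>z. sigma2_est X (cls_theta X (fst z) (snd z) :: real ^ 'p option) (fst z) (snd z)) \<longlongrightarrow> \<sigma>\<^sup>2) (whp M)"
proof (rule Lim_transform_eventually)
 let ?v = "\<lambda>z. cls_theta X (fst z) (snd z) :: real ^ 'p option" and ?D = "\<lambda>z. cls_error (fst z) (snd z)"
 let ?E = "\<lambda>z. (\<Sum>k<fst z. (mdiff (Suc k) (snd z))\<^sup>2 - cvar (state k (snd z))) / real (fst z) + \<sigma>\<^sup>2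
  + (\<Sum>i\<in>UNIV. (theta $ Some i * (1 - theta $ Some i) - ?v z $ Some i * (1 - ?v z $ Some i)) * average (\<lambda>x. yvec x $ Some i) (fst z) (snd z))
  - 2 * (?D z \<bullet> ((1 / real (fst z)) *\<^sub>R score_vec (fst z) (snd z)))
  + ?D z \<bullet> (((1 / real (fst z)) *\<^sub>R gram_sum (\<lambda>_. 1) (fst z) (snd z)) *v ?D z)"
 have "(?E \<longlongrightarrow>
  0 + \<sigma>\<^sup>2 + (\<Sum>i\<in>UNIV. (theta $ Some i * (1 - theta $ Some i) - theta $ Some i * (1 - theta $ Some i)) * ergodic_mean (\<lambda>x. yvec x $ Some i))
  - 2 * ((0 :: real ^ 'p option) \<bullet> 0) + 0 \<bullet> (gram (\<lambda>_. 1) *v 0)) (whp M)"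
  by (intro tendsto_add tendsto_diff tendsto_mult tendsto_sum tendsto_const tendsto_inner tendsto_matrix_vector square_average_null
   tendsto_vec_nth cls_theta_tendsto cls_consistent score_vec_average gram_sum_tendsto admissible_one average_tendsto tame_lag)
 then show "(?E \<longlongrightarrow> \<sigma>\<^sup>2) (whp M)" by simp
 show "\<forall>\<^sub>F z in whp M. ?E z = sigma2_est X (?v z) (fst z) (snd z)"
  using eventually_positive by eventually_elim (rule sigma2_est_eq[symmetric])
qed

lemma inar_I_eq:
 "inar_I X n w = (\<Sum>i\<in>UNIV. (cls_theta X n w $ Some i * (1 - cls_theta X n w $ Some i)) *\<^sub>R gram_sum (\<lambda>x. yvec x $ Some i) n w)
  + sigma2_est X (cls_theta X n w :: real ^ 'p option) n w *\<^sub>R gram_sum (\<lambda>_. 1) n w"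
proof -
 have "(\<Sum>i\<in>UNIV. (v $ Some i * (1 - v $ Some i)) *\<^sub>R gram_sum (\<lambda>x. yvec x $ Some i) n w) =
   (\<Sum>k<n. (\<Sum>i\<in>UNIV. v $ Some i * (1 - v $ Some i) * yvec (state k w) $ Some i) *\<^sub>R outer (yvec (state k w)) (yvec (state k w)))" for v :: "real ^ 'p option"
  unfolding gram_sum_def scaleR_sum_left scaleR_sum_right scaleR_scaleR by (rule sum.swap)
 then show ?thesis
  unfolding inar_I_def Let_def One_nat_def sum.atLeast1_atMost_eq thinning_variance_Suc inar_Y_Suc
  by (simp add: gram_sum_def scaleR_left_distrib sum.distrib scaleR_sum_right)
qed

lemma transpose_inar_I: "transpose (inar_I X n w :: real ^ 'p option ^ 'p option) = inar_I X n w"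
proof -
 have lin: "transpose (A + B) = transpose A + transpose B" "transpose (c *\<^sub>R A) = c *\<^sub>R transpose A" for A B :: "real ^ 'p option ^ 'p option" and c
  by (simp_all add: transpose_def vec_eq_iff)
 have "transpose (\<Sum>i\<in>I. f i) = (\<Sum>i\<in>I. transpose (f i))" for f :: "'p => real ^ 'p option ^ 'p option" and I
  by (simp add: transpose_def vec_eq_iff)
 then show ?thesis unfolding inar_I_eq by (simp add: lin transpose_gram_sum)
qed

lemma inar_I_tendsto: "((\<lambda>z. (1 / real (fst z)) *\<^sub>R inar_I X (fst z) (snd z)) \<longlongrightarrow> gram cvar) (whp M)"
proof -
 let ?v = "\<lambda>z. cls_theta X (fst z) (snd z) :: real ^ 'p option"
 have "((\<lambda>z. (\<Sum>i\<in>UNIV. (?v z $ Some i * (1 - ?v z $ Some i)) *\<^sub>R ((1 / real (fst z)) *\<^sub>R gram_sum (\<lambda>x. yvec x $ Some i) (fst z) (snd z)))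
   + sigma2_est X (?v z) (fst z) (snd z) *\<^sub>R ((1 / real (fst z)) *\<^sub>R gram_sum (\<lambda>_. 1) (fst z) (snd z)))
  \<longlongrightarrow> (\<Sum>i\<in>UNIV. (theta $ Some i * (1 - theta $ Some i)) *\<^sub>R gram (\<lambda>x. yvec x $ Some i)) + \<sigma>\<^sup>2 *\<^sub>R gram (\<lambda>_. 1)) (whp M)"
  by (intro tendsto_add tendsto_sum tendsto_scaleR tendsto_mult tendsto_diff tendsto_const gram_sum_tendsto admissible_lag admissible_one
   tendsto_vec_nth cls_theta_tendsto sigma2_tendsto)
 moreover have "(\<Sum>i\<in>UNIV. (?v z $ Some i * (1 - ?v z $ Some i)) *\<^sub>R (c *\<^sub>R gram_sum (\<lambda>x. yvec x $ Some i) (fst z) (snd z)))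
   + sigma2_est X (?v z) (fst z) (snd z) *\<^sub>R (c *\<^sub>R gram_sum (\<lambda>_. 1) (fst z) (snd z)) = c *\<^sub>R inar_I X (fst z) (snd z)" for z c
  unfolding inar_I_eq by (simp add: scaleR_right_distrib scaleR_sum_right mult.commute)
 ultimately show ?thesis unfolding gram_cvar by (simp only:)
qed

text \<open>The limit of the normalisation; \<open>whitener_est\<close> is its empirical counterpart.\<close>

definition whitener :: "real ^ 'p option ^ 'p option" where
 "whitener = matrix_inv (sqrt_mat (gram cvar))"

definition whitener_est :: "nat => 'a => real ^ 'p option ^ 'p option" where
 "whitener_est n w = matrix_inv (sqrt_mat ((1 / real n) *\<^sub>R inar_I X n w))"

lemma transpose_scaleR: "transpose (c *\<^sub>R A) = c *\<^sub>R transpose (A :: real ^ 'd ^ 'd)"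
 by (simp add: transpose_def vec_eq_iff)

lemma whitener_tendsto: "((\<lambda>z. whitener_est (fst z) (snd z)) \<longlongrightarrow> whitener) (whp M)"
proof -
 obtain m where m: "0 < m" "coercive m (gram cvar)" using gram_cvar_coercive by blast
 obtain r where r: "0 < r" "coercive r (sqrt_mat (gram cvar))" using sqrt_mat_pd(3)[OF transpose_gram m(2,1)] by blast
 have "((\<lambda>z. sqrt_mat ((1 / real (fst z)) *\<^sub>R inar_I X (fst z) (snd z) :: real ^ 'p option ^ 'p option)) \<longlongrightarrow> sqrt_mat (gram cvar)) (whp M)"
  by (rule sqrt_mat_tendsto[OF transpose_gram m(2,1) inar_I_tendsto]) (simp add: transpose_scaleR transpose_inar_I)
 then show ?thesis unfolding whitener_est_def whitener_def by (rule matrix_inv_tendsto[OF r(2,1)])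
qed

lemma whitener_properties:
 "(whitener *v u) \<bullet> (gram cvar *v (whitener *v v)) = u \<bullet> v" "transpose whitener = whitener"
proof -
 obtain m where m: "0 < m" "coercive m (gram cvar)" using gram_cvar_coercive by blast
 show "(whitener *v u) \<bullet> (gram cvar *v (whitener *v v)) = u \<bullet> v" "transpose whitener = whitener"
  unfolding whitener_def by (rule inverse_sqrt_whitens[OF transpose_gram m(2,1)])+
qed

text \<open>The normalisation is homogeneous, which extracts the factor \<open>1 / sqrt n\<close>. The formula can
fail only where the estimated information matrix is not positive definite.\<close>

lemma test_process_whp:
 "\<forall>\<^sub>F z in whp M. \<forall>t. test_process X (fst z) t (snd z) =
  (1 / sqrt (real (fst z))) *\<^sub>R (whitener_est (fst z) (snd z) *v
   (score_vec (nat \<lfloor>real (fst z) * t\<rfloor>) (snd z) - gram_sum (\<lambda>_. 1) (nat \<lfloor>real (fst z) * t\<rfloor>) (snd z) *v cls_error (fst z) (snd z)))"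
proof -
 obtain m where m: "0 < m" "coercive m (gram cvar)" using gram_cvar_coercive by blast
 show ?thesis
  using eventually_coercive[OF m(2,1) inar_I_tendsto] eventually_positive
 proof eventually_elim
  case (elim z)
  obtain n w where z: "z = (n, w)" by fastforce
  let ?A = "(1 / real n) *\<^sub>R inar_I X n w :: real ^ 'p option ^ 'p option"
  have n: "0 < real n" using elim(2) by (simp add: z)
  have "inar_I X n w = real n *\<^sub>R ?A" using n by simp
  then have "matrix_inv (sqrt_mat (inar_I X n w)) = (1 / sqrt (real n)) *\<^sub>R matrix_inv (sqrt_mat ?A)"
   using inverse_sqrt_scale[of ?A "m / 2" "real n"] elim(1) m(1) n by (simp add: z transpose_scaleR transpose_inar_I)
  then show ?case
   unfolding z fst_conv snd_conv test_process_def Let_def sum_residual_Y whitener_est_def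
   by (simp flip: scaleR_matrix_vector_assoc)
 qed
qed

end

section \<open>The bridge of the scores\<close>

definition grid_index :: "nat => real => nat" where
 "grid_index n t = nat \<lfloor>real n * t\<rfloor>"

lemma grid_index_bounds:
 assumes "0 <= t"
 shows "real (grid_index n t) <= real n * t" "real n * t < real (grid_index n t) + 1"
 using assms unfolding grid_index_def by (auto intro: of_nat_floor)

lemma grid_index_mono: "s <= t ==> grid_index n s <= grid_index n t"
 unfolding grid_index_def by (intro nat_mono floor_mono mult_left_mono) auto

lemma grid_index_le: "t <= 1 ==> grid_index n t <= n"
 using grid_index_mono[of t 1 n] by (simp add: grid_index_def)

lemma grid_index_fraction:
 assumes t: "0 <= t" and n: "0 < n" shows "\<bar>real (grid_index n t) / real n - t\<bar> <= 1 / real n"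
proof -
 have "\<bar>real (grid_index n t) - real n * t\<bar> <= 1" using grid_index_bounds[OF t, of n] by linarith
 then have "\<bar>real (grid_index n t) - real n * t\<bar> / real n <= 1 / real n" by (intro divide_right_mono) auto
 moreover have "\<bar>real (grid_index n t) - real n * t\<bar> / real n = \<bar>real (grid_index n t) / real n - t\<bar>"
 proof -
  have "real (grid_index n t) / real n - t = (real (grid_index n t) - real n * t) / real n" using n by (simp add: diff_divide_distrib)
  then show ?thesis by (simp only: abs_divide abs_of_nat)
 qed
 ultimately show ?thesis by simp
qed

lemma grid_index_limit: "0 <= t ==> (\<lambda>n. real (grid_index n t) / real n) \<longlonglongrightarrow> t"
proof (rule Lim_transform2[OF tendsto_const], rule Lim_null_comparison)
 assume t: "0 <= t"
 show "\<forall>\<^sub>F n in sequentially. norm (t - real (grid_index n t) / real n) <= 1 / real n"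
  using eventually_gt_at_top[of 0] by eventually_elim (use grid_index_fraction[OF t] in \<open>simp add: abs_minus_commute\<close>)
qed (rule lim_const_over_n)

context inar_estimation
begin

text \<open>The process \<open>V\<close> of the criterion: the limit matrices replace their estimates.\<close>

definition score_bridge :: "nat => real => 'a => real ^ 'p option" where
 "score_bridge n t w = whitener *v ((1 / sqrt (real n)) *\<^sub>R (score_vec (grid_index n t) w - t *\<^sub>R score_vec n w))"

lemma adapted_score_vec: "k <= n ==> adapted n (score_vec k)"
proof -
 assume k: "k <= n"
 have "adapted n (\<lambda>w. mdiff (Suc i) w *\<^sub>R yvec (state i w))" if "i \<in> {..<k}" for i
  by (rule adapted_comp2[where h = "\<lambda>x y. x *\<^sub>R y", OF adapted_mono[OF adapted_mdiff] adapted_mono[OF adapted_state_comp]]) (use that k in auto)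
 then show ?thesis unfolding score_vec_def[abs_def] by (rule adapted_sum)
qed

lemma score_bridge_measurable:
 assumes "t \<in> {0..1}" shows "score_bridge n t \<in> borel_measurable M"
proof (rule adapted_borel[of n])
 show "adapted n (score_bridge n t)"
  unfolding score_bridge_def[abs_def]
  by (rule adapted_comp2[where h = "\<lambda>x y. whitener *v ((1 / sqrt (real n)) *\<^sub>R (x - t *\<^sub>R y))", OF adapted_score_vec adapted_score_vec])
   (use assms grid_index_le in auto)
qed

text \<open>For fixed \<open>n\<close> the path is a function of finitely many values of the process. The map \<open>xs\<close> collects
these values, and the statistics are evaluated at the coordinate process.\<close>

lemma test_process_measurable:
 "(\<lambda>w. to_skorokhod (\<lambda>t. test_process X n t w :: real ^ 'p option)) \<in> borel_measurable M"
proof -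
 define xs where "xs w = (\<lambda>j. if - int CARD('p) < j \<and> j <= int n then X j w else 0)" for w
 have xs: "adapted n xs"
  unfolding xs_def[abs_def]
 proof (rule adapted_fun)
  fix j show "adapted n (\<lambda>w. if - int CARD('p) < j \<and> j <= int n then X j w else 0)"
   by (cases "- int CARD('p) < j \<and> j <= int n") (auto intro: adapted_X)
 qed
 have lagX: "X (int k - int (lag i)) w = xs w (int k - int (lag i))" if "k \<in> {1..n}" for k w and i :: 'p
  using that lag_range[of i] by (auto simp: xs_def)
 have Y: "inar_Y X k w = (inar_Y (\<lambda>j x. x j) k (xs w) :: real ^ 'p option)" if "k \<in> {1..n}" for k w
  unfolding inar_Y_def by (simp only: lagX[OF that])
 have Xk: "X (int k) w = xs w (int k)" if "k \<in> {1..n}" for k w using that by (auto simp: xs_def)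
 have Q: "inar_Q X n w = (inar_Q (\<lambda>j x. x j) n (xs w) :: real ^ 'p option ^ 'p option)" for w
  unfolding inar_Q_def by (intro sum.cong refl) (simp add: Y)
 have T: "cls_theta X n w = (cls_theta (\<lambda>j x. x j) n (xs w) :: real ^ 'p option)" for w
  unfolding cls_theta_def Q by (intro arg_cong2[where f = "(*v)"] sum.cong refl) (simp add: Y Xk)
 have Rk: "residual X v k w = residual (\<lambda>j x. x j) v k (xs w)" if "k \<in> {1..n}" for k w and v :: "real ^ 'p option"
  unfolding residual_def by (simp add: Y[OF that] Xk[OF that])
 have tv: "thinning_variance X v k w = thinning_variance (\<lambda>j x. x j) v k (xs w)" if "k \<in> {1..n}" for k w and v :: "real ^ 'p option"
  unfolding thinning_variance_def by (simp only: lagX[OF that])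
 have s2: "sigma2_est X v n w = sigma2_est (\<lambda>j x. x j) v n (xs w)" for w and v :: "real ^ 'p option"
  unfolding sigma2_est_def by (intro arg_cong2[where f = "(*)"] sum.cong refl) (simp add: Rk tv)
 have I: "inar_I X n w = (inar_I (\<lambda>j x. x j) n (xs w) :: real ^ 'p option ^ 'p option)" for w
  unfolding inar_I_def Let_def T s2 by (intro sum.cong refl) (simp add: Y tv)
 have tp: "test_process X n t w = (test_process (\<lambda>j x. x j) n t (xs w) :: real ^ 'p option)" if "t <= 1" for t w
 proof -
  have le: "nat \<lfloor>real n * t\<rfloor> <= n" using grid_index_le[OF that] by (simp add: grid_index_def)
  show ?thesis
   unfolding test_process_def Let_def T I using le
   by (intro arg_cong2[where f = "(*v)"] sum.cong refl) (simp add: Y Rk)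
 qed
 have "to_skorokhod (\<lambda>t. test_process X n t w :: real ^ 'p option) = to_skorokhod (\<lambda>t. test_process (\<lambda>j x. x j) n t (xs w))" for w
  unfolding to_skorokhod_def by (intro arg_cong[where f = Abs_skorokhod] restrict_ext) (simp add: tp)
 then have "adapted n (\<lambda>w. to_skorokhod (\<lambda>t. test_process X n t w :: real ^ 'p option))"
  by (simp only:) (rule adapted_comp[OF xs])
 then show ?thesis by (rule adapted_borel)
qed

end

section \<open>Oscillation of the scores and limits of weighted Gram sums\<close>

lemma sqrt_power4: "sqrt (real n) ^ 4 = (real n)\<^sup>2"
proof -
 have "sqrt (real n) ^ 4 = (sqrt (real n) ^ 2) ^ 2" by (simp only: power_mult[symmetric]) simp
 then show ?thesis by simp
qed

context inar_estimation
begin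

text \<open>The union over the coordinates costs five powers of their number: one for the number of events and four because each
coordinate has to stay below the corresponding fraction of the level.\<close>

definition score_const :: real where
 "score_const = real CARD('p option) ^ 5 * (16 * (3 * c4\<^sup>2 * (1 ^ 4 * env_bound)))"

lemma score_const_nonneg: "0 <= score_const"
 using env_bound(1) by (simp add: score_const_def)

lemma score_vec_maximal:
 assumes l: "0 < l"
 shows "\<exists>A\<in>events. prob A <= score_const * (real n)\<^sup>2 / l ^ 4 \<and>
  (\<forall>w\<in>space M - A. \<forall>k\<le>n. norm (score_vec (a + k) w - score_vec a w) <= l)"
proof -
 let ?N = "real CARD('p option)"
 have N: "0 < ?N" by simp
 have lN: "0 < l / ?N" using l N by (rule divide_pos_pos)
 let ?h = "\<lambda>c x. yvec x $ c"
 define E where "E c = {w \<in> space M. \<exists>k\<le>n. l / ?N < \<bar>score (?h c) (a + k) w - score (?h c) a w\<bar>}" for c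
 have hb: "\<bar>?h c (state k w)\<bar> <= 1 * env k w" for c k w using yvec_nonneg yvec_le_env by simp
 have Em: "E c \<in> events" for c unfolding E_def by (rule score_maximal(1)[OF hb lN])
 have Ep: "prob (E c) <= 16 * (3 * c4\<^sup>2 * (1 ^ 4 * env_bound)) * (real n)\<^sup>2 / (l / ?N) ^ 4" for c
  unfolding E_def by (rule score_maximal(2)[OF hb lN])
 show ?thesis
 proof (intro bexI conjI ballI allI impI)
  show "(\<Union>c\<in>UNIV. E c) \<in> events" using Em by (intro sets.finite_UN) auto
  have "prob (\<Union>c\<in>UNIV. E c) <= (\<Sum>c\<in>UNIV. prob (E c))" using Em by (intro finite_measure_subadditive_finite) auto
  also have "... <= (\<Sum>c\<in>(UNIV :: 'p option set). 16 * (3 * c4\<^sup>2 * (1 ^ 4 * env_bound)) * (real n)\<^sup>2 / (l / ?N) ^ 4)"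
   by (rule sum_mono) (rule Ep)
  also have "... = ?N * (16 * (3 * c4\<^sup>2 * (1 ^ 4 * env_bound)) * (real n)\<^sup>2 / (l / ?N) ^ 4)" by (simp only: sum_constant)
  also have "... = score_const * (real n)\<^sup>2 / l ^ 4"
   using l N unfolding score_const_def power_divide by (simp add: field_simps power_numeral_reduce)
  finally show "prob (\<Union>c\<in>UNIV. E c) <= score_const * (real n)\<^sup>2 / l ^ 4" .
  fix w k assume w: "w \<in> space M - (\<Union>c\<in>UNIV. E c)" and k: "k <= n"
  have "norm (score_vec (a + k) w - score_vec a w) <= (\<Sum>c\<in>UNIV. \<bar>(score_vec (a + k) w - score_vec a w) $ c\<bar>)" by (rule norm_le_l1_cart)
  also have "... <= (\<Sum>c\<in>(UNIV :: 'p option set). l / ?N)"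
   using w k by (intro sum_mono) (auto simp: E_def score_vec_nth not_less)
  also have "... = l" using N by simp
  finally show "norm (score_vec (a + k) w - score_vec a w) <= l" .
 qed
qed

lemma score_vec_bounded:
 assumes e: "0 < e"
 obtains C where "0 < C" "\<And>n. 0 < n ==> \<exists>A\<in>events. prob A <= e \<and> (\<forall>w\<in>space M - A. \<forall>k\<le>n. norm (score_vec k w) <= C * sqrt (real n))"
proof -
 define C where "C = max 1 (score_const / e)"
 have C: "1 <= C" "score_const / e <= C" by (auto simp: C_def)
 show ?thesis
 proof (rule that[of C])
  show "0 < C" using C by simp
  fix n :: nat assume n: "0 < n"
  have l: "0 < C * sqrt (real n)" using C n by simp
  from score_vec_maximal[OF l, of n 0]
  obtain A where A: "A \<in> events" "prob A <= score_const * (real n)\<^sup>2 / (C * sqrt (real n)) ^ 4"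
   "\<And>w k. w \<in> space M - A ==> k <= n ==> norm (score_vec (0 + k) w - score_vec 0 w) <= C * sqrt (real n)" by blast
  have "score_const * (real n)\<^sup>2 / (C * sqrt (real n)) ^ 4 = score_const / C ^ 4"
   using n by (simp add: power_mult_distrib sqrt_power4)
  also have "... <= e"
  proof -
   have "score_const <= e * C" using C(2) e by (simp add: field_simps)
   also have "C <= C ^ 4" using C(1) power_increasing[of 1 4 C] by simp
   then have "e * C <= e * C ^ 4" using e by simp
   finally show ?thesis using C(1) by (simp add: divide_le_eq)
  qed
  finally show "\<exists>A\<in>events. prob A <= e \<and> (\<forall>w\<in>space M - A. \<forall>k\<le>n. norm (score_vec k w) <= C * sqrt (real n))"
   using A by (intro bexI[of _ A]) (auto simp: score_vec_def)
 qed
qed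

text \<open>Over each of the \<open>m\<close> blocks of length about \<open>n / m\<close> the maximal inequality bounds the probability of an
oscillation of size \<open>d * sqrt n\<close> by a constant times \<open>1 / m\<^sup>2\<close>; the union bound costs a factor \<open>m\<close>. This is where the
fourth moments matter: second moments would leave a bound of order one.\<close>

lemma score_vec_oscillation:
 assumes d: "0 < d" and e: "0 < e"
 shows "\<forall>\<^sub>F m in sequentially. \<forall>\<^sub>F n in sequentially. \<exists>A\<in>events. prob A <= e \<and>
  (\<forall>w\<in>space M - A. \<forall>t\<in>{0..1}.
   norm (score_vec (grid_index n t) w - score_vec (grid_index n (of_int \<lfloor>real m * t\<rfloor> / real m)) w) <= d * sqrt (real n))"
proof -
 have "(\<lambda>m. (9 * score_const / d ^ 4) / real m) \<longlonglongrightarrow> 0" by (rule lim_const_over_n)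
 then have "\<forall>\<^sub>F m in sequentially. (9 * score_const / d ^ 4) / real m < e" using e by (rule order_tendstoD(2))
 then show ?thesis using eventually_gt_at_top[of 0]
 proof eventually_elim
  case (elim m)
  have m: "0 < m" by (rule elim(2))
  show ?case
  proof (rule eventually_mono[OF eventually_ge_at_top[of m]])
   fix n assume n: "m <= n"
   then have n0: "0 < real n" using m by simp
   have l: "0 < d * sqrt (real n)" using d n0 by simp
   \<comment> \<open>One unit for rounding at either end of the block.\<close>
   define L where "L = n div m + 2"
   define a where "a j = grid_index n (real j / real m)" for j
   have "\<forall>j. \<exists>A\<in>events. prob A <= score_const * (real L)\<^sup>2 / (d * sqrt (real n)) ^ 4 \<and>
     (\<forall>w\<in>space M - A. \<forall>k\<le>L. norm (score_vec (a j + k) w - score_vec (a j) w) <= d * sqrt (real n))"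
    using score_vec_maximal[OF l] by blast
   then obtain A where A: "\<And>j. A j \<in> events" "\<And>j. prob (A j) <= score_const * (real L)\<^sup>2 / (d * sqrt (real n)) ^ 4"
    "\<And>j w k. w \<in> space M - A j ==> k <= L ==> norm (score_vec (a j + k) w - score_vec (a j) w) <= d * sqrt (real n)"
    by metis
   have Lb: "real L <= 3 * (real n / real m)"
   proof -
    have "real (n div m) <= real n / real m" by (rule of_nat_div_le_of_nat)
    moreover have "1 <= real n / real m" using n m by simp
    ultimately show ?thesis by (simp add: L_def)
   qed
   show "\<exists>A\<in>events. prob A <= e \<and> (\<forall>w\<in>space M - A. \<forall>t\<in>{0..1}.
     norm (score_vec (grid_index n t) w - score_vec (grid_index n (of_int \<lfloor>real m * t\<rfloor> / real m)) w) <= d * sqrt (real n))"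
   proof (intro bexI conjI ballI)
    show "(\<Union>j<m. A j) \<in> events" using A(1) by (intro sets.finite_UN) auto
    have "prob (\<Union>j<m. A j) <= (\<Sum>j<m. prob (A j))" using A(1) by (intro finite_measure_subadditive_finite) auto
    also have "... <= (\<Sum>j<m. score_const * (real L)\<^sup>2 / (d * sqrt (real n)) ^ 4)" by (rule sum_mono) (rule A(2))
    also have "... = real m * (score_const * (real L)\<^sup>2 / (d * sqrt (real n)) ^ 4)" by simp
    also have "... <= real m * (score_const * (3 * (real n / real m))\<^sup>2 / (d * sqrt (real n)) ^ 4)"
     using Lb score_const_nonneg by (intro mult_left_mono divide_right_mono power_mono) auto
    also have "... = (9 * score_const / d ^ 4) / real m"
     using n0 m by (simp add: power_mult_distrib power_divide sqrt_power4 power2_eq_square mult.commute)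
    finally show "prob (\<Union>j<m. A j) <= e" using elim(1) by simp
    fix w t assume w: "w \<in> space M - (\<Union>j<m. A j)" and t: "t \<in> {0..1 :: real}"
    show "norm (score_vec (grid_index n t) w - score_vec (grid_index n (of_int \<lfloor>real m * t\<rfloor> / real m)) w) <= d * sqrt (real n)"
    proof (cases "t = 1")
     case True
     then show ?thesis using m l by simp
    next
     case False
     define j where "j = nat \<lfloor>real m * t\<rfloor>"
     have j: "of_int \<lfloor>real m * t\<rfloor> = real j" unfolding j_def using t by simp
     have jb: "real j <= real m * t" "real m * t < real j + 1"
      using grid_index_bounds[of t m] t unfolding grid_index_def j_def by auto
     have "real m * t < real m" using t False m by simp
     then have jm: "j < m" using jb(1) by linarith
     have le: "a j <= grid_index n t" unfolding a_def using jb(1) m by (intro grid_index_mono) (simp add: field_simps)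
     have "real (grid_index n t) <= real n * t" using grid_index_bounds[of t n] t by auto
     also have "real n * t <= real n * ((real j + 1) / real m)" using jb(2) m by (intro mult_left_mono) (auto simp: field_simps)
     also have "... = real n * (real j / real m) + real n / real m" by (simp add: add_divide_distrib distrib_left)
     also have "real n * (real j / real m) < real (a j) + 1" unfolding a_def by (rule grid_index_bounds(2)) simp
     also have "real n / real m < real (n div m) + 1"
     proof -
      have "n < m * (n div m) + m" using dividend_less_times_div[OF m, of n] by (simp add: add.commute)
      then have "real n < real (m * (n div m) + m)" by (simp only: of_nat_less_iff)
      then show ?thesis using m by (simp add: field_simps)
     qed
     finally have "grid_index n t - a j <= L" unfolding L_def by simp
     then have "norm (score_vec (a j + (grid_index n t - a j)) w - score_vec (a j) w) <= d * sqrt (real n)"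
      using w jm by (intro A(3)) auto
     then show ?thesis using le by (simp add: j a_def)
    qed
   qed
  qed
 qed
qed

lemma gram_sum_fraction:
 assumes g: "admissible g" and s: "0 <= s" "s <= 1"
 shows "((\<lambda>z. (1 / real (fst z)) *\<^sub>R gram_sum g (grid_index (fst z) s) (snd z)) \<longlongrightarrow> s *\<^sub>R gram g) (whp M)"
proof -
 have "((\<lambda>z. (1 / real (fst z)) *\<^sub>R (gram_sum g (grid_index (fst z) s) (snd z) - real (grid_index (fst z) s) *\<^sub>R gram g)) \<longlongrightarrow> 0) (whp M)"
 proof (rule tendstoI)
  fix e :: real assume e: "0 < e"
  then have e2: "0 < e / 2" by simp
  from gram_sum_uniform[OF g e2] eventually_positive
  show "\<forall>\<^sub>F z in whp M. dist ((1 / real (fst z)) *\<^sub>R (gram_sum g (grid_index (fst z) s) (snd z) - real (grid_index (fst z) s) *\<^sub>R gram g)) 0 < e"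
  proof eventually_elim
   case (elim z)
   then have "norm (gram_sum g (grid_index (fst z) s) (snd z) - real (grid_index (fst z) s) *\<^sub>R gram g) <= e / 2 * real (fst z)"
    using grid_index_le[OF s(2)] by blast
   then have "norm (gram_sum g (grid_index (fst z) s) (snd z) - real (grid_index (fst z) s) *\<^sub>R gram g) / real (fst z) <= e / 2"
    using elim(2) by (simp add: divide_le_eq)
   also have "e / 2 < e" using e by simp
   finally show ?case by (simp add: dist_norm)
  qed
 qed
 moreover have "((\<lambda>z. (real (grid_index (fst z) s) / real (fst z)) *\<^sub>R gram g) \<longlongrightarrow> s *\<^sub>R gram g) (whp M)"
  by (intro tendsto_scaleR tendsto_const tendsto_whp_deterministic[OF grid_index_limit[OF s(1)]])
 ultimately have "((\<lambda>z. (1 / real (fst z)) *\<^sub>R (gram_sum g (grid_index (fst z) s) (snd z) - real (grid_index (fst z) s) *\<^sub>R gram g)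
   + (real (grid_index (fst z) s) / real (fst z)) *\<^sub>R gram g) \<longlongrightarrow> 0 + s *\<^sub>R gram g) (whp M)"
  by (rule tendsto_add)
 then show ?thesis by (simp add: scaleR_right_diff_distrib)
qed

text \<open>The product of the two bridge weights expands into four indicator sums, whose limits combine to the covariance
of the Brownian bridge.\<close>

lemma weighted_gram_limit:
 assumes g: "admissible g" and s: "0 <= s" "s <= 1" and t: "0 <= t" "t <= 1"
 shows "((\<lambda>z. (\<Sum>k<fst z. ((of_bool (k < grid_index (fst z) s) - s) * (of_bool (k < grid_index (fst z) t) - t)) *
   (g (state k (snd z)) * ((u \<bullet> yvec (state k (snd z))) * (v \<bullet> yvec (state k (snd z)))))) / real (fst z))
  \<longlongrightarrow> (min s t - s * t) * (u \<bullet> (gram g *v v))) (whp M)"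
proof -
 let ?G = "\<lambda>z k. (1 / real (fst z)) *\<^sub>R gram_sum g k (snd z)"
 let ?A = "\<lambda>z. ?G z (grid_index (fst z) (min s t)) - t *\<^sub>R ?G z (grid_index (fst z) s) - s *\<^sub>R ?G z (grid_index (fst z) t) + (s * t) *\<^sub>R ?G z (grid_index (fst z) 1)" and ?L = "min s t *\<^sub>R gram g - t *\<^sub>R (s *\<^sub>R gram g) - s *\<^sub>R (t *\<^sub>R gram g) + (s * t) *\<^sub>R (1 *\<^sub>R gram g)"
 have lim: "((\<lambda>z. u \<bullet> (?A z *v v))
  \<longlongrightarrow> u \<bullet> (?L *v v)) (whp M)"
  by (intro tendsto_inner tendsto_const tendsto_matrix_vector tendsto_add tendsto_diff tendsto_scaleR gram_sum_fraction g) (use s t in auto)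
 have val: "u \<bullet> (?L *v v) = (min s t - s * t) * (u \<bullet> (gram g *v v))"
 proof -
  have "?L = (min s t - s * t) *\<^sub>R gram g"
   unfolding scaleR_scaleR scaleR_left_diff_distrib[symmetric] scaleR_left_distrib[symmetric] by (simp add: mult.commute)
  then show ?thesis by (simp flip: scaleR_matrix_vector_assoc)
 qed
 have quad: "u \<bullet> (gram_sum g k w *v v) = (\<Sum>i<k. g (state i w) * ((u \<bullet> yvec (state i w)) * (v \<bullet> yvec (state i w))))" for k w
  unfolding gram_sum_def matrix_vector_sum_left
  by (simp add: outer_mult_vec inner_sum_right inner_commute mult_ac flip: scaleR_matrix_vector_assoc)
 have eq: "u \<bullet> (?A z *v v) =
   (\<Sum>k<fst z. ((of_bool (k < grid_index (fst z) s) - s) * (of_bool (k < grid_index (fst z) t) - t)) *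
   (g (state k (snd z)) * ((u \<bullet> yvec (state k (snd z))) * (v \<bullet> yvec (state k (snd z)))))) / real (fst z)" for z
 proof -
  obtain n w where z: "z = (n, w)" by fastforce
  define f where "f k = g (state k w) * ((u \<bullet> yvec (state k w)) * (v \<bullet> yvec (state k w)))" for k
  have restr: "(\<Sum>i<k. f i) = (\<Sum>i<n. of_bool (i < k) * f i)" if "k <= n" for k
  proof -
   have "(\<Sum>i<n. of_bool (i < k) * f i) = (\<Sum>i\<in>{..<k}. of_bool (i < k) * f i)"
    using that by (intro sum.mono_neutral_right) auto
   then show ?thesis by simp
  qed
  have mn: "(of_bool (k < grid_index n (min s t)) :: real) = of_bool (k < grid_index n s) * of_bool (k < grid_index n t)" for k
   using grid_index_mono[of s t n] grid_index_mono[of t s n] by (cases "s <= t") (auto simp: min_def)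
  have one: "grid_index n 1 = n" by (simp add: grid_index_def)
  have "u \<bullet> (?A z *v v) =
   ((\<Sum>i<grid_index n (min s t). f i) - t * (\<Sum>i<grid_index n s. f i) - s * (\<Sum>i<grid_index n t. f i) + s * t * (\<Sum>i<n. f i)) / real n"
   by (simp add: z one matrix_vector_mult_add_rdistrib matrix_vector_mult_diff_rdistrib inner_add_right inner_diff_right quad f_def[symmetric]
    diff_divide_distrib add_divide_distrib flip: scaleR_matrix_vector_assoc)
  also have "... = (\<Sum>k<n. ((of_bool (k < grid_index n s) - s) * (of_bool (k < grid_index n t) - t)) * f k) / real n"
  proof -
   have "(\<Sum>i<grid_index n (min s t). f i) - t * (\<Sum>i<grid_index n s. f i) - s * (\<Sum>i<grid_index n t. f i) + s * t * (\<Sum>i<n. f i) =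
     (\<Sum>k<n. of_bool (k < grid_index n (min s t)) * f k - t * (of_bool (k < grid_index n s) * f k) - s * (of_bool (k < grid_index n t) * f k) + s * t * f k)"
    unfolding restr[OF grid_index_le[OF s(2)]] restr[OF grid_index_le[OF t(2)]] restr[OF grid_index_le[OF min.coboundedI1[OF s(2)]]]
     sum.distrib sum_subtractf sum_distrib_left ..
   also have "... = (\<Sum>k<n. ((of_bool (k < grid_index n s) - s) * (of_bool (k < grid_index n t) - t)) * f k)"
    unfolding mn by (intro sum.cong refl) (simp add: algebra_simps)
   finally show ?thesis by simp
  qed
  finally show ?thesis by (simp add: z f_def)
 qed
 show ?thesis using lim unfolding val eq .
qed

section \<open>Convergence of the test process\<close>

text \<open>A linear combination of bridge values is a score with the time-dependent weights \<open>h\<close>. Its limiting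
variance is \<open>whitener\<close> applied on both sides of \<open>gram cvar\<close>, which is the identity.\<close>

lemma score_bridge_clt:
 fixes v :: "nat => real ^ 'p option" and s :: "nat => real"
 assumes J: "finite J" and s: "\<And>j. j \<in> J ==> 0 <= s j \<and> s j <= 1"
 shows "(\<lambda>n. \<E> (\<lambda>w. iexp (\<Sum>j\<in>J. v j \<bullet> score_bridge n (s j) w))) \<longlonglongrightarrow>
  of_real (exp (- (\<Sum>i\<in>J. \<Sum>j\<in>J. (min (s i) (s j) - s i * s j) * (v i \<bullet> v j)) / 2))"
proof -
 define r where "r j = whitener *v v j" for j
 define b where "b n k j = (of_bool (k < grid_index n (s j)) - s j :: real)" for n k j
 define h where "h n k x = (\<Sum>j\<in>J. b n k j * (r j \<bullet> yvec x))" for n k x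
 define c where "c = (\<Sum>j\<in>J. (\<Sum>l<CARD('p). \<bar>r j $ Some (inv_into UNIV lag (Suc l))\<bar>) + \<bar>r j $ None\<bar>)"
 have b1: "\<bar>b n k j\<bar> <= 1" if "j \<in> J" for n k j using s[OF that] by (auto simp: b_def)
 have "\<bar>h n k (state k w)\<bar> <= c * env k w" for n k w
 proof -
  have "\<bar>h n k (state k w)\<bar> <= (\<Sum>j\<in>J. \<bar>b n k j * (r j \<bullet> yvec (state k w))\<bar>)" unfolding h_def by (rule sum_abs)
  also have "... <= (\<Sum>j\<in>J. 1 * (((\<Sum>l<CARD('p). \<bar>r j $ Some (inv_into UNIV lag (Suc l))\<bar>) + \<bar>r j $ None\<bar>) * env k w))"
   unfolding abs_mult inner_yvec by (intro sum_mono mult_mono b1 affine_le_env) auto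
  finally show ?thesis by (simp add: c_def sum_distrib_right)
 qed
 moreover have "0 <= c" unfolding c_def by (intro sum_nonneg add_nonneg_nonneg) auto
 moreover have "((\<lambda>z. (\<Sum>k<fst z. (h (fst z) k (state k (snd z)))\<^sup>2 * cvar (state k (snd z))) / real (fst z)) \<longlongrightarrow>
   (\<Sum>i\<in>J. \<Sum>j\<in>J. (min (s i) (s j) - s i * s j) * (v i \<bullet> v j))) (whp M)"
 proof -
  have "((\<lambda>z. \<Sum>i\<in>J. \<Sum>j\<in>J. (\<Sum>k<fst z. ((of_bool (k < grid_index (fst z) (s i)) - s i) * (of_bool (k < grid_index (fst z) (s j)) - s j)) *
    (cvar (state k (snd z)) * ((r i \<bullet> yvec (state k (snd z))) * (r j \<bullet> yvec (state k (snd z)))))) / real (fst z))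
   \<longlongrightarrow> (\<Sum>i\<in>J. \<Sum>j\<in>J. (min (s i) (s j) - s i * s j) * (r i \<bullet> (gram cvar *v r j)))) (whp M)"
   by (intro tendsto_sum weighted_gram_limit admissible_cvar) (use s in auto)
  moreover have "(\<Sum>i\<in>J. \<Sum>j\<in>J. (\<Sum>k<n. ((of_bool (k < grid_index n (s i)) - s i) * (of_bool (k < grid_index n (s j)) - s j)) *
    (cvar (state k w) * ((r i \<bullet> yvec (state k w)) * (r j \<bullet> yvec (state k w))))) / real n) =
    (\<Sum>k<n. (h n k (state k w))\<^sup>2 * cvar (state k w)) / real n" for n w
  proof -
   have "(h n k (state k w))\<^sup>2 * cvar (state k w) = (\<Sum>i\<in>J. \<Sum>j\<in>J. (b n k i * b n k j) * (cvar (state k w) * ((r i \<bullet> yvec (state k w)) * (r j \<bullet> yvec (state k w)))))" for k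
    unfolding h_def power2_eq_square sum_product by (simp add: sum_distrib_right sum_distrib_left mult_ac)
   then have "(\<Sum>k<n. (h n k (state k w))\<^sup>2 * cvar (state k w)) =
     (\<Sum>i\<in>J. \<Sum>k<n. \<Sum>j\<in>J. (b n k i * b n k j) * (cvar (state k w) * ((r i \<bullet> yvec (state k w)) * (r j \<bullet> yvec (state k w)))))"
    by (simp only:) (rule sum.swap)
   also have "... = (\<Sum>i\<in>J. \<Sum>j\<in>J. \<Sum>k<n. (b n k i * b n k j) * (cvar (state k w) * ((r i \<bullet> yvec (state k w)) * (r j \<bullet> yvec (state k w)))))"
    by (rule sum.cong[OF refl], rule sum.swap)
   finally show ?thesis by (simp only: b_def sum_divide_distrib)
  qed
  ultimately show ?thesis unfolding r_def whitener_properties(1) by simp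
 qed
 ultimately have "(\<lambda>n. \<E> (\<lambda>w. iexp ((\<Sum>k<n. h n k (state k w) * mdiff (Suc k) w) / sqrt (real n)))) \<longlonglongrightarrow>
   of_real (exp (- (\<Sum>i\<in>J. \<Sum>j\<in>J. (min (s i) (s j) - s i * s j) * (v i \<bullet> v j)) / 2))"
  by (intro weighted_score_clt)
 moreover have "(\<Sum>k<n. h n k (state k w) * mdiff (Suc k) w) / sqrt (real n) = (\<Sum>j\<in>J. v j \<bullet> score_bridge n (s j) w)" for n w
 proof -
  have one: "v j \<bullet> score_bridge n (s j) w = (\<Sum>k<n. b n k j * (r j \<bullet> yvec (state k w)) * mdiff (Suc k) w) / sqrt (real n)" if "j \<in> J" for j
  proof -
   have le: "grid_index n (s j) <= n" using s[OF that] by (intro grid_index_le) auto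
   have "r j \<bullet> score_vec (grid_index n (s j)) w = (\<Sum>k<grid_index n (s j). (r j \<bullet> yvec (state k w)) * mdiff (Suc k) w)"
    by (simp add: score_vec_def inner_sum_right mult.commute)
   also have "... = (\<Sum>k<n. of_bool (k < grid_index n (s j)) * ((r j \<bullet> yvec (state k w)) * mdiff (Suc k) w))"
    using le by (intro sum.mono_neutral_cong_left) auto
   finally have head: "r j \<bullet> score_vec (grid_index n (s j)) w = (\<Sum>k<n. of_bool (k < grid_index n (s j)) * ((r j \<bullet> yvec (state k w)) * mdiff (Suc k) w))" .
   have total: "r j \<bullet> (s j *\<^sub>R score_vec n w) = (\<Sum>k<n. s j * ((r j \<bullet> yvec (state k w)) * mdiff (Suc k) w))"
    by (simp add: score_vec_def inner_sum_right sum_distrib_left mult.commute)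
   have S: "r j \<bullet> (score_vec (grid_index n (s j)) w - s j *\<^sub>R score_vec n w) = (\<Sum>k<n. b n k j * (r j \<bullet> yvec (state k w)) * mdiff (Suc k) w)"
    unfolding inner_diff_right head total by (simp only: b_def left_diff_distrib sum_subtractf mult.assoc)
   have "v j \<bullet> score_bridge n (s j) w = r j \<bullet> ((1 / sqrt (real n)) *\<^sub>R (score_vec (grid_index n (s j)) w - s j *\<^sub>R score_vec n w))"
    unfolding score_bridge_def r_def by (simp only: inner_symmetric_matrix[OF whitener_properties(2)])
   then show ?thesis unfolding inner_scaleR_right S by simp
  qed
  have "(\<Sum>k<n. h n k (state k w) * mdiff (Suc k) w) = (\<Sum>j\<in>J. \<Sum>k<n. b n k j * (r j \<bullet> yvec (state k w)) * mdiff (Suc k) w)"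
   unfolding h_def sum_distrib_right by (rule sum.swap)
  then show ?thesis by (simp add: one sum_divide_distrib)
 qed
 ultimately show ?thesis by simp
qed

lemma score_bridge_fidi:
 fixes N :: "'b measure" and B :: "real => 'b => real ^ 'p option" and g :: "(nat \<times> 'p option => real) => real"
 assumes bridge: "standard_brownian_bridge_vec N B" and m: "1 <= m" and g: "continuous_on UNIV g" "bounded (range g)"
 shows "(\<lambda>n. \<integral>w. g (grid_values m (\<lambda>t. score_bridge n t w)) \<partial>M) \<longlonglongrightarrow> (\<integral>w. g (grid_values m (\<lambda>t. B t w)) \<partial>N)"
proof -
 let ?s = "\<lambda>j. real j / real m"
 have b: "standard_brownian_bridge N (\<lambda>t w. B t w $ c)" for c
  using bridge by (simp add: standard_brownian_bridge_vec_def)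
 have N: "prob_space N" using b by (simp add: standard_brownian_bridge_def)
 have s01: "?s j \<in> {0..1}" if "j <= m" for j using that m by (simp add: divide_le_eq)
 let ?L = "{..m} \<times> (UNIV :: 'p option set)"
 show ?thesis
 proof (rule continuity_theorem_finite_dim[OF prob_space_axioms N, where L = ?L, OF _ _ _ _ _ _ g])
  show "finite ?L" by simp
  show "(\<lambda>w. grid_values m (\<lambda>t. score_bridge n t w) l) \<in> borel_measurable M" for n l
  proof (cases "fst l <= m")
   case True
   have "(\<lambda>x :: real ^ 'p option. x $ snd l) \<in> borel_measurable borel"
    by (intro borel_measurable_continuous_onI continuous_intros)
   from measurable_compose[OF score_bridge_measurable[OF s01[OF True], of n] this]
   show ?thesis using True by (simp add: grid_values_def case_prod_beta)
  qed (simp add: grid_values_def case_prod_beta)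
  show "(\<lambda>w. grid_values m (\<lambda>t. B t w) l) \<in> borel_measurable N" for l
  proof (cases "fst l <= m")
   case True
   then show ?thesis
    using standard_brownian_bridge_char(3)[OF b _ _ s01[OF True], of "{}"] by (simp add: grid_values_def case_prod_beta)
  qed (simp add: grid_values_def case_prod_beta)
  show "grid_values m (\<lambda>t. score_bridge n t w) l = 0" if "l \<notin> ?L" for n w l using that by (cases l) (simp add: grid_values_def)
  show "grid_values m (\<lambda>t. B t w) l = 0" if "l \<notin> ?L" for w l using that by (cases l) (simp add: grid_values_def)
  fix u :: "nat \<times> 'p option => real"
  define v where "v j = (\<chi> c. u (j, c))" for j
  have grid: "(\<Sum>l\<in>?L. u l * grid_values m x l) = (\<Sum>j\<le>m. v j \<bullet> x (?s j))" for x
  proof -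
   have "(\<Sum>l\<in>?L. u l * grid_values m x l) = (\<Sum>j\<le>m. \<Sum>c\<in>UNIV. u (j, c) * grid_values m x (j, c))"
    by (simp add: sum.cartesian_product split_def)
   then show ?thesis by (simp add: grid_values_def inner_vec_def v_def)
  qed
  have inj: "inj_on ?s {..m}" using m by (auto simp: inj_on_def)
  define u' where "u' t c = u (the_inv_into {..m} ?s t, c)" for t c
  have u': "u' (?s j) c = u (j, c)" if "j <= m" for j c
   unfolding u'_def using the_inv_into_f_f[OF inj, of j] that by simp
  have "(\<integral>w. iexp (\<Sum>l\<in>?L. u l * grid_values m (\<lambda>t. B t w) l) \<partial>N) = (\<integral>w. iexp (\<Sum>t\<in>?s ` {..m}. \<Sum>c\<in>UNIV. u' t c * B t w $ c) \<partial>N)"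
   unfolding grid sum.reindex[OF inj] by (simp add: u' v_def inner_vec_def)
  also have "... = complex_of_real (exp (- (\<Sum>c\<in>UNIV. \<Sum>s\<in>?s ` {..m}. \<Sum>t\<in>?s ` {..m}. u' s c * u' t c * (min s t - s * t)) / 2))"
   by (rule standard_brownian_bridge_vec_char[OF bridge]) (use s01 in auto)
  also have "(\<Sum>c\<in>UNIV. \<Sum>s\<in>?s ` {..m}. \<Sum>t\<in>?s ` {..m}. u' s c * u' t c * (min s t - s * t)) =
    (\<Sum>i\<le>m. \<Sum>j\<le>m. (min (?s i) (?s j) - ?s i * ?s j) * (v i \<bullet> v j))"
  proof -
   have "(\<Sum>c\<in>UNIV. \<Sum>s\<in>?s ` {..m}. \<Sum>t\<in>?s ` {..m}. u' s c * u' t c * (min s t - s * t)) =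
     (\<Sum>c\<in>UNIV. \<Sum>i\<le>m. \<Sum>j\<le>m. u (i, c) * u (j, c) * (min (?s i) (?s j) - ?s i * ?s j))"
    unfolding sum.reindex[OF inj] by (intro sum.cong refl) (simp add: u')
   also have "... = (\<Sum>i\<le>m. \<Sum>c\<in>UNIV. \<Sum>j\<le>m. u (i, c) * u (j, c) * (min (?s i) (?s j) - ?s i * ?s j))" by (rule sum.swap)
   also have "... = (\<Sum>i\<le>m. \<Sum>j\<le>m. \<Sum>c\<in>UNIV. u (i, c) * u (j, c) * (min (?s i) (?s j) - ?s i * ?s j))"
    by (rule sum.cong[OF refl], rule sum.swap)
   also have "... = (\<Sum>i\<le>m. \<Sum>j\<le>m. (min (?s i) (?s j) - ?s i * ?s j) * (v i \<bullet> v j))"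
    unfolding v_def inner_vec_def vec_lambda_beta inner_real_def sum_distrib_left by (intro sum.cong refl) (rule mult.commute)
   finally show ?thesis .
  qed
  finally have rhs: "(\<integral>w. iexp (\<Sum>l\<in>?L. u l * grid_values m (\<lambda>t. B t w) l) \<partial>N) =
    complex_of_real (exp (- (\<Sum>i\<le>m. \<Sum>j\<le>m. (min (?s i) (?s j) - ?s i * ?s j) * (v i \<bullet> v j)) / 2))" .
  show "(\<lambda>n. \<integral>w. iexp (\<Sum>l\<in>?L. u l * grid_values m (\<lambda>t. score_bridge n t w) l) \<partial>M) \<longlonglongrightarrow>
    (\<integral>w. iexp (\<Sum>l\<in>?L. u l * grid_values m (\<lambda>t. B t w) l) \<partial>N)"
   unfolding rhs unfolding grid by (rule score_bridge_clt) (use s01 in auto)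
 qed
qed

text \<open>The deterministic part of the comparison. With \<open>A\<close> the normalised design matrix and \<open>w = A\<^sup>-\<^sup>1 u\<close>, the two bridges
differ by the increment of \<open>S\<close> and by \<open>E *v w\<close>, where \<open>E\<close> is the difference between the normalised
partial design matrix and \<open>s *\<^sub>R A\<close>.\<close>

lemma bridge_approximation_bound:
 fixes R R' Q :: "real ^ 'd ^ 'd::finite" and S :: "nat => real ^ 'd" and G :: "nat => real ^ 'd ^ 'd"
 assumes n: "0 < n" and t: "t \<in> {0..1}" and s: "s \<in> {0..1}" "\<bar>t - s\<bar> <= h"
  and m: "coercive c ((1 / real n) *\<^sub>R G n)" "0 < c"
  and D: "D = matrix_inv ((1 / real n) *\<^sub>R G n) *v ((1 / real n) *\<^sub>R S n)"
  and S: "\<And>k. k <= n ==> norm (S k) <= C * sqrt (real n)"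
  and osc: "norm (S (grid_index n t) - S (grid_index n s)) <= x * sqrt (real n)"
  and G: "\<And>k. k <= n ==> norm (G k - real k *\<^sub>R Q) <= y * real n"
  and R: "norm (R' - R) <= y" "y <= 1"
 shows "dist ((1 / sqrt (real n)) *\<^sub>R (R' *v (S (grid_index n t) - G (grid_index n t) *v D)))
   (R *v ((1 / sqrt (real n)) *\<^sub>R (S (grid_index n s) - s *\<^sub>R S n)))
  <= (norm R + 1) * (x + (2 * y + (1 / real n + h) * norm Q) * (C / c)) + y * (2 * C)"
proof -
 define k l where "k = grid_index n t" and "l = grid_index n s"
 have kl: "k <= n" "l <= n" unfolding k_def l_def using t s by (auto intro: grid_index_le)
 define q where "q = 1 / sqrt (real n)"
 have q: "0 < q" "q * sqrt (real n) = 1" using n by (auto simp: q_def)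
 have scaled: "norm (q *\<^sub>R v) <= z" if "norm v <= z * sqrt (real n)" for v :: "real ^ 'd" and z
 proof -
  have "norm (q *\<^sub>R v) = q * norm v" using q(1) by simp
  also have "... <= q * (z * sqrt (real n))" using that q(1) by (intro mult_left_mono) auto
  also have "... = z * (q * sqrt (real n))" by simp
  also have "... = z" using q(2) by simp
  finally show ?thesis .
 qed
 have C: "0 <= C" using order_trans[OF norm_ge_zero scaled[OF S[OF order_refl]]] .
 define A where "A = (1 / real n) *\<^sub>R G n"
 define u where "u = q *\<^sub>R S n"
 define w where "w = matrix_inv A *v u"
 define a where "a = q *\<^sub>R (S k - G k *v D)"
 define b where "b = q *\<^sub>R (S l - s *\<^sub>R S n)"
 have u: "norm u <= C" unfolding u_def by (rule scaled[OF S[OF order_refl]])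
 have A: "coercive c A" using m(1) by (simp add: A_def)
 have "norm w <= norm u / c" unfolding w_def by (rule matrix_inv_coercive(3)[OF A m(2)])
 also have "... <= C / c" using u m(2) by (simp add: divide_right_mono)
 finally have w: "norm w <= C / c" .
 have Aw: "A *v w = u" unfolding w_def using matrix_inv_coercive(1)[OF A m(2)] by (simp add: matrix_vector_mul_assoc)
 have qD: "q *\<^sub>R (G k *v D) = ((1 / real n) *\<^sub>R G k) *v w"
  unfolding D w_def u_def A_def[symmetric]
  by (simp add: matrix_vector_mult_scaleR mult.commute flip: scaleR_matrix_vector_assoc)
 define E where "E = ((1 / real n) *\<^sub>R (G k - real k *\<^sub>R Q)) - s *\<^sub>R ((1 / real n) *\<^sub>R (G n - real n *\<^sub>R Q)) + (real k / real n - s) *\<^sub>R Q"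
 have E: "(1 / real n) *\<^sub>R G k - s *\<^sub>R A = E"
  using n by (simp add: E_def A_def scaleR_right_diff_distrib scaleR_left_diff_distrib)
 have Gn: "norm ((1 / real n) *\<^sub>R (G i - real i *\<^sub>R Q)) <= y" if "i <= n" for i
  using G[OF that] n by (simp add: divide_le_eq)
 have y: "0 <= y" using order_trans[OF norm_ge_zero Gn[OF order_refl]] .
 have ks: "\<bar>real k / real n - s\<bar> <= 1 / real n + h"
  using grid_index_fraction[of t n] t n s(2) unfolding k_def by auto
 have nE: "norm E <= 2 * y + (1 / real n + h) * norm Q"
 proof -
  have "norm E <= norm ((1 / real n) *\<^sub>R (G k - real k *\<^sub>R Q)) + norm (s *\<^sub>R ((1 / real n) *\<^sub>R (G n - real n *\<^sub>R Q))) + norm ((real k / real n - s) *\<^sub>R Q)"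
   unfolding E_def by (rule order_trans[OF norm_triangle_ineq add_right_mono[OF norm_triangle_ineq4]])
  also have "norm ((1 / real n) *\<^sub>R (G k - real k *\<^sub>R Q)) <= y" by (rule Gn[OF kl(1)])
  also have "norm (s *\<^sub>R ((1 / real n) *\<^sub>R (G n - real n *\<^sub>R Q))) <= 1 * y"
   unfolding norm_scaleR[of s] using s(1) Gn[OF order_refl] by (intro mult_mono) auto
  also have "norm ((real k / real n - s) *\<^sub>R Q) <= (1 / real n + h) * norm Q"
   unfolding norm_scaleR using ks by (intro mult_right_mono) auto
  finally show ?thesis by simp
 qed
 have ab: "a - b = q *\<^sub>R (S k - S l) - E *v w"
 proof -
  have "E *v w = ((1 / real n) *\<^sub>R G k) *v w - s *\<^sub>R u"
   unfolding E[symmetric] by (simp add: matrix_vector_mult_diff_rdistrib Aw flip: scaleR_matrix_vector_assoc)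
  then show ?thesis unfolding a_def b_def scaleR_right_diff_distrib qD u_def by (simp add: scaleR_right_diff_distrib mult.commute)
 qed
 have nab: "norm (a - b) <= x + (2 * y + (1 / real n + h) * norm Q) * (C / c)"
 proof -
  have "norm (a - b) <= norm (q *\<^sub>R (S k - S l)) + norm (E *v w)" unfolding ab by (rule norm_triangle_ineq4)
  also have "norm (q *\<^sub>R (S k - S l)) <= x" by (rule scaled) (use osc in \<open>simp add: k_def l_def\<close>)
  also have "norm (E *v w) <= (2 * y + (1 / real n + h) * norm Q) * (C / c)"
   by (rule order_trans[OF norm_matrix_vector_le mult_mono[OF nE w order_trans[OF norm_ge_zero nE] norm_ge_zero]])
  finally show ?thesis by simp
 qed
 have nb: "norm b <= 2 * C"
 proof -
  have "norm b <= norm (q *\<^sub>R S l) + norm (s *\<^sub>R u)"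
   unfolding b_def scaleR_right_diff_distrib u_def using norm_triangle_ineq4[of "q *\<^sub>R S l" "q *\<^sub>R s *\<^sub>R S n"] by (simp add: mult.commute)
  also have "norm (q *\<^sub>R S l) <= C" by (rule scaled[OF S[OF kl(2)]])
  also have "norm (s *\<^sub>R u) <= 1 * C" unfolding norm_scaleR using s(1) u by (intro mult_mono) auto
  finally show ?thesis by simp
 qed
 have R'n: "norm R' <= norm R + 1"
  using norm_triangle_ineq[of R "R' - R"] R by simp
 have "dist (q *\<^sub>R (R' *v (S k - G k *v D))) (R *v b) = norm (R' *v (a - b) + (R' - R) *v b)"
  unfolding dist_norm a_def
  by (simp add: matrix_vector_mult_scaleR matrix_vector_mult_diff_distrib matrix_vector_mult_diff_rdistrib)
 also have "... <= norm (R' *v (a - b)) + norm ((R' - R) *v b)" by (rule norm_triangle_ineq)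
 also have "... <= norm R' * norm (a - b) + norm (R' - R) * norm b" by (intro add_mono norm_matrix_vector_le)
 also have "... <= (norm R + 1) * (x + (2 * y + (1 / real n + h) * norm Q) * (C / c)) + y * (2 * C)"
  using R'n nab R(1) nb C y by (intro add_mono mult_mono) auto
 finally show ?thesis unfolding b_def q_def k_def l_def .
qed

lemma test_process_close:
 assumes d: "0 < d" and e: "0 < e"
 shows "\<forall>\<^sub>F m in sequentially. \<forall>\<^sub>F n in sequentially. \<exists>A\<in>events. prob A <= e \<and>
  (\<forall>w\<in>space M - A. \<forall>t\<in>{0..1}. dist (test_process X n t w) (score_bridge n (of_int \<lfloor>real m * t\<rfloor> / real m) w) <= d)"
proof -
 define Q where "Q = gram (\<lambda>_. 1)"
 obtain c0 where c0: "0 < c0" "coercive c0 Q" unfolding Q_def using gram_one_coercive by blast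
 have e3: "0 < e / 3" using e by simp
 obtain C where C: "0 < C" "\<And>n. 0 < n ==> \<exists>A\<in>events. prob A <= e / 3 \<and> (\<forall>w\<in>space M - A. \<forall>k\<le>n. norm (score_vec k w) <= C * sqrt (real n))"
  using score_vec_bounded[OF e3] by blast
 define c where "c = c0 / 2"
 have c: "0 < c" using c0 by (simp add: c_def)
 define r where "r = norm whitener + 1"
 have r: "0 < r" unfolding r_def by (rule add_nonneg_pos) auto
 define x where "x = d / (4 * r)"
 have x: "0 < x" using d r by (simp add: x_def)
 \<comment> \<open>The choices of \<open>x\<close> and \<open>y\<close> split \<open>d\<close> into the error terms of \<open>bridge_approximation_bound\<close>.\<close>
 define y where "y = min 1 (min (d / (8 * r * (C / c))) (d / (8 * C)))"
 have y: "0 < y" "y <= 1" "y <= d / (8 * r * (C / c))" "y <= d / (8 * C)" using d r C c by (auto simp: y_def)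
 define K where "K = r * norm Q * (C / c)"
 have small: "\<forall>\<^sub>F m in sequentially. K / real m < d / 8"
  by (rule order_tendstoD(2)[OF lim_const_over_n]) (use d in simp)
 have good: "\<forall>\<^sub>F z in whp M. (\<forall>t. test_process X (fst z) t (snd z) =
   (1 / sqrt (real (fst z))) *\<^sub>R (whitener_est (fst z) (snd z) *v
   (score_vec (nat \<lfloor>real (fst z) * t\<rfloor>) (snd z) - gram_sum (\<lambda>_. 1) (nat \<lfloor>real (fst z) * t\<rfloor>) (snd z) *v cls_error (fst z) (snd z)))) \<and>
   cls_error (fst z) (snd z) = matrix_inv ((1 / real (fst z)) *\<^sub>R gram_sum (\<lambda>_. 1) (fst z) (snd z)) *v ((1 / real (fst z)) *\<^sub>R score_vec (fst z) (snd z)) \<and>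
   (\<forall>k\<le>fst z. norm (gram_sum (\<lambda>_. 1) k (snd z) - real k *\<^sub>R Q) <= y * real (fst z)) \<and>
   norm (whitener_est (fst z) (snd z) - whitener) <= y \<and>
   coercive c ((1 / real (fst z)) *\<^sub>R gram_sum (\<lambda>_. 1) (fst z) (snd z))"
 proof (intro eventually_conj test_process_whp cls_error_whp)
  show "\<forall>\<^sub>F z in whp M. \<forall>k\<le>fst z. norm (gram_sum (\<lambda>_. 1) k (snd z) - real k *\<^sub>R Q) <= y * real (fst z)"
   unfolding Q_def by (rule gram_sum_uniform[OF admissible_one y(1)])
  show "\<forall>\<^sub>F z in whp M. norm (whitener_est (fst z) (snd z) - whitener) <= y"
   using tendstoD[OF whitener_tendsto y(1)] by eventually_elim (simp add: dist_norm)
  show "\<forall>\<^sub>F z in whp M. coercive c ((1 / real (fst z)) *\<^sub>R gram_sum (\<lambda>_. 1) (fst z) (snd z))"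
   unfolding c_def using gram_sum_tendsto[OF admissible_one] c0 unfolding Q_def by (intro eventually_coercive)
 qed
 from score_vec_oscillation[OF x e3] small eventually_gt_at_top[of 0]
 show ?thesis
 proof eventually_elim
  case (elim m)
  note m = elim(3)
  from elim(1) good[unfolded eventually_whp, rule_format, OF e3] small eventually_gt_at_top[of 0]
  show ?case
  proof eventually_elim
   case (elim n)
   note n = elim(4)
   obtain A1 where A1: "A1 \<in> events" "prob A1 <= e / 3" "\<And>w t. w \<in> space M - A1 ==> t \<in> {0..1} ==>
     norm (score_vec (grid_index n t) w - score_vec (grid_index n (of_int \<lfloor>real m * t\<rfloor> / real m)) w) <= x * sqrt (real n)"
    using elim(1) by blast
   obtain A2 where A2: "A2 \<in> events" "prob A2 <= e / 3" and G: "\<And>w. w \<in> space M - A2 ==> (\<forall>t. test_process X n t w =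
     (1 / sqrt (real n)) *\<^sub>R (whitener_est n w *v (score_vec (nat \<lfloor>real n * t\<rfloor>) w - gram_sum (\<lambda>_. 1) (nat \<lfloor>real n * t\<rfloor>) w *v cls_error n w))) \<and>
     cls_error n w = matrix_inv ((1 / real n) *\<^sub>R gram_sum (\<lambda>_. 1) n w) *v ((1 / real n) *\<^sub>R score_vec n w) \<and>
     (\<forall>k\<le>n. norm (gram_sum (\<lambda>_. 1) k w - real k *\<^sub>R Q) <= y * real n) \<and>
     norm (whitener_est n w - whitener) <= y \<and> coercive c ((1 / real n) *\<^sub>R gram_sum (\<lambda>_. 1) n w)"
    using elim(2) unfolding fst_conv snd_conv by blast
   obtain A3 where A3: "A3 \<in> events" "prob A3 <= e / 3" "\<And>w k. w \<in> space M - A3 ==> k <= n ==> norm (score_vec k w) <= C * sqrt (real n)"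
    using C(2)[OF n] by blast
   show ?case
   proof (intro bexI[of _ "A1 \<union> A2 \<union> A3"] conjI ballI)
    show "A1 \<union> A2 \<union> A3 \<in> events" using A1 A2 A3 by auto
    have "prob (A1 \<union> A2 \<union> A3) <= prob (A1 \<union> A2) + prob A3" using A1 A2 A3 by (intro measure_Un_le) auto
    also have "prob (A1 \<union> A2) <= prob A1 + prob A2" using A1 A2 by (intro measure_Un_le) auto
    finally show "prob (A1 \<union> A2 \<union> A3) <= e" using A1(2) A2(2) A3(2) by linarith
    fix w t assume w: "w \<in> space M - (A1 \<union> A2 \<union> A3)" and t: "t \<in> {0..1 :: real}"
    define s where "s = of_int \<lfloor>real m * t\<rfloor> / real m"
    have fl: "0 <= \<lfloor>real m * t\<rfloor>" "of_int \<lfloor>real m * t\<rfloor> <= real m * t" "real m * t < of_int \<lfloor>real m * t\<rfloor> + 1"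
     using t by auto
    have s: "0 <= s" "s <= t" "t - s <= 1 / real m"
    proof -
     have sm: "s * real m = of_int \<lfloor>real m * t\<rfloor>" using m by (simp add: s_def)
     show "0 <= s" using fl(1) by (simp add: s_def)
     have "s * real m <= t * real m" unfolding sm using fl(2) mult.commute[of t "real m"] by linarith
     then show "s <= t" using m by simp
     have "(t - s) * real m <= 1" unfolding left_diff_distrib sm using fl(3) mult.commute[of t "real m"] by linarith
     then show "t - s <= 1 / real m" using m by (simp add: pos_le_divide_eq)
    qed
    have s01: "s \<in> {0..1}" "\<bar>t - s\<bar> <= 1 / real m" using s t by auto
    have w1: "w \<in> space M - A1" and w2: "w \<in> space M - A2" and w3: "w \<in> space M - A3" using w by auto
    note g = G[OF w2]
    have "dist (test_process X n t w) (score_bridge n s w) <= (norm whitener + 1) * (x + (2 * y + (1 / real n + 1 / real m) * norm Q) * (C / c)) + y * (2 * C)"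
     unfolding g[THEN conjunct1, rule_format] score_bridge_def grid_index_def[symmetric]
     by (rule bridge_approximation_bound[OF n t s01]) (use g c A3(3)[OF w3] A1(3)[OF w1 t] y(2) in \<open>auto simp: s_def\<close>)
    also have "... = r * x + 2 * (y * (r * (C / c))) + K / real n + K / real m + 2 * (y * C)"
     unfolding r_def[symmetric] K_def by (simp add: algebra_simps)
    also have "... <= d / 4 + 2 * (d / 8) + d / 8 + d / 8 + 2 * (d / 8)"
    proof (intro add_mono mult_left_mono)
     show "r * x <= d / 4" using r by (simp add: x_def)
     have p: "0 < r * (C / c)" using r C c by simp
     have "y * (r * (C / c)) <= d / (8 * r * (C / c)) * (r * (C / c))" using y(3) p by (intro mult_right_mono) auto
     also have "... = d / 8" using r C(1) c by (simp add: field_simps)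
     finally show "y * (r * (C / c)) <= d / 8" .
     show "y * C <= d / 8" using y(4) C(1) by (simp add: field_simps)
     show "K / real n <= d / 8" using elim(3) by simp
     show "K / real m <= d / 8" using \<open>K / real m < d / 8\<close> by simp
    qed auto
    also have "... = d" by simp
    finally show "dist (test_process X n t w) (score_bridge n (of_int \<lfloor>real m * t\<rfloor> / real m) w) <= d" unfolding s_def .
   qed
  qed
 qed
qed

lemma test_process_cadlag: "cadlag_on01 (\<lambda>t. test_process X n t w :: real ^ 'p option)"
 unfolding test_process_def Let_def
 by (rule cadlag_on01_floor[where c = "real n" and g = "\<lambda>i. matrix_inv (sqrt_mat (inar_I X n w)) *v (\<Sum>k=1..nat i. residual X (cls_theta X n w :: real ^ 'p option) k w *\<^sub>R inar_Y X k w)"]) simp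

theorem test_process_converges:
 assumes bridge: "standard_brownian_bridge_vec N B"
 shows "conv_in_distribution_D M (\<lambda>n. test_process X n) N (B :: real => 'b => real ^ 'p option)"
proof (rule conv_in_distribution_D_criterion[where V = score_bridge])
 have b: "standard_brownian_bridge N (\<lambda>t w. B t w $ c)" for c
  using bridge by (simp add: standard_brownian_bridge_vec_def)
 show "prob_space M" by (rule prob_space_axioms)
 show "prob_space N" using b by (simp add: standard_brownian_bridge_def)
 show "cadlag_on01 (\<lambda>t. test_process X n t w :: real ^ 'p option)" for n w by (rule test_process_cadlag)
 show "(\<lambda>w. to_skorokhod (\<lambda>t. test_process X n t w :: real ^ 'p option)) \<in> borel_measurable M" for n by (rule test_process_measurable)
 show "score_bridge n t \<in> borel_measurable M" if "t \<in> {0..1}" for n t by (rule score_bridge_measurable[OF that])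
 show "B t \<in> borel_measurable N" if t: "t \<in> {0..1}" for t
 proof (subst borel_measurable_euclidean_space, rule ballI)
  fix i :: "real ^ 'p option" assume "i \<in> Basis"
  then obtain c where i: "i = axis c 1" by (auto simp: Basis_vec_def)
  have "(\<lambda>w. B t w $ c) \<in> borel_measurable N" using standard_brownian_bridge_char(3)[OF b _ _ t, of "{}"] by simp
  then show "(\<lambda>w. B t w \<bullet> i) \<in> borel_measurable N" by (simp add: i inner_axis)
 qed
 show "continuous_on {0..1} (\<lambda>t. B t w)" if "w \<in> space N" for w
 proof -
  have "continuous_on {0..1} (\<lambda>t. \<chi> c. B t w $ c)"
   by (rule continuous_on_vec_lambda) (use b that in \<open>auto simp: standard_brownian_bridge_def\<close>)
  then show ?thesis by (simp only: vec_nth_inverse)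
 qed
 show "(\<lambda>n. \<integral>w. g (grid_values m (\<lambda>t. score_bridge n t w)) \<partial>M) \<longlonglongrightarrow> (\<integral>w. g (grid_values m (\<lambda>t. B t w)) \<partial>N)"
  if "1 <= m" "continuous_on UNIV g" "bounded (range g)" for m and g :: "(nat \<times> 'p option => real) => real"
  by (rule score_bridge_fidi[OF bridge that])
 show "\<forall>\<^sub>F m in sequentially. \<forall>\<^sub>F n in sequentially. \<exists>A\<in>events. prob A <= e \<and>
   (\<forall>w\<in>space M - A. \<forall>t\<in>{0..1}. dist (test_process X n t w) (score_bridge n (of_int \<lfloor>real m * t\<rfloor> / real m) w) <= d)" if "0 < d" "0 < e" for d e
  by (rule test_process_close[OF that])
qed

end

theorem theorem3p1:
 fixes M :: "'a measure" and N :: "'b measure"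
  and \<alpha> :: "nat \<Rightarrow> real" and \<mu> \<sigma> :: real
  and X :: "int \<Rightarrow> 'a \<Rightarrow> nat"
  and \<xi> :: "nat \<Rightarrow> nat \<Rightarrow> nat \<Rightarrow> 'a \<Rightarrow> nat"
  and \<epsilon> :: "nat \<Rightarrow> 'a \<Rightarrow> nat"
  and B :: "real \<Rightarrow> 'b \<Rightarrow> real ^ 'p::{finite,linorder} option"
 assumes inar: "inar_process M CARD('p) \<alpha> \<mu> \<sigma> X \<xi> \<epsilon>"
  and init_moment: "\<And>k. k \<in> {- int CARD('p) + 1..0} \<Longrightarrow> integrable M (\<lambda>\<omega>. real (X k \<omega>) ^ 6)"
  and innovation_moment: "integrable M (\<lambda>\<omega>. real (\<epsilon> 1 \<omega>) ^ 6)"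
  and stable: "(\<Sum>i=1..CARD('p). \<alpha> i) < 1"
  and mean_pos: "\<mu> > 0"
  and nondegenerate: "(\<Sum>i=1..CARD('p). \<alpha> i) > 0 \<or> \<sigma>\<^sup>2 > 0"
  and bridge: "standard_brownian_bridge_vec N B"
 shows "conv_in_distribution_D M (\<lambda>n. test_process X n) N B"
proof -
 interpret inar_process M "CARD('p)" \<alpha> \<mu> \<sigma> X \<xi> \<epsilon> by (rule inar)
 interpret inar_estimation M \<alpha> \<mu> \<sigma> X \<xi> \<epsilon> "TYPE('p)"
  by unfold_locales (fact init_moment innovation_moment stable mean_pos nondegenerate)+
 show ?thesis by (rule test_process_converges[OF bridge])
qed

end
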